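(* Let $\mathcal F:\mathcal P_2(\mathbb R^d)\to\mathbb R\cup\{+\infty\}$ satisfy Hypothesis (A) (stated in the context) with constants $\lambda,K\in\mathbb R$, and let $\mu_0\in\mathcal P_2(\mathbb R^d)$ satisfy $\mathcal F(\mu_0)<+\infty$ and $H(\mu_0)<+\infty$. Let $t\ge0$ and let $\rho^0(t)=\lim_{n\to+\infty}J^0_{n,t/n}(\mu_0)$. Then for all $\alpha_0>0$ there exists a constant $C$, depending only on the second moment of $\mu_0$, $t$, $\mathcal F(\mu_0)$, $H(\mu_0)$, $\lambda$, $K$ and $\alpha_0$, such that for all $n\in\mathbb N^*$ (with, when $\lambda\neq0$, time step $\tau=t/n$ satisfying $\tau\le\frac1{2\lambda_-}$) and all $0<\alpha\le\alpha_0$, $$W_2\big(J^\alpha_{n,t/n}(\mu_0),\rho^0(t)\big)\le C\Big(\sqrt\alpha+\sqrt{\tfrac1n}\Big).$$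
   Context: $\mathcal P_2(\mathbb R^d)$: Borel probability measures on $\mathbb R^d$ with finite second moment; $W_2$: the quadratic Wasserstein distance; $\lambda_-=\max(-\lambda,0)$, with the convention $1/0=+\infty$ (so there is no condition on $\tau$ when $\lambda\ge0$). Boltzmann entropy: for $\rho\in\mathcal P_2(\mathbb R^m)$, $H(\rho)=\int\rho\ln\rho\,dx$ if $\rho$ is absolutely continuous with respect to Lebesgue measure, $+\infty$ otherwise; well defined in $\mathbb R\cup\{+\infty\}$. Heat kernel: for $t>0$, $\sigma_t$ has density $(2\pi t)^{-d/2}e^{-|x|^2/(2t)}$; $\sigma_0=\delta_0$. $\lambda$-convexity along generalized geodesics: with $\pi_1,\pi_2,\pi_3:(\mathbb R^d)^3\to\mathbb R^d$ the canonical projections, $\mathcal F$ is $\lambda$-convex along generalized geodesics if for all $\mu,\nu,\rho\in\mathcal P_2(\mathbb R^d)$ and every $\Pi\in\mathcal P_2((\mathbb R^d)^3)$ such that $(\pi_1,\pi_2)_\#\Pi$ is an optimal ($W_2$) transport plan between $\mu$ and $\nu$ and $(\pi_1,\pi_3)_\#\Pi$ is an optimal transport plan between $\mu$ and $\rho$, for all $t\in[0,1]$, $$\mathcal F((t\pi_3+(1-t)\pi_2)_\#\Pi)\le t\mathcal F(\rho)+(1-t)\mathcal F(\nu)-\tfrac\lambda2t(1-t)\int|y-z|^2\,d(\pi_2,\pi_3)_\#\Pi(y,z).$$ Hypothesis (A): (1) $\mathcal F$ is lower semicontinuous along sequences in $\mathcal P_2(\mathbb R^d)$ that converge narrowly (in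 duality with bounded continuous functions) and have uniformly bounded second moments; (2) $\mathcal F$ is $\lambda$-convex along generalized geodesics; (3) for all $\mu\in\mathcal P_2(\mathbb R^d)$ and $t\ge0$, $\mathcal F(\mu*\sigma_t)\le\mathcal F(\mu)+K\frac t2$. Schrödinger cost: $\mathrm{Sch}^{\alpha\tau}(\mu,\nu)=\inf_{\gamma\in\Pi(\mu,\nu)}\{\int\frac{|x-y|^2}{2}d\gamma+\alpha\tau H(\gamma)+\frac{\alpha\tau d}{2}\ln(2\pi\alpha\tau)\}$, with $\Pi(\mu,\nu)$ the set of couplings and $H(\gamma)$ the Boltzmann entropy on $\mathbb R^{2d}$. Schemes: for $\tau,\alpha>0$, $J^0_\tau(\mu)$ is a minimizer over $\rho\in\mathcal P_2(\mathbb R^d)$ of $\frac{W_2^2(\mu,\rho)}{2\tau}+\mathcal F(\rho)$, and $J^\alpha_\tau(\mu)$ a minimizer of $\frac{\mathrm{Sch}^{\alpha\tau}(\mu,\rho)}{\tau}+\mathcal F(\rho)$ (any choice if not unique); $J^0_{n,\tau}$, $J^\alpha_{n,\tau}$ are the $n$-fold iterates. For $t=0$ the iterates with time step $0$ are read as $\mu_0$. Under (1) and (2) and $\mathcal F(\mu_0)<+\infty$, the limit (in $W_2$) defining $\rho^0(t)$ exists (Ambrosio–Gigli–Savaré).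
   Formalization: The constant C may also depend on the functional F (and the dimension d), not only on the listed quantities; uniformity over F fails, e.g. for F(ρ)=∫|x−a|²/2 dρ − c(a) with c(a) chosen so that F(μ₀)=0 and |a|→∞. *)

theory Defs
  imports "HOL-Probability.Probability"
begin

definition second_moment :: "'a::euclidean_space measure \<Rightarrow> real" where
  "second_moment \<mu> = (\<integral>x. (norm x)\<^sup>2 \<partial>\<mu>)"

definition P2 :: "'a::euclidean_space measure set" where
  "P2 = {\<mu>. sets \<mu> = sets borel \<and> prob_space \<mu> \<and> integrable \<mu> (\<lambda>x. (norm x)\<^sup>2)}"

definition couplings :: "'a::euclidean_space measure \<Rightarrow> 'a measure \<Rightarrow> ('a \<times> 'a) measure set" where
  "couplings \<mu> \<nu> = {\<gamma>. sets \<gamma> = sets borel \<and> distr \<gamma> borel fst = \<mu> \<and> distr \<gamma> borel snd = \<nu>}"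

definition transport_cost :: "('a::euclidean_space \<times> 'a) measure \<Rightarrow> ennreal" where
  "transport_cost \<gamma> = (\<integral>\<^sup>+(x, y). ennreal ((norm (x - y))\<^sup>2) \<partial>\<gamma>)"

definition W2_squared :: "'a::euclidean_space measure \<Rightarrow> 'a measure \<Rightarrow> ennreal" where
  "W2_squared \<mu> \<nu> = (INF \<gamma>\<in>couplings \<mu> \<nu>. transport_cost \<gamma>)"

(* W2_squared is finite on P2; outside P2 the value of W2 is irrelevant. *)
definition W2 :: "'a::euclidean_space measure \<Rightarrow> 'a measure \<Rightarrow> real" where
  "W2 \<mu> \<nu> = sqrt (enn2real (W2_squared \<mu> \<nu>))"

definition optimal_plan ::
  "'a::euclidean_space measure \<Rightarrow> 'a measure \<Rightarrow> ('a \<times> 'a) measure \<Rightarrow> bool" where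
  "optimal_plan \<mu> \<nu> \<gamma> \<longleftrightarrow> \<gamma> \<in> couplings \<mu> \<nu> \<and> transport_cost \<gamma> = W2_squared \<mu> \<nu>"

(* The integral of r ln r is split into positive and negative part so that the value +\<infinity> is
   attained when the positive part diverges. On P2 the negative part is finite, so the difference
   is never \<infinity> - \<infinity>. *)
definition boltzmann_entropy :: "'a::euclidean_space measure \<Rightarrow> ereal" where
  "boltzmann_entropy \<rho> =
    (if absolutely_continuous lborel \<rho> then
       (let r = (\<lambda>x. enn2real (RN_deriv lborel \<rho> x)) in
          enn2ereal (\<integral>\<^sup>+x. ennreal (max 0 (r x * ln (r x))) \<partial>lborel)
          - enn2ereal (\<integral>\<^sup>+x. ennreal (max 0 (- (r x * ln (r x)))) \<partial>lborel))
     else \<infinity>)"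

definition heat_kernel :: "real \<Rightarrow> 'a::euclidean_space measure" where
  "heat_kernel t =
    (if t = 0 then return borel 0
     else density lborel (\<lambda>x. ennreal ((2 * pi * t) powr (- real DIM('a) / 2)
                                        * exp (- (norm x)\<^sup>2 / (2 * t)))))"

definition narrowly_converges :: "(nat \<Rightarrow> 'a::euclidean_space measure) \<Rightarrow> 'a measure \<Rightarrow> bool" where
  "narrowly_converges \<mu>s \<mu> \<longleftrightarrow>
    (\<forall>f :: 'a \<Rightarrow> real. continuous_on UNIV f \<and> bounded (range f) \<longrightarrow>
       (\<lambda>n. \<integral>x. f x \<partial>\<mu>s n) \<longlonglongrightarrow> (\<integral>x. f x \<partial>\<mu>))"

definition lsc_narrow :: "('a::euclidean_space measure \<Rightarrow> ereal) \<Rightarrow> bool" where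
  "lsc_narrow F \<longleftrightarrow>
    (\<forall>\<mu>s \<mu>. (\<forall>n. \<mu>s n \<in> P2) \<and> \<mu> \<in> P2 \<and> narrowly_converges \<mu>s \<mu> \<and>
       (\<exists>B. \<forall>n. second_moment (\<mu>s n) \<le> B) \<longrightarrow>
       F \<mu> \<le> liminf (\<lambda>n. F (\<mu>s n)))"

definition convex_gen_geodesics ::
  "real \<Rightarrow> ('a::euclidean_space measure \<Rightarrow> ereal) \<Rightarrow> bool" where
  "convex_gen_geodesics l F \<longleftrightarrow>
    (\<forall>\<mu>\<in>P2. \<forall>\<nu>\<in>P2. \<forall>\<rho>\<in>P2. \<forall>\<theta>\<in>(P2 :: ('a \<times> 'a \<times> 'a) measure set).
       optimal_plan \<mu> \<nu> (distr \<theta> borel (\<lambda>(x, y, z). (x, y))) \<and>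
       optimal_plan \<mu> \<rho> (distr \<theta> borel (\<lambda>(x, y, z). (x, z))) \<longrightarrow>
       (\<forall>t\<in>{0..1}.
          F (distr \<theta> borel (\<lambda>(x, y, z). t *\<^sub>R z + (1 - t) *\<^sub>R y))
          \<le> ereal t * F \<rho> + ereal (1 - t) * F \<nu>
            - ereal (l / 2 * t * (1 - t) *
                (\<integral>(y, z). (norm (y - z))\<^sup>2 \<partial>(distr \<theta> borel (\<lambda>(x, y, z). (y, z)))))))"

definition hypothesis_A ::
  "('a::ordered_euclidean_space measure \<Rightarrow> ereal) \<Rightarrow> real \<Rightarrow> real \<Rightarrow> bool" where
  "hypothesis_A F l K \<longleftrightarrow>
    lsc_narrow F \<and>
    convex_gen_geodesics l F \<and>
    (\<forall>\<mu>\<in>P2. \<forall>t\<ge>0. F (\<mu> \<star> heat_kernel t) \<le> F \<mu> + ereal (K * (t / 2)))"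

(* sch e is the Schroedinger cost with regularization parameter e, later taken to be \<alpha> * \<tau>. *)
definition sch :: "real \<Rightarrow> 'a::euclidean_space measure \<Rightarrow> 'a measure \<Rightarrow> ereal" where
  "sch e \<mu> \<nu> = (INF \<gamma>\<in>couplings \<mu> \<nu>.
      ereal (\<integral>(x, y). (norm (x - y))\<^sup>2 / 2 \<partial>\<gamma>) + ereal e * boltzmann_entropy \<gamma>
      + ereal (e * real DIM('a) / 2 * ln (2 * pi * e)))"

(* One step of each scheme, as a relation because minimizers need not be unique: \<mu> is related
   to every minimizer. A step of size 0 is the identity, so that all iterates with time step 0
   equal the initial datum. *)
definition jko_step ::
  "('a::euclidean_space measure \<Rightarrow> ereal) \<Rightarrow> real \<Rightarrow> 'a measure \<Rightarrow> 'a measure \<Rightarrow> bool" where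
  "jko_step F \<tau> \<mu> \<rho> \<longleftrightarrow>
    (if \<tau> = 0 then \<rho> = \<mu>
     else is_arg_min (\<lambda>\<rho>. ereal ((W2 \<mu> \<rho>)\<^sup>2 / (2 * \<tau>)) + F \<rho>) (\<lambda>\<rho>. \<rho> \<in> P2) \<rho>)"

definition entropic_jko_step ::
  "('a::euclidean_space measure \<Rightarrow> ereal) \<Rightarrow> real \<Rightarrow> real \<Rightarrow> 'a measure \<Rightarrow> 'a measure \<Rightarrow> bool" where
  "entropic_jko_step F \<alpha> \<tau> \<mu> \<rho> \<longleftrightarrow>
    (if \<tau> = 0 then \<rho> = \<mu>
     else is_arg_min (\<lambda>\<rho>. sch (\<alpha> * \<tau>) \<mu> \<rho> / ereal \<tau> + F \<rho>) (\<lambda>\<rho>. \<rho> \<in> P2) \<rho>)"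

(* \<rho> is the W2-limit of n-fold iterates with time step t / n. The iterates are only required for
   large n, since for negative l minimizers may fail to exist when the time step is large. *)
definition jko_limit ::
  "('a::euclidean_space measure \<Rightarrow> ereal) \<Rightarrow> 'a measure \<Rightarrow> real \<Rightarrow> 'a measure \<Rightarrow> bool" where
  "jko_limit F \<mu>0 t \<rho> \<longleftrightarrow>
    \<rho> \<in> P2 \<and>
    (\<exists>\<mu>s. (\<forall>\<^sub>F n in sequentially. (jko_step F (t / real n) ^^ n) \<mu>0 (\<mu>s n)) \<and>
          (\<lambda>n. W2 (\<mu>s n) \<rho>) \<longlonglongrightarrow> 0)"

end

theory Submission
  imports Defs "HOL-Library.Diagonal_Subsequence"
begin

text \<open>Let \<open>x i\<close> be the entropic iterates with step \<open>\<tau> = t / n\<close> and \<open>y j\<close> the iterates of the minimizing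
  movement with step \<open>\<eta> = \<tau> / k\<close>. Inserting the midpoint of a Brownian bridge over and over, and bounding
  what remains by Talagrand's inequality, gives
  \<open>W2\<^sup>2(\<mu>, \<rho>)/2 + e (H(\<mu>) + H(\<rho>))/2 \<le> Sch\<^sup>e(\<mu>, \<rho>)\<close>, while smearing the second marginal of an optimal plan
  by the heat kernel gives \<open>Sch\<^sup>e(\<mu>, \<nu> * \<sigma>\<^sub>e) \<le> W2\<^sup>2(\<mu>, \<nu>)/2 + e H(\<mu>)\<close>.
  Hence an entropic step minimizes \<open>W2\<^sup>2 / (2\<tau>) + F\<close> up to a defect that telescopes in the entropy, and
  convexity along generalized geodesics turns this into a discrete evolution variational inequality. Combining
  it with the one for \<open>y\<close>, by doubling of variables, shows that \<open>W2\<^sup>2\<close> between \<open>x n\<close> and \<open>y (n k)\<close> is of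
  order \<open>\<alpha> + 1/n\<close> uniformly in large \<open>k\<close>. Then \<open>k\<close> tends to infinity. The constants are uniform in the initial
  datum: the lower bound for \<open>F\<close> comes from one fixed datum with the same second moment, energy and entropy.\<close>

section \<open>Compactness of couplings\<close>

text \<open>The two bounds for the cost place the entropy differently: \<open>e * Ent \<mu>\<close>
  from above, half of \<open>e\<close> at either end from below. Their gap is
  \<open>e / 2 * (Ent \<rho> - Ent \<mu>)\<close>, so the defect telescopes. Its sign is unknown,
  and interpolating at parameter \<open>s\<close> divides it by \<open>s\<close> while costing a
  factor \<open>1 - s\<close> in the squared distance. With \<open>s = 1 / n\<close> the accumulated
  loss stays bounded, and the weighted defects sum to \<open>t * \<alpha>\<close> times one
  difference of entropies. A single use of Talagrand's inequality compares \<open>\<rho>\<close>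
  with \<open>\<mu>\<close> smeared at scale \<open>e\<close>. Each midpoint halves the scale, and a
  squared distance is at most twice the sum of those of its halves, which is what the halved costs
  offer; nothing is lost in the limit. \<open>F\<close> is not assumed bounded below. One minimizer
  of the fine scheme gives some quadratic lower bound, and convexity improves its coefficient to
  nearly half of \<open>max (- l) 0\<close>, which the restriction on the time step
  tolerates.\<close>

lemma sets_borel_prod:
  "sets (borel :: ('a::second_countable_topology \<times> 'b::second_countable_topology) measure) =
    sets (borel \<Otimes>\<^sub>M borel)"
  by (subst borel_prod) (rule refl)

text \<open>Sets that can be shrunk to compact subsets at a small loss of mass for all
  \<open>\<gamma> k\<close> at once. Tightness asks this of the whole space; asked of every set of
  an algebra, it makes a setwise limit countably additive.\<close>

definition inner_compact :: "(nat \<Rightarrow> 'c::euclidean_space measure) \<Rightarrow> 'c set set" where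
  "inner_compact \<gamma> =
    {E \<in> sets borel. \<forall>e>0. \<exists>K. compact K \<and> K \<subseteq> E \<and> (\<forall>k. measure (\<gamma> k) (E - K) \<le> e)}"

lemma inner_compactD:
  assumes "E \<in> inner_compact \<gamma>" "e > 0"
  obtains K where "compact K" "K \<subseteq> E" "\<And>k. measure (\<gamma> k) (E - K) \<le> e"
  using assms unfolding inner_compact_def by blast

lemma inner_compact_borel: "E \<in> inner_compact \<gamma> \<Longrightarrow> E \<in> sets borel"
  by (simp add: inner_compact_def)

text \<open>Both losses lie in \<open>(E - K) \<union> (F - L)\<close>, so half of the tolerance
  goes to each set.\<close>

lemma inner_compact_Un_Int:
  assumes \<gamma>: "\<And>k. prob_space (\<gamma> k)" "\<And>k. sets (\<gamma> k) = sets borel"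
  assumes E: "E \<in> inner_compact \<gamma>" and F: "F \<in> inner_compact \<gamma>"
  shows "E \<union> F \<in> inner_compact \<gamma>" "E \<inter> F \<in> inner_compact \<gamma>"
proof -
  have [measurable]: "E \<in> sets borel" "F \<in> sets borel"
    using E F by (auto simp: inner_compact_borel)
  have *: "\<exists>K L. compact K \<and> compact L \<and> K \<subseteq> E \<and> L \<subseteq> F \<and>
      (\<forall>k. measure (\<gamma> k) (E \<union> F - (K \<union> L)) \<le> e) \<and> (\<forall>k. measure (\<gamma> k) (E \<inter> F - (K \<inter> L)) \<le> e)" if "e > 0" for e
  proof -
    have "e / 2 > 0" using that by simp
    obtain K where K: "compact K" "K \<subseteq> E" "\<And>k. measure (\<gamma> k) (E - K) \<le> e / 2"
      using inner_compactD[OF E \<open>e / 2 > 0\<close>] by blast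
    obtain L where L: "compact L" "L \<subseteq> F" "\<And>k. measure (\<gamma> k) (F - L) \<le> e / 2"
      using inner_compactD[OF F \<open>e / 2 > 0\<close>] by blast
    have [measurable]: "K \<in> sets borel" "L \<in> sets borel"
      using K L by (auto intro: borel_compact)
    have "measure (\<gamma> k) X \<le> e" if X: "X \<subseteq> (E - K) \<union> (F - L)" "X \<in> sets borel" for k X
    proof -
      interpret prob_space "\<gamma> k" by (rule \<gamma>)
      have "measure (\<gamma> k) X \<le> measure (\<gamma> k) ((E - K) \<union> (F - L))"
        by (rule finite_measure_mono[OF X(1)]) (simp add: \<gamma>)
      also have "\<dots> \<le> measure (\<gamma> k) (E - K) + measure (\<gamma> k) (F - L)"
        by (rule measure_Un_le) (simp_all add: \<gamma>)
      also have "\<dots> \<le> e" using K(3)[of k] L(3)[of k] by simp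
      finally show ?thesis .
    qed
    note this[of "E \<union> F - (K \<union> L)"] this[of "E \<inter> F - (K \<inter> L)"]
    moreover have "E \<union> F - (K \<union> L) \<in> sets borel" "E \<inter> F - (K \<inter> L) \<in> sets borel" by measurable
    ultimately show ?thesis
      using K L by (intro exI[of _ K] exI[of _ L]) auto
  qed
  show "E \<union> F \<in> inner_compact \<gamma>"
    unfolding inner_compact_def
  proof (intro CollectI conjI allI impI)
    fix e :: real assume "e > 0"
    from *[OF this] obtain K L where "compact K" "compact L" "K \<subseteq> E" "L \<subseteq> F"
      "\<forall>k. measure (\<gamma> k) (E \<union> F - (K \<union> L)) \<le> e" by blast
    then show "\<exists>K. compact K \<and> K \<subseteq> E \<union> F \<and> (\<forall>k. measure (\<gamma> k) (E \<union> F - K) \<le> e)"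
      by (intro exI[of _ "K \<union> L"]) (auto intro: compact_Un)
  qed measurable
  show "E \<inter> F \<in> inner_compact \<gamma>"
    unfolding inner_compact_def
  proof (intro CollectI conjI allI impI)
    fix e :: real assume "e > 0"
    from *[OF this] obtain K L where "compact K" "compact L" "K \<subseteq> E" "L \<subseteq> F"
      "\<forall>k. measure (\<gamma> k) (E \<inter> F - (K \<inter> L)) \<le> e" by blast
    then show "\<exists>K. compact K \<and> K \<subseteq> E \<inter> F \<and> (\<forall>k. measure (\<gamma> k) (E \<inter> F - K) \<le> e)"
      by (intro exI[of _ "K \<inter> L"]) (auto intro: compact_Int)
  qed measurable
qed

text \<open>Finite additivity survives the limit; the issue is continuity at the empty set. Uniform
  compact approximation reduces it to the finite intersection property, with a bound independent of
  \<open>k\<close> that passes to \<open>\<beta>\<close>. Caratheodory's theorem does the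
  rest.\<close>

lemma prob_space_setwise_limit:
  fixes \<gamma> :: "nat \<Rightarrow> 'c::euclidean_space measure"
  assumes \<gamma>: "\<And>k. prob_space (\<gamma> k)" "\<And>k. sets (\<gamma> k) = sets borel"
  assumes alg: "algebra UNIV \<A>" and sub: "\<A> \<subseteq> inner_compact \<gamma>"
  assumes gen: "sigma_sets UNIV \<A> = sets borel"
  assumes lim: "\<And>A. A \<in> \<A> \<Longrightarrow> (\<lambda>k. measure (\<gamma> k) A) \<longlonglongrightarrow> \<beta> A"
  shows "\<exists>\<mu>. prob_space \<mu> \<and> sets \<mu> = sets borel \<and> (\<forall>A\<in>\<A>. measure \<mu> A = \<beta> A)"
proof -
  interpret A: algebra UNIV \<A> by fact
  interpret G: prob_space "\<gamma> k" for k by (rule \<gamma>)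
  have Ab: "A \<in> sets (\<gamma> k)" if "A \<in> \<A>" for A k
    using that sub \<gamma>(2) by (auto simp: inner_compact_borel)
  have pos: "0 \<le> \<beta> A" if "A \<in> \<A>" for A
    by (rule LIMSEQ_le_const[OF lim[OF that]]) auto
  have empty: "\<beta> {} = 0"
    using lim[of "{}"] by (simp add: LIMSEQ_const_iff)
  have sp: "space (\<gamma> k) = UNIV" for k
    using sets_eq_imp_space_eq[OF \<gamma>(2)[of k]] by simp
  have one: "\<beta> UNIV = 1"
  proof -
    have "(\<lambda>k. measure (\<gamma> k) UNIV) = (\<lambda>k. 1)" using G.prob_space by (simp add: sp)
    then show ?thesis using lim[of UNIV] A.top by (simp add: LIMSEQ_const_iff)
  qed
  have "\<exists>\<mu> :: 'c set \<Rightarrow> ennreal. (\<forall>s \<in> \<A>. \<mu> s = ennreal (\<beta> s)) \<and> measure_space UNIV (sigma_sets UNIV \<A>) \<mu>"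
  proof (rule A.caratheodory_empty_continuous)
    show "positive \<A> (\<lambda>x. ennreal (\<beta> x))" by (simp add: positive_def empty)
    show "additive \<A> (\<lambda>x. ennreal (\<beta> x))"
    unfolding additive_def
    proof (intro ballI impI)
      fix x y assume xy: "x \<in> \<A>" "y \<in> \<A>" "x \<inter> y = {}"
      have "(\<lambda>k. measure (\<gamma> k) x + measure (\<gamma> k) y) \<longlonglongrightarrow> \<beta> x + \<beta> y"
        by (intro tendsto_add lim xy)
      moreover have "(\<lambda>k. measure (\<gamma> k) x + measure (\<gamma> k) y) = (\<lambda>k. measure (\<gamma> k) (x \<union> y))"
        using xy by (auto simp: fun_eq_iff G.finite_measure_Union Ab)
      moreover have "x \<union> y \<in> \<A>" using xy by auto
      ultimately have "\<beta> (x \<union> y) = \<beta> x + \<beta> y"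
        using lim[of "x \<union> y"] LIMSEQ_unique by metis
      then show "ennreal (\<beta> (x \<union> y)) = ennreal (\<beta> x) + ennreal (\<beta> y)"
        using pos xy by simp
    qed
    fix A :: "nat \<Rightarrow> 'c set" assume A: "range A \<subseteq> \<A>" "decseq A" "(\<Inter>i. A i) = {}"
    have AA: "A i \<in> \<A>" for i using A by auto
    have "(\<lambda>i. \<beta> (A i)) \<longlonglongrightarrow> 0"
    proof (rule LIMSEQ_I)
      fix e :: real assume e: "e > 0"
      \<comment> \<open>The losses \<open>e/4 * (1/2)^i\<close> add up to at most
        \<open>e/2\<close>.\<close>
      have "\<exists>K. compact K \<and> K \<subseteq> A i \<and> (\<forall>k. measure (\<gamma> k) (A i - K) \<le> e/4 * (1/2)^i)" for i
      proof -
        have "A i \<in> inner_compact \<gamma>" "e/4 * (1/2)^i > 0" using AA sub e by auto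
        from inner_compactD[OF this] show ?thesis by metis
      qed
      then obtain K where K: "\<And>i. compact (K i)" "\<And>i. K i \<subseteq> A i"
        "\<And>i k. measure (\<gamma> k) (A i - K i) \<le> e/4 * (1/2)^i" by metis
      have Kb: "K i \<in> sets (\<gamma> k)" for i k using K(1) \<gamma>(2) by (simp add: borel_compact)
      \<comment> \<open>Nested compact sets with empty intersection are empty from a finite stage
        \<open>n\<close> on. A point of \<open>A m\<close> with \<open>m \<ge> n\<close> then misses
        some \<open>K i\<close>, so it lies in one of the losses \<open>A i - K i\<close> with
        \<open>i \<le> n\<close>.\<close>
      define L where "L n = (\<Inter>i\<le>n. K i)" for n
      have "\<exists>n. L n = {}"
      proof (rule ccontr)
        assume "\<nexists>n. L n = {}"
        then have ne: "\<And>n. L n \<noteq> {}" by auto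
        have "\<Inter>(range L) \<noteq> {}"
        proof (rule compact_nest[where F=L])
          show "compact (L n)" for n unfolding L_def using K(1)
            by (intro compact_Inter) (auto intro: compact_imp_closed)
          show "\<And>m n. m \<le> n \<Longrightarrow> L n \<subseteq> L m" unfolding L_def by auto
        qed (rule ne)
        moreover have "\<Inter>(range L) \<subseteq> (\<Inter>i. A i)"
          using K(2) unfolding L_def by fastforce
        ultimately show False using A(3) by auto
      qed
      then obtain n where n: "L n = {}" by auto
      have small: "measure (\<gamma> k) (A m) \<le> e/2" if "m \<ge> n" for m k
      proof -
        have "A m \<subseteq> (\<Union>i\<le>n. A i - K i)"
        proof
          fix x assume x: "x \<in> A m"
          from n obtain i where i: "i \<le> n" "x \<notin> K i" unfolding L_def by auto
          have "A m \<subseteq> A i" using A(2) i that by (auto simp: decseq_def)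
          then show "x \<in> (\<Union>i\<le>n. A i - K i)" using x i by auto
        qed
        then have "measure (\<gamma> k) (A m) \<le> measure (\<gamma> k) (\<Union>i\<le>n. A i - K i)"
          by (rule G.finite_measure_mono)
           (intro sets.finite_UN finite_atMost sets.Diff Ab[OF AA] Kb)
        also have "\<dots> \<le> (\<Sum>i\<le>n. measure (\<gamma> k) (A i - K i))"
          by (rule measure_UNION_le) (simp, intro sets.Diff Ab[OF AA] Kb)
        also have "\<dots> \<le> (\<Sum>i\<le>n. e/4 * (1/2)^i)" by (intro sum_mono K)
        also have "\<dots> = e/4 * (\<Sum>i<Suc n. (1/2)^i)" by (simp add: sum_distrib_left lessThan_Suc_atMost)
        also have "\<dots> \<le> e/4 * 2" using e by (intro mult_left_mono) (auto simp: geometric_sum)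
        finally show ?thesis by simp
      qed
      show "\<exists>no. \<forall>m\<ge>no. norm (\<beta> (A m) - 0) < e"
      proof (intro exI[of _ n] allI impI)
        fix m assume "m \<ge> n"
        then have "\<beta> (A m) \<le> e/2"
          using small by (intro LIMSEQ_le_const2[OF lim[OF AA]]) auto
        then show "norm (\<beta> (A m) - 0) < e" using pos[OF AA[of m]] e by simp
      qed
    qed
    then show "(\<lambda>i. ennreal (\<beta> (A i))) \<longlonglongrightarrow> 0"
      using tendsto_ennrealI[where x=0] by fastforce
  qed simp
  then obtain \<mu> :: "'c set \<Rightarrow> ennreal" where \<mu>: "\<And>s. s \<in> \<A> \<Longrightarrow> \<mu> s = ennreal (\<beta> s)"
    "measure_space UNIV (sigma_sets UNIV \<A>) \<mu>" by blast
  define R where "R = measure_of UNIV (sets borel) \<mu>"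
  have ms: "measure_space UNIV (sets borel) \<mu>" using \<mu>(2) gen by simp
  have sR: "sets R = sets borel" unfolding R_def
    using sets.sigma_sets_eq[of "borel :: 'c measure"] by (simp add: sets_measure_of)
  have eR: "emeasure R A = \<mu> A" if "A \<in> sets borel" for A
    using ms that unfolding R_def measure_space_def
    by (intro emeasure_measure_of_sigma) auto
  have eA: "emeasure R A = ennreal (\<beta> A)" if "A \<in> \<A>" for A
    using eR[of A] \<mu>(1)[OF that] that gen by auto
  have spR: "space R = UNIV" using sets_eq_imp_space_eq[OF sR] by simp
  have "prob_space R"
    by (rule prob_spaceI) (use eA[of UNIV] one A.top in \<open>simp add: spR\<close>)
  moreover have "measure R A = \<beta> A" if "A \<in> \<A>" for A
    using eA[OF that] pos[OF that] by (simp add: measure_def)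
  ultimately show ?thesis using sR by blast
qed

text \<open>Countability serves the diagonal extraction; minimality lets all members inherit uniform
  compact approximation from the generators.\<close>

lemma countable_generated_algebra:
  fixes \<G> :: "'c set set"
  assumes "countable \<G>"
  shows "\<exists>\<A>. countable \<A> \<and> \<G> \<subseteq> \<A> \<and> algebra UNIV \<A> \<and>
    (\<forall>\<B>. algebra UNIV \<B> \<and> \<G> \<subseteq> \<B> \<longrightarrow> \<A> \<subseteq> \<B>)"
proof -
  define step where "step S = S \<union> uminus ` S \<union> (\<lambda>(a, b). a \<union> b) ` (S \<times> S)" for S :: "'c set set"
  define \<A> where "\<A> = (\<Union>n. (step ^^ n) (insert {} \<G>))"
  have c: "countable ((step ^^ n) (insert {} \<G>))" for n
    by (induction n) (use assms in \<open>auto simp: step_def\<close>)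
  have mono: "(step ^^ m) (insert {} \<G>) \<subseteq> (step ^^ n) (insert {} \<G>)" if "m \<le> n" for m n
    using that
  proof (induction n rule: dec_induct)
    case (step n)
    then show ?case by (auto simp: step_def)
  qed simp
  have stepA: "(step ^^ n) (insert {} \<G>) \<subseteq> \<A>" for n unfolding \<A>_def by auto
  have 1: "- a \<in> \<A>" if a: "a \<in> \<A>" for a
  proof -
    obtain n where "a \<in> (step ^^ n) (insert {} \<G>)" using a unfolding \<A>_def by blast
    then have "- a \<in> (step ^^ Suc n) (insert {} \<G>)" by (auto simp: step_def)
    then show ?thesis using stepA by blast
  qed
  have 2: "a \<union> b \<in> \<A>" if ab: "a \<in> \<A>" "b \<in> \<A>" for a b
  proof -
    obtain n m where "a \<in> (step ^^ n) (insert {} \<G>)" "b \<in> (step ^^ m) (insert {} \<G>)"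
      using ab unfolding \<A>_def by blast
    then have "a \<in> (step ^^ max n m) (insert {} \<G>)" "b \<in> (step ^^ max n m) (insert {} \<G>)"
      using mono[of n "max n m"] mono[of m "max n m"] by auto
    then have "a \<union> b \<in> (step ^^ Suc (max n m)) (insert {} \<G>)" by (auto simp: step_def)
    then show ?thesis using stepA by blast
  qed
  have 0: "insert {} \<G> \<subseteq> \<A>" using stepA[of 0] by simp
  have "algebra UNIV \<A>"
    unfolding algebra_iff_Un using 0 1 2 by (auto simp: Compl_eq_Diff_UNIV)
  moreover have "\<A> \<subseteq> \<B>" if "algebra UNIV \<B>" "\<G> \<subseteq> \<B>" for \<B>
  proof -
    interpret B: algebra UNIV \<B> by fact
    have "(step ^^ n) (insert {} \<G>) \<subseteq> \<B>" for n
    proof (induction n)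
      case (Suc n)
      have "- a \<in> \<B>" if "a \<in> \<B>" for a using B.compl_sets[OF that] by (simp add: Compl_eq_Diff_UNIV)
      then show ?case using Suc by (auto simp: step_def)
    qed (use that in auto)
    then show ?thesis unfolding \<A>_def by auto
  qed
  moreover have "countable \<A>" unfolding \<A>_def using c by auto
  ultimately show ?thesis using 0 by (intro exI[of _ \<A>]) auto
qed

lemma bounded_diagonal_subseq:
  fixes f :: "nat \<Rightarrow> 'i \<Rightarrow> real"
  assumes c: "countable I" and b: "\<And>k i. i \<in> I \<Longrightarrow> f k i \<in> {0..1}"
  shows "\<exists>r. strict_mono r \<and> (\<forall>i\<in>I. convergent (\<lambda>k. f (r k) i))"
proof (cases "I = {}")
  case True then show ?thesis using strict_mono_id by auto
next
  case False
  define e where "e = from_nat_into I"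
  have eI: "e n \<in> I" for n using False by (simp add: e_def from_nat_into)
  interpret subseqs "\<lambda>n s. convergent (\<lambda>k. f (s k) (e n))"
  proof
    fix n and s :: "nat \<Rightarrow> nat"
    have "compact {0..1::real}" by simp
    then have "seq_compact {0..1::real}" using compact_eq_seq_compact_metric by blast
    then obtain l r where "strict_mono r" "((\<lambda>k. f (s k) (e n)) \<circ> r) \<longlonglongrightarrow> l"
      using b[OF eI] unfolding seq_compact_def by metis
    then show "\<exists>r'. strict_mono r' \<and> convergent (\<lambda>k. f ((s \<circ> r') k) (e n))"
      by (intro exI[of _ r]) (auto simp: convergent_def o_def)
  qed
  have "convergent (\<lambda>k. f (diagseq k) (e n))" for n
  proof -
    have "convergent (\<lambda>k. f ((diagseq \<circ> ((+) (Suc n))) k) (e n))"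
    proof (rule diagseq_holds)
      fix r s n assume "strict_mono (r :: nat \<Rightarrow> nat)" "convergent (\<lambda>k. f (s k) (e n))"
      then show "convergent (\<lambda>k. f ((s \<circ> r) k) (e n))"
        using convergent_subseq_convergent[of "\<lambda>k. f (s k) (e n)" r] by (simp add: o_def)
    qed
    then have "convergent (\<lambda>k. f (diagseq (k + Suc n)) (e n))" by (simp add: o_def add.commute)
    then show ?thesis using convergent_ignore_initial_segment[of "\<lambda>k. f (diagseq k) (e n)" "Suc n"] by simp
  qed
  moreover have "\<exists>n. i = e n" if "i \<in> I" for i
    using from_nat_into_surj[OF c that] by (auto simp: e_def)
  ultimately show ?thesis using subseq_diagseq by blast
qed

text \<open>The uniform inner approximation needs only the marginals: the mass lost by a compact
  rectangle inside a rectangle is controlled by the two marginals.\<close>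

lemma times_inner_compact:
  fixes M :: "'a::euclidean_space measure" and N :: "'b::euclidean_space measure"
    and \<gamma> :: "nat \<Rightarrow> ('a \<times> 'b) measure"
  assumes MN: "prob_space M" "prob_space N" "sets M = sets borel" "sets N = sets borel"
  assumes \<gamma>: "\<And>k. sets (\<gamma> k) = sets borel" "\<And>k. distr (\<gamma> k) borel fst = M" "\<And>k. distr (\<gamma> k) borel snd = N"
  assumes AB: "A \<in> sets borel" "B \<in> sets borel"
  shows "A \<times> B \<in> inner_compact \<gamma>"
  unfolding inner_compact_def
proof (intro CollectI conjI allI impI)
  show "A \<times> B \<in> sets borel" using AB by (simp add: sets_borel_prod)
  fix e :: real assume e: "e > 0"
  have cpt: "\<exists>K. compact K \<and> K \<subseteq> B \<and> measure R (B - K) \<le> e/2"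
    if R: "prob_space R" "sets R = sets borel" "B \<in> sets borel" for B and R :: "'d::euclidean_space measure"
  proof -
    interpret prob_space R by fact
    have "(SUP K \<in> {K. K \<subseteq> B \<and> compact K}. emeasure R K) = emeasure R B"
      by (rule inner_regular[symmetric]) (use R in auto)
    moreover have "emeasure R B - ennreal (e/2) < emeasure R B \<or> emeasure R B = 0"
    proof (cases "measure R B = 0")
      case False
      then have "measure R B > 0" by (simp add: zero_less_measure_iff)
      then show ?thesis using e by (auto simp: emeasure_eq_measure ennreal_minus intro!: ennreal_lessI)
    qed (simp add: emeasure_eq_measure)
    ultimately consider "emeasure R B - ennreal (e/2) < (SUP K \<in> {K. K \<subseteq> B \<and> compact K}. emeasure R K)" | "emeasure R B = 0"
      by auto
    then show ?thesis
    proof cases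
      case 1
      then obtain K where K: "K \<subseteq> B" "compact K" "emeasure R B - ennreal (e/2) < emeasure R K"
        by (auto simp: less_SUP_iff)
      have Kb: "K \<in> sets R" "B \<in> sets R" using K R by (auto intro: borel_compact)
      have "measure R B - e/2 < measure R K"
        using K(3) e by (cases "measure R B - e/2 \<ge> 0")
          (auto simp: emeasure_eq_measure ennreal_minus ennreal_less_iff intro: less_le_trans[OF _ measure_nonneg])
      then have "measure R (B - K) \<le> e/2"
        using finite_measure_Diff[OF Kb(2,1) K(1)] by simp
      then show ?thesis using K by auto
    next
      case 2
      then show ?thesis using e by (intro exI[of _ "{}"]) (auto simp: measure_def)
    qed
  qed
  obtain K where K: "compact K" "K \<subseteq> A" "measure M (A - K) \<le> e/2" using cpt[of M A] MN AB by auto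
  obtain L where L: "compact L" "L \<subseteq> B" "measure N (B - L) \<le> e/2" using cpt[of N B] MN AB by auto
  have [measurable]: "K \<in> sets borel" "L \<in> sets borel" using K L by (auto intro: borel_compact)
  have [measurable]: "A \<in> sets borel" "B \<in> sets borel" using AB by auto
  show "\<exists>K. compact K \<and> K \<subseteq> A \<times> B \<and> (\<forall>k. measure (\<gamma> k) (A \<times> B - K) \<le> e)"
  proof (intro exI[of _ "K \<times> L"] conjI allI)
    fix k
    have [measurable_cong]: "sets (\<gamma> k) = sets (borel \<Otimes>\<^sub>M borel)" using \<gamma>(1) by (simp add: sets_borel_prod)
    have sp: "space (\<gamma> k) = UNIV" using sets_eq_imp_space_eq[OF \<gamma>(1)[of k]] by simp
    have [measurable]: "fst \<in> measurable (\<gamma> k) borel" "snd \<in> measurable (\<gamma> k) borel" by measurable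
    interpret prob_space "\<gamma> k"
      using prob_space_distrD[of fst "\<gamma> k" borel] MN(1) \<gamma>(2) by simp
    have m1: "measure M (A - K) = measure (\<gamma> k) ((A - K) \<times> UNIV)"
      unfolding \<gamma>(2)[of k, symmetric] by (subst measure_distr) (auto simp: sp vimage_def intro!: arg_cong[where f="measure (\<gamma> k)"])
    have m2: "measure N (B - L) = measure (\<gamma> k) (UNIV \<times> (B - L))"
      unfolding \<gamma>(3)[of k, symmetric] by (subst measure_distr) (auto simp: sp vimage_def intro!: arg_cong[where f="measure (\<gamma> k)"])
    have S: "(A - K) \<times> UNIV \<in> sets (\<gamma> k)" "UNIV \<times> (B - L) \<in> sets (\<gamma> k)" by measurable
    have "measure (\<gamma> k) (A \<times> B - K \<times> L) \<le> measure (\<gamma> k) ((A - K) \<times> UNIV \<union> UNIV \<times> (B - L))"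
      using S by (intro finite_measure_mono) auto
    also have "\<dots> \<le> measure (\<gamma> k) ((A - K) \<times> UNIV) + measure (\<gamma> k) (UNIV \<times> (B - L))"
      by (rule measure_Un_le[OF S])
    also have "\<dots> \<le> e" using K(3) L(3) m1 m2 by simp
    finally show "measure (\<gamma> k) (A \<times> B - K \<times> L) \<le> e" .
  qed (use K L in \<open>auto intro: compact_Times\<close>)
qed

lemma sigma_sets_topological_basis:
  fixes B :: "'c::second_countable_topology set set"
  assumes "topological_basis B" "countable B"
  shows "sigma_sets UNIV B = sets borel"
  by (subst borel_eq_countable_basis[OF assms(2,1)]) (simp add: sets_measure_of)

lemma prob_measure_eqI_algebra:
  fixes P Q :: "'d::second_countable_topology measure"
  assumes P: "prob_space P" "prob_space Q" "sets P = sets borel" "sets Q = sets borel"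
    and B: "countable B" "topological_basis B" and AB: "algebra UNIV \<D>" "B \<subseteq> \<D>" "\<D> \<subseteq> sets borel"
    and eq: "\<And>E. E \<in> \<D> \<Longrightarrow> measure P E = measure Q E"
  shows "P = Q"
proof (rule measure_eqI_generator_eq[where E=\<D> and \<Omega>=UNIV and A="\<lambda>_. UNIV"])
  interpret D: algebra UNIV \<D> by fact
  interpret P: prob_space P by fact
  interpret Q: prob_space Q by fact
  show "Int_stable \<D>" by (auto simp: Int_stable_def)
  show "\<D> \<subseteq> Pow UNIV" by simp
  show "emeasure P X = emeasure Q X" if "X \<in> \<D>" for X
    using eq[OF that] by (simp add: P.emeasure_eq_measure Q.emeasure_eq_measure)
  have "sigma_sets UNIV \<D> = sets borel"
  proof
    show "sigma_sets UNIV \<D> \<subseteq> sets borel" using AB(3) sets.sigma_sets_subset[of \<D> borel] by auto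
    show "sets borel \<subseteq> sigma_sets UNIV \<D>"
      using sigma_sets_topological_basis[OF B(2,1)] sigma_sets_mono'[OF AB(2)] by auto
  qed
  then show "sets P = sigma_sets UNIV \<D>" "sets Q = sigma_sets UNIV \<D>" using P by auto
  show "range (\<lambda>_. UNIV) \<subseteq> \<D>" using D.top by auto
  show "(\<Union>i. UNIV) = UNIV" by simp
  show "emeasure P UNIV \<noteq> \<infinity>" by simp
qed

text \<open>A form of Prokhorov's theorem that yields convergence of masses. With fixed marginals
  every measurable rectangle is approximated from inside uniformly in \<open>k\<close>, so a
  subsequence converges on the countable algebra generated by the wanted rectangles
  \<open>\<C>\<close> and a basis. Convergence on \<open>\<C>\<close> identifies the limit in the
  gluing; the bound on open sets gives lower semicontinuity of the cost.\<close>

proposition couplings_setwise_compact: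
  fixes M :: "'a::euclidean_space measure" and N :: "'b::euclidean_space measure"
    and \<gamma> :: "nat \<Rightarrow> ('a \<times> 'b) measure"
  assumes MN: "prob_space M" "prob_space N" "sets M = sets borel" "sets N = sets borel"
  assumes \<gamma>: "\<And>k. sets (\<gamma> k) = sets borel" "\<And>k. distr (\<gamma> k) borel fst = M" "\<And>k. distr (\<gamma> k) borel snd = N"
  assumes C: "countable \<C>" "\<And>E. E \<in> \<C> \<Longrightarrow> \<exists>A\<in>sets borel. \<exists>B\<in>sets borel. E = A \<times> B"
  obtains r \<theta> where "strict_mono r" "sets \<theta> = sets borel" "distr \<theta> borel fst = M" "distr \<theta> borel snd = N"
    "\<And>E. E \<in> \<C> \<Longrightarrow> (\<lambda>k. measure (\<gamma> (r k)) E) \<longlonglongrightarrow> measure \<theta> E"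
    "\<And>U. open U \<Longrightarrow> emeasure \<theta> U \<le> liminf (\<lambda>k. emeasure (\<gamma> (r k)) U)"
proof -
  obtain B1 :: "'a set set" where B1: "countable B1" "topological_basis B1" using ex_countable_basis by auto
  obtain B2 :: "'b set set" where B2: "countable B2" "topological_basis B2" using ex_countable_basis by auto
  have b1: "A \<in> sets borel" if "A \<in> B1" for A using that B1 topological_basis_open borel_open by blast
  have b2: "A \<in> sets borel" if "A \<in> B2" for A using that B2 topological_basis_open borel_open by blast
  define BB where "BB = (\<lambda>(a, b). a \<times> b) ` (B1 \<times> B2)"
  have BB: "countable BB" "topological_basis BB"
    using B1 B2 topological_basis_prod[OF B1(2) B2(2)] by (auto simp: BB_def)
  \<comment> \<open>The cylinders over basic sets are included in order to read off the marginals of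
    the limit.\<close>
  define \<G> where "\<G> = \<C> \<union> BB \<union> (\<lambda>a. a \<times> UNIV) ` B1 \<union> (\<lambda>b. UNIV \<times> b) ` B2"
  have rect: "\<exists>A\<in>sets borel. \<exists>B\<in>sets borel. E = A \<times> B" if "E \<in> \<G>" for E
    using that C(2) b1 b2 unfolding \<G>_def BB_def by (auto; (metis UNIV_I b1 b2 borel_open open_UNIV)?)
  have "countable \<G>" using B1 B2 C BB by (auto simp: \<G>_def)
  from countable_generated_algebra[OF this] obtain \<A> where A: "countable \<A>" "\<G> \<subseteq> \<A>" "algebra UNIV \<A>"
    "\<And>\<B>. algebra UNIV \<B> \<and> \<G> \<subseteq> \<B> \<Longrightarrow> \<A> \<subseteq> \<B>" by blast
  interpret A: algebra UNIV \<A> by fact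
  have G: "prob_space (\<gamma> k)" for k
  proof -
    have "sets (\<gamma> k) = sets ((borel :: 'a measure) \<Otimes>\<^sub>M (borel :: 'b measure))" using \<gamma>(1) by (simp add: sets_borel_prod)
    then have "fst \<in> measurable (\<gamma> k) borel" using measurable_cong_sets measurable_fst by blast
    then show ?thesis using prob_space_distrD[of fst "\<gamma> k" borel] MN(1) \<gamma>(2) by simp
  qed
  interpret G: prob_space "\<gamma> k" for k by (rule G)
  let ?I = "inner_compact \<gamma>"
  note tic = times_inner_compact[OF MN \<gamma>]
  \<comment> \<open>\<open>inner_compact\<close> is closed under unions and intersections, but not
    visibly under complements; demanding it of a set and of its complement gives an algebra. The
    complement of a rectangle is a union of two rectangles, so the generators belong to it.\<close>
  define \<B> where "\<B> = {E. E \<in> ?I \<and> - E \<in> ?I}"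
  have "algebra UNIV \<B>"
  proof (unfold algebra_iff_Un, intro conjI ballI)
    show "\<B> \<subseteq> Pow UNIV" by simp
    show "{} \<in> \<B>" using tic[of "{}" "{}"] tic[of UNIV UNIV] by (simp add: \<B>_def)
    fix a assume a: "a \<in> \<B>"
    then show "UNIV - a \<in> \<B>" by (simp add: \<B>_def Compl_eq_Diff_UNIV[symmetric])
    fix b assume "b \<in> \<B>"
    then show "a \<union> b \<in> \<B>" using a inner_compact_Un_Int[OF G \<gamma>(1)] by (simp add: \<B>_def)
  qed
  moreover have "\<G> \<subseteq> \<B>"
  proof
    fix E assume "E \<in> \<G>"
    then obtain A B where AB: "A \<in> sets borel" "B \<in> sets borel" "E = A \<times> B" using rect by blast
    have "- E = (- A) \<times> UNIV \<union> UNIV \<times> (- B)" using AB by auto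
    then show "E \<in> \<B>" using AB inner_compact_Un_Int(1)[OF G \<gamma>(1)] tic[of "- A" UNIV] tic[of UNIV "- B"] tic[of A B]
      by (simp add: \<B>_def borel_comp)
  qed
  ultimately have AI: "\<A> \<subseteq> ?I" using A(4)[of \<B>] by (auto simp: \<B>_def)
  have gen: "sigma_sets UNIV \<A> = sets borel"
  proof
    show "sigma_sets UNIV \<A> \<subseteq> sets borel"
      using AI inner_compact_borel sets.sigma_sets_subset[of \<A> borel] by auto
    have "BB \<subseteq> \<A>" using A(2) by (auto simp: \<G>_def)
    then show "sets borel \<subseteq> sigma_sets UNIV \<A>"
      using sigma_sets_topological_basis[OF BB(2,1)] sigma_sets_mono'[of BB \<A>] by auto
  qed
  obtain r where r: "strict_mono r" "\<And>E. E \<in> \<A> \<Longrightarrow> convergent (\<lambda>k. measure (\<gamma> (r k)) E)"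
    using bounded_diagonal_subseq[OF A(1), of "\<lambda>k E. measure (\<gamma> k) E"] G.prob_le_1 by auto
  define \<beta> where "\<beta> E = lim (\<lambda>k. measure (\<gamma> (r k)) E)" for E
  have lim: "(\<lambda>k. measure (\<gamma> (r k)) E) \<longlonglongrightarrow> \<beta> E" if "E \<in> \<A>" for E
    using r(2)[OF that, unfolded convergent_LIMSEQ_iff] unfolding \<beta>_def .
  have "\<exists>\<mu>. prob_space \<mu> \<and> sets \<mu> = sets borel \<and> (\<forall>A\<in>\<A>. measure \<mu> A = \<beta> A)"
  proof (rule prob_space_setwise_limit[where \<gamma>="\<lambda>k. \<gamma> (r k)"])
    show "\<A> \<subseteq> inner_compact (\<lambda>k. \<gamma> (r k))"
    proof
      fix E assume "E \<in> \<A>"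
      then have E: "E \<in> ?I" using AI by auto
      show "E \<in> inner_compact (\<lambda>k. \<gamma> (r k))"
        unfolding inner_compact_def
        using inner_compactD[OF E] inner_compact_borel[OF E] by (smt (verit, best) mem_Collect_eq)
    qed
  qed (use G \<gamma>(1) A(3) gen lim in auto)
  then obtain \<theta> where \<theta>: "prob_space \<theta>" "sets \<theta> = sets borel" "\<And>E. E \<in> \<A> \<Longrightarrow> measure \<theta> E = \<beta> E" by blast
  interpret T: prob_space \<theta> by fact
  have sT: "sets \<theta> = sets ((borel :: 'a measure) \<Otimes>\<^sub>M (borel :: 'b measure))" using \<theta>(2) by (simp add: sets_borel_prod)
  have sp: "space \<theta> = UNIV" using sets_eq_imp_space_eq[OF \<theta>(2)] by simp
  have spk: "space (\<gamma> k) = UNIV" for k using sets_eq_imp_space_eq[OF \<gamma>(1)[of k]] by simp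
  have limT: "(\<lambda>k. measure (\<gamma> (r k)) E) \<longlonglongrightarrow> measure \<theta> E" if "E \<in> \<A>" for E
    using lim \<theta>(3) that by simp
  have fst_m: "fst \<in> measurable \<theta> borel" using measurable_cong_sets[OF sT refl] measurable_fst by blast
  have snd_m: "snd \<in> measurable \<theta> borel" using measurable_cong_sets[OF sT refl] measurable_snd by blast
  have sk: "sets (\<gamma> k) = sets ((borel :: 'a measure) \<Otimes>\<^sub>M (borel :: 'b measure))" for k using \<gamma>(1) by (simp add: sets_borel_prod)
  have fst_k: "fst \<in> measurable (\<gamma> k) borel" for k using measurable_cong_sets[OF sk refl] measurable_fst by blast
  have snd_k: "snd \<in> measurable (\<gamma> k) borel" for k using measurable_cong_sets[OF sk refl] measurable_snd by blast
  \<comment> \<open>On cylinders of the algebra the masses do not depend on \<open>k\<close>, so the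
    limit has the prescribed marginal there; the bases of these cylinders form an algebra that
    contains a topological basis.\<close>
  have m1: "distr \<theta> borel fst = M"
  proof (rule prob_measure_eqI_algebra[OF _ MN(1) _ MN(3) B1, where \<D>="{A \<in> sets borel. A \<times> UNIV \<in> \<A>}"])
    show "prob_space (distr \<theta> borel fst)" by (rule T.prob_space_distr[OF fst_m])
    have "(- a) \<times> UNIV = UNIV - a \<times> UNIV" for a :: "'a set" by auto
    then have "(- a) \<times> (UNIV :: 'b set) \<in> \<A>" if "a \<times> (UNIV :: 'b set) \<in> \<A>" for a
      using A.compl_sets[OF that] by metis
    then show "algebra UNIV {A \<in> sets borel. A \<times> (UNIV :: 'b set) \<in> \<A>}"
      unfolding algebra_iff_Un by (auto simp: Compl_eq_Diff_UNIV[symmetric] Sigma_Un_distrib1 borel_comp)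
    show "B1 \<subseteq> {A \<in> sets borel. A \<times> (UNIV :: 'b set) \<in> \<A>}" using A(2) b1 by (auto simp: \<G>_def)
    fix E assume E: "E \<in> {A \<in> sets borel. A \<times> (UNIV :: 'b set) \<in> \<A>}"
    have [simp]: "fst -` E = E \<times> (UNIV :: 'b set)" by auto
    have "measure (\<gamma> k) (E \<times> UNIV) = measure M E" for k
      unfolding \<gamma>(2)[of k, symmetric] using E by (subst measure_distr[OF fst_k]) (auto simp: spk)
    then have "measure \<theta> (E \<times> UNIV) = measure M E"
      using limT[of "E \<times> UNIV"] E by (simp add: LIMSEQ_const_iff)
    then show "measure (distr \<theta> borel fst) E = measure M E"
      using E by (subst measure_distr[OF fst_m]) (auto simp: sp)
  qed auto
  have m2: "distr \<theta> borel snd = N"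
  proof (rule prob_measure_eqI_algebra[OF _ MN(2) _ MN(4) B2, where \<D>="{A \<in> sets borel. UNIV \<times> A \<in> \<A>}"])
    show "prob_space (distr \<theta> borel snd)" by (rule T.prob_space_distr[OF snd_m])
    have "UNIV \<times> (- a) = UNIV - UNIV \<times> a" for a :: "'b set" by auto
    then have "(UNIV :: 'a set) \<times> (- a) \<in> \<A>" if "(UNIV :: 'a set) \<times> a \<in> \<A>" for a
      using A.compl_sets[OF that] by metis
    then show "algebra UNIV {A \<in> sets borel. (UNIV :: 'a set) \<times> A \<in> \<A>}"
      unfolding algebra_iff_Un by (auto simp: Compl_eq_Diff_UNIV[symmetric] Sigma_Un_distrib2 borel_comp)
    show "B2 \<subseteq> {A \<in> sets borel. (UNIV :: 'a set) \<times> A \<in> \<A>}" using A(2) b2 by (auto simp: \<G>_def)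
    fix E assume E: "E \<in> {A \<in> sets borel. (UNIV :: 'a set) \<times> A \<in> \<A>}"
    have [simp]: "snd -` E = (UNIV :: 'a set) \<times> E" by auto
    have "measure (\<gamma> k) (UNIV \<times> E) = measure N E" for k
      unfolding \<gamma>(3)[of k, symmetric] using E by (subst measure_distr[OF snd_k]) (auto simp: spk)
    then have "measure \<theta> (UNIV \<times> E) = measure N E"
      using limT[of "UNIV \<times> E"] E by (simp add: LIMSEQ_const_iff)
    then show "measure (distr \<theta> borel snd) E = measure N E"
      using E by (subst measure_distr[OF snd_m]) (auto simp: sp)
  qed auto
  have lsc: "emeasure \<theta> U \<le> liminf (\<lambda>k. emeasure (\<gamma> (r k)) U)" if U: "open U" for U
  proof -
    obtain B' where B': "B' \<subseteq> BB" "\<Union>B' = U" using BB(2) U unfolding topological_basis_def by meson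
    have cB: "countable B'" using B' BB(1) countable_subset by blast
    show ?thesis
    proof (cases "B' = {}")
      case True then show ?thesis using B' by simp
    next
      case False
      \<comment> \<open>Convergence of masses is known on the algebra only, so the open set is
        exhausted by finite unions of basic rectangles.\<close>
      define V where "V n = (\<Union>i\<le>n. from_nat_into B' i)" for n :: nat
      have BA: "B' \<subseteq> \<A>" using B' A(2) by (auto simp: \<G>_def)
      have VA: "V n \<in> \<A>" for n
        unfolding V_def using from_nat_into[OF False] BA by (intro A.finite_UN) auto
      have Vs: "V n \<in> sets \<theta>" for n using VA AI inner_compact_borel \<theta>(2) by auto
      have UV: "U = (\<Union>n. V n)"
      proof -
        have "U = (\<Union>n. from_nat_into B' n)" using B' range_from_nat_into[OF False cB] by (metis Union_eq image_def)
        then show ?thesis unfolding V_def by auto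
      qed
      have "incseq V" unfolding V_def incseq_def by (auto intro: order_trans)
      then have "emeasure \<theta> U = (SUP n. emeasure \<theta> (V n))"
        unfolding UV using Vs by (intro SUP_emeasure_incseq[symmetric]) auto
      also have "\<dots> \<le> liminf (\<lambda>k. emeasure (\<gamma> (r k)) U)"
      proof (rule SUP_least)
        fix n
        have "(\<lambda>k. emeasure (\<gamma> (r k)) (V n)) \<longlonglongrightarrow> emeasure \<theta> (V n)"
          unfolding G.emeasure_eq_measure T.emeasure_eq_measure by (intro tendsto_ennrealI limT VA)
        then have "emeasure \<theta> (V n) = liminf (\<lambda>k. emeasure (\<gamma> (r k)) (V n))"
          using lim_imp_Liminf[OF sequentially_bot] by metis
        also have "\<dots> \<le> liminf (\<lambda>k. emeasure (\<gamma> (r k)) U)"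
          by (intro Liminf_mono always_eventually allI emeasure_mono) (use UV U in \<open>auto simp: \<gamma>\<close>)
        finally show "emeasure \<theta> (V n) \<le> liminf (\<lambda>k. emeasure (\<gamma> (r k)) U)" .
      qed
      finally show ?thesis .
    qed
  qed
  show thesis
    by (rule that[OF r(1) \<theta>(2) m1 m2 _ lsc]) (use limT A(2) in \<open>auto simp: \<G>_def\<close>)
qed

section \<open>Optimal plans and gluing\<close>

text \<open>Fubini for the region under the graph; the indicator of \<open>{0..}\<close> matches the
  truncation of negative values by \<open>ennreal\<close>.\<close>

lemma nn_integral_layer_cake:
  fixes c :: "'c::euclidean_space \<Rightarrow> real"
  assumes M: "finite_measure M" "sets M = sets borel"
    and c: "continuous_on UNIV c"
  shows "(\<integral>\<^sup>+x. ennreal (c x) \<partial>M) = (\<integral>\<^sup>+s. emeasure M {x. s < c x} * indicator {0..} s \<partial>lborel)"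
proof -
  interpret M: finite_measure M by fact
  interpret P: pair_sigma_finite lborel M by unfold_locales
  have [measurable_cong]: "sets M = sets borel" by fact
  have [measurable]: "c \<in> borel_measurable borel" using c by (rule borel_measurable_continuous_onI)
  have sp: "space M = UNIV" using sets_eq_imp_space_eq[OF M(2)] by simp
  have "(\<integral>\<^sup>+x. ennreal (c x) \<partial>M) = (\<integral>\<^sup>+x. (\<integral>\<^sup>+s. (if 0 \<le> s \<and> s < c x then 1 else 0) \<partial>lborel) \<partial>M)"
  proof (rule nn_integral_cong)
    fix x
    have "(\<integral>\<^sup>+s. (if 0 \<le> s \<and> s < c x then 1 else 0) \<partial>lborel) = (\<integral>\<^sup>+s. indicator {0..<c x} s \<partial>lborel)"
      by (intro nn_integral_cong) (auto simp: indicator_def)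
    also have "\<dots> = ennreal (c x)" by (cases "0 \<le> c x") (auto simp: ennreal_neg)
    finally show "ennreal (c x) = (\<integral>\<^sup>+s. (if 0 \<le> s \<and> s < c x then 1 else 0) \<partial>lborel)" ..
  qed
  also have "\<dots> = (\<integral>\<^sup>+s. (\<integral>\<^sup>+x. (if 0 \<le> s \<and> s < c x then 1 else 0) \<partial>M) \<partial>lborel)"
    by (rule P.Fubini') measurable
  also have "\<dots> = (\<integral>\<^sup>+s. emeasure M {x. s < c x} * indicator {0..} s \<partial>lborel)"
  proof (rule nn_integral_cong)
    fix s
    have "(\<integral>\<^sup>+x. (if 0 \<le> s \<and> s < c x then 1 else 0) \<partial>M) = (\<integral>\<^sup>+x. indicator {x. s < c x} x * indicator {0..} s \<partial>M)"
      by (intro nn_integral_cong) (auto simp: indicator_def)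
    also have "\<dots> = emeasure M {x. s < c x} * indicator {0..} s"
    proof (subst nn_integral_multc)
      have "{x \<in> space M. s < c x} \<in> sets M" by measurable
      then have S: "{x. s < c x} \<in> sets M" by (simp add: sp)
      then show "indicator {x. s < c x} \<in> borel_measurable M" by simp
      show "(\<integral>\<^sup>+x. indicator {x. s < c x} x \<partial>M) * indicator {0..} s = emeasure M {x. s < c x} * indicator {0..} s"
        using S by simp
    qed
    finally show "(\<integral>\<^sup>+x. (if 0 \<le> s \<and> s < c x then 1 else 0) \<partial>M) = emeasure M {x. s < c x} * indicator {0..} s" .
  qed
  finally show ?thesis .
qed

text \<open>The layer cake formula involves superlevel sets, which are open for continuous
  \<open>c\<close>; Fatou's lemma moves the lower limit out of the integral over the levels.\<close>

lemma nn_integral_lsc: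
  fixes c :: "'c::euclidean_space \<Rightarrow> real"
  assumes T: "finite_measure \<theta>" "sets \<theta> = sets borel"
    and G: "\<And>k. finite_measure (\<gamma> k)" "\<And>k. sets (\<gamma> k) = sets borel"
    and lsc: "\<And>U. open U \<Longrightarrow> emeasure \<theta> U \<le> liminf (\<lambda>k. emeasure (\<gamma> k) U)"
    and c: "continuous_on UNIV c"
  shows "(\<integral>\<^sup>+x. ennreal (c x) \<partial>\<theta>) \<le> liminf (\<lambda>k. \<integral>\<^sup>+x. ennreal (c x) \<partial>\<gamma> k)"
proof -
  have op: "open {x. s < c x}" for s using c by (intro open_Collect_less) auto
  have [measurable]: "c \<in> borel_measurable borel" using c by (rule borel_measurable_continuous_onI)
  have meas: "(\<lambda>s. emeasure (\<gamma> k) {x. s < c x} * indicator {0..} s) \<in> borel_measurable lborel" for k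
  proof -
    interpret finite_measure "\<gamma> k" by (rule G)
    have [measurable_cong]: "sets (\<gamma> k) = sets borel" by (rule G)
    have sp: "space (\<gamma> k) = UNIV" using sets_eq_imp_space_eq[OF G(2)[of k]] by simp
    have "(\<lambda>s. emeasure (\<gamma> k) {x \<in> space (\<gamma> k). s < c x}) \<in> borel_measurable lborel"
      by measurable
    then show ?thesis unfolding sp by simp
  qed
  have "(\<integral>\<^sup>+x. ennreal (c x) \<partial>\<theta>) = (\<integral>\<^sup>+s. emeasure \<theta> {x. s < c x} * indicator {0..} s \<partial>lborel)"
    by (rule nn_integral_layer_cake) fact+
  also have "\<dots> \<le> (\<integral>\<^sup>+s. liminf (\<lambda>k. emeasure (\<gamma> k) {x. s < c x} * indicator {0..} s) \<partial>lborel)"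
    using lsc[OF op] by (intro nn_integral_mono) (auto simp: indicator_def)
  also have "\<dots> \<le> liminf (\<lambda>k. \<integral>\<^sup>+s. emeasure (\<gamma> k) {x. s < c x} * indicator {0..} s \<partial>lborel)"
    by (rule nn_integral_liminf) (rule meas)
  also have "\<dots> = liminf (\<lambda>k. \<integral>\<^sup>+x. ennreal (c x) \<partial>\<gamma> k)"
    by (subst nn_integral_layer_cake[OF G c]) simp
  finally show ?thesis .
qed

section \<open>Couplings and existence of optimal plans\<close>

lemma measurable_borel_prod:
  fixes \<gamma> :: "('a::second_countable_topology \<times> 'b::second_countable_topology) measure"
  assumes "sets \<gamma> = sets borel"
  shows "fst \<in> measurable \<gamma> borel" "snd \<in> measurable \<gamma> borel"
  using assms by (simp_all add: measurable_cong_sets[OF assms refl] borel_measurable_continuous_onI continuous_on_fst continuous_on_snd continuous_on_id)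

lemma couplingsD:
  assumes "\<gamma> \<in> couplings \<mu> \<nu>"
  shows "sets \<gamma> = sets borel" "distr \<gamma> borel fst = \<mu>" "distr \<gamma> borel snd = \<nu>"
    "space \<gamma> = UNIV" "fst \<in> measurable \<gamma> borel" "snd \<in> measurable \<gamma> borel"
  using assms measurable_borel_prod[of \<gamma>] sets_eq_imp_space_eq[of \<gamma> borel] by (auto simp: couplings_def)

lemma couplings_prob_space:
  assumes "\<gamma> \<in> couplings \<mu> \<nu>" "prob_space \<mu>"
  shows "prob_space \<gamma>"
  using prob_space_distrD[OF couplingsD(5)[OF assms(1)]] assms couplingsD(2)[OF assms(1)] by simp

lemma pair_measure_couplings:
  assumes "prob_space \<mu>" "prob_space \<nu>" "sets \<mu> = sets borel" "sets \<nu> = sets borel"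
  shows "\<mu> \<Otimes>\<^sub>M \<nu> \<in> couplings \<mu> \<nu>"
proof -
  interpret M: prob_space \<mu> by fact
  interpret N: prob_space \<nu> by fact
  interpret P: pair_prob_space \<mu> \<nu> ..
  have 1: "sets (\<mu> \<Otimes>\<^sub>M \<nu>) = sets borel"
    using sets_pair_measure_cong[OF assms(3,4)] by (simp add: sets_borel_prod)
  have "distr (\<mu> \<Otimes>\<^sub>M \<nu>) borel fst = distr (\<mu> \<Otimes>\<^sub>M \<nu>) \<mu> fst"
    by (rule distr_cong) (simp_all add: assms)
  moreover have "distr (\<mu> \<Otimes>\<^sub>M \<nu>) \<mu> fst = \<mu>"
    by (rule N.distr_pair_fst)
  moreover have "distr (\<mu> \<Otimes>\<^sub>M \<nu>) borel snd = \<nu>"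
  proof (rule measure_eqI)
    fix A assume "A \<in> sets (distr (\<mu> \<Otimes>\<^sub>M \<nu>) borel snd)"
    then have A: "A \<in> sets \<nu>" using assms by simp
    have "emeasure (distr (\<mu> \<Otimes>\<^sub>M \<nu>) borel snd) A = emeasure (\<mu> \<Otimes>\<^sub>M \<nu>) (space \<mu> \<times> A)"
      using A assms measurable_borel_prod(2)[OF 1] sets.sets_into_space[OF A]
      by (subst emeasure_distr) (auto simp: space_pair_measure intro!: arg_cong[where f="emeasure _"])
    also have "\<dots> = emeasure \<nu> A"
      using A by (subst N.emeasure_pair_measure_Times) (auto simp: M.emeasure_space_1)
    finally show "emeasure (distr (\<mu> \<Otimes>\<^sub>M \<nu>) borel snd) A = emeasure \<nu> A" .
  qed (simp add: assms)
  ultimately show ?thesis using 1 by (simp add: couplings_def)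
qed

lemma transport_cost_alt: "transport_cost \<gamma> = (\<integral>\<^sup>+p. ennreal ((norm (fst p - snd p))\<^sup>2) \<partial>\<gamma>)"
  by (simp add: transport_cost_def case_prod_unfold)

text \<open>The direct method: the limit of a minimizing sequence keeps both marginals, and the cost
  is lower semicontinuous along it.\<close>

proposition optimal_plan_exists:
  fixes \<mu> \<nu> :: "'a::euclidean_space measure"
  assumes MN: "prob_space \<mu>" "prob_space \<nu>" "sets \<mu> = sets borel" "sets \<nu> = sets borel"
  shows "\<exists>\<gamma>. optimal_plan \<mu> \<nu> \<gamma>"
proof -
  have "transport_cost ` couplings \<mu> \<nu> \<noteq> {}" using pair_measure_couplings[OF MN] by auto
  from Inf_as_limit[OF this] obtain u where u: "\<And>n. u n \<in> transport_cost ` couplings \<mu> \<nu>"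
    "u \<longlonglongrightarrow> W2_squared \<mu> \<nu>" unfolding W2_squared_def by blast
  from u(1) have "\<forall>n. \<exists>\<gamma>. \<gamma> \<in> couplings \<mu> \<nu> \<and> u n = transport_cost \<gamma>" by auto
  then obtain \<gamma> where \<gamma>: "\<And>n. \<gamma> n \<in> couplings \<mu> \<nu>" "\<And>n. u n = transport_cost (\<gamma> n)" by metis
  note cD = couplingsD[OF \<gamma>(1)]
  have pk: "prob_space (\<gamma> k)" for k using couplings_prob_space[OF \<gamma>(1) MN(1)] .
  obtain r \<theta> where \<theta>: "strict_mono r" "sets \<theta> = sets borel" "distr \<theta> borel fst = \<mu>" "distr \<theta> borel snd = \<nu>"
    and lsc: "\<And>U. open U \<Longrightarrow> emeasure \<theta> U \<le> liminf (\<lambda>k. emeasure (\<gamma> (r k)) U)"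
    by (rule couplings_setwise_compact[where \<gamma>=\<gamma> and \<C>="{}", OF MN cD(1,2,3)]) auto
  have \<theta>c: "\<theta> \<in> couplings \<mu> \<nu>" using \<theta> by (simp add: couplings_def)
  have pt: "prob_space \<theta>" using couplings_prob_space[OF \<theta>c MN(1)] .
  have "transport_cost \<theta> \<le> liminf (\<lambda>k. transport_cost (\<gamma> (r k)))"
    unfolding transport_cost_alt
    by (rule nn_integral_lsc[OF _ \<theta>(2) _ cD(1) lsc])
       (use pk pt in \<open>auto intro!: continuous_intros simp: prob_space.finite_measure\<close>)
  also have "\<dots> = W2_squared \<mu> \<nu>"
  proof -
    have "(\<lambda>k. transport_cost (\<gamma> (r k))) \<longlonglongrightarrow> W2_squared \<mu> \<nu>"
      using LIMSEQ_subseq_LIMSEQ[OF u(2) \<theta>(1)] \<gamma>(2) by (simp add: o_def)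
    then show ?thesis using lim_imp_Liminf[OF sequentially_bot] by blast
  qed
  finally have "transport_cost \<theta> \<le> W2_squared \<mu> \<nu>" .
  moreover have "W2_squared \<mu> \<nu> \<le> transport_cost \<theta>"
    unfolding W2_squared_def using \<theta>c by (rule INF_lower)
  ultimately show ?thesis using \<theta>c unfolding optimal_plan_def by (intro exI[of _ \<theta>]) auto
qed

text \<open>The cells \<open>{x. {i. i < k \<and> x \<in> U i} = S}\<close> are the atoms of the
  algebra generated by the first \<open>k\<close> sets. As a density, the weight forces
  \<open>x\<close> and \<open>y\<close> into a common cell and makes them independent within it;
  \<open>1 / 0 = 0\<close> discards null cells.\<close>

definition glue_weight :: "'a measure \<Rightarrow> (nat \<Rightarrow> 'a set) \<Rightarrow> nat \<Rightarrow> 'a \<Rightarrow> 'a \<Rightarrow> ennreal" where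
  "glue_weight \<mu> U k x y =
    (\<Sum>S\<in>Pow {..<k}. indicator {x. {i. i < k \<and> x \<in> U i} = S} x * indicator {x. {i. i < k \<and> x \<in> U i} = S} y
      * ennreal (1 / measure \<mu> {x. {i. i < k \<and> x \<in> U i} = S}))"

lemma glue_weight_eq_0:
  assumes "{i. i < k \<and> x \<in> U i} \<noteq> {i. i < k \<and> y \<in> U i}"
  shows "glue_weight \<mu> U k x y = 0"
  unfolding glue_weight_def using assms by (intro sum.neutral) (auto simp: indicator_def)

lemma glue_weight_commute: "glue_weight \<mu> U k x y = glue_weight \<mu> U k y x"
  unfolding glue_weight_def by (simp add: mult.commute)

lemma glue_cell_measurable:
  fixes U :: "nat \<Rightarrow> 'a::topological_space set"
  assumes "\<And>i. U i \<in> sets borel"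
  shows "{x. {i. i < k \<and> x \<in> U i} = S} \<in> sets borel"
proof (cases "S \<subseteq> {..<k}")
  case True
  have "{x. {i. i < k \<and> x \<in> U i} = S} = {x \<in> space borel. \<forall>i\<in>{..<k}. x \<in> U i \<longleftrightarrow> i \<in> S}"
    using True by auto
  also have "\<dots> \<in> sets borel"
  proof (rule sets.sets_Collect_finite_All)
    show "{x \<in> space borel. x \<in> U i \<longleftrightarrow> i \<in> S} \<in> sets borel" for i
    proof (cases "i \<in> S")
      case False
      then have "{x \<in> space borel. x \<in> U i \<longleftrightarrow> i \<in> S} = - U i" by auto
      then show ?thesis using assms by simp
    qed (use assms in simp)
  qed simp
  finally show ?thesis .
next
  case False
  then have "{x. {i. i < k \<and> x \<in> U i} = S} = {}" by auto
  then show ?thesis by simp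
qed

lemma glue_weight_measurable[measurable]:
  fixes \<mu> :: "'a::topological_space measure"
  assumes "\<And>i. U i \<in> sets borel"
  shows "(\<lambda>(x, y). glue_weight \<mu> U k x y) \<in> borel_measurable (borel \<Otimes>\<^sub>M borel)"
proof -
  have [measurable]: "{x. {i. i < k \<and> x \<in> U i} = S} \<in> sets borel" for S
    using assms by (rule glue_cell_measurable)
  show ?thesis unfolding glue_weight_def case_prod_beta by measurable
qed

text \<open>Integrating over \<open>\<eta>\<close> gives 1 on each cell of positive mass. Null
  cells, where it gives 0, are not charged by \<open>\<gamma>\<close>, whose first marginal is the
  same \<open>\<mu>\<close>.\<close>

lemma glue_weight_marginal:
  fixes \<mu> :: "'a::euclidean_space measure" and \<gamma> :: "('a \<times> 'b::euclidean_space) measure"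
    and \<eta> :: "('a \<times> 'c::euclidean_space) measure"
  assumes \<mu>: "prob_space \<mu>" "sets \<mu> = sets borel" and U: "\<And>i. U i \<in> sets borel"
    and \<gamma>: "sets \<gamma> = sets borel" "distr \<gamma> borel fst = \<mu>"
    and \<eta>: "sets \<eta> = sets borel" "distr \<eta> borel fst = \<mu>"
    and f: "f \<in> borel_measurable borel"
  shows "(\<integral>\<^sup>+p. f p * (\<integral>\<^sup>+q. glue_weight \<mu> U k (fst p) (fst q) \<partial>\<eta>) \<partial>\<gamma>) = (\<integral>\<^sup>+p. f p \<partial>\<gamma>)"
proof -
  define P where "P S = {x. {i. i < k \<and> x \<in> U i} = S}" for S
  have P[measurable]: "P S \<in> sets borel" for S unfolding P_def using U by (rule glue_cell_measurable)
  interpret M: prob_space \<mu> by fact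
  have f1[measurable]: "fst \<in> measurable \<gamma> borel" "fst \<in> measurable \<eta> borel"
    using measurable_borel_prod \<gamma> \<eta> by blast+
  have [measurable_cong]: "sets \<mu> = sets borel" by fact
  have inner: "(\<integral>\<^sup>+q. glue_weight \<mu> U k x (fst q) \<partial>\<eta>) = (\<Sum>S\<in>Pow {..<k}. indicator (P S) x * (if measure \<mu> (P S) = 0 then 0 else 1))" for x
  proof -
    have "(\<integral>\<^sup>+q. glue_weight \<mu> U k x (fst q) \<partial>\<eta>) = (\<integral>\<^sup>+q. glue_weight \<mu> U k x q \<partial>distr \<eta> borel fst)"
      unfolding glue_weight_def P_def[symmetric] by (subst nn_integral_distr) measurable
    also have "\<dots> = (\<integral>\<^sup>+q. glue_weight \<mu> U k x q \<partial>\<mu>)" by (simp add: \<eta>)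
    also have "\<dots> = (\<Sum>S\<in>Pow {..<k}. indicator (P S) x * emeasure \<mu> (P S) * ennreal (1 / measure \<mu> (P S)))"
      unfolding glue_weight_def P_def[symmetric]
      by (simp add: nn_integral_sum nn_integral_multc nn_integral_cmult)
    also have "\<dots> = (\<Sum>S\<in>Pow {..<k}. indicator (P S) x * (if measure \<mu> (P S) = 0 then 0 else 1))"
      by (intro sum.cong refl) (auto simp: M.emeasure_eq_measure mult.assoc ennreal_mult'[symmetric])
    finally show ?thesis .
  qed
  have "AE x in \<mu>. \<forall>S\<in>Pow {..<k}. x \<in> P S \<longrightarrow> measure \<mu> (P S) \<noteq> 0"
  proof (rule AE_finite_allI)
    fix S
    show "AE x in \<mu>. x \<in> P S \<longrightarrow> measure \<mu> (P S) \<noteq> 0"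
    proof (cases "measure \<mu> (P S) = 0")
      case True
      have "P S \<in> null_sets \<mu>" using P[of S] \<mu> True by (simp add: null_sets_def M.emeasure_eq_measure)
      then have "AE x in \<mu>. x \<notin> P S" by (rule AE_not_in)
      then show ?thesis by eventually_elim simp
    qed simp
  qed simp
  then have "AE x in distr \<gamma> borel fst. \<forall>S\<in>Pow {..<k}. x \<in> P S \<longrightarrow> measure \<mu> (P S) \<noteq> 0" unfolding \<gamma>(2) .
  then have ae: "AE p in \<gamma>. \<forall>S\<in>Pow {..<k}. fst p \<in> P S \<longrightarrow> measure \<mu> (P S) \<noteq> 0"
    by (rule AE_distrD[OF f1(1)])
  show ?thesis
  proof (rule nn_integral_cong_AE, use ae in eventually_elim)
    case (elim p)
    define T where "T = {i. i < k \<and> fst p \<in> U i}"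
    have T: "T \<in> Pow {..<k}" "fst p \<in> P T" by (auto simp: T_def P_def)
    have "(\<Sum>S\<in>Pow {..<k}. indicator (P S) (fst p) * (if measure \<mu> (P S) = 0 then 0 else 1)) = (1::ennreal)"
    proof -
      have "(\<Sum>S\<in>Pow {..<k}. indicator (P S) (fst p) * (if measure \<mu> (P S) = 0 then 0 else 1)) =
          (\<Sum>S\<in>Pow {..<k}. if S = T then 1 else (0::ennreal))"
      proof (rule sum.cong[OF refl])
        fix S assume "S \<in> Pow {..<k}"
        then show "indicator (P S) (fst p) * (if measure \<mu> (P S) = 0 then 0 else 1) = (if S = T then 1 else (0::ennreal))"
          using T elim by (cases "S = T") (auto simp: P_def T_def)
      qed
      then show ?thesis using T(1) by simp
    qed
    then show ?case by (simp add: inner)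
  qed
qed


text \<open>No conditional laws are formed. The two plans are joined independently inside the cells
  of ever finer partitions of the common factor, and a limit is extracted from these approximate
  gluings.\<close>

proposition gluing:
  fixes \<mu> :: "'a::euclidean_space measure" and \<gamma> :: "('a \<times> 'b::euclidean_space) measure"
    and \<eta> :: "('a \<times> 'c::euclidean_space) measure"
  assumes \<mu>: "prob_space \<mu>" "sets \<mu> = sets borel"
    and \<gamma>: "sets \<gamma> = sets borel" "distr \<gamma> borel fst = \<mu>"
    and \<eta>: "sets \<eta> = sets borel" "distr \<eta> borel fst = \<mu>"
  obtains \<theta> where "sets \<theta> = sets borel" "distr \<theta> borel fst = \<gamma>"
    "distr \<theta> borel (\<lambda>p. (fst (fst p), snd p)) = \<eta>"
proof -
  obtain B1 :: "'a set set" where B1: "countable B1" "topological_basis B1" using ex_countable_basis by auto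
  obtain B2 :: "'c set set" where B2: "countable B2" "topological_basis B2" using ex_countable_basis by auto
  have B1ne: "insert {} B1 \<noteq> {}" and B2ne: "insert {} B2 \<noteq> {}" by auto
  define U where "U = from_nat_into (insert {} B1)"
  define V where "V = from_nat_into (insert {} B2)"
  have rU: "range U = insert {} B1" and rV: "range V = insert {} B2"
    using B1 B2 by (simp_all add: U_def V_def range_from_nat_into)
  have oU: "open (U i)" and oV: "open (V i)" for i
    using rU rV B1(2) B2(2) topological_basis_open by (metis insertE open_empty rangeI)+
  have U: "U i \<in> sets borel" and V: "V i \<in> sets borel" for i using oU oV by auto
  have prob: "prob_space \<gamma>" "prob_space \<eta>"
    using prob_space_distrD[OF measurable_borel_prod(1)] \<gamma> \<eta> \<mu> by metis+
  interpret M: prob_space \<mu> by fact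
  interpret G: prob_space \<gamma> by fact
  interpret H: prob_space \<eta> by fact
  interpret GH: pair_prob_space \<gamma> \<eta> ..
  interpret HG: pair_prob_space \<eta> \<gamma> ..
  note mG[measurable] = measurable_borel_prod[OF \<gamma>(1)]
  note mH[measurable] = measurable_borel_prod[OF \<eta>(1)]
  have [measurable_cong]: "sets \<gamma> = sets borel" "sets \<eta> = sets borel" by fact+
  define w where "w k p q = glue_weight \<mu> U k (fst p) (fst q)" for k and p :: "'a \<times> 'b" and q :: "'a \<times> 'c"
  have wc: "w k p q = glue_weight \<mu> U k (fst q) (fst p)" for k p q
    unfolding w_def by (rule glue_weight_commute)
  have w1: "(\<lambda>z. w k (fst z) (snd z)) \<in> borel_measurable (\<gamma> \<Otimes>\<^sub>M \<eta>)" for k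
  proof -
    have "(\<lambda>z. (fst (fst z), fst (snd z))) \<in> measurable (\<gamma> \<Otimes>\<^sub>M \<eta>) (borel \<Otimes>\<^sub>M borel)" by measurable
    from measurable_compose[OF this glue_weight_measurable[OF U]] show ?thesis
      by (simp add: w_def)
  qed
  \<comment> \<open>For every \<open>k\<close> the first marginal is exactly \<open>\<gamma>\<close>
    and the last one exactly that of \<open>\<eta>\<close>, so the compactness of couplings applies.
    Only the joint law of the common and the last coordinate is approximate.\<close>
  define \<theta>k where "\<theta>k k = distr (density (\<gamma> \<Otimes>\<^sub>M \<eta>) (\<lambda>z. w k (fst z) (snd z))) borel (\<lambda>z. (fst z, snd (snd z)))" for k
  have map_m: "(\<lambda>z. (fst z, snd (snd z))) \<in> measurable (\<gamma> \<Otimes>\<^sub>M \<eta>) borel"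
  proof -
    have "fst \<in> measurable (\<gamma> \<Otimes>\<^sub>M \<eta>) borel" using measurable_fst[of \<gamma> \<eta>] measurable_cong_sets[OF refl \<gamma>(1)] by blast
    then have "(\<lambda>z. (fst z, snd (snd z))) \<in> measurable (\<gamma> \<Otimes>\<^sub>M \<eta>) (borel \<Otimes>\<^sub>M borel)" by measurable
    then show ?thesis by (simp add: measurable_cong_sets[OF refl sets_borel_prod])
  qed
  have nn: "(\<integral>\<^sup>+z. f z \<partial>\<theta>k k) = (\<integral>\<^sup>+p. \<integral>\<^sup>+q. w k p q * f (p, snd q) \<partial>\<eta> \<partial>\<gamma>)"
    "(\<integral>\<^sup>+z. f z \<partial>\<theta>k k) = (\<integral>\<^sup>+q. \<integral>\<^sup>+p. w k p q * f (p, snd q) \<partial>\<gamma> \<partial>\<eta>)"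
    if f: "f \<in> borel_measurable borel" for f k
  proof -
    have fm: "(\<lambda>z. f (fst z, snd (snd z))) \<in> borel_measurable (\<gamma> \<Otimes>\<^sub>M \<eta>)"
      using measurable_compose[OF map_m f] .
    have m: "(\<lambda>z. w k (fst z) (snd z) * f (fst z, snd (snd z))) \<in> borel_measurable (\<gamma> \<Otimes>\<^sub>M \<eta>)"
      using w1 fm by (rule borel_measurable_times_ennreal)
    have "(\<integral>\<^sup>+z. f z \<partial>\<theta>k k) = (\<integral>\<^sup>+z. f (fst z, snd (snd z)) \<partial>density (\<gamma> \<Otimes>\<^sub>M \<eta>) (\<lambda>z. w k (fst z) (snd z)))"
      unfolding \<theta>k_def by (rule nn_integral_distr) (use map_m f in auto)
    also have "\<dots> = (\<integral>\<^sup>+z. w k (fst z) (snd z) * f (fst z, snd (snd z)) \<partial>(\<gamma> \<Otimes>\<^sub>M \<eta>))"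
      by (rule nn_integral_density[OF w1 fm])
    finally have *: "(\<integral>\<^sup>+z. f z \<partial>\<theta>k k) = (\<integral>\<^sup>+z. w k (fst z) (snd z) * f (fst z, snd (snd z)) \<partial>(\<gamma> \<Otimes>\<^sub>M \<eta>))" .
    show "(\<integral>\<^sup>+z. f z \<partial>\<theta>k k) = (\<integral>\<^sup>+p. \<integral>\<^sup>+q. w k p q * f (p, snd q) \<partial>\<eta> \<partial>\<gamma>)"
      unfolding * by (subst H.nn_integral_fst[OF m, symmetric]) simp
    show "(\<integral>\<^sup>+z. f z \<partial>\<theta>k k) = (\<integral>\<^sup>+q. \<integral>\<^sup>+p. w k p q * f (p, snd q) \<partial>\<gamma> \<partial>\<eta>)"
      unfolding * by (subst GH.nn_integral_snd[symmetric]) (use m in \<open>simp_all add: case_prod_unfold\<close>)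
  qed
  have w2: "(\<lambda>q. w k p q) \<in> borel_measurable \<eta>" for k p
    using measurable_compose[OF measurable_Pair1' w1] by (simp add: sets_eq_imp_space_eq[OF \<gamma>(1)])
  have w3: "(\<lambda>p. w k p q) \<in> borel_measurable \<gamma>" for k q
    using measurable_compose[OF measurable_Pair2' w1] by (simp add: sets_eq_imp_space_eq[OF \<eta>(1)])
  have sk: "sets (\<theta>k k) = sets borel" for k by (simp add: \<theta>k_def)
  note mk = measurable_borel_prod[OF sk]
  have m1: "distr (\<theta>k k) borel fst = \<gamma>" for k
  proof (rule measure_eqI)
    fix A assume "A \<in> sets (distr (\<theta>k k) borel fst)"
    then have A[measurable]: "A \<in> sets borel" by simp
    have fm: "(\<lambda>z. indicator A (fst z)) \<in> borel_measurable (borel :: (('a \<times> 'b) \<times> 'c) measure)"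
      using measurable_borel_prod[OF refl] by measurable
    have "emeasure (distr (\<theta>k k) borel fst) A = (\<integral>\<^sup>+z. indicator A (fst z) \<partial>\<theta>k k)"
      by (subst nn_integral_indicator[symmetric], simp, subst nn_integral_distr[OF mk(1)]) auto
    also have "\<dots> = (\<integral>\<^sup>+p. \<integral>\<^sup>+q. indicator A p * w k p q \<partial>\<eta> \<partial>\<gamma>)"
      by (subst nn(1)[OF fm]) (simp add: mult.commute)
    also have "\<dots> = (\<integral>\<^sup>+p. indicator A p * (\<integral>\<^sup>+q. w k p q \<partial>\<eta>) \<partial>\<gamma>)"
      by (intro nn_integral_cong nn_integral_cmult w2)
    also have "\<dots> = (\<integral>\<^sup>+p. indicator A p \<partial>\<gamma>)"
      unfolding w_def by (rule glue_weight_marginal[OF \<mu> U \<gamma> \<eta>]) simp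
    finally show "emeasure (distr (\<theta>k k) borel fst) A = emeasure \<gamma> A" using A by (simp add: \<gamma>)
  qed (simp add: \<gamma>)
  have snd_int: "(\<integral>\<^sup>+z. f (snd z) \<partial>\<theta>k k) = (\<integral>\<^sup>+q. f (snd q) \<partial>\<eta>)" if f[measurable]: "f \<in> borel_measurable borel" for f k
  proof -
    have fm: "(\<lambda>z. f (snd z)) \<in> borel_measurable (borel :: (('a \<times> 'b) \<times> 'c) measure)"
      using measurable_borel_prod[OF refl] by measurable
    have fm': "(\<lambda>z. f (snd z)) \<in> borel_measurable (borel :: ('a \<times> 'c) measure)"
      using measurable_borel_prod[OF refl] by measurable
    have "(\<integral>\<^sup>+z. f (snd z) \<partial>\<theta>k k) = (\<integral>\<^sup>+q. \<integral>\<^sup>+p. f (snd q) * w k p q \<partial>\<gamma> \<partial>\<eta>)"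
      by (subst nn(2)[OF fm]) (simp add: mult.commute)
    also have "\<dots> = (\<integral>\<^sup>+q. f (snd q) * (\<integral>\<^sup>+p. w k p q \<partial>\<gamma>) \<partial>\<eta>)"
      by (intro nn_integral_cong nn_integral_cmult w3)
    also have "\<dots> = (\<integral>\<^sup>+q. f (snd q) \<partial>\<eta>)"
      unfolding wc by (rule glue_weight_marginal[OF \<mu> U \<eta> \<gamma> fm'])
    finally show ?thesis .
  qed
  define N where "N = distr \<eta> borel snd"
  have N: "prob_space N" "sets N = sets borel" unfolding N_def by (auto intro!: H.prob_space_distr)
  have m2: "distr (\<theta>k k) borel snd = N" for k
  proof (rule measure_eqI)
    fix A assume "A \<in> sets (distr (\<theta>k k) borel snd)"
    then have A[measurable]: "A \<in> sets borel" by simp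
    have "emeasure (distr (\<theta>k k) borel snd) A = (\<integral>\<^sup>+z. indicator A (snd z) \<partial>\<theta>k k)"
      by (subst nn_integral_indicator[symmetric], simp, subst nn_integral_distr[OF mk(2)]) auto
    also have "\<dots> = (\<integral>\<^sup>+q. indicator A (snd q) \<partial>\<eta>)" by (rule snd_int) simp
    also have "\<dots> = emeasure N A" unfolding N_def
      by (subst nn_integral_indicator[symmetric], simp, subst nn_integral_distr[OF mH(2)]) auto
    finally show "emeasure (distr (\<theta>k k) borel snd) A = emeasure N A" .
  qed (simp add: N)
  \<comment> \<open>Finite intersections provide an Int-stable generator; the empty index set yields
    the whole space.\<close>
  define I where "I J = (\<Inter>i\<in>J. U i)" for J :: "nat set"
  define K where "K J = (\<Inter>i\<in>J. V i)" for J :: "nat set"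
  have Ib[measurable]: "I J \<in> sets borel" and Kb[measurable]: "K J \<in> sets borel" if "finite J" for J
    using that U V unfolding I_def K_def by (cases "J = {}"; auto intro!: sets.finite_INT)+
  define \<C> where "\<C> = (\<lambda>(J, J'). (I J \<times> (UNIV :: 'b set)) \<times> K J') ` ({J. finite J} \<times> {J. finite J})"
  \<comment> \<open>Once \<open>J \<subseteq> {..<k}\<close>, membership in \<open>I J\<close>
    depends on the cell only, and the weight vanishes for \<open>p\<close>, \<open>q\<close> in
    different cells. The constraint on \<open>p\<close> can therefore be moved to \<open>q\<close>,
    and the law of such a rectangle is exact from some \<open>k\<close> on.\<close>
  have rect: "measure (\<theta>k k) ((I J \<times> UNIV) \<times> K J') = measure \<eta> (I J \<times> K J')"
    if J: "finite J" "finite J'" "J \<subseteq> {..<k}" for J J' k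
  proof -
    have S: "I J \<times> K J' \<in> sets (borel :: ('a \<times> 'c) measure)" "(I J \<times> (UNIV::'b set)) \<times> K J' \<in> sets borel"
      using Ib[OF J(1)] Kb[OF J(2)] by (auto simp: sets_borel_prod intro!: pair_measureI)
    have "emeasure (\<theta>k k) ((I J \<times> UNIV) \<times> K J') = (\<integral>\<^sup>+z. indicator ((I J \<times> UNIV) \<times> K J') z \<partial>\<theta>k k)"
      using S by (simp add: sk)
    also have "\<dots> = (\<integral>\<^sup>+q. \<integral>\<^sup>+p. w k p q * indicator ((I J \<times> UNIV) \<times> K J') (p, snd q) \<partial>\<gamma> \<partial>\<eta>)"
      using S by (intro nn(2)) simp
    also have "\<dots> = (\<integral>\<^sup>+q. \<integral>\<^sup>+p. indicator (I J \<times> K J') q * w k p q \<partial>\<gamma> \<partial>\<eta>)"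
    proof (intro nn_integral_cong)
      fix p q
      show "w k p q * indicator ((I J \<times> UNIV) \<times> K J') (p, snd q) = indicator (I J \<times> K J') q * w k p q"
      proof (cases "{i. i < k \<and> fst p \<in> U i} = {i. i < k \<and> fst q \<in> U i}")
        case True
        then have "fst p \<in> I J \<longleftrightarrow> fst q \<in> I J" using J(3) unfolding I_def by blast
        then show ?thesis by (cases p; cases q) (auto simp: indicator_def)
      next
        case False
        then show ?thesis by (simp add: w_def glue_weight_eq_0)
      qed
    qed
    also have "\<dots> = (\<integral>\<^sup>+q. indicator (I J \<times> K J') q * (\<integral>\<^sup>+p. w k p q \<partial>\<gamma>) \<partial>\<eta>)"
      by (intro nn_integral_cong nn_integral_cmult w3)
    also have "\<dots> = (\<integral>\<^sup>+q. indicator (I J \<times> K J') q \<partial>\<eta>)"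
      unfolding wc by (rule glue_weight_marginal[OF \<mu> U \<eta> \<gamma>]) (use S in simp)
    also have "\<dots> = emeasure \<eta> (I J \<times> K J')" using S by (simp add: \<eta>)
    finally show ?thesis by (simp add: measure_def)
  qed
  have cC: "countable \<C>" unfolding \<C>_def by (intro countable_image countable_SIGMA countable_Collect_finite)
  have rC: "\<exists>A\<in>sets borel. \<exists>B\<in>sets borel. E = A \<times> B" if "E \<in> \<C>" for E
  proof -
    from that obtain J J' where J: "finite J" "finite J'" "E = (I J \<times> UNIV) \<times> K J'" unfolding \<C>_def by auto
    have "I J \<times> UNIV \<in> sets (borel :: ('a \<times> 'b) measure)" using Ib[OF J(1)]
      by (auto simp: sets_borel_prod intro!: pair_measureI)
    then show ?thesis using J Kb by blast
  qed
  obtain r \<theta> where \<theta>: "strict_mono r" "sets \<theta> = sets borel" "distr \<theta> borel fst = \<gamma>" "distr \<theta> borel snd = N"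
    and lim: "\<And>E. E \<in> \<C> \<Longrightarrow> (\<lambda>k. measure (\<theta>k (r k)) E) \<longlonglongrightarrow> measure \<theta> E"
    by (rule couplings_setwise_compact[where \<gamma>=\<theta>k and \<C>=\<C>, OF prob(1) N(1) \<gamma>(1) N(2) sk m1 m2 cC rC]) auto
  have pt: "prob_space \<theta>" using prob_space_distrD[OF measurable_borel_prod(1)[OF \<theta>(2)]] \<theta>(3) prob(1) by simp
  interpret T: prob_space \<theta> by fact
  note mT[measurable] = measurable_borel_prod[OF \<theta>(2)]
  have mp: "(\<lambda>p. (fst (fst p), snd p)) \<in> measurable \<theta> borel"
  proof -
    have "(\<lambda>p. fst (fst p)) \<in> measurable \<theta> borel"
      using measurable_compose[OF mT(1) measurable_borel_prod(1)[OF refl]] .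
    then have "(\<lambda>p. (fst (fst p), snd p)) \<in> measurable \<theta> (borel \<Otimes>\<^sub>M borel)" by measurable
    then show ?thesis by (simp add: measurable_cong_sets[OF refl sets_borel_prod])
  qed
  have spT: "space \<theta> = UNIV" using sets_eq_imp_space_eq[OF \<theta>(2)] by simp
  have eqm: "measure \<theta> ((I J \<times> UNIV) \<times> K J') = measure \<eta> (I J \<times> K J')" if J: "finite J" "finite J'" for J J'
  proof -
    obtain n where n: "J \<subseteq> {..<n}" using J(1) finite_nat_set_iff_bounded by auto
    have "(\<lambda>k. measure (\<theta>k (r k)) ((I J \<times> UNIV) \<times> K J')) \<longlonglongrightarrow> measure \<theta> ((I J \<times> UNIV) \<times> K J')"
      by (rule lim) (use J in \<open>auto simp: \<C>_def\<close>)
    moreover have "eventually (\<lambda>k. measure (\<theta>k (r k)) ((I J \<times> UNIV) \<times> K J') = measure \<eta> (I J \<times> K J')) sequentially"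
      using eventually_ge_at_top[of n]
    proof eventually_elim
      case (elim k)
      then have "J \<subseteq> {..<r k}" using n seq_suble[OF \<theta>(1), of k] by fastforce
      then show ?case using J by (intro rect)
    qed
    ultimately have "(\<lambda>k::nat. measure \<eta> (I J \<times> K J')) \<longlonglongrightarrow> measure \<theta> ((I J \<times> UNIV) \<times> K J')"
      using tendsto_cong by fast
    then show ?thesis by (simp add: LIMSEQ_const_iff)
  qed
  have "distr \<theta> borel (\<lambda>p. (fst (fst p), snd p)) = \<eta>"
  proof (rule measure_eqI_generator_eq[where \<Omega>=UNIV and A="\<lambda>_. UNIV" and
      E="(\<lambda>(J, J'). I J \<times> K J') ` ({J. finite J} \<times> {J. finite J})"])
    let ?E = "(\<lambda>(J, J'). I J \<times> K J') ` ({J. finite J} \<times> {J. finite J})"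
    show "Int_stable ?E"
    proof (rule Int_stableI)
      fix a b assume "a \<in> ?E" "b \<in> ?E"
      then obtain J J' L L' where J: "finite J" "finite J'" "a = I J \<times> K J'" "finite L" "finite L'" "b = I L \<times> K L'"
        by auto
      then have "a \<inter> b = I (J \<union> L) \<times> K (J' \<union> L')" unfolding I_def K_def by auto
      then show "a \<inter> b \<in> ?E" using J by (auto intro!: image_eqI[of _ _ "(J \<union> L, J' \<union> L')"])
    qed
    have sub: "?E \<subseteq> sets borel" using Ib Kb by (auto simp: sets_borel_prod intro!: pair_measureI)
    have BB: "topological_basis ((\<lambda>(a, b). a \<times> b) ` (B1 \<times> B2))" "countable ((\<lambda>(a, b). a \<times> b) ` (B1 \<times> B2))"
      using B1 B2 topological_basis_prod[OF B1(2) B2(2)] by auto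
    have BE: "(\<lambda>(a, b). a \<times> b) ` (B1 \<times> B2) \<subseteq> ?E"
    proof
      fix e assume "e \<in> (\<lambda>(a, b). a \<times> b) ` (B1 \<times> B2)"
      then obtain a b where ab: "a \<in> B1" "b \<in> B2" "e = a \<times> b" by auto
      then obtain i j where "a = U i" "b = V j" using rU rV by (metis imageE insertI2)
      then show "e \<in> ?E" using ab by (auto intro!: image_eqI[of _ _ "({i}, {j})"] simp: I_def K_def)
    qed
    have "sigma_sets UNIV ?E = sets borel"
    proof
      show "sigma_sets UNIV ?E \<subseteq> sets borel" using sub sets.sigma_sets_subset[of ?E borel] by auto
      show "sets borel \<subseteq> sigma_sets UNIV ?E"
        using sigma_sets_topological_basis[OF BB] sigma_sets_mono'[OF BE] by auto
    qed
    then show "sets (distr \<theta> borel (\<lambda>p. (fst (fst p), snd p))) = sigma_sets UNIV ?E" "sets \<eta> = sigma_sets UNIV ?E"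
      by (auto simp: \<eta>)
    show "?E \<subseteq> Pow UNIV" by simp
    show "range (\<lambda>_. UNIV) \<subseteq> ?E" by (auto intro!: image_eqI[of _ _ "({}, {})"] simp: I_def K_def)
    show "(\<Union>i::nat. UNIV) = UNIV" by simp
    interpret D: prob_space "distr \<theta> borel (\<lambda>p. (fst (fst p), snd p))" by (rule T.prob_space_distr[OF mp])
    show "emeasure (distr \<theta> borel (\<lambda>p. (fst (fst p), snd p))) UNIV \<noteq> \<infinity>" by simp
    fix X assume X: "X \<in> ?E"
    then obtain J J' where J: "finite J" "finite J'" "X = I J \<times> K J'" by auto
    have "(\<lambda>p. (fst (fst p), snd p)) -` X = (I J \<times> (UNIV :: 'b set)) \<times> K J'" using J by auto
    moreover have "X \<in> sets borel" using X sub by blast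
    ultimately have "measure (distr \<theta> borel (\<lambda>p. (fst (fst p), snd p))) X = measure \<theta> ((I J \<times> UNIV) \<times> K J')"
      by (subst measure_distr[OF mp]) (simp_all add: spT)
    also have "\<dots> = measure \<eta> X" using eqm J by simp
    finally show "emeasure (distr \<theta> borel (\<lambda>p. (fst (fst p), snd p))) X = emeasure \<eta> X"
      by (simp add: D.emeasure_eq_measure H.emeasure_eq_measure)
  qed
  then show thesis using that \<theta> by blast
qed

section \<open>The Wasserstein distance\<close>

lemma measurable_continuous_borel:
  assumes "sets \<theta> = sets borel" "continuous_on UNIV f"
  shows "f \<in> measurable \<theta> borel"
  using borel_measurable_continuous_onI[OF assms(2)] by (simp add: measurable_cong_sets[OF assms(1) refl])

lemma P2D:
  assumes "\<mu> \<in> P2"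
  shows "sets \<mu> = sets borel" "prob_space \<mu>" "integrable \<mu> (\<lambda>x. (norm x)\<^sup>2)" "space \<mu> = UNIV"
  using assms sets_eq_imp_space_eq[of \<mu> borel] by (auto simp: P2_def)

lemma P2_linear:
  fixes f :: "'a::euclidean_space \<Rightarrow> 'b::euclidean_space"
  assumes \<mu>: "\<mu> \<in> P2" and f: "bounded_linear f"
  shows "f \<in> measurable \<mu> borel" "integrable \<mu> (\<lambda>x. (norm (f x))\<^sup>2)" "distr \<mu> borel f \<in> P2"
proof -
  note D = P2D[OF \<mu>]
  show m[measurable]: "f \<in> measurable \<mu> borel"
    by (rule measurable_continuous_borel[OF D(1) linear_continuous_on[OF f]])
  obtain K where K: "\<And>x. norm (f x) \<le> norm x * K" using bounded_linear.bounded[OF f] by blast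
  show i: "integrable \<mu> (\<lambda>x. (norm (f x))\<^sup>2)"
  proof (rule Bochner_Integration.integrable_bound)
    show "integrable \<mu> (\<lambda>x. K\<^sup>2 * (norm x)\<^sup>2)" using D(3) by simp
    have "(norm (f x))\<^sup>2 \<le> K\<^sup>2 * (norm x)\<^sup>2" for x
      using power_mono[OF K[of x] norm_ge_zero, of 2] by (simp add: power_mult_distrib mult.commute)
    then show "AE x in \<mu>. norm ((norm (f x))\<^sup>2) \<le> norm (K\<^sup>2 * (norm x)\<^sup>2)" by simp
  qed measurable
  show "distr \<mu> borel f \<in> P2"
    using prob_space.prob_space_distr[OF D(2) m] i by (simp add: P2_def integrable_distr_eq[OF m])
qed

lemma integral_distr_norm_sq:
  fixes f :: "'a::euclidean_space \<Rightarrow> 'b::euclidean_space"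
  assumes "\<mu> \<in> P2" "bounded_linear f" "bounded_linear g"
  shows "(\<integral>x. (norm (g x))\<^sup>2 \<partial>distr \<mu> borel f) = (\<integral>x. (norm (g (f x)))\<^sup>2 \<partial>\<mu>)"
  using P2_linear(1)[OF assms(1,2)] linear_continuous_on[OF assms(3)]
  by (subst integral_distr) (auto intro!: borel_measurable_continuous_onI continuous_intros)

lemma couplings_P2:
  assumes "\<gamma> \<in> couplings \<mu> \<nu>" "\<mu> \<in> P2" "\<nu> \<in> P2"
  shows "\<gamma> \<in> P2"
proof -
  note C = couplingsD[OF assms(1)]
  have p: "prob_space \<gamma>" using couplings_prob_space[OF assms(1)] P2D[OF assms(2)] by auto
  have 1: "integrable \<gamma> (\<lambda>p. (norm (fst p))\<^sup>2)"
    using P2D(3)[OF assms(2)] unfolding C(2)[symmetric] by (subst (asm) integrable_distr_eq) (use C in auto)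
  have 2: "integrable \<gamma> (\<lambda>p. (norm (snd p))\<^sup>2)"
    using P2D(3)[OF assms(3)] unfolding C(3)[symmetric] by (subst (asm) integrable_distr_eq) (use C in auto)
  have "integrable \<gamma> (\<lambda>p. (norm (fst p))\<^sup>2 + (norm (snd p))\<^sup>2)" using 1 2 by simp
  then have "integrable \<gamma> (\<lambda>p. (norm p)\<^sup>2)" by (simp add: norm_prod_def)
  then show ?thesis using C(1) p by (simp add: P2_def)
qed

lemma couplings_cost:
  assumes "\<gamma> \<in> couplings \<mu> \<nu>" "\<mu> \<in> P2" "\<nu> \<in> P2"
  shows "integrable \<gamma> (\<lambda>p. (norm (fst p - snd p))\<^sup>2)"
    "transport_cost \<gamma> = ennreal (\<integral>p. (norm (fst p - snd p))\<^sup>2 \<partial>\<gamma>)"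
proof -
  show "integrable \<gamma> (\<lambda>p. (norm (fst p - snd p))\<^sup>2)"
    by (rule P2_linear(2)[OF couplings_P2[OF assms]]) (intro bounded_linear_intros)
  then show "transport_cost \<gamma> = ennreal (\<integral>p. (norm (fst p - snd p))\<^sup>2 \<partial>\<gamma>)"
    unfolding transport_cost_alt by (intro nn_integral_eq_integral) auto
qed

lemma couplings_marginal_sq:
  assumes "\<gamma> \<in> couplings \<mu> \<nu>"
  shows "(\<integral>p. (norm (fst p))\<^sup>2 \<partial>\<gamma>) = second_moment \<mu>" "(\<integral>p. (norm (snd p))\<^sup>2 \<partial>\<gamma>) = second_moment \<nu>"
proof -
  note C = couplingsD[OF assms]
  have "second_moment \<mu> = (\<integral>x. (norm x)\<^sup>2 \<partial>distr \<gamma> borel fst)" by (simp add: second_moment_def C)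
  also have "\<dots> = (\<integral>p. (norm (fst p))\<^sup>2 \<partial>\<gamma>)" by (rule integral_distr[OF C(5)]) simp
  finally show "(\<integral>p. (norm (fst p))\<^sup>2 \<partial>\<gamma>) = second_moment \<mu>" ..
  have "second_moment \<nu> = (\<integral>x. (norm x)\<^sup>2 \<partial>distr \<gamma> borel snd)" by (simp add: second_moment_def C)
  also have "\<dots> = (\<integral>p. (norm (snd p))\<^sup>2 \<partial>\<gamma>)" by (rule integral_distr[OF C(6)]) simp
  finally show "(\<integral>p. (norm (snd p))\<^sup>2 \<partial>\<gamma>) = second_moment \<nu>" ..
qed

lemma W2_sq_le_transport:
  assumes "\<gamma> \<in> couplings \<mu> \<nu>" "transport_cost \<gamma> \<le> ennreal c" "0 \<le> c"
  shows "(W2 \<mu> \<nu>)\<^sup>2 \<le> c"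
proof -
  have "W2_squared \<mu> \<nu> \<le> ennreal c"
    unfolding W2_squared_def using assms by (meson INF_lower order_trans)
  then have "enn2real (W2_squared \<mu> \<nu>) \<le> c" using assms(3) by (simp add: enn2real_leI)
  then show ?thesis by (simp add: W2_def)
qed

lemma W2_sq_le:
  assumes "\<gamma> \<in> couplings \<mu> \<nu>" "\<mu> \<in> P2" "\<nu> \<in> P2"
  shows "(W2 \<mu> \<nu>)\<^sup>2 \<le> (\<integral>p. (norm (fst p - snd p))\<^sup>2 \<partial>\<gamma>)"
  using assms by (intro W2_sq_le_transport[OF assms(1)]) (simp_all add: couplings_cost)

lemma optimal_plan_cost:
  assumes "optimal_plan \<mu> \<nu> \<gamma>" "\<mu> \<in> P2" "\<nu> \<in> P2"
  shows "\<gamma> \<in> couplings \<mu> \<nu>" "(\<integral>p. (norm (fst p - snd p))\<^sup>2 \<partial>\<gamma>) = (W2 \<mu> \<nu>)\<^sup>2"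
proof -
  show c: "\<gamma> \<in> couplings \<mu> \<nu>" using assms by (simp add: optimal_plan_def)
  have "W2_squared \<mu> \<nu> = ennreal (\<integral>p. (norm (fst p - snd p))\<^sup>2 \<partial>\<gamma>)"
    using assms couplings_cost(2)[OF c assms(2,3)] by (simp add: optimal_plan_def)
  then show "(\<integral>p. (norm (fst p - snd p))\<^sup>2 \<partial>\<gamma>) = (W2 \<mu> \<nu>)\<^sup>2" by (simp add: W2_def)
qed

lemma linear_coupling:
  fixes f g :: "'c::euclidean_space \<Rightarrow> 'a::euclidean_space"
  assumes \<theta>: "\<theta> \<in> P2" and fg: "bounded_linear f" "bounded_linear g"
  shows "distr \<theta> borel (\<lambda>p. (f p, g p)) \<in> couplings (distr \<theta> borel f) (distr \<theta> borel g)"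
    "(\<integral>p. (norm (fst p - snd p))\<^sup>2 \<partial>distr \<theta> borel (\<lambda>p. (f p, g p))) = (\<integral>p. (norm (f p - g p))\<^sup>2 \<partial>\<theta>)"
proof -
  have bl: "bounded_linear (\<lambda>p. (f p, g p))" using fg by (intro bounded_linear_Pair)
  note m = P2_linear(1)[OF \<theta> bl]
  have "distr (distr \<theta> borel (\<lambda>p. (f p, g p))) borel fst = distr \<theta> borel (fst \<circ> (\<lambda>p. (f p, g p)))"
    "distr (distr \<theta> borel (\<lambda>p. (f p, g p))) borel snd = distr \<theta> borel (snd \<circ> (\<lambda>p. (f p, g p)))"
    by (rule distr_distr; use m measurable_borel_prod[OF refl] in simp)+
  then show "distr \<theta> borel (\<lambda>p. (f p, g p)) \<in> couplings (distr \<theta> borel f) (distr \<theta> borel g)"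
    by (simp add: couplings_def o_def)
  have "bounded_linear (\<lambda>p. fst p - snd p :: 'a)" by (intro bounded_linear_intros)
  from integral_distr_norm_sq[OF \<theta> bl this]
  show "(\<integral>p. (norm (fst p - snd p))\<^sup>2 \<partial>distr \<theta> borel (\<lambda>p. (f p, g p))) = (\<integral>p. (norm (f p - g p))\<^sup>2 \<partial>\<theta>)"
    by simp
qed

lemma W2_sq_le_linear:
  fixes f g :: "'c::euclidean_space \<Rightarrow> 'a::euclidean_space"
  assumes \<theta>: "\<theta> \<in> P2" and fg: "bounded_linear f" "bounded_linear g"
  shows "(W2 (distr \<theta> borel f) (distr \<theta> borel g))\<^sup>2 \<le> (\<integral>p. (norm (f p - g p))\<^sup>2 \<partial>\<theta>)"
  using W2_sq_le[OF linear_coupling(1)[OF assms] P2_linear(3)[OF \<theta> fg(1)] P2_linear(3)[OF \<theta> fg(2)]]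
    linear_coupling(2)[OF assms] by simp

text \<open>Gluing along \<open>\<mu>\<close> keeps two plans optimal at once, while
  \<open>\<nu>\<close> and \<open>\<rho>\<close> are merely coupled. This is the configuration of a
  generalized geodesic with base point \<open>\<mu>\<close>, and it also yields the triangle
  inequality.\<close>

lemma three_plan_exists:
  fixes \<mu> \<nu> \<rho> :: "'a::euclidean_space measure"
  assumes "\<mu> \<in> P2" "\<nu> \<in> P2" "\<rho> \<in> P2"
  obtains \<theta> :: "('a \<times> 'a \<times> 'a) measure" where "\<theta> \<in> P2"
    "optimal_plan \<mu> \<nu> (distr \<theta> borel (\<lambda>p. (fst p, fst (snd p))))"
    "optimal_plan \<mu> \<rho> (distr \<theta> borel (\<lambda>p. (fst p, snd (snd p))))"
    "distr \<theta> borel fst = \<mu>" "distr \<theta> borel (\<lambda>p. fst (snd p)) = \<nu>" "distr \<theta> borel (\<lambda>p. snd (snd p)) = \<rho>"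
proof -
  obtain \<gamma> \<eta> where opt: "optimal_plan \<mu> \<nu> \<gamma>" "optimal_plan \<mu> \<rho> \<eta>"
    using optimal_plan_exists[of \<mu> \<nu>] optimal_plan_exists[of \<mu> \<rho>] P2D assms by metis
  then have c: "\<gamma> \<in> couplings \<mu> \<nu>" "\<eta> \<in> couplings \<mu> \<rho>" by (auto simp: optimal_plan_def)
  note C = couplingsD[OF c(1)] and E = couplingsD[OF c(2)]
  obtain \<theta>0 where \<theta>0: "sets \<theta>0 = sets borel" "distr \<theta>0 borel fst = \<gamma>"
    "distr \<theta>0 borel (\<lambda>p. (fst (fst p), snd p)) = \<eta>"
    by (rule gluing[OF P2D(2,1)[OF assms(1)] C(1,2) E(1,2)])
  have mp: "(\<lambda>p. (fst (fst p), snd p)) \<in> measurable \<theta>0 borel"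
    by (rule measurable_continuous_borel[OF \<theta>0(1)]) (intro continuous_intros)
  have "distr \<theta>0 borel snd = distr (distr \<theta>0 borel (\<lambda>p. (fst (fst p), snd p))) borel snd"
    by (subst distr_distr[OF _ mp]) (auto simp: o_def measurable_borel_prod)
  then have s: "distr \<theta>0 borel snd = \<rho>" using \<theta>0(3) E(3) by simp
  have p\<theta>0: "prob_space \<theta>0"
    using prob_space_distrD[OF measurable_borel_prod(1)[OF \<theta>0(1)]] \<theta>0(2) couplings_prob_space[OF c(1)] P2D assms by auto
  have g2: "\<gamma> \<in> P2" using couplings_P2[OF c(1)] assms by auto
  have 1: "integrable \<theta>0 (\<lambda>p. (norm (fst p))\<^sup>2)"
    using P2D(3)[OF g2] unfolding \<theta>0(2)[symmetric]
    by (subst (asm) integrable_distr_eq) (use measurable_borel_prod[OF \<theta>0(1)] in auto)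
  have 2: "integrable \<theta>0 (\<lambda>p. (norm (snd p))\<^sup>2)"
    using P2D(3)[OF assms(3)] unfolding s[symmetric]
    by (subst (asm) integrable_distr_eq) (use measurable_borel_prod[OF \<theta>0(1)] in auto)
  have "integrable \<theta>0 (\<lambda>p. (norm (fst p))\<^sup>2 + (norm (snd p))\<^sup>2)" using 1 2 by simp
  then have "integrable \<theta>0 (\<lambda>p. (norm p)\<^sup>2)" by (simp add: norm_prod_def)
  then have \<theta>0P: "\<theta>0 \<in> P2" using \<theta>0(1) p\<theta>0 by (simp add: P2_def)
  define \<theta> where "\<theta> = distr \<theta>0 borel (\<lambda>p. (fst (fst p), snd (fst p), snd p))"
  have bl: "bounded_linear (\<lambda>p :: ('a \<times> 'a) \<times> 'a. (fst (fst p), snd (fst p), snd p))"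
    by (intro bounded_linear_Pair bounded_linear_intros)
  have \<theta>P: "\<theta> \<in> P2" unfolding \<theta>_def by (rule P2_linear(3)[OF \<theta>0P bl])
  have dd: "distr \<theta> borel f = distr \<theta>0 borel (\<lambda>p. f (fst (fst p), snd (fst p), snd p))"
    if "continuous_on UNIV f" for f :: "'a \<times> 'a \<times> 'a \<Rightarrow> 'd::euclidean_space"
    unfolding \<theta>_def by (subst distr_distr[OF _ P2_linear(1)[OF \<theta>0P bl]])
      (use that in \<open>auto simp: o_def intro: borel_measurable_continuous_onI\<close>)
  have a: "distr \<theta> borel (\<lambda>p. (fst p, fst (snd p))) = \<gamma>"
    by (subst dd) (auto simp: \<theta>0 intro!: continuous_intros)
  have b: "distr \<theta> borel (\<lambda>p. (fst p, snd (snd p))) = \<eta>"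
    by (subst dd) (auto simp: \<theta>0 intro!: continuous_intros)
  have d: "distr \<theta> borel (\<lambda>p. snd (snd p)) = \<rho>"
    by (subst dd) (auto simp: s intro!: continuous_intros)
  have mf: "(fst :: ('a \<times> 'a) \<times> 'a \<Rightarrow> _) \<in> measurable \<theta>0 borel" by (rule measurable_borel_prod[OF \<theta>0(1)])
  have e: "distr \<theta> borel fst = \<mu>"
  proof -
    have "distr \<theta> borel fst = distr (distr \<theta>0 borel fst) borel fst"
      by (subst dd, simp add: continuous_on_fst continuous_on_id, subst distr_distr[OF _ mf]) (auto simp: o_def measurable_borel_prod)
    then show ?thesis using \<theta>0(2) C(2) by simp
  qed
  have f: "distr \<theta> borel (\<lambda>p. fst (snd p)) = \<nu>"
  proof -
    have "distr \<theta> borel (\<lambda>p. fst (snd p)) = distr (distr \<theta>0 borel fst) borel snd"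
      by (subst dd, intro continuous_intros, subst distr_distr[OF _ mf]) (auto simp: o_def measurable_borel_prod)
    then show ?thesis using \<theta>0(2) C(3) by simp
  qed
  show thesis by (rule that[OF \<theta>P]) (use opt a b d e f in simp_all)
qed

lemma W2_commute:
  assumes "\<mu> \<in> P2" "\<nu> \<in> P2"
  shows "W2 \<mu> \<nu> = W2 \<nu> \<mu>"
proof -
  have *: "(W2 \<nu> \<mu>)\<^sup>2 \<le> (W2 \<mu> \<nu>)\<^sup>2" if P: "\<mu> \<in> P2" "\<nu> \<in> P2" for \<mu> \<nu> :: "'a measure"
  proof -
    obtain \<gamma> where \<gamma>: "optimal_plan \<mu> \<nu> \<gamma>" using optimal_plan_exists[of \<mu> \<nu>] P P2D by metis
    note o = optimal_plan_cost[OF \<gamma> P]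
    have "(W2 (distr \<gamma> borel snd) (distr \<gamma> borel fst))\<^sup>2 \<le> (\<integral>p. (norm (snd p - fst p))\<^sup>2 \<partial>\<gamma>)"
      by (rule W2_sq_le_linear[OF couplings_P2[OF o(1) P]]) (intro bounded_linear_intros)+
    then show ?thesis using o couplingsD[OF o(1)] by (simp add: norm_minus_commute)
  qed
  have "(W2 \<nu> \<mu>)\<^sup>2 = (W2 \<mu> \<nu>)\<^sup>2" using *[OF assms] *[OF assms(2,1)] by simp
  moreover have "W2 \<nu> \<mu> \<ge> 0" "W2 \<mu> \<nu> \<ge> 0" by (simp_all add: W2_def)
  ultimately show ?thesis by (metis power2_eq_imp_eq)
qed

lemma norm_sq_add_le:
  fixes a b :: "'a::real_inner"
  assumes "c > 0"
  shows "(norm (a + b))\<^sup>2 \<le> (1 + c) * (norm a)\<^sup>2 + (1 + 1/c) * (norm b)\<^sup>2"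
proof -
  have "0 \<le> (norm (sqrt c *\<^sub>R a - (1 / sqrt c) *\<^sub>R b))\<^sup>2" by simp
  also have "\<dots> = c * (norm a)\<^sup>2 - 2 * (a \<bullet> b) + (1/c) * (norm b)\<^sup>2"
    using assms by (simp add: power2_norm_eq_inner inner_diff_left inner_diff_right inner_commute power2_eq_square[symmetric] power_divide)
  finally have "2 * (a \<bullet> b) \<le> c * (norm a)\<^sup>2 + (1/c) * (norm b)\<^sup>2" by simp
  moreover have "(norm (a + b))\<^sup>2 = (norm a)\<^sup>2 + 2 * (a \<bullet> b) + (norm b)\<^sup>2"
    by (simp add: power2_norm_eq_inner inner_add_left inner_add_right inner_commute)
  ultimately show ?thesis by (simp add: algebra_simps)
qed

text \<open>The triangle inequality in squared form with a free weight: \<open>c = 1\<close> for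
  rough estimates, \<open>c\<close> tending to 0 where nothing may be lost, \<open>c\<close>
  proportional to the time step in a Gronwall argument.\<close>

lemma W2_sq_triangle:
  assumes P: "\<nu> \<in> P2" "\<mu> \<in> P2" "\<rho> \<in> P2" and c: "c > 0"
  shows "(W2 \<nu> \<rho>)\<^sup>2 \<le> (1 + c) * (W2 \<nu> \<mu>)\<^sup>2 + (1 + 1/c) * (W2 \<mu> \<rho>)\<^sup>2"
proof -
  obtain \<theta> :: "('a \<times> 'a \<times> 'a) measure" where \<theta>: "\<theta> \<in> P2"
    "optimal_plan \<mu> \<nu> (distr \<theta> borel (\<lambda>p. (fst p, fst (snd p))))"
    "optimal_plan \<mu> \<rho> (distr \<theta> borel (\<lambda>p. (fst p, snd (snd p))))"
    "distr \<theta> borel fst = \<mu>" "distr \<theta> borel (\<lambda>p. fst (snd p)) = \<nu>" "distr \<theta> borel (\<lambda>p. snd (snd p)) = \<rho>"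
    by (rule three_plan_exists[OF P(2,1,3)])
  have bl: "bounded_linear (fst :: 'a \<times> 'a \<times> 'a \<Rightarrow> 'a)" "bounded_linear (\<lambda>p :: 'a \<times> 'a \<times> 'a. fst (snd p))"
    "bounded_linear (\<lambda>p :: 'a \<times> 'a \<times> 'a. snd (snd p))" by (intro bounded_linear_intros)+
  have 1: "(\<integral>p. (norm (fst p - fst (snd p)))\<^sup>2 \<partial>\<theta>) = (W2 \<nu> \<mu>)\<^sup>2"
    using optimal_plan_cost(2)[OF \<theta>(2) P(2,1)] linear_coupling(2)[OF \<theta>(1) bl(1,2)] W2_commute[OF P(1,2)] by simp
  have 2: "(\<integral>p. (norm (fst p - snd (snd p)))\<^sup>2 \<partial>\<theta>) = (W2 \<mu> \<rho>)\<^sup>2"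
    using optimal_plan_cost(2)[OF \<theta>(3) P(2,3)] linear_coupling(2)[OF \<theta>(1) bl(1,3)] by simp
  have i: "integrable \<theta> (\<lambda>p. (norm (fst p - fst (snd p)))\<^sup>2)" "integrable \<theta> (\<lambda>p. (norm (fst p - snd (snd p)))\<^sup>2)"
    "integrable \<theta> (\<lambda>p. (norm (fst (snd p) - snd (snd p)))\<^sup>2)"
    by (rule P2_linear(2)[OF \<theta>(1)], intro bounded_linear_intros)+
  have "(W2 \<nu> \<rho>)\<^sup>2 \<le> (\<integral>p. (norm (fst (snd p) - snd (snd p)))\<^sup>2 \<partial>\<theta>)"
    using W2_sq_le_linear[OF \<theta>(1) bl(2,3)] \<theta> by simp
  also have "\<dots> \<le> (\<integral>p. (1 + c) * (norm (fst p - fst (snd p)))\<^sup>2 + (1 + 1/c) * (norm (fst p - snd (snd p)))\<^sup>2 \<partial>\<theta>)"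
  proof (rule integral_mono)
    fix p :: "'a \<times> 'a \<times> 'a"
    show "(norm (fst (snd p) - snd (snd p)))\<^sup>2 \<le> (1 + c) * (norm (fst p - fst (snd p)))\<^sup>2 + (1 + 1/c) * (norm (fst p - snd (snd p)))\<^sup>2"
      using norm_sq_add_le[OF c, of "fst (snd p) - fst p" "fst p - snd (snd p)"] by (simp add: norm_minus_commute)
  qed (use i in auto)
  also have "\<dots> = (1 + c) * (W2 \<nu> \<mu>)\<^sup>2 + (1 + 1/c) * (W2 \<mu> \<rho>)\<^sup>2"
    by (simp add: i 1 2)
  finally show ?thesis .
qed

lemma norm_sq_convex_comb:
  fixes x y z :: "'a::real_inner"
  shows "(norm (x - (s *\<^sub>R z + (1 - s) *\<^sub>R y)))\<^sup>2 =
    s * (norm (x - z))\<^sup>2 + (1 - s) * (norm (x - y))\<^sup>2 - s * (1 - s) * (norm (y - z))\<^sup>2"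
proof -
  have *: "x - (s *\<^sub>R z + (1 - s) *\<^sub>R y) = (x - y) - s *\<^sub>R (z - y)" "x - z = (x - y) - (z - y)"
    by (simp_all add: algebra_simps)
  define a b where "a = x - y" "b = z - y"
  have "(norm (a - s *\<^sub>R b))\<^sup>2 = s * (norm (a - b))\<^sup>2 + (1 - s) * (norm a)\<^sup>2 - s * (1 - s) * (norm b)\<^sup>2"
    by (simp add: power2_norm_eq_inner inner_diff_left inner_diff_right inner_commute algebra_simps)
  then show ?thesis unfolding * a_b_def by (simp add: norm_minus_commute)
qed

text \<open>\<open>Q\<close> is the mean squared distance of the second and third coordinates under
  the glued plan. It may exceed \<open>(W2 \<nu> \<rho>)\<^sup>2\<close>, but it does not depend on
  \<open>s\<close>, and the same \<open>Q\<close> occurs in the convexity of \<open>F\<close> and in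
  the expansion of the squared distance to the base point.\<close>

lemma gen_geodesic_interpolation:
  fixes \<mu> \<nu> \<rho> :: "'a::euclidean_space measure"
  assumes F: "convex_gen_geodesics l F" and P: "\<mu> \<in> P2" "\<nu> \<in> P2" "\<rho> \<in> P2"
  obtains Q where "(W2 \<nu> \<rho>)\<^sup>2 \<le> Q"
    "\<And>s. s \<in> {0..1} \<Longrightarrow> \<exists>\<eta>\<in>P2. F \<eta> \<le> ereal s * F \<rho> + ereal (1 - s) * F \<nu> - ereal (l / 2 * s * (1 - s) * Q) \<and>
      (W2 \<mu> \<eta>)\<^sup>2 \<le> s * (W2 \<mu> \<rho>)\<^sup>2 + (1 - s) * (W2 \<mu> \<nu>)\<^sup>2 - s * (1 - s) * Q"
proof -
  obtain \<theta> :: "('a \<times> 'a \<times> 'a) measure" where \<theta>: "\<theta> \<in> P2"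
    "optimal_plan \<mu> \<nu> (distr \<theta> borel (\<lambda>p. (fst p, fst (snd p))))"
    "optimal_plan \<mu> \<rho> (distr \<theta> borel (\<lambda>p. (fst p, snd (snd p))))"
    "distr \<theta> borel fst = \<mu>" "distr \<theta> borel (\<lambda>p. fst (snd p)) = \<nu>" "distr \<theta> borel (\<lambda>p. snd (snd p)) = \<rho>"
    by (rule three_plan_exists[OF P])
  have bl: "bounded_linear (fst :: 'a \<times> 'a \<times> 'a \<Rightarrow> 'a)" "bounded_linear (\<lambda>p :: 'a \<times> 'a \<times> 'a. fst (snd p))"
    "bounded_linear (\<lambda>p :: 'a \<times> 'a \<times> 'a. snd (snd p))"
    "\<And>s. bounded_linear (\<lambda>p :: 'a \<times> 'a \<times> 'a. s *\<^sub>R snd (snd p) + (1 - s) *\<^sub>R fst (snd p))"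
    by (intro bounded_linear_intros)+
  have 1: "(\<integral>p. (norm (fst p - fst (snd p)))\<^sup>2 \<partial>\<theta>) = (W2 \<mu> \<nu>)\<^sup>2"
    using optimal_plan_cost(2)[OF \<theta>(2) P(1,2)] linear_coupling(2)[OF \<theta>(1) bl(1,2)] by simp
  have 2: "(\<integral>p. (norm (fst p - snd (snd p)))\<^sup>2 \<partial>\<theta>) = (W2 \<mu> \<rho>)\<^sup>2"
    using optimal_plan_cost(2)[OF \<theta>(3) P(1,3)] linear_coupling(2)[OF \<theta>(1) bl(1,3)] by simp
  have i: "integrable \<theta> (\<lambda>p. (norm (fst p - fst (snd p)))\<^sup>2)" "integrable \<theta> (\<lambda>p. (norm (fst p - snd (snd p)))\<^sup>2)"
    "integrable \<theta> (\<lambda>p. (norm (fst (snd p) - snd (snd p)))\<^sup>2)"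
    by (rule P2_linear(2)[OF \<theta>(1)], intro bounded_linear_intros)+
  define Q where "Q = (\<integral>p. (norm (fst (snd p) - snd (snd p)))\<^sup>2 \<partial>\<theta>)"
  show thesis
  proof (rule that[of Q])
    show "(W2 \<nu> \<rho>)\<^sup>2 \<le> Q" using W2_sq_le_linear[OF \<theta>(1) bl(2,3)] \<theta> by (simp add: Q_def)
    fix s :: real assume s: "s \<in> {0..1}"
    define \<eta> where "\<eta> = distr \<theta> borel (\<lambda>p. s *\<^sub>R snd (snd p) + (1 - s) *\<^sub>R fst (snd p))"
    have \<eta>P: "\<eta> \<in> P2" unfolding \<eta>_def by (rule P2_linear(3)[OF \<theta>(1) bl(4)])
    have Q': "(\<integral>(y, z). (norm (y - z))\<^sup>2 \<partial>(distr \<theta> borel (\<lambda>(x, y, z). (y, z)))) = Q"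
      using linear_coupling(2)[OF \<theta>(1) bl(2,3)] by (simp add: Q_def case_prod_unfold)
    have "optimal_plan \<mu> \<nu> (distr \<theta> borel (\<lambda>(x, y, z). (x, y)))" "optimal_plan \<mu> \<rho> (distr \<theta> borel (\<lambda>(x, y, z). (x, z)))"
      using \<theta>(2,3) by (simp_all add: case_prod_unfold)
    then have "F (distr \<theta> borel (\<lambda>(x, y, z). s *\<^sub>R z + (1 - s) *\<^sub>R y))
          \<le> ereal s * F \<rho> + ereal (1 - s) * F \<nu> - ereal (l / 2 * s * (1 - s) *
                (\<integral>(y, z). (norm (y - z))\<^sup>2 \<partial>(distr \<theta> borel (\<lambda>(x, y, z). (y, z)))))"
      using F P \<theta>(1) s unfolding convex_gen_geodesics_def by blast
    then have "F \<eta> \<le> ereal s * F \<rho> + ereal (1 - s) * F \<nu> - ereal (l / 2 * s * (1 - s) * Q)"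
      unfolding Q' by (simp add: \<eta>_def case_prod_unfold)
    moreover have "(W2 \<mu> \<eta>)\<^sup>2 \<le> s * (W2 \<mu> \<rho>)\<^sup>2 + (1 - s) * (W2 \<mu> \<nu>)\<^sup>2 - s * (1 - s) * Q"
    proof -
      have "(W2 \<mu> \<eta>)\<^sup>2 \<le> (\<integral>p. (norm (fst p - (s *\<^sub>R snd (snd p) + (1 - s) *\<^sub>R fst (snd p))))\<^sup>2 \<partial>\<theta>)"
        using W2_sq_le_linear[OF \<theta>(1) bl(1) bl(4)[of s]] \<theta>(4) by (simp add: \<eta>_def)
      also have "\<dots> = (\<integral>p. s * (norm (fst p - snd (snd p)))\<^sup>2 + (1 - s) * (norm (fst p - fst (snd p)))\<^sup>2
          - s * (1 - s) * (norm (fst (snd p) - snd (snd p)))\<^sup>2 \<partial>\<theta>)"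
        unfolding norm_sq_convex_comb ..
      also have "\<dots> = s * (W2 \<mu> \<rho>)\<^sup>2 + (1 - s) * (W2 \<mu> \<nu>)\<^sup>2 - s * (1 - s) * Q"
        by (simp add: i 1 2 Q_def)
      finally show ?thesis .
    qed
    ultimately show "\<exists>\<eta>\<in>P2. F \<eta> \<le> ereal s * F \<rho> + ereal (1 - s) * F \<nu> - ereal (l / 2 * s * (1 - s) * Q) \<and>
      (W2 \<mu> \<eta>)\<^sup>2 \<le> s * (W2 \<mu> \<rho>)\<^sup>2 + (1 - s) * (W2 \<mu> \<nu>)\<^sup>2 - s * (1 - s) * Q" using \<eta>P by blast
  qed
qed

section \<open>Talagrand's inequality\<close>

text \<open>The integrand of relative entropy with the affine correction that makes it nonnegative
  pointwise. With \<open>ln 0 = 0\<close> the value at 0 is 1, the right limit.\<close>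

definition ent :: "real \<Rightarrow> real" where
  "ent k = k * ln k - k + 1"

lemma ent_measurable[measurable]: "ent \<in> borel_measurable borel"
  unfolding ent_def[abs_def] by measurable

text \<open>Fenchel duality: \<open>exp b - 1\<close> is the convex conjugate of \<open>ent\<close>.
  The proof is the tangent inequality of \<open>exp\<close> scaled by \<open>k\<close>. Suitable
  choices of \<open>b\<close> give most of the entropy bounds below.\<close>

lemma ent_Young:
  assumes "0 \<le> k"
  shows "k * b \<le> ent k + exp b - 1"
proof (cases "k = 0")
  case True then show ?thesis by (simp add: ent_def)
next
  case False
  then have k: "k > 0" using assms by simp
  have "k * (1 + (b - ln k)) \<le> k * exp (b - ln k)"
    using k by (intro mult_left_mono exp_ge_add_one_self) auto
  also have "\<dots> = exp b" using k by (simp add: exp_diff)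
  finally show ?thesis by (simp add: ent_def algebra_simps)
qed

lemma ent_nonneg: "0 \<le> k \<Longrightarrow> 0 \<le> ent k"
  using ent_Young[of k 0] by simp

section \<open>The one-dimensional Gaussian: distribution function, quantiles, moments\<close>

abbreviation gauss1 :: "real \<Rightarrow> real measure" where
  "gauss1 v \<equiv> density lborel (\<lambda>x. ennreal (normal_density 0 (sqrt v) x))"

lemma normal_density_sqrt: "v > 0 \<Longrightarrow> normal_density 0 (sqrt v) x = exp (- x\<^sup>2 / (2 * v)) / sqrt (2 * pi * v)"
  by (simp add: normal_density_def)

lemma real_distribution_gauss1: "v > 0 \<Longrightarrow> real_distribution (gauss1 v)"
  using prob_space_normal_density[of "sqrt v" 0] by (simp add: real_distribution_def real_distribution_axioms_def)

text \<open>The density is positive, so null sets are the Lebesgue null sets: points have no mass,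
  which gives continuity, and intervals have some, which gives strictness.\<close>

lemma gauss1_cdf:
  assumes v: "v > 0"
  shows "continuous_on UNIV (cdf (gauss1 v))" "strict_mono (cdf (gauss1 v))"
    "0 < cdf (gauss1 v) x" "cdf (gauss1 v) x < 1"
proof -
  interpret real_distribution "gauss1 v" by (rule real_distribution_gauss1[OF v])
  have null: "emeasure (gauss1 v) A = 0 \<longleftrightarrow> emeasure lborel A = 0" if A[measurable]: "A \<in> sets borel" for A
  proof -
    have "A \<in> null_sets (gauss1 v) \<longleftrightarrow> A \<in> sets lborel \<and> (AE x in lborel. x \<in> A \<longrightarrow> ennreal (normal_density 0 (sqrt v) x) = 0)"
      by (rule null_sets_density_iff) simp
    also have "\<dots> \<longleftrightarrow> A \<in> null_sets lborel"
      using A v normal_density_pos[of "sqrt v" 0] by (simp add: AE_iff_null_sets not_le[symmetric] ennreal_eq_0_iff)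
    finally show ?thesis using A by (auto simp: null_sets_def)
  qed
  have pos: "a < b \<Longrightarrow> measure (gauss1 v) {a<..b} > 0" for a b
    using null[of "{a<..b}"] emeasure_eq_measure[of "{a<..b}"]
    by (auto simp: zero_less_measure_iff simp del: emeasure_eq_measure)
  show c: "continuous_on UNIV (cdf (gauss1 v))"
    unfolding continuous_on_eq_continuous_at[OF open_UNIV]
  proof
    fix x :: real
    have "emeasure (gauss1 v) {x} = 0" using null[of "{x}"] by simp
    then show "isCont (cdf (gauss1 v)) x" unfolding isCont_cdf by (simp add: measure_def)
  qed
  show s: "strict_mono (cdf (gauss1 v))"
  proof (rule strict_monoI)
    fix a b :: real assume ab: "a < b"
    show "cdf (gauss1 v) a < cdf (gauss1 v) b"
      using cdf_diff_eq[OF ab] pos[OF ab] by linarith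
  qed
  show "0 < cdf (gauss1 v) x" using strict_monoD[OF s, of "x - 1" x] cdf_nonneg[of "x - 1"] by simp
  show "cdf (gauss1 v) x < 1" using strict_monoD[OF s, of x "x + 1"] cdf_bounded_prob[of "x + 1"] by simp
qed

lemma (in real_distribution) cdf_surj:
  assumes c: "continuous_on UNIV (cdf M)" and a: "0 < a" "a < 1"
  shows "\<exists>y. cdf M y = a"
proof -
  have "eventually (\<lambda>y. cdf M y < a) at_bot" using order_tendstoD(2)[OF cdf_lim_at_bot a(1)] .
  then obtain y0 where y0: "cdf M y0 < a" using eventually_happens trivial_limit_at_bot_linorder by blast
  have "eventually (\<lambda>y. cdf M y > a) at_top" using order_tendstoD(1)[OF cdf_lim_at_top_prob a(2)] .
  then obtain y1 where y1: "cdf M y1 > a" using eventually_happens trivial_limit_at_top_linorder by blast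
  have "y0 \<le> y1" using y0 y1 cdf_nondecreasing[of y1 y0] by (cases "y0 \<le> y1") auto
  then show ?thesis using IVT'[of "cdf M" y0 a y1] y0 y1 continuous_on_subset[OF c] by auto
qed

text \<open>Under its own law a continuous distribution function is uniform: the sublevel set is a
  closed half line whose endpoint has the value \<open>a\<close> by continuity.\<close>

lemma (in real_distribution) measure_cdf_le:
  assumes c: "continuous_on UNIV (cdf M)" and a: "0 < a" "a < 1"
  shows "measure M {y. cdf M y \<le> a} = a"
proof -
  obtain y0 where y0: "cdf M y0 = a" using cdf_surj[OF assms] by blast
  have "eventually (\<lambda>y. cdf M y > a) at_top" using order_tendstoD(1)[OF cdf_lim_at_top_prob a(2)] .
  then obtain y1 where y1: "cdf M y1 > a" using eventually_happens trivial_limit_at_top_linorder by blast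
  let ?T = "{y. cdf M y \<le> a}"
  have bdd: "bdd_above ?T"
    using y1 cdf_nondecreasing[of y1] by (intro bdd_aboveI[of _ y1]) (smt (verit) mem_Collect_eq)
  have cl: "closed ?T" using c by (intro closed_Collect_le) auto
  have "Sup ?T \<in> ?T" using closed_contains_Sup[OF _ bdd cl] y0 by auto
  then have S: "cdf M (Sup ?T) \<le> a" by simp
  have "y0 \<le> Sup ?T" using y0 bdd by (intro cSup_upper) auto
  then have S2: "cdf M (Sup ?T) = a" using S cdf_nondecreasing[of y0] y0 by fastforce
  have "?T = {..Sup ?T}"
  proof (intro set_eqI iffI)
    fix y assume "y \<in> ?T" then show "y \<in> {..Sup ?T}" using cSup_upper[OF _ bdd] by auto
  next
    fix y assume "y \<in> {..Sup ?T}"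
    then show "y \<in> ?T" using cdf_nondecreasing[of y "Sup ?T"] S by auto
  qed
  then have "measure M ?T = cdf M (Sup ?T)" unfolding cdf_def2 by simp
  then show ?thesis using S2 by simp
qed

text \<open>The value 0 outside the open unit interval is a convention; the levels at which the
  quantile is evaluated lie inside almost surely.\<close>

definition gauss1_quantile :: "real \<Rightarrow> real \<Rightarrow> real" where
  "gauss1_quantile v p = (if 0 < p \<and> p < 1 then (SOME z. cdf (gauss1 v) z = p) else 0)"

lemma cdf_gauss1_quantile:
  assumes "v > 0" "0 < p" "p < 1"
  shows "cdf (gauss1 v) (gauss1_quantile v p) = p"
proof -
  interpret real_distribution "gauss1 v" by (rule real_distribution_gauss1[OF assms(1)])
  show ?thesis
    using someI_ex[OF cdf_surj[OF gauss1_cdf(1)[OF assms(1)] assms(2,3)]] assms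
    by (simp add: gauss1_quantile_def)
qed

text \<open>The Galois connection between quantile and distribution function; measurability and the
  law of the rearrangement follow from it.\<close>

lemma gauss1_quantile_le:
  assumes "v > 0" "0 < p" "p < 1"
  shows "gauss1_quantile v p \<le> z \<longleftrightarrow> p \<le> cdf (gauss1 v) z"
  using cdf_gauss1_quantile[OF assms] strict_mono_less_eq[OF gauss1_cdf(2)[OF assms(1)]] by metis

lemma gauss1_quantile_measurable:
  assumes v: "v > 0"
  shows "gauss1_quantile v \<in> borel_measurable borel"
proof (rule borel_measurableI_le)
  fix z
  have "{p \<in> space borel. gauss1_quantile v p \<le> z} =
    ({0<..<1} \<inter> {..cdf (gauss1 v) z}) \<union> (if 0 \<le> z then - {0<..<1} else {})"
    using gauss1_quantile_le[OF v] by (auto simp: gauss1_quantile_def)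
  then show "{p \<in> space borel. gauss1_quantile v p \<le> z} \<in> sets borel" by simp
qed

text \<open>The first claim holds because minus \<open>v\<close> times the density is a primitive of
  \<open>z\<close> times the density. It later stands in for a change of variables.\<close>

lemma gauss1_tail:
  assumes v: "v > 0"
  shows "(\<integral>z. z * indicator {c<..} z \<partial>gauss1 v) = v * normal_density 0 (sqrt v) c"
    "integrable (gauss1 v) (\<lambda>z. z)" "integrable (gauss1 v) (\<lambda>z. z\<^sup>2)" 
    "(\<integral>z. z\<^sup>2 \<partial>gauss1 v) = v" "(\<integral>z. z \<partial>gauss1 v) = 0"
proof -
  let ?n = "normal_density 0 (sqrt v)"
  have s: "sqrt v > 0" using v by simp
  have m1: "has_bochner_integral lborel (\<lambda>x. ?n x * x) 0"
    using normal_moment_nz_1[of "sqrt v" 0] s by simp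
  have m2: "has_bochner_integral lborel (\<lambda>x. ?n x * x\<^sup>2) v"
    using normal_moment_even[OF s, of 0 1] v by (simp add: fact_numeral)
  show "integrable (gauss1 v) (\<lambda>z. z)" "integrable (gauss1 v) (\<lambda>z. z\<^sup>2)"
    using m1 m2 by (subst integrable_density; auto simp: has_bochner_integral_iff)+
  show "(\<integral>z. z\<^sup>2 \<partial>gauss1 v) = v" "(\<integral>z. z \<partial>gauss1 v) = 0"
    using m1 m2 by (subst integral_density; auto simp: has_bochner_integral_iff)+
  have lim: "((\<lambda>x. - (v * ?n x)) \<longlongrightarrow> - (v * 0)) at_top"
  proof (intro tendsto_intros)
    have "((\<lambda>x::real. exp (- x\<^sup>2 / (2 * v)) / sqrt (2 * pi * v)) \<longlongrightarrow> 0) at_top"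
      using v by real_asymp
    then show "(?n \<longlongrightarrow> 0) at_top" using normal_density_sqrt[OF v] by presburger
  qed
  have "(LBINT z=c..\<infinity>. ?n z * z) = 0 - (- (v * ?n c))"
  proof (rule interval_integral_FTC_integrable[where F="\<lambda>x. - (v * ?n x)"])
    show "((\<lambda>x. - (v * ?n x)) has_vector_derivative ?n x * x) (at x)" for x
      unfolding has_real_derivative_iff_has_vector_derivative[symmetric] normal_density_sqrt[OF v]
      using v by (auto intro!: derivative_eq_intros simp: field_simps power2_eq_square)
    show "isCont (\<lambda>z. ?n z * z) x" for x
      unfolding normal_density_sqrt[OF v] by (intro continuous_intros) (use v in auto)
    show "set_integrable lborel (einterval c \<infinity>) (\<lambda>z. ?n z * z)"
      using m1 unfolding set_integrable_def has_bochner_integral_iff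
      by (intro integrable_mult_indicator) auto
    show "(((\<lambda>x. - (v * ?n x)) \<circ> real_of_ereal) \<longlongrightarrow> - (v * ?n c)) (at_right (ereal c))"
    proof -
      have "isCont (\<lambda>x. - (v * ?n x)) c"
        unfolding normal_density_sqrt[OF v] by (intro continuous_intros) (use v in auto)
      then have "((\<lambda>x. - (v * ?n x)) \<longlongrightarrow> - (v * ?n c)) (at_right c)"
        unfolding isCont_def filterlim_at_split by blast
      then show ?thesis by (simp only: ereal_tendsto_simps)
    qed
    show "(((\<lambda>x. - (v * ?n x)) \<circ> real_of_ereal) \<longlongrightarrow> 0) (at_left \<infinity>)"
      using lim by (simp add: ereal_tendsto_simps)
  qed simp
  then have "(\<integral>z. indicator {c<..} z * (?n z * z) \<partial>lborel) = v * ?n c"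
    by (simp add: interval_lebesgue_integral_def set_lebesgue_integral_def)
  moreover have "(\<integral>z. z * indicator {c<..} z \<partial>gauss1 v) = (\<integral>z. ?n z * (z * indicator {c<..} z) \<partial>lborel)"
    by (subst integral_density) auto
  ultimately show "(\<integral>z. z * indicator {c<..} z \<partial>gauss1 v) = v * ?n c" by (simp add: ac_simps)
qed


section \<open>Monotone rearrangement onto the Gaussian and Talagrand's inequality on the
  line\<close>

context
  fixes v :: real and f :: "real \<Rightarrow> real"
  assumes v: "v > 0" and fm[measurable]: "f \<in> borel_measurable borel" and f0: "\<And>y. 0 \<le> f y"
    and f1: "(\<integral>\<^sup>+y. ennreal (f y) \<partial>gauss1 v) = 1"
begin

abbreviation "tilt \<equiv> density (gauss1 v) (\<lambda>y. ennreal (f y))"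
abbreviation "rearr \<equiv> (\<lambda>y. gauss1_quantile v (cdf tilt y))"

lemma real_distribution_tilt: "real_distribution tilt"
proof -
  have "prob_space tilt"
    by (rule prob_spaceI) (use f1 in \<open>simp add: emeasure_density\<close>)
  then show ?thesis by (simp add: real_distribution_def real_distribution_axioms_def)
qed

interpretation N: real_distribution tilt by (rule real_distribution_tilt)
interpretation G: real_distribution "gauss1 v" by (rule real_distribution_gauss1[OF v])

lemma continuous_cdf_tilt: "continuous_on UNIV (cdf tilt)"
  unfolding continuous_on_eq_continuous_at[OF open_UNIV]
proof
  fix x :: real
  have "{x} \<in> null_sets lborel" by (simp add: null_sets_def)
  then have "{x} \<in> null_sets (gauss1 v)"
    using absolutely_continuousI_density[of "\<lambda>x. ennreal (normal_density 0 (sqrt v) x)" lborel]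
    by (auto simp: absolutely_continuous_def)
  then have "{x} \<in> null_sets tilt"
    using absolutely_continuousI_density[of "\<lambda>y. ennreal (f y)" "gauss1 v"]
    by (auto simp: absolutely_continuous_def)
  then show "isCont (cdf tilt) x" unfolding N.isCont_cdf by (simp add: measure_def null_sets_def)
qed

lemma cdf_tilt_measurable[measurable]: "cdf tilt \<in> borel_measurable borel"
  by (rule borel_measurable_continuous_onI[OF continuous_cdf_tilt])

lemma rearr_measurable[measurable]: "rearr \<in> borel_measurable borel"
  using measurable_compose[OF cdf_tilt_measurable gauss1_quantile_measurable[OF v]] .

text \<open>The sublevel set at level \<open>a\<close> has mass exactly \<open>a\<close>, so levels
  near 0 and near 1 carry arbitrarily little mass.\<close>

lemma AE_cdf_tilt: "AE y in tilt. 0 < cdf tilt y \<and> cdf tilt y < 1"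
proof -
  have m[measurable]: "{y. cdf tilt y \<le> a} \<in> sets tilt" for a
  proof -
    have "{y \<in> space tilt. cdf tilt y \<le> a} \<in> sets tilt" by measurable
    then show ?thesis by simp
  qed
  have "measure tilt {y. cdf tilt y \<le> 0} \<le> 0"
  proof (rule field_le_epsilon)
    fix e :: real assume e: "e > 0"
    define a where "a = min e (1/2)"
    have a: "0 < a" "a < 1" "a \<le> e" using e by (auto simp: a_def)
    have "measure tilt {y. cdf tilt y \<le> 0} \<le> measure tilt {y. cdf tilt y \<le> a}"
      using a by (intro N.finite_measure_mono m) auto
    then show "measure tilt {y. cdf tilt y \<le> 0} \<le> 0 + e" using N.measure_cdf_le[OF continuous_cdf_tilt a(1,2)] a by simp
  qed
  then have "measure tilt {y. cdf tilt y \<le> 0} = 0" using measure_nonneg[of tilt "{y. cdf tilt y \<le> 0}"] by linarith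
  then have 1: "AE y in tilt. \<not> cdf tilt y \<le> 0"
    using AE_not_in[of "{y. cdf tilt y \<le> 0}" tilt] by (auto simp: null_sets_def N.emeasure_eq_measure m)
  let ?B = "{y. 1 \<le> cdf tilt y}"
  have mB: "?B \<in> sets tilt"
  proof -
    have "{y \<in> space tilt. 1 \<le> cdf tilt y} \<in> sets tilt" by measurable
    then show ?thesis by simp
  qed
  have "measure tilt ?B \<le> 0"
  proof (rule field_le_epsilon)
    fix e :: real assume e: "e > 0"
    define a where "a = min e (1/2)"
    have a: "0 < 1 - a" "1 - a < 1" "a \<le> e" using e by (auto simp: a_def)
    have "measure tilt ?B + measure tilt {y. cdf tilt y \<le> 1 - a} = measure tilt (?B \<union> {y. cdf tilt y \<le> 1 - a})"
      using a mB by (intro N.finite_measure_Union[symmetric] m) auto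
    also have "\<dots> \<le> 1" by simp
    finally show "measure tilt ?B \<le> 0 + e" using N.measure_cdf_le[OF continuous_cdf_tilt a(1,2)] a by simp
  qed
  then have "measure tilt ?B = 0" using measure_nonneg[of tilt ?B] by linarith
  then have 2: "AE y in tilt. \<not> 1 \<le> cdf tilt y"
    using AE_not_in[of ?B tilt] by (auto simp: null_sets_def N.emeasure_eq_measure mB)
  show ?thesis using 1 2 by eventually_elim auto
qed

text \<open>By the Galois connection the event that the rearranged point is at most \<open>z\<close>
  is a sublevel set of \<open>cdf tilt\<close> at level \<open>cdf (gauss1 v) z\<close>, and its
  mass is that level.\<close>

lemma distr_tilt_rearr: "distr tilt borel rearr = gauss1 v"
proof -
  interpret D: real_distribution "distr tilt borel rearr" by (intro N.real_distribution_distr) measurable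
  have "cdf (distr tilt borel rearr) z = cdf (gauss1 v) z" for z
  proof -
    have "cdf (distr tilt borel rearr) z = measure tilt {y. rearr y \<le> z}"
      unfolding cdf_def2[of "distr tilt borel rearr"] by (subst measure_distr) (auto simp: vimage_def)
    also have "\<dots> = measure tilt {y. cdf tilt y \<le> cdf (gauss1 v) z}"
    proof (rule measure_eq_AE)
      show "AE y in tilt. (y \<in> {y. rearr y \<le> z}) = (y \<in> {y. cdf tilt y \<le> cdf (gauss1 v) z})"
        using AE_cdf_tilt by eventually_elim (simp add: gauss1_quantile_le[OF v])
      have "{y \<in> space tilt. rearr y \<le> z} \<in> sets tilt" "{y \<in> space tilt. cdf tilt y \<le> cdf (gauss1 v) z} \<in> sets tilt" by measurable
      then show "{y. rearr y \<le> z} \<in> sets tilt" "{y. cdf tilt y \<le> cdf (gauss1 v) z} \<in> sets tilt" by simp_all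
    qed
    also have "\<dots> = cdf (gauss1 v) z"
      by (intro N.measure_cdf_le continuous_cdf_tilt gauss1_cdf v)
    finally show ?thesis .
  qed
  then show ?thesis by (intro cdf_unique D.real_distribution_axioms G.real_distribution_axioms) auto
qed

lemma rearr_moments:
  "integrable tilt rearr" "integrable tilt (\<lambda>y. (rearr y)\<^sup>2)" "(\<integral>y. (rearr y)\<^sup>2 \<partial>tilt) = v" "(\<integral>y. rearr y \<partial>tilt) = 0"
proof -
  have TN: "rearr \<in> measurable tilt borel" by simp
  have i: "integrable (distr tilt borel rearr) (\<lambda>z. z)" "integrable (distr tilt borel rearr) (\<lambda>z. z\<^sup>2)"
    unfolding distr_tilt_rearr using gauss1_tail[OF v] by auto
  show "integrable tilt rearr" "integrable tilt (\<lambda>y. (rearr y)\<^sup>2)"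
    using integrable_distr[OF TN i(1)] integrable_distr[OF TN i(2)] by simp_all
  have "(\<integral>y. (rearr y)\<^sup>2 \<partial>tilt) = (\<integral>z. z\<^sup>2 \<partial>distr tilt borel rearr)" by (subst integral_distr) auto
  then show "(\<integral>y. (rearr y)\<^sup>2 \<partial>tilt) = v" unfolding distr_tilt_rearr by (simp add: gauss1_tail[OF v])
  have "(\<integral>y. rearr y \<partial>tilt) = (\<integral>z. z \<partial>distr tilt borel rearr)" by (subst integral_distr) auto
  then show "(\<integral>y. rearr y \<partial>tilt) = 0" unfolding distr_tilt_rearr by (simp add: gauss1_tail[OF v])
qed

text \<open>The half line above \<open>y\<close> and the preimage of the half line above
  \<open>rearr y\<close> differ by the flat piece of the distribution function to the right of
  \<open>y\<close>, a null set. The tail integral thus becomes a Gaussian one.\<close>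

lemma rearr_tail:
  assumes "0 < cdf tilt y" "cdf tilt y < 1"
  shows "(\<integral>u. rearr u * indicator {y<..} u \<partial>tilt) = v * normal_density 0 (sqrt v) (rearr y)"
proof -
  have s: "{u. cdf tilt u \<le> cdf tilt y} \<in> sets tilt"
  proof -
    have "{u \<in> space tilt. cdf tilt u \<le> cdf tilt y} \<in> sets tilt" by measurable
    then show ?thesis by simp
  qed
  have "measure tilt ({u. cdf tilt u \<le> cdf tilt y} - {..y}) = measure tilt {u. cdf tilt u \<le> cdf tilt y} - measure tilt {..y}"
    using s N.cdf_nondecreasing by (intro N.finite_measure_Diff) auto
  also have "\<dots> = 0" using N.measure_cdf_le[OF continuous_cdf_tilt assms] by (simp add: cdf_def2[symmetric])
  finally have "AE u in tilt. u \<notin> {u. cdf tilt u \<le> cdf tilt y} - {..y}"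
    using s by (intro AE_not_in) (auto simp: null_sets_def N.emeasure_eq_measure)
  then have ae: "AE u in tilt. rearr u * indicator {y<..} u = rearr u * indicator {rearr y<..} (rearr u)"
    using AE_cdf_tilt
  proof eventually_elim
    case (elim u)
    have "rearr y < rearr u \<longleftrightarrow> cdf tilt y < cdf tilt u"
      using gauss1_quantile_le[OF v, of "cdf tilt u" "rearr y"] elim cdf_gauss1_quantile[OF v assms] by (simp add: not_le[symmetric])
    also have "\<dots> \<longleftrightarrow> y < u" using elim N.cdf_nondecreasing[of u y] by (auto simp: not_le[symmetric])
    finally show ?case by (simp add: indicator_def)
  qed
  have "(\<integral>u. rearr u * indicator {y<..} u \<partial>tilt) = (\<integral>u. rearr u * indicator {rearr y<..} (rearr u) \<partial>tilt)"
    by (rule integral_cong_AE[OF _ _ ae]) measurable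
  also have "\<dots> = (\<integral>z. z * indicator {rearr y<..} z \<partial>distr tilt borel rearr)" by (subst integral_distr) auto
  also have "\<dots> = v * normal_density 0 (sqrt v) (rearr y)" unfolding distr_tilt_rearr by (rule gauss1_tail(1)[OF v])
  finally show ?thesis .
qed

lemma rearr_tail_0:
  assumes "cdf tilt y \<le> 0"
  shows "(\<integral>u. rearr u * indicator {..y} u \<partial>tilt) = 0"
proof -
  have "measure tilt {..y} = 0" using assms N.cdf_nonneg[of y] unfolding cdf_def2 by linarith
  then have "AE u in tilt. u \<notin> {..y}" by (intro AE_not_in) (auto simp: null_sets_def N.emeasure_eq_measure)
  then have "AE u in tilt. rearr u * indicator {..y} u = 0" by eventually_elim simp
  then show ?thesis using integral_cong_AE[of "\<lambda>u. rearr u * indicator {..y} u" tilt "\<lambda>_. 0"] by simp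
qed

lemma rearr_tail_1:
  assumes "1 \<le> cdf tilt y"
  shows "(\<integral>u. rearr u * indicator {y<..} u \<partial>tilt) = 0"
proof -
  have "measure tilt {y<..} = 1 - measure tilt {..y}"
    using N.prob_compl[of "{..y}"] by (simp add: Compl_eq_Diff_UNIV[symmetric])
  then have "measure tilt {y<..} = 0" using assms N.cdf_bounded_prob[of y] measure_nonneg[of tilt "{y<..}"] unfolding cdf_def2 by linarith
  then have "AE u in tilt. u \<notin> {y<..}" by (intro AE_not_in) (auto simp: null_sets_def N.emeasure_eq_measure)
  then have "AE u in tilt. rearr u * indicator {y<..} u = 0" by eventually_elim simp
  then show ?thesis using integral_cong_AE[of "\<lambda>u. rearr u * indicator {y<..} u" tilt "\<lambda>_. 0"] by simp
qed

text \<open>The Gaussian density evaluated at the rearranged point, which is not the density of a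
  probability law. By \<open>rearr_tail\<close>, \<open>v\<close> times it is a tail integral of
  \<open>rearr\<close>.\<close>

definition rearr_density :: "real \<Rightarrow> real" where
  "rearr_density y = (if 0 < cdf tilt y \<and> cdf tilt y < 1 then normal_density 0 (sqrt v) (rearr y) else 0)"

lemma rearr_density_measurable[measurable]: "rearr_density \<in> borel_measurable borel"
  unfolding rearr_density_def by measurable

text \<open>Formally, \<open>v * rearr_density\<close> has derivative minus \<open>rearr\<close>
  times the tilted density, and the second claim is integration by parts against \<open>y\<close>.
  Fubini gives it without differentiating the rearrangement.\<close>

lemma rearr_density_integral:
  assumes i2: "integrable tilt (\<lambda>y. y\<^sup>2)"
  shows "integrable lborel rearr_density" "v * (\<integral>y. rearr_density y \<partial>lborel) = (\<integral>y. y * rearr y \<partial>tilt)"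
proof -
  interpret P: pair_sigma_finite tilt lborel by unfold_locales
  \<comment> \<open>A signed layer representation: integration in \<open>y\<close> gives
    \<open>u * rearr u\<close> for either sign of \<open>u\<close>.\<close>
  define g where "g u y = rearr u * (if 0 \<le> y \<and> y < u then 1 else 0) - rearr u * (if u \<le> y \<and> y < 0 then 1 else (0::real))" for u y
  have gm[measurable]: "case_prod g \<in> borel_measurable (tilt \<Otimes>\<^sub>M lborel)"
    unfolding g_def case_prod_unfold by measurable
  have yT: "integrable tilt (\<lambda>y. y * rearr y)"
  proof (rule Bochner_Integration.integrable_bound[of tilt "\<lambda>y. y\<^sup>2 + (rearr y)\<^sup>2"])
    show "integrable tilt (\<lambda>y. y\<^sup>2 + (rearr y)\<^sup>2)" using i2 rearr_moments(2) by simp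
    have "\<bar>a * b\<bar> \<le> a\<^sup>2 + b\<^sup>2" for a b :: real
    proof -
      have "2 * \<bar>a\<bar> * \<bar>b\<bar> \<le> a\<^sup>2 + b\<^sup>2" using sum_squares_bound[of "\<bar>a\<bar>" "\<bar>b\<bar>"] by simp
      moreover have "0 \<le> \<bar>a\<bar> * \<bar>b\<bar>" by simp
      ultimately show ?thesis unfolding abs_mult by linarith
    qed
    then show "AE y in tilt. norm (y * rearr y) \<le> norm (y\<^sup>2 + (rearr y)\<^sup>2)" by simp
  qed measurable
  have g_inner: "(\<integral>y. g u y \<partial>lborel) = u * rearr u" "integrable lborel (\<lambda>y. g u y)"
    "(\<integral>y. norm (g u y) \<partial>lborel) = \<bar>u * rearr u\<bar>" for u
  proof -
    have *: "g u y = rearr u * indicator {0..<u} y - rearr u * indicator {u..<0} y" for y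
      by (auto simp: g_def indicator_def)
    have **: "norm (g u y) = \<bar>rearr u\<bar> * indicator {0..<u} y + \<bar>rearr u\<bar> * indicator {u..<0} y" for y
      by (auto simp: g_def indicator_def)
    have em: "emeasure lborel {a..<b} = ennreal (b - a)" for a b :: real
      by (cases "a \<le> b") (auto simp: ennreal_neg)
    have i: "integrable lborel (indicator {a..<b} :: real \<Rightarrow> real)" for a b :: real
      by (rule integrable_real_indicator) (auto simp: em)
    have me: "measure lborel {a..<b} = max 0 (b - a)" for a b :: real
      by (simp add: measure_def em max_def ennreal_neg)
    show "integrable lborel (\<lambda>y. g u y)" unfolding * by (intro Bochner_Integration.integrable_diff integrable_mult_right i)
    show "(\<integral>y. g u y \<partial>lborel) = u * rearr u"
      unfolding * by (subst Bochner_Integration.integral_diff) (auto intro!: integrable_mult_right i simp: me max_def)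
    show "(\<integral>y. norm (g u y) \<partial>lborel) = \<bar>u * rearr u\<bar>"
      unfolding ** by (subst Bochner_Integration.integral_add) (auto intro!: integrable_mult_right i simp: me max_def abs_mult)
  qed
  have g_int: "integrable (tilt \<Otimes>\<^sub>M lborel) (case_prod g)"
  proof (rule P.Fubini_integrable[OF gm])
    show "integrable tilt (\<lambda>x. \<integral>y. norm (case (x, y) of (u, y) \<Rightarrow> g u y) \<partial>lborel)"
      using yT by (simp only: prod.case g_inner integrable_abs)
  qed (simp add: g_inner)
  have inner: "(\<integral>u. g u y \<partial>tilt) = v * rearr_density y" for y
  proof -
    have iT: "integrable tilt (\<lambda>u. rearr u * indicator A u)" if "A \<in> sets borel" for A
      using integrable_mult_indicator[of A tilt rearr] rearr_moments(1) that by (simp add: mult.commute)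
    \<comment> \<open>For negative \<open>y\<close> the layers run over \<open>u \<le> y\<close>.
      Since \<open>rearr\<close> has mean 0, minus that integral is the upper tail, and both signs
      of \<open>y\<close> lead to the same formula.\<close>
    have split: "(\<integral>u. rearr u * indicator {..y} u \<partial>tilt) + (\<integral>u. rearr u * indicator {y<..} u \<partial>tilt) = 0"
    proof -
      have "(\<integral>u. rearr u * indicator {..y} u \<partial>tilt) + (\<integral>u. rearr u * indicator {y<..} u \<partial>tilt) = (\<integral>u. rearr u * indicator {..y} u + rearr u * indicator {y<..} u \<partial>tilt)"
        by (subst Bochner_Integration.integral_add) (auto intro: iT)
      also have "\<dots> = (\<integral>u. rearr u \<partial>tilt)" by (intro Bochner_Integration.integral_cong) (auto simp: indicator_def)
      finally show ?thesis by (simp add: rearr_moments)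
    qed
    have "(\<integral>u. rearr u * indicator {y<..} u \<partial>tilt) = v * rearr_density y"
    proof -
      consider "0 < cdf tilt y \<and> cdf tilt y < 1" | "cdf tilt y \<le> 0" | "1 \<le> cdf tilt y" by linarith
      then show ?thesis
      proof cases
        case 1 then show ?thesis using rearr_tail[of y] by (simp add: rearr_density_def)
      next
        case 2 then show ?thesis using rearr_tail_0[of y] split by (simp add: rearr_density_def)
      next
        case 3 then show ?thesis using rearr_tail_1[of y] by (simp add: rearr_density_def)
      qed
    qed
    moreover have "(\<integral>u. g u y \<partial>tilt) = (\<integral>u. rearr u * indicator {y<..} u \<partial>tilt)"
    proof (cases "0 \<le> y")
      case True
      then show ?thesis by (intro Bochner_Integration.integral_cong) (auto simp: g_def indicator_def)
    next
      case False
      then have "(\<integral>u. g u y \<partial>tilt) = (\<integral>u. - (rearr u * indicator {..y} u) \<partial>tilt)"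
        by (intro Bochner_Integration.integral_cong) (auto simp: g_def indicator_def)
      then show ?thesis using split by simp
    qed
    ultimately show ?thesis by simp
  qed
  have "integrable lborel (\<lambda>y. v * rearr_density y)" using P.integrable_snd[OF g_int] by (simp add: inner)
  then show "integrable lborel rearr_density" using v by simp
  have "v * (\<integral>y. rearr_density y \<partial>lborel) = (\<integral>y. (\<integral>u. g u y \<partial>tilt) \<partial>lborel)" by (simp add: inner)
  also have "\<dots> = (\<integral>u. (\<integral>y. g u y \<partial>lborel) \<partial>tilt)"
    unfolding P.integral_snd[OF g_int] using P.integral_fst'[OF g_int] by simp
  also have "\<dots> = (\<integral>u. u * rearr u \<partial>tilt)" by (simp add: g_inner)
  finally show "v * (\<integral>y. rearr_density y \<partial>lborel) = (\<integral>y. y * rearr y \<partial>tilt)" .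
qed

text \<open>Young's inequality at \<open>b = y^2 / (4 * v)\<close>, half of the Gaussian exponent:
  the Gaussian density times \<open>exp b\<close> is \<open>sqrt 2\<close> times the density of
  variance \<open>2 * v\<close>, hence integrable.\<close>

lemma integrable_square_of_ent:
  assumes e: "integrable (gauss1 v) (\<lambda>y. ent (f y))"
  shows "integrable tilt (\<lambda>y. y\<^sup>2)"
proof -
  have v2: "v > 0" "2 * v > 0" using v by auto
  have i: "integrable (gauss1 v) (\<lambda>y. exp (y\<^sup>2 / (4 * v)))"
  proof (subst integrable_density)
    have "normal_density 0 (sqrt v) y *\<^sub>R exp (y\<^sup>2 / (4 * v)) = sqrt 2 * normal_density 0 (sqrt (2 * v)) y" for y
    proof -
      have "- y\<^sup>2 / (2 * v) + y\<^sup>2 / (4 * v) = - y\<^sup>2 / (2 * (2 * v))" using v by (simp add: field_simps)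
      then have "exp (- y\<^sup>2 / (2 * v)) * exp (y\<^sup>2 / (4 * v)) = exp (- y\<^sup>2 / (2 * (2 * v)))"
        by (simp add: exp_add[symmetric])
      then show ?thesis unfolding normal_density_sqrt[OF v2(1)] normal_density_sqrt[OF v2(2)]
        using v by (simp add: real_sqrt_mult field_simps)
    qed
    then show "integrable lborel (\<lambda>y. normal_density 0 (sqrt v) y *\<^sub>R exp (y\<^sup>2 / (4 * v)))"
      using integrable_normal_density[of "sqrt (2 * v)" 0] v by simp
  qed auto
  have "integrable (gauss1 v) (\<lambda>y. f y * (y\<^sup>2 / (4 * v)))"
  proof (rule Bochner_Integration.integrable_bound)
    show "integrable (gauss1 v) (\<lambda>y. ent (f y) + exp (y\<^sup>2 / (4 * v)))" using e i by simp
    show "AE y in gauss1 v. norm (f y * (y\<^sup>2 / (4 * v))) \<le> norm (ent (f y) + exp (y\<^sup>2 / (4 * v)))"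
    proof (intro AE_I2)
      fix y
      have "f y * (y\<^sup>2 / (4 * v)) \<le> ent (f y) + exp (y\<^sup>2 / (4 * v)) - 1" by (rule ent_Young[OF f0])
      moreover have "0 \<le> f y * (y\<^sup>2 / (4 * v))" using f0 v by simp
      ultimately show "norm (f y * (y\<^sup>2 / (4 * v))) \<le> norm (ent (f y) + exp (y\<^sup>2 / (4 * v)))" by simp
    qed
  qed measurable
  then have "integrable (gauss1 v) (\<lambda>y. 4 * v * (f y * (y\<^sup>2 / (4 * v))))" by (rule integrable_mult_right)
  then have "integrable (gauss1 v) (\<lambda>y. f y *\<^sub>R y\<^sup>2)" using v by simp
  then show ?thesis by (subst integrable_density) (use f0 in auto)
qed

text \<open>Write \<open>T\<close> for the rearrangement and apply \<open>ent_Young\<close> at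
  \<open>b = (y^2 - T^2) / (2 * v)\<close>, where \<open>exp b\<close> is the ratio of the Gaussian
  densities at \<open>T\<close> and at \<open>y\<close>. The Gaussian mean of this ratio is the
  tilted mean of \<open>y * T\<close> divided by \<open>v\<close>, by
  \<open>rearr_density_integral\<close>; multiplying by \<open>2 * v\<close> completes the square
  \<open>(y - T)^2\<close>.\<close>

lemma talagrand_1:
  "(\<integral>\<^sup>+y. ennreal ((y - rearr y)\<^sup>2) \<partial>tilt) \<le> ennreal (2 * v) * (\<integral>\<^sup>+y. ennreal (ent (f y)) \<partial>gauss1 v)"
proof (cases "(\<integral>\<^sup>+y. ennreal (ent (f y)) \<partial>gauss1 v) = \<infinity>")
  case True
  then show ?thesis using v by (simp add: ennreal_mult_top)
next
  case False
  have e: "integrable (gauss1 v) (\<lambda>y. ent (f y))"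
  proof (rule integrableI_bounded)
    have "(\<integral>\<^sup>+y. ennreal (norm (ent (f y))) \<partial>gauss1 v) = (\<integral>\<^sup>+y. ennreal (ent (f y)) \<partial>gauss1 v)"
      using ent_nonneg f0 by (intro nn_integral_cong) simp
    then show "(\<integral>\<^sup>+y. ennreal (norm (ent (f y))) \<partial>gauss1 v) < \<infinity>" using False by (simp add: less_top)
  qed measurable
  note i2 = integrable_square_of_ent[OF e]
  note psi = rearr_density_integral[OF i2]
  note tm = rearr_moments
  have yT: "integrable tilt (\<lambda>y. (y - rearr y)\<^sup>2)"
  proof (rule Bochner_Integration.integrable_bound)
    show "integrable tilt (\<lambda>y. 2 * y\<^sup>2 + 2 * (rearr y)\<^sup>2)" using i2 tm(2) by simp
    have "(a - b)\<^sup>2 \<le> 2 * a\<^sup>2 + 2 * b\<^sup>2" for a b :: real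
      using zero_le_power2[of "a + b"] by (simp add: power2_sum power2_diff)
    then show "AE y in tilt. norm ((y - rearr y)\<^sup>2) \<le> norm (2 * y\<^sup>2 + 2 * (rearr y)\<^sup>2)" by simp
  qed measurable
  have yT1: "integrable tilt (\<lambda>y. y * rearr y)"
  proof -
    have "integrable tilt (\<lambda>y. (1/2) * (y\<^sup>2 + (rearr y)\<^sup>2 - (y - rearr y)\<^sup>2))" using i2 tm(2) yT by simp
    then show ?thesis by (simp add: power2_diff)
  qed
  define R where "R y = rearr_density y / normal_density 0 (sqrt v) y" for y
  have npos: "normal_density 0 (sqrt v) y > 0" for y using v by (simp add: normal_density_pos)
  have Rm[measurable]: "R \<in> borel_measurable borel" unfolding R_def by measurable
  have iR: "integrable (gauss1 v) R" "(\<integral>y. R y \<partial>gauss1 v) = (\<integral>y. rearr_density y \<partial>lborel)"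
  proof -
    have *: "normal_density 0 (sqrt v) y *\<^sub>R R y = rearr_density y" for y using npos[of y] by (simp add: R_def)
    show "integrable (gauss1 v) R" by (subst integrable_density) (use psi * in auto)
    show "(\<integral>y. R y \<partial>gauss1 v) = (\<integral>y. rearr_density y \<partial>lborel)" by (subst integral_density) (use * in auto)
  qed
  have "AE y in gauss1 v. ennreal (f y) > 0 \<longrightarrow> (0 < cdf tilt y \<and> cdf tilt y < 1)"
    using AE_cdf_tilt by (subst (asm) AE_density) auto
  then have ae: "AE y in gauss1 v. f y * ((y\<^sup>2 - (rearr y)\<^sup>2) / (2 * v)) + 1 \<le> ent (f y) + R y"
  proof eventually_elim
    case (elim y)
    show ?case
    proof (cases "0 < cdf tilt y \<and> cdf tilt y < 1")
      case True
      have "R y = exp ((y\<^sup>2 - (rearr y)\<^sup>2) / (2 * v))"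
      proof -
        have "(y\<^sup>2 - (rearr y)\<^sup>2) / (2 * v) = - (rearr y)\<^sup>2 / (2 * v) - - y\<^sup>2 / (2 * v)" by (simp add: diff_divide_distrib)
        then have "exp ((y\<^sup>2 - (rearr y)\<^sup>2) / (2 * v)) = exp (- (rearr y)\<^sup>2 / (2 * v)) / exp (- y\<^sup>2 / (2 * v))"
          by (simp only: exp_diff)
        then show ?thesis using True v unfolding R_def rearr_density_def normal_density_sqrt[OF v] by simp
      qed
      then show ?thesis using ent_Young[OF f0[of y], of "(y\<^sup>2 - (rearr y)\<^sup>2) / (2 * v)"] by simp
    next
      case False
      \<comment> \<open>Where the rearrangement is undefined both sides equal 1:
        \<open>f y = 0\<close>, \<open>R y = 0\<close> and \<open>ent 0 = 1\<close>.\<close>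
      then have "f y = 0" using elim f0[of y] by (auto simp: ennreal_eq_0_iff zero_less_iff_neq_zero)
      then show ?thesis using False by (auto simp: ent_def R_def rearr_density_def)
    qed
  qed
  have iN: "integrable (gauss1 v) (\<lambda>y. f y * ((y\<^sup>2 - (rearr y)\<^sup>2) / (2 * v)))"
    "(\<integral>y. f y * ((y\<^sup>2 - (rearr y)\<^sup>2) / (2 * v)) \<partial>gauss1 v) = ((\<integral>y. y\<^sup>2 \<partial>tilt) - v) / (2 * v)"
  proof -
    have "integrable tilt (\<lambda>y. (y\<^sup>2 - (rearr y)\<^sup>2) / (2 * v))" using i2 tm(2) by simp
    then show "integrable (gauss1 v) (\<lambda>y. f y * ((y\<^sup>2 - (rearr y)\<^sup>2) / (2 * v)))"
      by (subst (asm) integrable_density) (use f0 in auto)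
    have "(\<integral>y. f y * ((y\<^sup>2 - (rearr y)\<^sup>2) / (2 * v)) \<partial>gauss1 v) = (\<integral>y. (y\<^sup>2 - (rearr y)\<^sup>2) / (2 * v) \<partial>tilt)"
      by (subst integral_density) (use f0 in auto)
    also have "\<dots> = ((\<integral>y. y\<^sup>2 \<partial>tilt) - v) / (2 * v)" using i2 tm by simp
    finally show "(\<integral>y. f y * ((y\<^sup>2 - (rearr y)\<^sup>2) / (2 * v)) \<partial>gauss1 v) = ((\<integral>y. y\<^sup>2 \<partial>tilt) - v) / (2 * v)" .
  qed
  have "(\<integral>y. f y * ((y\<^sup>2 - (rearr y)\<^sup>2) / (2 * v)) + 1 \<partial>gauss1 v) \<le> (\<integral>y. ent (f y) + R y \<partial>gauss1 v)"
    by (rule integral_mono_AE[OF _ _ ae]) (use iN e iR in auto)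
  moreover have "(\<integral>y. f y * ((y\<^sup>2 - (rearr y)\<^sup>2) / (2 * v)) + 1 \<partial>gauss1 v) = ((\<integral>y. y\<^sup>2 \<partial>tilt) - v) / (2 * v) + 1"
    using iN G.prob_space by (subst Bochner_Integration.integral_add) auto
  moreover have "(\<integral>y. ent (f y) + R y \<partial>gauss1 v) = (\<integral>y. ent (f y) \<partial>gauss1 v) + (\<integral>y. y * rearr y \<partial>tilt) / v"
    using e iR psi(2) v by (subst Bochner_Integration.integral_add) (auto simp: field_simps)
  ultimately have "((\<integral>y. y\<^sup>2 \<partial>tilt) - v) / (2 * v) + 1 \<le> (\<integral>y. ent (f y) \<partial>gauss1 v) + (\<integral>y. y * rearr y \<partial>tilt) / v" by simp
  then have "2 * v * (((\<integral>y. y\<^sup>2 \<partial>tilt) - v) / (2 * v) + 1) \<le> 2 * v * ((\<integral>y. ent (f y) \<partial>gauss1 v) + (\<integral>y. y * rearr y \<partial>tilt) / v)"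
    using v by (intro mult_left_mono) auto
  moreover have "2 * v * (((\<integral>y. y\<^sup>2 \<partial>tilt) - v) / (2 * v) + 1) = (\<integral>y. y\<^sup>2 \<partial>tilt) + v"
    using v by (simp add: distrib_left)
  moreover have "2 * v * ((\<integral>y. ent (f y) \<partial>gauss1 v) + (\<integral>y. y * rearr y \<partial>tilt) / v) = 2 * v * (\<integral>y. ent (f y) \<partial>gauss1 v) + 2 * (\<integral>y. y * rearr y \<partial>tilt)"
    using v by (simp add: distrib_left)
  ultimately have "(\<integral>y. y\<^sup>2 \<partial>tilt) + v - 2 * (\<integral>y. y * rearr y \<partial>tilt) \<le> 2 * v * (\<integral>y. ent (f y) \<partial>gauss1 v)"
    by linarith
  moreover have "(\<integral>y. (y - rearr y)\<^sup>2 \<partial>tilt) = (\<integral>y. y\<^sup>2 \<partial>tilt) + v - 2 * (\<integral>y. y * rearr y \<partial>tilt)"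
  proof -
    have "(\<integral>y. (y - rearr y)\<^sup>2 \<partial>tilt) = (\<integral>y. (y\<^sup>2 + (rearr y)\<^sup>2) - 2 * (y * rearr y) \<partial>tilt)"
      by (intro Bochner_Integration.integral_cong) (auto simp: power2_diff)
    also have "\<dots> = (\<integral>y. y\<^sup>2 + (rearr y)\<^sup>2 \<partial>tilt) - (\<integral>y. 2 * (y * rearr y) \<partial>tilt)"
      using i2 tm yT1 by (intro Bochner_Integration.integral_diff) auto
    finally show ?thesis using i2 tm yT1 by simp
  qed
  ultimately have "(\<integral>y. (y - rearr y)\<^sup>2 \<partial>tilt) \<le> 2 * v * (\<integral>y. ent (f y) \<partial>gauss1 v)" by simp
  moreover have "(\<integral>\<^sup>+y. ennreal ((y - rearr y)\<^sup>2) \<partial>tilt) = ennreal (\<integral>y. (y - rearr y)\<^sup>2 \<partial>tilt)"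
    using yT by (intro nn_integral_eq_integral) auto
  moreover have "(\<integral>\<^sup>+y. ennreal (ent (f y)) \<partial>gauss1 v) = ennreal (\<integral>y. ent (f y) \<partial>gauss1 v)"
    using e ent_nonneg f0 by (intro nn_integral_eq_integral) auto
  moreover have "0 \<le> (\<integral>y. ent (f y) \<partial>gauss1 v)" using ent_nonneg f0 by (intro Bochner_Integration.integral_nonneg) auto
  ultimately show ?thesis using v by (simp add: ennreal_mult[symmetric] ennreal_leI)
qed

end

text \<open>\<open>ent (f y)\<close> and \<open>a * ent (f y / a) + ent a\<close> differ by
  \<open>(f y - a) * ln a\<close>, which has integral 0. In extended nonnegative reals each part of
  that term goes to the side where it is nonnegative, hence the split on the sign of
  \<open>ln a\<close>.\<close>

lemma ent_chain:
  assumes G: "prob_space G" and f[measurable]: "f \<in> borel_measurable G" and f0: "\<And>y. 0 \<le> f y"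
    and a: "(\<integral>\<^sup>+y. ennreal (f y) \<partial>G) = ennreal a" "a > 0"
  shows "ennreal a * (\<integral>\<^sup>+y. ennreal (ent (f y / a)) \<partial>G) + ennreal (ent a) = (\<integral>\<^sup>+y. ennreal (ent (f y)) \<partial>G)"
proof -
  interpret prob_space G by fact
  define L where "L = ln a"
  have id: "ent (f y) + a * L = a * ent (f y / a) + ent a + f y * L" for y
  proof (cases "f y = 0")
    case True then show ?thesis by (simp add: ent_def L_def)
  next
    case False
    then have "f y > 0" using f0[of y] by simp
    then show ?thesis using a(2) by (simp add: ent_def L_def ln_div field_simps)
  qed
  have e0: "0 \<le> ent (f y)" "0 \<le> ent (f y / a)" "0 \<le> ent a" for y using ent_nonneg f0 a by auto
  have iA: "(\<integral>\<^sup>+y. ennreal (a * ent (f y / a)) \<partial>G) = ennreal a * (\<integral>\<^sup>+y. ennreal (ent (f y / a)) \<partial>G)"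
    using a by (simp add: ennreal_mult' nn_integral_cmult)
  have ifL: "(\<integral>\<^sup>+y. ennreal (f y * c) \<partial>G) = ennreal (a * c)" if "0 \<le> c" for c
    using that f0 a by (simp add: ennreal_mult'' ennreal_mult nn_integral_multc)
  show ?thesis
  proof (cases "0 \<le> L")
    case True
    have "(\<integral>\<^sup>+y. ennreal (ent (f y)) \<partial>G) + ennreal (a * L) = (\<integral>\<^sup>+y. ennreal (ent (f y)) + ennreal (a * L) \<partial>G)"
      by (subst nn_integral_add) (auto simp: emeasure_space_1)
    also have "\<dots> = (\<integral>\<^sup>+y. ennreal (a * ent (f y / a)) + ennreal (ent a) + ennreal (f y * L) \<partial>G)"
    proof (rule nn_integral_cong)
      fix y
      show "ennreal (ent (f y)) + ennreal (a * L) = ennreal (a * ent (f y / a)) + ennreal (ent a) + ennreal (f y * L)"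
        using id[of y] e0 f0 a True by (simp add: ennreal_plus[symmetric] del: ennreal_plus)
    qed
    also have "\<dots> = (ennreal a * (\<integral>\<^sup>+y. ennreal (ent (f y / a)) \<partial>G) + ennreal (ent a)) + ennreal (a * L)"
      using True by (simp add: nn_integral_add iA ifL emeasure_space_1)
    finally show ?thesis by (metis ennreal_add_left_cancel add.commute ennreal_neq_top infinity_ennreal_def)
  next
    case False
    have "(\<integral>\<^sup>+y. ennreal (ent (f y)) \<partial>G) + ennreal (a * - L) = (\<integral>\<^sup>+y. ennreal (ent (f y)) + ennreal (f y * - L) \<partial>G)"
      using False ifL[of "- L"] by (subst nn_integral_add) auto
    also have "\<dots> = (\<integral>\<^sup>+y. ennreal (a * ent (f y / a)) + ennreal (ent a) + ennreal (a * - L) \<partial>G)"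
    proof (rule nn_integral_cong)
      fix y
      have nn: "f y * - L \<ge> 0" "a * - L \<ge> 0" using False f0 a by (simp_all add: mult_nonneg_nonpos)
      show "ennreal (ent (f y)) + ennreal (f y * - L) = ennreal (a * ent (f y / a)) + ennreal (ent a) + ennreal (a * - L)"
      proof -
        have "ennreal (ent (f y)) + ennreal (f y * - L) = ennreal (ent (f y) + f y * - L)"
          by (rule ennreal_plus[symmetric]) (use e0 nn in auto)
        also have "ent (f y) + f y * - L = a * ent (f y / a) + ent a + a * - L" using id[of y] by simp
        also have "ennreal \<dots> = ennreal (a * ent (f y / a) + ent a) + ennreal (a * - L)"
          using e0 a nn by (intro ennreal_plus) auto
        also have "ennreal (a * ent (f y / a) + ent a) = ennreal (a * ent (f y / a)) + ennreal (ent a)"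
          using e0 a by (intro ennreal_plus) auto
        finally show ?thesis .
      qed
    qed
    also have "\<dots> = (ennreal a * (\<integral>\<^sup>+y. ennreal (ent (f y / a)) \<partial>G) + ennreal (ent a)) + ennreal (a * - L)"
      by (simp add: nn_integral_add iA emeasure_space_1)
    finally show ?thesis by (metis ennreal_add_left_cancel add.commute ennreal_neq_top infinity_ennreal_def)
  qed
qed

section \<open>Tensorization over product Gaussians\<close>

lemma rearr_measurable_param:
  assumes v: "v > 0" and k[measurable]: "(\<lambda>(w, y). k w y) \<in> borel_measurable (M \<Otimes>\<^sub>M borel)"
  shows "(\<lambda>(w, y). rearr v (k w) y) \<in> borel_measurable (M \<Otimes>\<^sub>M borel)"
proof -
  interpret G: real_distribution "gauss1 v" by (rule real_distribution_gauss1[OF v])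
  have *: "cdf (tilt v (k w)) y = enn2real (\<integral>\<^sup>+u. ennreal (k w u) * indicator {..y} u \<partial>gauss1 v)" if "w \<in> space M" for w y
  proof -
    have [measurable]: "k w \<in> borel_measurable borel"
      using measurable_compose[OF measurable_Pair1'[OF that] k] by simp
    show ?thesis unfolding cdf_def2 measure_def by (subst emeasure_density) auto
  qed
  have "(\<lambda>(w, y). gauss1_quantile v (enn2real (\<integral>\<^sup>+u. ennreal (k w u) * indicator {..y} u \<partial>gauss1 v))) \<in> borel_measurable (M \<Otimes>\<^sub>M borel)"
  proof -
    have [measurable]: "gauss1_quantile v \<in> borel_measurable borel" by (rule gauss1_quantile_measurable[OF v])
    have "indicator {..y} u = (if u \<le> y then 1 else (0::ennreal))" for u y :: real by (simp add: indicator_def)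
    then show ?thesis unfolding case_prod_unfold by simp
  qed
  then show ?thesis
    by (rule measurable_cong[THEN iffD2, rotated]) (auto simp: space_pair_measure *)
qed

abbreviation gaussI :: "real \<Rightarrow> 'i set \<Rightarrow> ('i \<Rightarrow> real) measure" where
  "gaussI v I \<equiv> PiM I (\<lambda>_. gauss1 v)"

lemma gauss1_law:
  assumes v: "v > 0" and f: "f \<in> borel_measurable borel" "\<And>y. 0 \<le> f y" "(\<integral>\<^sup>+y. ennreal (f y) \<partial>gauss1 v) = 1"
    and g: "g \<in> borel_measurable borel"
  shows "(\<integral>\<^sup>+y. ennreal (f y) * g (rearr v f y) \<partial>gauss1 v) = (\<integral>\<^sup>+z. g z \<partial>gauss1 v)"
proof -
  have "(\<integral>\<^sup>+z. g z \<partial>gauss1 v) = (\<integral>\<^sup>+z. g z \<partial>distr (tilt v f) borel (rearr v f))"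
    using distr_tilt_rearr[OF v f] by simp
  also have "\<dots> = (\<integral>\<^sup>+y. g (rearr v f y) \<partial>tilt v f)"
    by (rule nn_integral_distr) (use rearr_measurable[OF v f] g in auto)
  also have "\<dots> = (\<integral>\<^sup>+y. ennreal (f y) * g (rearr v f y) \<partial>gauss1 v)"
    by (rule nn_integral_density) (use rearr_measurable[OF v f] g f(1) in auto)
  finally show ?thesis ..
qed

text \<open>The Knothe rearrangement: coordinates are rearranged one after the other, each one
  conditionally on the parameter and the previous coordinates.\<close>

lemma talagrand_PiM:
  fixes k :: "'p \<times> ('i \<Rightarrow> real) \<Rightarrow> real"
  assumes P: "prob_space P" and v: "v > 0" and I: "finite I"
    and k: "k \<in> borel_measurable (P \<Otimes>\<^sub>M PiM I (\<lambda>_. borel))" "\<And>w y. 0 \<le> k (w, y)"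
    and k1: "\<And>w. w \<in> space P \<Longrightarrow> (\<integral>\<^sup>+y. ennreal (k (w, y)) \<partial>gaussI v I) = 1"
  shows "\<exists>S \<in> measurable (P \<Otimes>\<^sub>M PiM I (\<lambda>_. borel)) (PiM I (\<lambda>_. borel)).
    (\<forall>g \<in> borel_measurable (P \<Otimes>\<^sub>M PiM I (\<lambda>_. borel)).
      (\<integral>\<^sup>+w. \<integral>\<^sup>+y. ennreal (k (w, y)) * g (w, S (w, y)) \<partial>gaussI v I \<partial>P) = (\<integral>\<^sup>+w. \<integral>\<^sup>+z. g (w, z) \<partial>gaussI v I \<partial>P)) \<and>
    (\<integral>\<^sup>+w. \<integral>\<^sup>+y. ennreal (k (w, y)) * ennreal (\<Sum>i\<in>I. (y i - S (w, y) i)\<^sup>2) \<partial>gaussI v I \<partial>P)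
      \<le> ennreal (2 * v) * (\<integral>\<^sup>+w. \<integral>\<^sup>+y. ennreal (ent (k (w, y))) \<partial>gaussI v I \<partial>P)"
  using I k k1
proof (induction I arbitrary: k rule: finite_induct)
  case empty
  interpret P: prob_space P by fact
  interpret Pr: product_prob_space "\<lambda>_::'i. gauss1 v" "{}"
    using real_distribution.axioms(1)[OF real_distribution_gauss1[OF v]] by (intro product_prob_spaceI)
  \<comment> \<open>The empty product is the point mass at the undefined function.\<close>
  have E: "(\<integral>\<^sup>+y. f y \<partial>gaussI v {}) = f (\<lambda>_. undefined)" for f :: "('i \<Rightarrow> real) \<Rightarrow> ennreal"
    by (simp add: PiM_empty nn_integral_count_space_finite)
  show ?case
  proof (intro bexI[of _ snd] conjI ballI)
    fix g :: "'p \<times> ('i \<Rightarrow> real) \<Rightarrow> ennreal" 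
    show "(\<integral>\<^sup>+w. \<integral>\<^sup>+y. ennreal (k (w, y)) * g (w, snd (w, y)) \<partial>gaussI v {} \<partial>P) = (\<integral>\<^sup>+w. \<integral>\<^sup>+z. g (w, z) \<partial>gaussI v {} \<partial>P)"
      using empty(3) unfolding E by (intro nn_integral_cong) simp
  qed (simp_all)
next
  case (insert i I)
  interpret P: prob_space P by fact
  interpret G: real_distribution "gauss1 v" by (rule real_distribution_gauss1[OF v])
  interpret Pr: product_sigma_finite "\<lambda>_::'i. gauss1 v" by (rule product_sigma_finite.intro) unfold_locales
  interpret GI: prob_space "gaussI v I" by (intro prob_space_PiM G.prob_space_axioms)
  note I = \<open>finite I\<close> and iI = \<open>i \<notin> I\<close>
  let ?B = "\<lambda>I. PiM I (\<lambda>_::'i. borel :: real measure)"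
  have sB: "sets (gaussI v J) = sets (?B J)" for J by (rule sets_PiM_cong) auto
  have [measurable_cong]: "sets (gaussI v I) = sets (?B I)" by (rule sB)
  note km[measurable] = insert.prems(1)
  have k0: "0 \<le> k (w, y)" for w y by (rule insert.prems(2))
  define k' where "k' w y = k (fst w, (snd w)(i := y))" for w :: "'p \<times> ('i \<Rightarrow> real)" and y
  have upd[measurable]: "(\<lambda>(w, y). (snd w)(i := y)) \<in> measurable ((P \<Otimes>\<^sub>M ?B I) \<Otimes>\<^sub>M borel) (?B (insert i I))"
    unfolding case_prod_unfold by measurable
  have k'm[measurable]: "(\<lambda>(w, y). k' w y) \<in> borel_measurable ((P \<Otimes>\<^sub>M ?B I) \<Otimes>\<^sub>M borel)"
    unfolding k'_def case_prod_unfold using upd unfolding case_prod_unfold by measurable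
  have k'0: "0 \<le> k' w y" for w y by (simp add: k'_def k0)
  have split: "(\<integral>\<^sup>+z. f z \<partial>gaussI v (insert i I)) = (\<integral>\<^sup>+x. \<integral>\<^sup>+y. f (x(i := y)) \<partial>gauss1 v \<partial>gaussI v I)"
    if "f \<in> borel_measurable (?B (insert i I))" for f
    by (rule Pr.product_nn_integral_insert[OF I iI]) (use that measurable_cong_sets[OF sB refl] in blast)
  \<comment> \<open>The marginal density of the earlier coordinates. It may be infinite on a null
    set, where its real version \<open>a\<close> is 0.\<close>
  define A where "A w = (\<integral>\<^sup>+y. ennreal (k' w y) \<partial>gauss1 v)" for w
  define a where "a w = enn2real (A w)" for w
  have Am[measurable]: "A \<in> borel_measurable (P \<Otimes>\<^sub>M ?B I)" unfolding A_def by measurable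
  have am[measurable]: "a \<in> borel_measurable (P \<Otimes>\<^sub>M ?B I)" unfolding a_def by measurable
  have a0: "0 \<le> a w" for w by (simp add: a_def)
  have kw: "(\<lambda>y. k (w, y)) \<in> borel_measurable (?B (insert i I))" if "w \<in> space P" for w
    using measurable_compose[OF measurable_Pair1'[OF that] km] by simp
  have A1: "(\<integral>\<^sup>+x. A (w, x) \<partial>gaussI v I) = 1" if w: "w \<in> space P" for w
    using insert.prems(3)[OF w] kw[OF w] by (simp add: split A_def k'_def)
  have Aw: "(\<lambda>x. A (w, x)) \<in> borel_measurable (gaussI v I)" if "w \<in> space P" for w
    using measurable_compose[OF measurable_Pair1'[OF that] Am] measurable_cong_sets[OF sB refl] by blast
  have Afin: "AE x in gaussI v I. A (w, x) \<noteq> \<infinity>" if w: "w \<in> space P" for w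
    by (rule nn_integral_PInf_AE[OF Aw[OF w]]) (simp add: A1[OF w])
  have aA: "AE x in gaussI v I. ennreal (a (w, x)) = A (w, x)" if w: "w \<in> space P" for w
    using Afin[OF w] by eventually_elim (simp add: a_def less_top)
  have a1: "(\<integral>\<^sup>+x. ennreal (a (w, x)) \<partial>gaussI v I) = 1" if w: "w \<in> space P" for w
    using nn_integral_cong_AE[OF aA[OF w]] A1[OF w] by simp
  \<comment> \<open>The marginal is rearranged first, with the same parameter space; the new
    coordinate follows, conditionally on the earlier ones.\<close>
  from insert.IH[of a, OF am a0 a1] obtain S2 where S2m: "S2 \<in> measurable (P \<Otimes>\<^sub>M ?B I) (?B I)"
    and S2law: "\<And>g. g \<in> borel_measurable (P \<Otimes>\<^sub>M ?B I) \<Longrightarrow>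
      (\<integral>\<^sup>+w. \<integral>\<^sup>+y. ennreal (a (w, y)) * g (w, S2 (w, y)) \<partial>gaussI v I \<partial>P) = (\<integral>\<^sup>+w. \<integral>\<^sup>+z. g (w, z) \<partial>gaussI v I \<partial>P)"
    and S2cost: "(\<integral>\<^sup>+w. \<integral>\<^sup>+y. ennreal (a (w, y)) * ennreal (\<Sum>i\<in>I. (y i - S2 (w, y) i)\<^sup>2) \<partial>gaussI v I \<partial>P)
      \<le> ennreal (2 * v) * (\<integral>\<^sup>+w. \<integral>\<^sup>+y. ennreal (ent (a (w, y))) \<partial>gaussI v I \<partial>P)" by blast
  note [measurable] = S2m
  \<comment> \<open>The conditional density of the new coordinate. The default 1 keeps it a
    probability density where the marginal vanishes, so \<open>talagrand_1\<close> applies for every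
    value of the condition.\<close>
  define \<kappa> where "\<kappa> w y = (if a w > 0 then k' w y / a w else 1)" for w y
  have \<kappa>m[measurable]: "(\<lambda>(w, y). \<kappa> w y) \<in> borel_measurable ((P \<Otimes>\<^sub>M ?B I) \<Otimes>\<^sub>M borel)"
    unfolding \<kappa>_def case_prod_unfold using k'm unfolding case_prod_unfold by measurable
  define E\<kappa> where "E\<kappa> w = (\<integral>\<^sup>+y. ennreal (ent (\<kappa> w y)) \<partial>gauss1 v)" for w
  have E\<kappa>m[measurable]: "E\<kappa> \<in> borel_measurable (P \<Otimes>\<^sub>M ?B I)" unfolding E\<kappa>_def using \<kappa>m by measurable
  have \<kappa>0: "0 \<le> \<kappa> w y" for w y using k'0 a0 by (simp add: \<kappa>_def)
  have k'w: "k' w \<in> borel_measurable borel" "\<kappa> w \<in> borel_measurable borel" if "w \<in> space (P \<Otimes>\<^sub>M ?B I)" for w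
    using measurable_compose[OF measurable_Pair1'[OF that] k'm] measurable_compose[OF measurable_Pair1'[OF that] \<kappa>m] by simp_all
  have Apos: "A w = ennreal (a w)" if "a w > 0" for w
    using that by (cases "A w") (auto simp: a_def)
  have \<kappa>1: "(\<integral>\<^sup>+y. ennreal (\<kappa> w y) \<partial>gauss1 v) = 1" if w: "w \<in> space (P \<Otimes>\<^sub>M ?B I)" for w
  proof (cases "a w > 0")
    case True
    have "(\<integral>\<^sup>+y. ennreal (\<kappa> w y) \<partial>gauss1 v) = (\<integral>\<^sup>+y. ennreal (k' w y) * ennreal (1 / a w) \<partial>gauss1 v)"
      using True k'0 by (intro nn_integral_cong) (simp add: \<kappa>_def ennreal_mult''[symmetric])
    also have "\<dots> = A w * ennreal (1 / a w)"
      unfolding A_def using k'w[OF w] by (intro nn_integral_multc) auto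
    also have "\<dots> = 1" using True Apos[OF True] by (simp add: ennreal_mult''[symmetric])
    finally show ?thesis .
  next
    case False then show ?thesis using G.emeasure_space_1 by (simp add: \<kappa>_def)
  qed
  define S1 where "S1 w y = rearr v (\<kappa> w) y" for w y
  have S1m[measurable]: "(\<lambda>(w, y). S1 w y) \<in> borel_measurable ((P \<Otimes>\<^sub>M ?B I) \<Otimes>\<^sub>M borel)"
    unfolding S1_def by (rule rearr_measurable_param[OF v \<kappa>m])
  \<comment> \<open>The conditioning uses the original coordinates, not their images. Whatever their
    values, the image of the new coordinate has the same Gaussian law, so it is independent of the
    other images and the target is the product.\<close>
  define S where "S p = (S2 (fst p, restrict (snd p) I))(i := S1 (fst p, restrict (snd p) I) (snd p i))" for p
  have rm[measurable]: "(\<lambda>p. (fst p, restrict (snd p) I)) \<in> measurable (P \<Otimes>\<^sub>M ?B (insert i I)) (P \<Otimes>\<^sub>M ?B I)"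
    by (intro measurable_Pair measurable_fst measurable_compose[OF measurable_snd] measurable_restrict_subset) auto
  have S_m: "S \<in> measurable (P \<Otimes>\<^sub>M ?B (insert i I)) (?B (insert i I))"
  proof -
    have 1: "(\<lambda>p. S2 (fst p, restrict (snd p) I)) \<in> measurable (P \<Otimes>\<^sub>M ?B (insert i I)) (?B I)"
      by (rule measurable_compose[OF rm S2m])
    have "(\<lambda>p. ((fst p, restrict (snd p) I), snd p i)) \<in> measurable (P \<Otimes>\<^sub>M ?B (insert i I)) ((P \<Otimes>\<^sub>M ?B I) \<Otimes>\<^sub>M borel)"
      using rm by measurable
    from measurable_compose[OF this S1m]
    have 2: "(\<lambda>p. S1 (fst p, restrict (snd p) I) (snd p i)) \<in> borel_measurable (P \<Otimes>\<^sub>M ?B (insert i I))" by simp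
    show ?thesis unfolding S_def by (rule measurable_fun_upd[OF _ 1 2]) auto
  qed
  have Sx: "S (w, x(i := y)) = (S2 (w, x))(i := S1 (w, x) y)" if "x \<in> space (gaussI v I)" for w x y
  proof -
    have "restrict (x(i := y)) I = x"
      using that iI by (auto simp: space_PiM restrict_def fun_eq_iff PiE_def extensional_def)
    then show ?thesis by (simp add: S_def)
  qed
  have sp: "space (gaussI v I) = space (?B I)" using sets_eq_imp_space_eq[OF sB] .
  \<comment> \<open>Disintegration into marginal and conditional density. Where \<open>a\<close>
    vanishes and the mass is finite, \<open>k'\<close> vanishes almost everywhere, so the default in
    \<open>\<kappa>\<close> does no harm.\<close>
  have k'\<kappa>: "(\<integral>\<^sup>+y. ennreal (k' (w, x) y) * h y \<partial>gauss1 v) = ennreal (a (w, x)) * (\<integral>\<^sup>+y. ennreal (\<kappa> (w, x) y) * h y \<partial>gauss1 v)"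
    if w: "w \<in> space P" and x: "x \<in> space (gaussI v I)" and fin: "A (w, x) \<noteq> \<infinity>" and h: "h \<in> borel_measurable borel" for w x h
  proof (cases "a (w, x) > 0")
    case True
    have "ennreal (k' (w, x) y) = ennreal (a (w, x)) * ennreal (\<kappa> (w, x) y)" for y
      using True k'0 by (simp add: \<kappa>_def ennreal_mult'[symmetric])
    then have "(\<integral>\<^sup>+y. ennreal (k' (w, x) y) * h y \<partial>gauss1 v) = (\<integral>\<^sup>+y. ennreal (a (w, x)) * (ennreal (\<kappa> (w, x) y) * h y) \<partial>gauss1 v)"
      by (simp add: mult.assoc)
    also have "\<dots> = ennreal (a (w, x)) * (\<integral>\<^sup>+y. ennreal (\<kappa> (w, x) y) * h y \<partial>gauss1 v)"
      using k'w(2)[of "(w, x)"] w x h by (intro nn_integral_cmult) (auto simp: space_pair_measure sp)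
    finally show ?thesis .
  next
    case False
    then have a: "a (w, x) = 0" using a0[of "(w, x)"] by simp
    then have "A (w, x) = 0" using fin by (auto simp: a_def enn2real_eq_0_iff)
    then have "AE y in gauss1 v. ennreal (k' (w, x) y) = 0"
      using k'w(1)[of "(w, x)"] w x unfolding A_def by (subst (asm) nn_integral_0_iff_AE) (auto simp: space_pair_measure sp)
    then have "AE y in gauss1 v. ennreal (k' (w, x) y) * h y = 0" by eventually_elim simp
    then have "(\<integral>\<^sup>+y. ennreal (k' (w, x) y) * h y \<partial>gauss1 v) = (\<integral>\<^sup>+y. 0 \<partial>gauss1 v)" by (rule nn_integral_cong_AE)
    then show ?thesis using a by simp
  qed
  show ?case
  proof (intro bexI[of _ S] conjI ballI S_m)
    fix g :: "'p \<times> ('i \<Rightarrow> real) \<Rightarrow> ennreal" assume g[measurable]: "g \<in> borel_measurable (P \<Otimes>\<^sub>M ?B (insert i I))"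
    define g' where "g' w = (\<integral>\<^sup>+z. g (fst w, (snd w)(i := z)) \<partial>gauss1 v)" for w
    have gm: "(\<lambda>(w, z). g (fst w, (snd w)(i := z))) \<in> borel_measurable ((P \<Otimes>\<^sub>M ?B I) \<Otimes>\<^sub>M borel)"
      unfolding case_prod_unfold using upd unfolding case_prod_unfold by measurable
    have g'm[measurable]: "g' \<in> borel_measurable (P \<Otimes>\<^sub>M ?B I)" unfolding g'_def using gm by measurable
    have S2s: "S2 (w, x) \<in> space (?B I)" if "w \<in> space P" "x \<in> space (gaussI v I)" for w x
      using measurable_space[OF S2m, of "(w, x)"] that by (simp add: space_pair_measure sp)
    have gS: "(\<lambda>p. g (fst p, S p)) \<in> borel_measurable (P \<Otimes>\<^sub>M ?B (insert i I))"
      using S_m by measurable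
    have "(\<integral>\<^sup>+w. \<integral>\<^sup>+y. ennreal (k (w, y)) * g (w, S (w, y)) \<partial>gaussI v (insert i I) \<partial>P)
      = (\<integral>\<^sup>+w. \<integral>\<^sup>+x. ennreal (a (w, x)) * g' (w, S2 (w, x)) \<partial>gaussI v I \<partial>P)"
    proof (rule nn_integral_cong)
      fix w assume w: "w \<in> space P"
      have m: "(\<lambda>y. ennreal (k (w, y)) * g (w, S (w, y))) \<in> borel_measurable (?B (insert i I))"
        using measurable_compose[OF measurable_Pair1'[OF w] gS] kw[OF w] by simp
      have "(\<integral>\<^sup>+y. ennreal (k (w, y)) * g (w, S (w, y)) \<partial>gaussI v (insert i I))
        = (\<integral>\<^sup>+x. \<integral>\<^sup>+y. ennreal (k' (w, x) y) * g (w, (S2 (w, x))(i := S1 (w, x) y)) \<partial>gauss1 v \<partial>gaussI v I)"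
        unfolding split[OF m] by (intro nn_integral_cong) (simp add: Sx k'_def)
      also have "\<dots> = (\<integral>\<^sup>+x. ennreal (a (w, x)) * g' (w, S2 (w, x)) \<partial>gaussI v I)"
      proof (rule nn_integral_cong_AE, use Afin[OF w] AE_space in eventually_elim)
        case (elim x)
        have wx: "(w, x) \<in> space (P \<Otimes>\<^sub>M ?B I)" "(w, S2 (w, x)) \<in> space (P \<Otimes>\<^sub>M ?B I)"
          using w elim(2) S2s[OF w elim(2)] by (auto simp: space_pair_measure sp)
        have hm: "(\<lambda>z. g (w, (S2 (w, x))(i := z))) \<in> borel_measurable borel"
          using measurable_compose[OF measurable_Pair1'[OF wx(2)] gm] by simp
        have S1w: "S1 (w, x) \<in> borel_measurable borel"
          using measurable_compose[OF measurable_Pair1'[OF wx(1)] S1m] by simp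
        have "(\<integral>\<^sup>+y. ennreal (k' (w, x) y) * g (w, (S2 (w, x))(i := S1 (w, x) y)) \<partial>gauss1 v)
          = ennreal (a (w, x)) * (\<integral>\<^sup>+y. ennreal (\<kappa> (w, x) y) * g (w, (S2 (w, x))(i := S1 (w, x) y)) \<partial>gauss1 v)"
          by (rule k'\<kappa>[OF w elim(2,1)]) (use measurable_compose[OF S1w hm] in simp)
        also have "(\<integral>\<^sup>+y. ennreal (\<kappa> (w, x) y) * g (w, (S2 (w, x))(i := S1 (w, x) y)) \<partial>gauss1 v) = g' (w, S2 (w, x))"
          unfolding S1_def using gauss1_law[OF v k'w(2)[OF wx(1)] \<kappa>0 \<kappa>1[OF wx(1)] hm] by (simp add: g'_def)
        finally show ?case .
      qed
      finally show "(\<integral>\<^sup>+y. ennreal (k (w, y)) * g (w, S (w, y)) \<partial>gaussI v (insert i I))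
        = (\<integral>\<^sup>+x. ennreal (a (w, x)) * g' (w, S2 (w, x)) \<partial>gaussI v I)" .
    qed
    also have "\<dots> = (\<integral>\<^sup>+w. \<integral>\<^sup>+z. g' (w, z) \<partial>gaussI v I \<partial>P)" by (rule S2law[OF g'm])
    also have "\<dots> = (\<integral>\<^sup>+w. \<integral>\<^sup>+z. g (w, z) \<partial>gaussI v (insert i I) \<partial>P)"
    proof (rule nn_integral_cong)
      fix w assume w: "w \<in> space P"
      have "(\<lambda>z. g (w, z)) \<in> borel_measurable (?B (insert i I))"
        using measurable_compose[OF measurable_Pair1'[OF w] g] by simp
      then show "(\<integral>\<^sup>+z. g' (w, z) \<partial>gaussI v I) = (\<integral>\<^sup>+z. g (w, z) \<partial>gaussI v (insert i I))"
        by (simp add: split g'_def)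
    qed
    finally show "(\<integral>\<^sup>+w. \<integral>\<^sup>+y. ennreal (k (w, y)) * g (w, S (w, y)) \<partial>gaussI v (insert i I) \<partial>P)
      = (\<integral>\<^sup>+w. \<integral>\<^sup>+z. g (w, z) \<partial>gaussI v (insert i I) \<partial>P)" .
  next
    define c2 where "c2 w = (\<Sum>j\<in>I. (snd w j - S2 w j)\<^sup>2)" for w
    have c20: "0 \<le> c2 w" for w unfolding c2_def by (intro sum_nonneg) simp
    have c2m[measurable]: "c2 \<in> borel_measurable (P \<Otimes>\<^sub>M ?B I)"
      unfolding c2_def by measurable
    have point: "(\<integral>\<^sup>+y. ennreal (k (w, y)) * ennreal (\<Sum>j\<in>insert i I. (y j - S (w, y) j)\<^sup>2) \<partial>gaussI v (insert i I))
      \<le> (\<integral>\<^sup>+x. ennreal (a (w, x)) * ennreal (c2 (w, x)) \<partial>gaussI v I) + ennreal (2 * v) *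
         (\<integral>\<^sup>+x. ennreal (a (w, x)) * E\<kappa> (w, x) \<partial>gaussI v I)"
      if w: "w \<in> space P" for w
    proof -
      have m: "(\<lambda>y. ennreal (k (w, y)) * ennreal (\<Sum>j\<in>insert i I. (y j - S (w, y) j)\<^sup>2)) \<in> borel_measurable (?B (insert i I))"
      proof -
        have "(\<lambda>y. S (w, y)) \<in> measurable (?B (insert i I)) (?B (insert i I))"
          using measurable_compose[OF measurable_Pair1'[OF w] S_m] by simp
        then have "(\<lambda>y. S (w, y) j) \<in> borel_measurable (?B (insert i I))" if "j \<in> insert i I" for j
          using measurable_compose[OF _ measurable_component_singleton[OF that]] by blast
        then show ?thesis using kw[OF w] by (intro borel_measurable_times_ennreal measurable_compose[OF _ measurable_ennreal]
            borel_measurable_sum borel_measurable_power borel_measurable_diff measurable_component_singleton) auto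
      qed
      have "(\<integral>\<^sup>+y. ennreal (k (w, y)) * ennreal (\<Sum>j\<in>insert i I. (y j - S (w, y) j)\<^sup>2) \<partial>gaussI v (insert i I))
        = (\<integral>\<^sup>+x. \<integral>\<^sup>+y. ennreal (k' (w, x) y) * (ennreal (c2 (w, x)) + ennreal ((y - S1 (w, x) y)\<^sup>2)) \<partial>gauss1 v \<partial>gaussI v I)"
        unfolding split[OF m]
      proof (intro nn_integral_cong)
        fix x y assume x: "x \<in> space (gaussI v I)"
        have "(\<Sum>j\<in>insert i I. ((x(i := y)) j - S (w, x(i := y)) j)\<^sup>2) = (y - S1 (w, x) y)\<^sup>2 + c2 (w, x)"
        proof -
          have "(\<Sum>j\<in>I. ((x(i := y)) j - ((S2 (w, x))(i := S1 (w, x) y)) j)\<^sup>2) = c2 (w, x)"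
            unfolding c2_def using iI by (intro sum.cong) auto
          then show ?thesis using I iI by (simp add: Sx[OF x])
        qed
        then show "ennreal (k (w, x(i := y))) * ennreal (\<Sum>j\<in>insert i I. ((x(i := y)) j - S (w, x(i := y)) j)\<^sup>2)
          = ennreal (k' (w, x) y) * (ennreal (c2 (w, x)) + ennreal ((y - S1 (w, x) y)\<^sup>2))"
          using c20[of "(w, x)"] by (simp add: k'_def ennreal_plus[symmetric] add.commute del: ennreal_plus)
      qed
      also have "\<dots> \<le> (\<integral>\<^sup>+x. ennreal (a (w, x)) * ennreal (c2 (w, x)) + ennreal (2 * v) * (ennreal (a (w, x)) * E\<kappa> (w, x)) \<partial>gaussI v I)"
      proof (rule nn_integral_mono_AE, use Afin[OF w] AE_space in eventually_elim)
        case (elim x)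
        have wx: "(w, x) \<in> space (P \<Otimes>\<^sub>M ?B I)" using w elim(2) by (auto simp: space_pair_measure sp)
        note [measurable] = k'w[OF wx]
        have S1w[measurable]: "S1 (w, x) \<in> borel_measurable borel"
          using measurable_compose[OF measurable_Pair1'[OF wx(1)] S1m] by simp
        have "(\<integral>\<^sup>+y. ennreal (k' (w, x) y) * (ennreal (c2 (w, x)) + ennreal ((y - S1 (w, x) y)\<^sup>2)) \<partial>gauss1 v)
          = ennreal (a (w, x)) * (\<integral>\<^sup>+y. ennreal (\<kappa> (w, x) y) * (ennreal (c2 (w, x)) + ennreal ((y - S1 (w, x) y)\<^sup>2)) \<partial>gauss1 v)"
          by (rule k'\<kappa>[OF w elim(2,1)]) simp
        also have "(\<integral>\<^sup>+y. ennreal (\<kappa> (w, x) y) * (ennreal (c2 (w, x)) + ennreal ((y - S1 (w, x) y)\<^sup>2)) \<partial>gauss1 v)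
          = (\<integral>\<^sup>+y. ennreal (\<kappa> (w, x) y) * ennreal (c2 (w, x)) \<partial>gauss1 v) + (\<integral>\<^sup>+y. ennreal (\<kappa> (w, x) y) * ennreal ((y - S1 (w, x) y)\<^sup>2) \<partial>gauss1 v)"
          unfolding distrib_left by (intro nn_integral_add) auto
        also have "(\<integral>\<^sup>+y. ennreal (\<kappa> (w, x) y) * ennreal (c2 (w, x)) \<partial>gauss1 v) = ennreal (c2 (w, x))"
          using \<kappa>1[OF wx] by (subst nn_integral_multc) auto
        also have "(\<integral>\<^sup>+y. ennreal (\<kappa> (w, x) y) * ennreal ((y - S1 (w, x) y)\<^sup>2) \<partial>gauss1 v) \<le> ennreal (2 * v) * E\<kappa> (w, x)"
        proof -
          have "(\<integral>\<^sup>+y. ennreal (\<kappa> (w, x) y) * ennreal ((y - S1 (w, x) y)\<^sup>2) \<partial>gauss1 v) = (\<integral>\<^sup>+y. ennreal ((y - S1 (w, x) y)\<^sup>2) \<partial>tilt v (\<kappa> (w, x)))"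
            by (subst nn_integral_density) auto
          then show ?thesis unfolding S1_def E\<kappa>_def using talagrand_1[OF v k'w(2)[OF wx] \<kappa>0 \<kappa>1[OF wx]] by simp
        qed
        finally show ?case by (simp add: distrib_left mult.left_commute mult_left_mono)
      qed
      also have "\<dots> = (\<integral>\<^sup>+x. ennreal (a (w, x)) * ennreal (c2 (w, x)) \<partial>gaussI v I) + ennreal (2 * v) *
         (\<integral>\<^sup>+x. ennreal (a (w, x)) * E\<kappa> (w, x) \<partial>gaussI v I)"
      proof -
        have m1: "(\<lambda>w. ennreal (a w) * ennreal (c2 w)) \<in> borel_measurable (P \<Otimes>\<^sub>M ?B I)" by measurable
        have m2: "(\<lambda>w. ennreal (a w) * E\<kappa> w) \<in> borel_measurable (P \<Otimes>\<^sub>M ?B I)" by measurable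
        show ?thesis
          using measurable_compose[OF measurable_Pair1'[OF w] m1] measurable_compose[OF measurable_Pair1'[OF w] m2]
          by (subst nn_integral_add) (auto simp: measurable_cong_sets[OF sB refl] nn_integral_cmult)
      qed
      finally show ?thesis .
    qed
    \<comment> \<open>Chain rule: the entropy of the joint density is that of the marginal plus the
      mean of the conditional ones. Hence the bounds for the two stages add up with the same factor
      \<open>2 * v\<close>.\<close>
    have chain: "(\<integral>\<^sup>+x. ennreal (ent (a (w, x))) \<partial>gaussI v I) + (\<integral>\<^sup>+x. ennreal (a (w, x)) * E\<kappa> (w, x) \<partial>gaussI v I)
      = (\<integral>\<^sup>+y. ennreal (ent (k (w, y))) \<partial>gaussI v (insert i I))" if w: "w \<in> space P" for w
    proof -
      have m1: "(\<lambda>w. ennreal (ent (a w))) \<in> borel_measurable (P \<Otimes>\<^sub>M ?B I)" by measurable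
      have m2: "(\<lambda>w. ennreal (a w) * E\<kappa> w) \<in> borel_measurable (P \<Otimes>\<^sub>M ?B I)" by measurable
      have "(\<integral>\<^sup>+x. ennreal (ent (a (w, x))) \<partial>gaussI v I) + (\<integral>\<^sup>+x. ennreal (a (w, x)) * E\<kappa> (w, x) \<partial>gaussI v I)
        = (\<integral>\<^sup>+x. ennreal (ent (a (w, x))) + ennreal (a (w, x)) * E\<kappa> (w, x) \<partial>gaussI v I)"
        using measurable_compose[OF measurable_Pair1'[OF w] m1] measurable_compose[OF measurable_Pair1'[OF w] m2]
        by (subst nn_integral_add) (auto simp: measurable_cong_sets[OF sB refl])
      also have "\<dots> = (\<integral>\<^sup>+x. \<integral>\<^sup>+y. ennreal (ent (k' (w, x) y)) \<partial>gauss1 v \<partial>gaussI v I)"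
      proof (rule nn_integral_cong_AE, use Afin[OF w] AE_space in eventually_elim)
        case (elim x)
        have wx: "(w, x) \<in> space (P \<Otimes>\<^sub>M ?B I)" using w elim(2) by (auto simp: space_pair_measure sp)
        have km': "k' (w, x) \<in> borel_measurable (gauss1 v)" using k'w[OF wx] by simp
        show ?case
        proof (cases "a (w, x) > 0")
          case True
          have "ennreal (a (w, x)) * (\<integral>\<^sup>+y. ennreal (ent (k' (w, x) y / a (w, x))) \<partial>gauss1 v) + ennreal (ent (a (w, x)))
            = (\<integral>\<^sup>+y. ennreal (ent (k' (w, x) y)) \<partial>gauss1 v)"
            by (rule ent_chain[OF G.prob_space_axioms km' k'0 _ True]) (use Apos[OF True] in \<open>simp add: A_def\<close>)
          then show ?thesis using True by (simp add: E\<kappa>_def \<kappa>_def add.commute)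
        next
          case False
          then have a: "a (w, x) = 0" using a0[of "(w, x)"] by simp
          then have "A (w, x) = 0" using elim by (auto simp: a_def enn2real_eq_0_iff)
          then have "AE y in gauss1 v. ennreal (k' (w, x) y) = 0"
            using km' unfolding A_def by (subst (asm) nn_integral_0_iff_AE) auto
          then have "AE y in gauss1 v. ennreal (ent (k' (w, x) y)) = 1"
          proof eventually_elim
            case (elim y)
            then have "k' (w, x) y = 0" using k'0[of "(w, x)" y] by (simp add: ennreal_eq_0_iff)
            then show ?case by (simp add: ent_def)
          qed
          then have "(\<integral>\<^sup>+y. ennreal (ent (k' (w, x) y)) \<partial>gauss1 v) = (\<integral>\<^sup>+y. 1 \<partial>gauss1 v)" by (rule nn_integral_cong_AE)
          then show ?thesis using a G.emeasure_space_1 by (simp add: ent_def)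
        qed
      qed
      also have "\<dots> = (\<integral>\<^sup>+y. ennreal (ent (k (w, y))) \<partial>gaussI v (insert i I))"
        using kw[OF w] by (subst split) (auto simp: k'_def)
      finally show ?thesis .
    qed
    have mA: "(\<lambda>w. \<integral>\<^sup>+x. ennreal (a (w, x)) * ennreal (c2 (w, x)) \<partial>gaussI v I) \<in> borel_measurable P" by measurable
    have mB: "(\<lambda>w. \<integral>\<^sup>+x. ennreal (a (w, x)) * E\<kappa> (w, x) \<partial>gaussI v I) \<in> borel_measurable P" by measurable
    have mC: "(\<lambda>w. \<integral>\<^sup>+x. ennreal (ent (a (w, x))) \<partial>gaussI v I) \<in> borel_measurable P" by measurable
    have "(\<integral>\<^sup>+w. \<integral>\<^sup>+y. ennreal (k (w, y)) * ennreal (\<Sum>i\<in>insert i I. (y i - S (w, y) i)\<^sup>2) \<partial>gaussI v (insert i I) \<partial>P)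
      \<le> (\<integral>\<^sup>+w. (\<integral>\<^sup>+x. ennreal (a (w, x)) * ennreal (c2 (w, x)) \<partial>gaussI v I) + ennreal (2 * v) *
         (\<integral>\<^sup>+x. ennreal (a (w, x)) * E\<kappa> (w, x) \<partial>gaussI v I) \<partial>P)"
      by (intro nn_integral_mono point)
    also have "\<dots> = (\<integral>\<^sup>+w. \<integral>\<^sup>+x. ennreal (a (w, x)) * ennreal (c2 (w, x)) \<partial>gaussI v I \<partial>P) + ennreal (2 * v) *
         (\<integral>\<^sup>+w. \<integral>\<^sup>+x. ennreal (a (w, x)) * E\<kappa> (w, x) \<partial>gaussI v I \<partial>P)"
      using mA mB by (subst nn_integral_add) (auto simp: nn_integral_cmult)
    also have "\<dots> \<le> ennreal (2 * v) * (\<integral>\<^sup>+w. \<integral>\<^sup>+y. ennreal (ent (a (w, y))) \<partial>gaussI v I \<partial>P) + ennreal (2 * v) *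
         (\<integral>\<^sup>+w. \<integral>\<^sup>+x. ennreal (a (w, x)) * E\<kappa> (w, x) \<partial>gaussI v I \<partial>P)"
      using S2cost by (intro add_right_mono) (simp add: c2_def)
    also have "\<dots> = ennreal (2 * v) * (\<integral>\<^sup>+w. (\<integral>\<^sup>+x. ennreal (ent (a (w, x))) \<partial>gaussI v I) + (\<integral>\<^sup>+x. ennreal (a (w, x)) * E\<kappa> (w, x) \<partial>gaussI v I) \<partial>P)"
      using mB mC by (subst nn_integral_add) (auto simp: distrib_left)
    also have "\<dots> = ennreal (2 * v) * (\<integral>\<^sup>+w. \<integral>\<^sup>+y. ennreal (ent (k (w, y))) \<partial>gaussI v (insert i I) \<partial>P)"
      by (intro arg_cong[where f="\<lambda>x. ennreal (2 * v) * x"] nn_integral_cong chain)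
    finally show "(\<integral>\<^sup>+w. \<integral>\<^sup>+y. ennreal (k (w, y)) * ennreal (\<Sum>i\<in>insert i I. (y i - S (w, y) i)\<^sup>2) \<partial>gaussI v (insert i I) \<partial>P)
      \<le> ennreal (2 * v) * (\<integral>\<^sup>+w. \<integral>\<^sup>+y. ennreal (ent (k (w, y))) \<partial>gaussI v (insert i I) \<partial>P)" .
  qed
qed

section \<open>The heat kernel as an image of a product Gaussian\<close>

definition heat_density :: "real \<Rightarrow> 'a::euclidean_space \<Rightarrow> real" where
  "heat_density v x = (2 * pi * v) powr (- real DIM('a) / 2) * exp (- (norm x)\<^sup>2 / (2 * v))"

lemma heat_kernel_density: "v > 0 \<Longrightarrow> heat_kernel v = density lborel (\<lambda>x. ennreal (heat_density v x))"
  by (simp add: heat_kernel_def heat_density_def)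

lemma heat_density_measurable[measurable]: "heat_density v \<in> borel_measurable borel"
  unfolding heat_density_def[abs_def] by measurable

lemma nn_integral_heat_kernel:
  assumes "v > 0" "f \<in> borel_measurable borel"
  shows "(\<integral>\<^sup>+z. f z \<partial>heat_kernel v) = (\<integral>\<^sup>+z. ennreal (heat_density v z) * f z \<partial>lborel)"
  unfolding heat_kernel_density[OF assms(1)] by (rule nn_integral_density) (use assms in auto)

lemma heat_density_pos: "v > 0 \<Longrightarrow> 0 < heat_density v x"
  by (simp add: heat_density_def)

lemma heat_density_minus: "heat_density v (- x) = heat_density v x"
  by (simp add: heat_density_def)

lemma heat_density_prod:
  assumes "v > 0"
  shows "heat_density v (x::'a::euclidean_space) = (\<Prod>b\<in>Basis. normal_density 0 (sqrt v) (x \<bullet> b))"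
proof -
  have "(norm x)\<^sup>2 = (\<Sum>b\<in>Basis. (x \<bullet> b)\<^sup>2)"
    by (subst power2_norm_eq_inner, subst euclidean_inner) (simp add: power2_eq_square)
  then have e1: "exp (- (norm x)\<^sup>2 / (2 * v)) = (\<Prod>b\<in>(Basis::'a set). exp (- (x \<bullet> b)\<^sup>2 / (2 * v)))"
    by (simp add: exp_sum[symmetric] sum_divide_distrib sum_negf)
  have e2: "(2 * pi * v) powr (- real DIM('a) / 2) = (\<Prod>b\<in>(Basis::'a set). 1 / sqrt (2 * pi * v))"
  proof -
    have p: "2 * pi * v > 0" using assms by simp
    have "(\<Prod>b\<in>(Basis::'a set). 1 / sqrt (2 * pi * v)) = (1 / sqrt (2 * pi * v)) ^ DIM('a)" by simp
    also have "\<dots> = ((2 * pi * v) powr (- 1 / 2)) ^ DIM('a)"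
      using p by (simp add: powr_half_sqrt powr_minus_divide)
    also have "\<dots> = ((2 * pi * v) powr (- 1 / 2)) powr (real DIM('a))"
      using p by (subst powr_realpow) auto
    also have "\<dots> = (2 * pi * v) powr (- real DIM('a) / 2)" by (simp add: powr_powr)
    finally show ?thesis ..
  qed
  show ?thesis
    unfolding heat_density_def normal_density_sqrt[OF assms] e1 e2 prod.distrib[symmetric]
    by (intro prod.cong) auto
qed

definition of_coords :: "('a \<Rightarrow> real) \<Rightarrow> 'a::euclidean_space" where
  "of_coords f = (\<Sum>b\<in>Basis. f b *\<^sub>R b)"

lemma of_coords_inner: "b \<in> Basis \<Longrightarrow> of_coords f \<bullet> b = f b"
  by (simp add: of_coords_def)

lemma of_coords_measurable[measurable]: "of_coords \<in> measurable (PiM Basis (\<lambda>_. borel)) borel"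
  unfolding of_coords_def[abs_def] by measurable

lemma sets_gaussI: "sets (gaussI v I) = sets (PiM I (\<lambda>_. borel))"
  by (rule sets_PiM_cong) auto

lemma prob_space_gaussI: "v > 0 \<Longrightarrow> prob_space (gaussI v I)"
  by (intro prob_space_PiM real_distribution.axioms(1) real_distribution_gauss1)

text \<open>On boxes both sides factor over the coordinates. This carries the result for products
  over to Euclidean space.\<close>

lemma heat_kernel_eq_distr:
  assumes v: "v > 0"
  shows "heat_kernel v = distr (gaussI v (Basis :: 'a::euclidean_space set)) borel of_coords"
proof (rule measure_eqI_generator_eq)
  interpret G: real_distribution "gauss1 v" by (rule real_distribution_gauss1[OF v])
  interpret Pr: product_sigma_finite "\<lambda>_::'a. gauss1 v" by (rule product_sigma_finite.intro) unfold_locales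
  interpret GI: prob_space "gaussI v (Basis :: 'a set)" by (rule prob_space_gaussI[OF v])
  let ?E = "range (\<lambda>(a, b). box a b::'a set)"
  let ?D = "distr (gaussI v (Basis :: 'a set)) borel of_coords"
  have mc: "of_coords \<in> measurable (gaussI v (Basis :: 'a set)) borel"
    using of_coords_measurable measurable_cong_sets[OF sets_gaussI refl] by blast
  show "Int_stable ?E" by (auto simp: Int_stable_def box_Int_box)
  show "?E \<subseteq> Pow UNIV" "sets (heat_kernel v) = sigma_sets UNIV ?E" "sets ?D = sigma_sets UNIV ?E"
    by (simp_all add: borel_eq_box heat_kernel_density[OF v])
  let ?A = "\<lambda>n::nat. box (- (real n *\<^sub>R One)) (real n *\<^sub>R One) :: 'a set"
  show "range ?A \<subseteq> ?E" "(\<Union>i. ?A i) = UNIV" unfolding UN_box_eq_UNIV by auto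
  have box: "emeasure (heat_kernel v) (box l u) = (\<Prod>b\<in>Basis. emeasure (gauss1 v) {l \<bullet> b<..<u \<bullet> b})" for l u :: 'a
  proof -
    have "emeasure (heat_kernel v) (box l u) = (\<integral>\<^sup>+x. ennreal (heat_density v x) * indicator (box l u) x \<partial>lborel)"
      by (simp add: heat_kernel_density[OF v] emeasure_density)
    also have "\<dots> = (\<integral>\<^sup>+x. (\<Prod>b\<in>Basis. ennreal (normal_density 0 (sqrt v) (x \<bullet> b)) * indicator {l \<bullet> b<..<u \<bullet> b} (x \<bullet> b)) \<partial>lborel)"
    proof (rule nn_integral_cong)
      fix x :: 'a
      have "(indicator (box l u) x :: ennreal) = (\<Prod>b\<in>Basis. indicator {l \<bullet> b<..<u \<bullet> b} (x \<bullet> b))"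
        by (auto simp: indicator_def box_def prod_zero_iff)
      then show "ennreal (heat_density v x) * indicator (box l u) x = (\<Prod>b\<in>Basis. ennreal (normal_density 0 (sqrt v) (x \<bullet> b)) * indicator {l \<bullet> b<..<u \<bullet> b} (x \<bullet> b))"
        by (simp add: heat_density_prod[OF v] prod.distrib prod_ennreal)
    qed
    also have "\<dots> = (\<Prod>b\<in>Basis. \<integral>\<^sup>+x. ennreal (normal_density 0 (sqrt v) x) * indicator {l \<bullet> b<..<u \<bullet> b} x \<partial>lborel)"
      by (rule nn_integral_lborel_prod[where f="\<lambda>b x. ennreal (normal_density 0 (sqrt v) x) * indicator {l \<bullet> b<..<u \<bullet> b} x"]) auto
    also have "\<dots> = (\<Prod>b\<in>Basis. emeasure (gauss1 v) {l \<bullet> b<..<u \<bullet> b})"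
      by (intro prod.cong) (auto simp: emeasure_density)
    finally show ?thesis .
  qed
  show "emeasure (heat_kernel v) (?A i) \<noteq> \<infinity>" for i
    unfolding box G.emeasure_eq_measure by (simp add: prod_ennreal ennreal_power)
  fix X assume "X \<in> ?E"
  then obtain l u where X: "X = box l u" by auto
  have "of_coords -` box l u \<inter> space (gaussI v Basis) = PiE Basis (\<lambda>b. {l \<bullet> b<..<u \<bullet> b})"
    by (auto simp: space_PiM box_def of_coords_inner PiE_iff)
  then have "emeasure ?D X = emeasure (gaussI v Basis) (PiE Basis (\<lambda>b. {l \<bullet> b<..<u \<bullet> b}))"
    unfolding X by (subst emeasure_distr[OF mc]) auto
  also have "\<dots> = (\<Prod>b\<in>Basis. emeasure (gauss1 v) {l \<bullet> b<..<u \<bullet> b})"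
    by (rule Pr.emeasure_PiM) auto
  finally show "emeasure (heat_kernel v) X = emeasure ?D X" unfolding X box ..
qed

lemma prob_space_heat_kernel: "prob_space (heat_kernel v :: 'a::euclidean_space measure)" if "v > 0"
proof -
  have "of_coords \<in> measurable (gaussI v (Basis :: 'a set)) borel"
    using of_coords_measurable measurable_cong_sets[OF sets_gaussI refl] by blast
  then show ?thesis
    unfolding heat_kernel_eq_distr[OF that]
    by (intro prob_space.prob_space_distr prob_space_gaussI that)
qed

lemma sets_heat_kernel[simp, measurable_cong]: "v > 0 \<Longrightarrow> sets (heat_kernel v) = sets borel"
  by (simp add: heat_kernel_density)

text \<open>Here \<open>k (x, z)\<close> is the density of the noise added to \<open>x\<close>,
  relative to the Gaussian. Rearranging the noise for each \<open>x\<close> separately couples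
  \<open>x + z\<close> with \<open>x + S (x, z)\<close>; the starting point drops out of the cost,
  and what remains is the mean of the conditional entropies.\<close>

proposition talagrand:
  fixes \<mu> :: "'a::euclidean_space measure" and k :: "'a \<times> 'a \<Rightarrow> real"
  assumes \<mu>: "prob_space \<mu>" "sets \<mu> = sets borel" and v: "v > 0"
    and k: "k \<in> borel_measurable borel" "\<And>x z. 0 \<le> k (x, z)"
    and k1: "\<And>x. (\<integral>\<^sup>+z. ennreal (k (x, z)) \<partial>heat_kernel v) = 1"
  shows "W2_squared (distr (density (\<mu> \<Otimes>\<^sub>M heat_kernel v) (\<lambda>p. ennreal (k p))) borel (\<lambda>(x, z). x + z))
      (distr (\<mu> \<Otimes>\<^sub>M heat_kernel v) borel (\<lambda>(x, z). x + z))
    \<le> ennreal (2 * v) * (\<integral>\<^sup>+x. \<integral>\<^sup>+z. ennreal (ent (k (x, z))) \<partial>heat_kernel v \<partial>\<mu>)"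
    (is "W2_squared ?\<rho> ?\<nu> \<le> _")
proof -
  interpret M: prob_space \<mu> by fact
  interpret H: prob_space "heat_kernel v :: 'a measure" by (rule prob_space_heat_kernel[OF v])
  let ?G = "gaussI v (Basis :: 'a set)"
  let ?B = "PiM Basis (\<lambda>_. borel) :: ('a \<Rightarrow> real) measure"
  interpret GI: prob_space ?G by (rule prob_space_gaussI[OF v])
  have [measurable_cong]: "sets \<mu> = sets borel" "sets ?G = sets ?B" by (fact, rule sets_gaussI)
  have sH[measurable_cong]: "sets (heat_kernel v :: 'a measure) = sets borel" using v by simp
  have km[measurable]: "k \<in> borel_measurable (borel \<Otimes>\<^sub>M borel)" using k(1) by (simp add: measurable_cong_sets[OF sets_borel_prod[symmetric] refl])
  have mc: "of_coords \<in> measurable ?G borel"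
    using of_coords_measurable measurable_cong_sets[OF sets_gaussI refl] by blast
  have heat: "(\<integral>\<^sup>+z. f z \<partial>heat_kernel v) = (\<integral>\<^sup>+y. f (of_coords y) \<partial>?G)" if "f \<in> borel_measurable borel" for f :: "'a \<Rightarrow> ennreal"
    unfolding heat_kernel_eq_distr[OF v] by (rule nn_integral_distr) (use mc that in auto)
  define kc where "kc = (\<lambda>(x :: 'a, y). k (x, of_coords y))"
  have kcm[measurable]: "kc \<in> borel_measurable (\<mu> \<Otimes>\<^sub>M ?B)" unfolding kc_def by measurable
  have kx: "(\<lambda>z. ennreal (k (x, z))) \<in> borel_measurable borel" "(\<lambda>z. ennreal (ent (k (x, z)))) \<in> borel_measurable borel" for x
    by measurable
  obtain S where Sm[measurable]: "S \<in> measurable (\<mu> \<Otimes>\<^sub>M ?B) ?B"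
    and law: "\<And>g. g \<in> borel_measurable (\<mu> \<Otimes>\<^sub>M ?B) \<Longrightarrow>
      (\<integral>\<^sup>+w. \<integral>\<^sup>+y. ennreal (kc (w, y)) * g (w, S (w, y)) \<partial>?G \<partial>\<mu>) = (\<integral>\<^sup>+w. \<integral>\<^sup>+z. g (w, z) \<partial>?G \<partial>\<mu>)"
    and cost: "(\<integral>\<^sup>+w. \<integral>\<^sup>+y. ennreal (kc (w, y)) * ennreal (\<Sum>i\<in>Basis. (y i - S (w, y) i)\<^sup>2) \<partial>?G \<partial>\<mu>)
      \<le> ennreal (2 * v) * (\<integral>\<^sup>+w. \<integral>\<^sup>+y. ennreal (ent (kc (w, y))) \<partial>?G \<partial>\<mu>)"
  proof -
    have "(\<integral>\<^sup>+y. ennreal (kc (w, y)) \<partial>?G) = 1" for w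
      using k1[of w] heat[OF kx(1)] by (simp add: kc_def)
    moreover have "0 \<le> kc (w, y)" for w y using k(2) by (simp add: kc_def)
    ultimately show thesis using talagrand_PiM[OF \<mu>(1) v finite_Basis kcm] that by blast
  qed
  define \<Gamma> where "\<Gamma> = density (\<mu> \<Otimes>\<^sub>M ?G) (\<lambda>p. ennreal (kc p))"
  define f where "f p = (fst p + of_coords (snd p) :: 'a, fst p + of_coords (S p))" for p :: "'a \<times> ('a \<Rightarrow> real)"
  have fm[measurable]: "f \<in> measurable (\<mu> \<Otimes>\<^sub>M ?B) (borel \<Otimes>\<^sub>M borel)" unfolding f_def by measurable
  have fm': "f \<in> measurable \<Gamma> borel"
  proof -
    have "sets \<Gamma> = sets (\<mu> \<Otimes>\<^sub>M ?B)" unfolding \<Gamma>_def sets_density by (intro sets_pair_measure_cong sets_gaussI refl)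
    then show ?thesis using fm by (simp add: measurable_cong_sets[OF _ sets_borel_prod])
  qed
  define \<gamma> where "\<gamma> = distr \<Gamma> borel f"
  have nn: "(\<integral>\<^sup>+p. h p \<partial>\<Gamma>) = (\<integral>\<^sup>+w. \<integral>\<^sup>+y. ennreal (kc (w, y)) * h (w, y) \<partial>?G \<partial>\<mu>)"
    if h[measurable]: "h \<in> borel_measurable (\<mu> \<Otimes>\<^sub>M ?B)" for h
    unfolding \<Gamma>_def by (subst nn_integral_density, measurable, subst GI.nn_integral_fst[symmetric]) auto
  have c1: "distr \<gamma> borel fst = ?\<rho>"
  proof (rule measure_eqI)
    fix A assume "A \<in> sets (distr \<gamma> borel fst)"
    then have A[measurable]: "A \<in> sets borel" by simp
    have "emeasure (distr \<gamma> borel fst) A = (\<integral>\<^sup>+p. indicator A (fst (f p)) \<partial>\<Gamma>)"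
      unfolding \<gamma>_def
      by (subst nn_integral_indicator[symmetric], simp, subst nn_integral_distr, simp_all add: measurable_borel_prod,
          subst nn_integral_distr[OF fm']) (use measurable_borel_prod[OF refl] in \<open>auto intro: measurable_compose\<close>)
    also have "\<dots> = (\<integral>\<^sup>+w. \<integral>\<^sup>+y. ennreal (kc (w, y)) * indicator A (w + of_coords y) \<partial>?G \<partial>\<mu>)"
      by (subst nn) (auto simp: f_def)
    also have "\<dots> = (\<integral>\<^sup>+w. \<integral>\<^sup>+z. ennreal (k (w, z)) * indicator A (w + z) \<partial>heat_kernel v \<partial>\<mu>)"
      by (subst heat) (auto simp: kc_def)
    also have "\<dots> = (\<integral>\<^sup>+p. ennreal (k p) * indicator A (fst p + snd p) \<partial>(\<mu> \<Otimes>\<^sub>M heat_kernel v))"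
      by (subst H.nn_integral_fst[symmetric]) auto
    also have "\<dots> = (\<integral>\<^sup>+p. indicator A (fst p + snd p) \<partial>density (\<mu> \<Otimes>\<^sub>M heat_kernel v) (\<lambda>p. ennreal (k p)))"
      by (subst nn_integral_density) auto
    also have "\<dots> = emeasure ?\<rho> A"
      by (subst nn_integral_indicator[symmetric], simp, subst nn_integral_distr) (auto simp: case_prod_unfold)
    finally show "emeasure (distr \<gamma> borel fst) A = emeasure ?\<rho> A" .
  qed simp
  have c2: "distr \<gamma> borel snd = ?\<nu>"
  proof (rule measure_eqI)
    fix A assume "A \<in> sets (distr \<gamma> borel snd)"
    then have A[measurable]: "A \<in> sets borel" by simp
    have gA: "(\<lambda>p. indicator A (fst p + of_coords (snd p)) :: ennreal) \<in> borel_measurable (\<mu> \<Otimes>\<^sub>M ?B)" by measurable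
    have "emeasure (distr \<gamma> borel snd) A = (\<integral>\<^sup>+p. indicator A (snd (f p)) \<partial>\<Gamma>)"
      unfolding \<gamma>_def
      by (subst nn_integral_indicator[symmetric], simp, subst nn_integral_distr, simp_all add: measurable_borel_prod,
          subst nn_integral_distr[OF fm']) (use measurable_borel_prod[OF refl] in \<open>auto intro: measurable_compose\<close>)
    also have "\<dots> = (\<integral>\<^sup>+w. \<integral>\<^sup>+y. ennreal (kc (w, y)) * indicator A (w + of_coords (S (w, y))) \<partial>?G \<partial>\<mu>)"
      by (subst nn) (auto simp: f_def)
    also have "\<dots> = (\<integral>\<^sup>+w. \<integral>\<^sup>+y. indicator A (w + of_coords y) \<partial>?G \<partial>\<mu>)"
      using law[OF gA] by simp
    also have "\<dots> = (\<integral>\<^sup>+w. \<integral>\<^sup>+z. indicator A (w + z) \<partial>heat_kernel v \<partial>\<mu>)"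
      by (subst heat) auto
    also have "\<dots> = (\<integral>\<^sup>+p. indicator A (fst p + snd p) \<partial>(\<mu> \<Otimes>\<^sub>M heat_kernel v))"
      by (subst H.nn_integral_fst[symmetric]) auto
    also have "\<dots> = emeasure ?\<nu> A"
      by (subst nn_integral_indicator[symmetric], simp, subst nn_integral_distr) (auto simp: case_prod_unfold)
    finally show "emeasure (distr \<gamma> borel snd) A = emeasure ?\<nu> A" .
  qed simp
  have "\<gamma> \<in> couplings ?\<rho> ?\<nu>" using c1 c2 by (simp add: couplings_def \<gamma>_def)
  then have "W2_squared ?\<rho> ?\<nu> \<le> transport_cost \<gamma>" unfolding W2_squared_def by (rule INF_lower)
  also have "\<dots> = (\<integral>\<^sup>+p. ennreal ((norm (of_coords (snd p) - of_coords (S p) :: 'a))\<^sup>2) \<partial>\<Gamma>)"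
    unfolding transport_cost_alt \<gamma>_def
    by (subst nn_integral_distr[OF fm']) (auto simp: f_def intro!: borel_measurable_continuous_onI continuous_intros measurable_compose[OF _ measurable_ennreal])
  also have "\<dots> = (\<integral>\<^sup>+w. \<integral>\<^sup>+y. ennreal (kc (w, y)) * ennreal ((norm (of_coords y - of_coords (S (w, y)) :: 'a))\<^sup>2) \<partial>?G \<partial>\<mu>)"
    by (subst nn) auto
  also have "\<dots> = (\<integral>\<^sup>+w. \<integral>\<^sup>+y. ennreal (kc (w, y)) * ennreal (\<Sum>i\<in>Basis. (y i - S (w, y) i)\<^sup>2) \<partial>?G \<partial>\<mu>)"
  proof -
    have "(norm (of_coords y - of_coords y' :: 'a))\<^sup>2 = (\<Sum>i\<in>Basis. (y i - y' i)\<^sup>2)" for y y' :: "'a \<Rightarrow> real"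
      by (subst power2_norm_eq_inner, subst euclidean_inner) (simp add: inner_diff_left of_coords_inner power2_eq_square)
    then show ?thesis by simp
  qed
  also have "\<dots> \<le> ennreal (2 * v) * (\<integral>\<^sup>+w. \<integral>\<^sup>+y. ennreal (ent (kc (w, y))) \<partial>?G \<partial>\<mu>)" by (rule cost)
  also have "\<dots> = ennreal (2 * v) * (\<integral>\<^sup>+x. \<integral>\<^sup>+z. ennreal (ent (k (x, z))) \<partial>heat_kernel v \<partial>\<mu>)"
    unfolding heat[OF kx(2)] by (simp add: kc_def)
  finally show ?thesis .
qed

section \<open>Measures of finite entropy\<close>

lemma nn_integral_heat_density: "v > 0 \<Longrightarrow> (\<integral>\<^sup>+x. ennreal (heat_density v (x::'a::euclidean_space)) \<partial>lborel) = 1"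
  using prob_space.emeasure_space_1[OF prob_space_heat_kernel[of v, where 'a='a]]
  by (simp add: heat_kernel_density emeasure_density)

lemma nn_integral_exp_norm_sq:
  assumes "a > 0"
  shows "(\<integral>\<^sup>+x. ennreal (exp (- a * (norm (x::'a::euclidean_space))\<^sup>2)) \<partial>lborel) = ennreal ((pi / a) powr (real DIM('a) / 2))"
proof -
  define v where "v = 1 / (2 * a)"
  have v: "v > 0" using assms by (simp add: v_def)
  have "exp (- a * (norm x)\<^sup>2) = (pi / a) powr (real DIM('a) / 2) * heat_density v x" for x :: 'a
  proof -
    have "pi / a = 2 * pi * v" by (simp add: v_def)
    moreover have "2 * pi * v > 0" using v by simp
    moreover have "- (norm x)\<^sup>2 / (2 * v) = - a * (norm x)\<^sup>2" by (simp add: v_def)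
    ultimately show ?thesis using v by (simp add: heat_density_def mult.assoc[symmetric] powr_add[symmetric])
  qed
  then have "(\<integral>\<^sup>+x. ennreal (exp (- a * (norm (x::'a))\<^sup>2)) \<partial>lborel) = (\<integral>\<^sup>+x. ennreal ((pi / a) powr (real DIM('a) / 2)) * ennreal (heat_density v (x::'a)) \<partial>lborel)"
    by (simp add: ennreal_mult'' less_imp_le[OF heat_density_pos[OF v]])
  also have "\<dots> = ennreal ((pi / a) powr (real DIM('a) / 2))"
    using nn_integral_heat_density[OF v, where 'a='a] by (simp add: nn_integral_cmult)
  finally show ?thesis .
qed

text \<open>With an explicit real density in place of the Radon-Nikodym derivative, and finiteness
  expressed as integrability, entropies can be added and subtracted as real numbers.\<close>

definition has_ent :: "'a::euclidean_space measure \<Rightarrow> ('a \<Rightarrow> real) \<Rightarrow> bool" where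
  "has_ent \<rho> r \<longleftrightarrow> r \<in> borel_measurable borel \<and> (\<forall>x. 0 \<le> r x) \<and>
    \<rho> = density lborel (\<lambda>x. ennreal (r x)) \<and> integrable lborel (\<lambda>x. r x * ln (r x))"

lemma has_entD:
  assumes "has_ent \<rho> r"
  shows "r \<in> borel_measurable borel" "0 \<le> r x" "\<rho> = density lborel (\<lambda>x. ennreal (r x))" "integrable lborel (\<lambda>x. r x * ln (r x))"
  using assms by (auto simp: has_ent_def)

lemma has_ent_ln:
  assumes "has_ent \<rho> r"
  shows "integrable \<rho> (\<lambda>x. ln (r x))" "(\<integral>x. ln (r x) \<partial>\<rho>) = (\<integral>x. r x * ln (r x) \<partial>lborel)" "AE x in \<rho>. r x > 0"
proof -
  note D = has_entD[OF assms]
  note [measurable] = D(1)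
  show "integrable \<rho> (\<lambda>x. ln (r x))"
    unfolding D(3) by (subst integrable_density) (use D in auto)
  show "(\<integral>x. ln (r x) \<partial>\<rho>) = (\<integral>x. r x * ln (r x) \<partial>lborel)"
    unfolding D(3) by (subst integral_density) (use D in auto)
  show "AE x in \<rho>. r x > 0"
    unfolding D(3) by (subst AE_density) (auto simp: ennreal_neg)
qed

lemma density_P2_moment:
  assumes "\<rho> \<in> P2" "\<rho> = density lborel (\<lambda>x. ennreal (r x))" "r \<in> borel_measurable borel" "\<And>x. 0 \<le> r x"
  shows "integrable lborel (\<lambda>x. r x * (norm x)\<^sup>2)" "(\<integral>x. r x * (norm x)\<^sup>2 \<partial>lborel) = second_moment \<rho>"
proof -
  show "integrable lborel (\<lambda>x. r x * (norm x)\<^sup>2)"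
    using P2D(3)[OF assms(1)] unfolding assms(2) by (subst (asm) integrable_density) (use assms in auto)
  show "(\<integral>x. r x * (norm x)\<^sup>2 \<partial>lborel) = second_moment \<rho>"
    unfolding second_moment_def assms(2) by (subst integral_density) (use assms in auto)
qed

text \<open>Young's inequality with \<open>b\<close> equal to minus \<open>a\<close> times the
  squared norm. A small \<open>a\<close> weakens the dependence on the second moment at the price of
  a large Gaussian integral; the a priori bounds exploit this freedom.\<close>

lemma entropy_neg_part:
  fixes \<rho> :: "'a::euclidean_space measure"
  assumes "\<rho> \<in> P2" "\<rho> = density lborel (\<lambda>x. ennreal (r x))" "r \<in> borel_measurable borel" "\<And>x. 0 \<le> r x" and a: "a > 0"
  shows "(\<integral>\<^sup>+x. ennreal (max 0 (- (r x * ln (r x)))) \<partial>lborel) \<le> ennreal (a * second_moment \<rho> + (pi / a) powr (real DIM('a) / 2))"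
proof -
  note m = density_P2_moment[OF assms(1,2,3,4)]
  have pt: "max 0 (- (r x * ln (r x))) \<le> a * (r x * (norm x)\<^sup>2) + exp (- a * (norm x)\<^sup>2)" for x
  proof -
    have "r x * (- a * (norm x)\<^sup>2) \<le> ent (r x) + exp (- a * (norm x)\<^sup>2) - 1" by (rule ent_Young[OF assms(4)])
    then have "- (r x * ln (r x)) \<le> a * (r x * (norm x)\<^sup>2) + exp (- a * (norm x)\<^sup>2)"
      using assms(4)[of x] by (simp add: ent_def algebra_simps)
    moreover have "0 \<le> a * (r x * (norm x)\<^sup>2) + exp (- a * (norm x)\<^sup>2)" using assms(4)[of x] a by (intro add_nonneg_nonneg) auto
    ultimately show ?thesis by simp
  qed
  have nn: "0 \<le> a * (r x * (norm x)\<^sup>2)" for x using assms(4)[of x] a by simp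
  have "(\<integral>\<^sup>+x. ennreal (max 0 (- (r x * ln (r x)))) \<partial>lborel) \<le> (\<integral>\<^sup>+x. ennreal (a * (r x * (norm x)\<^sup>2)) + ennreal (exp (- a * (norm x)\<^sup>2)) \<partial>lborel)"
  proof (rule nn_integral_mono)
    fix x :: 'a
    show "ennreal (max 0 (- (r x * ln (r x)))) \<le> ennreal (a * (r x * (norm x)\<^sup>2)) + ennreal (exp (- a * (norm x)\<^sup>2))"
      using ennreal_leI[OF pt[of x]] nn[of x] by (subst ennreal_plus[symmetric]) auto
  qed
  also have "\<dots> = (\<integral>\<^sup>+x. ennreal (a * (r x * (norm x)\<^sup>2)) \<partial>lborel) + (\<integral>\<^sup>+x. ennreal (exp (- a * (norm (x::'a))\<^sup>2)) \<partial>lborel)"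
    by (rule nn_integral_add) (use assms(3) in auto)
  also have "(\<integral>\<^sup>+x. ennreal (exp (- a * (norm (x::'a))\<^sup>2)) \<partial>lborel) = ennreal ((pi / a) powr (real DIM('a) / 2))"
    by (rule nn_integral_exp_norm_sq[OF a])
  also have "(\<integral>\<^sup>+x. ennreal (a * (r x * (norm x)\<^sup>2)) \<partial>lborel) = ennreal (a * second_moment \<rho>)"
    using m nn by (subst nn_integral_eq_integral) auto
  also have "ennreal (a * second_moment \<rho>) + ennreal ((pi / a) powr (real DIM('a) / 2)) = ennreal (a * second_moment \<rho> + (pi / a) powr (real DIM('a) / 2))"
    using a by (subst ennreal_plus) (auto simp: second_moment_def)
  finally show ?thesis .
qed

text \<open>Only the positive part has to be checked, as the second moment controls the negative
  one.\<close>

lemma has_entI: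
  fixes \<rho> :: "'a::euclidean_space measure"
  assumes "\<rho> \<in> P2" "\<rho> = density lborel (\<lambda>x. ennreal (r x))" and [measurable]: "r \<in> borel_measurable borel" and "\<And>x. 0 \<le> r x"
    and pos: "(\<integral>\<^sup>+x. ennreal (max 0 (r x * ln (r x))) \<partial>lborel) < \<infinity>"
  shows "has_ent \<rho> r"
proof -
  have "integrable lborel (\<lambda>x. r x * ln (r x))"
  proof (rule integrableI_bounded)
    have "(\<integral>\<^sup>+x. ennreal (norm (r x * ln (r x))) \<partial>lborel) =
      (\<integral>\<^sup>+x. ennreal (max 0 (r x * ln (r x))) + ennreal (max 0 (- (r x * ln (r x)))) \<partial>lborel)"
      by (intro nn_integral_cong) (auto simp: max_def ennreal_neg)
    also have "\<dots> = (\<integral>\<^sup>+x. ennreal (max 0 (r x * ln (r x))) \<partial>lborel) + (\<integral>\<^sup>+x. ennreal (max 0 (- (r x * ln (r x)))) \<partial>lborel)"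
      by (intro nn_integral_add) auto
    also have "\<dots> < \<infinity>"
      using pos entropy_neg_part[OF assms(1,2,3,4), of 1] by (auto simp: less_top[symmetric] top_unique)
    finally show "(\<integral>\<^sup>+x. ennreal (norm (r x * ln (r x))) \<partial>lborel) < \<infinity>" .
  qed measurable
  then show ?thesis using assms by (simp add: has_ent_def)
qed

lemma boltzmann_density:
  fixes \<rho> :: "'a::euclidean_space measure"
  assumes "\<rho> = density lborel (\<lambda>x. ennreal (r x))" and [measurable]: "r \<in> borel_measurable borel" and "\<And>x. 0 \<le> r x"
  shows "boltzmann_entropy \<rho> = enn2ereal (\<integral>\<^sup>+x. ennreal (max 0 (r x * ln (r x))) \<partial>lborel)
          - enn2ereal (\<integral>\<^sup>+x. ennreal (max 0 (- (r x * ln (r x)))) \<partial>lborel)"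
proof -
  have ac: "absolutely_continuous lborel \<rho>"
    unfolding assms(1) by (rule absolutely_continuousI_density) measurable
  have "AE x in lborel. ennreal (r x) = RN_deriv lborel \<rho> x"
    by (rule sigma_finite_measure.RN_deriv_unique[OF sigma_finite_lborel]) (simp_all add: assms(1))
  then have ae: "AE x in lborel. enn2real (RN_deriv lborel \<rho> x) = r x"
    by eventually_elim (metis assms(3) enn2real_ennreal)
  have "(\<integral>\<^sup>+x. ennreal (max 0 (enn2real (RN_deriv lborel \<rho> x) * ln (enn2real (RN_deriv lborel \<rho> x)))) \<partial>lborel) = (\<integral>\<^sup>+x. ennreal (max 0 (r x * ln (r x))) \<partial>lborel)"
    by (rule nn_integral_cong_AE, use ae in eventually_elim) simp
  moreover have "(\<integral>\<^sup>+x. ennreal (max 0 (- (enn2real (RN_deriv lborel \<rho> x) * ln (enn2real (RN_deriv lborel \<rho> x))))) \<partial>lborel) = (\<integral>\<^sup>+x. ennreal (max 0 (- (r x * ln (r x)))) \<partial>lborel)"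
    by (rule nn_integral_cong_AE, use ae in eventually_elim) simp
  ultimately show ?thesis using ac by (simp add: boltzmann_entropy_def Let_def)
qed

lemma boltzmann_has_ent:
  assumes "has_ent \<rho> r"
  shows "boltzmann_entropy \<rho> = ereal (\<integral>x. r x * ln (r x) \<partial>lborel)"
proof -
  note D = has_entD[OF assms]
  let ?f = "\<lambda>x. r x * ln (r x)"
  have p: "integrable lborel (\<lambda>x. max 0 (?f x))" "integrable lborel (\<lambda>x. max 0 (- ?f x))" using D(4) by auto
  have "(\<integral>\<^sup>+x. ennreal (max 0 (?f x)) \<partial>lborel) = ennreal (\<integral>x. max 0 (?f x) \<partial>lborel)"
    "(\<integral>\<^sup>+x. ennreal (max 0 (- ?f x)) \<partial>lborel) = ennreal (\<integral>x. max 0 (- ?f x) \<partial>lborel)"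
    by (rule nn_integral_eq_integral[OF p(1)], simp, rule nn_integral_eq_integral[OF p(2)], simp)
  then have "boltzmann_entropy \<rho> = ereal ((\<integral>x. max 0 (?f x) \<partial>lborel) - (\<integral>x. max 0 (- ?f x) \<partial>lborel))"
    using boltzmann_density[OF D(3,1,2)] by (simp add: enn2ereal_ennreal Bochner_Integration.integral_nonneg)
  also have "(\<integral>x. max 0 (?f x) \<partial>lborel) - (\<integral>x. max 0 (- ?f x) \<partial>lborel) = (\<integral>x. max 0 (?f x) - max 0 (- ?f x) \<partial>lborel)"
    using p by simp
  also have "\<dots> = (\<integral>x. ?f x \<partial>lborel)" by (intro Bochner_Integration.integral_cong) auto
  finally show ?thesis .
qed

lemma has_ent_exists:
  fixes \<rho> :: "'a::euclidean_space measure"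
  assumes \<rho>: "\<rho> \<in> P2" and fin: "boltzmann_entropy \<rho> < \<infinity>"
  obtains r where "has_ent \<rho> r"
proof -
  note D = P2D[OF \<rho>]
  interpret prob_space \<rho> by fact
  have ac: "absolutely_continuous lborel \<rho>" using fin by (auto simp: boltzmann_entropy_def split: if_splits)
  define r where "r x = enn2real (RN_deriv lborel \<rho> x)" for x
  have rm[measurable]: "r \<in> borel_measurable borel"
  proof -
    have "RN_deriv lborel \<rho> \<in> borel_measurable lborel" by simp
    then show ?thesis unfolding r_def[abs_def] by simp
  qed
  have "AE x in lborel. RN_deriv lborel \<rho> x \<noteq> \<infinity>"
    using sigma_finite_measure.RN_deriv_finite[OF sigma_finite_lborel sigma_finite_measure_axioms ac] D by simp
  then have "AE x in lborel. ennreal (r x) = RN_deriv lborel \<rho> x"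
    by eventually_elim (simp add: r_def less_top)
  then have "density lborel (\<lambda>x. ennreal (r x)) = density lborel (RN_deriv lborel \<rho>)"
    by (intro density_cong) auto
  also have "\<dots> = \<rho>" using sigma_finite_measure.density_RN_deriv[OF sigma_finite_lborel ac] D by simp
  finally have eq: "\<rho> = density lborel (\<lambda>x. ennreal (r x))" ..
  have r0: "0 \<le> r x" for x by (simp add: r_def)
  let ?n = "\<integral>\<^sup>+x. ennreal (max 0 (- (r x * ln (r x)))) \<partial>lborel"
  have "?n < \<infinity>"
    using entropy_neg_part[OF \<rho> eq rm r0, of 1] by (auto simp: less_top[symmetric] top_unique)
  then obtain c where c: "?n = ennreal c" "0 \<le> c" by (cases ?n) auto
  have "(\<integral>\<^sup>+x. ennreal (max 0 (r x * ln (r x))) \<partial>lborel) < \<infinity>"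
  proof (rule ccontr)
    assume "\<not> (\<integral>\<^sup>+x. ennreal (max 0 (r x * ln (r x))) \<partial>lborel) < \<infinity>"
    then have "(\<integral>\<^sup>+x. ennreal (max 0 (r x * ln (r x))) \<partial>lborel) = \<infinity>" by (simp add: less_top[symmetric])
    then have "boltzmann_entropy \<rho> = \<infinity>" using boltzmann_density[OF eq rm r0] c by (simp add: enn2ereal_ennreal)
    then show False using fin by simp
  qed
  then have "has_ent \<rho> r" by (rule has_entI[OF \<rho> eq rm r0])
  then show thesis by (rule that)
qed

lemma boltzmann_lower_bound:
  fixes \<rho> :: "'a::euclidean_space measure"
  assumes \<rho>: "\<rho> \<in> P2" and a: "a > 0"
  shows "ereal (- (a * second_moment \<rho>) - (pi / a) powr (real DIM('a) / 2)) \<le> boltzmann_entropy \<rho>"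
proof (cases "boltzmann_entropy \<rho> < \<infinity>")
  case True
  then obtain r where r: "has_ent \<rho> r" using has_ent_exists[OF \<rho>] by blast
  note D = has_entD[OF r]
  let ?f = "\<lambda>x. r x * ln (r x)"
  have "ennreal (\<integral>x. max 0 (- ?f x) \<partial>lborel) \<le> ennreal (a * second_moment \<rho> + (pi / a) powr (real DIM('a) / 2))"
    using entropy_neg_part[OF \<rho> D(3,1,2) a] D(4) by (subst (asm) nn_integral_eq_integral) auto
  then have "(\<integral>x. max 0 (- ?f x) \<partial>lborel) \<le> a * second_moment \<rho> + (pi / a) powr (real DIM('a) / 2)"
    using a by (subst (asm) ennreal_le_iff) (auto simp: second_moment_def)
  moreover have "(\<integral>x. - max 0 (- ?f x) \<partial>lborel) \<le> (\<integral>x. ?f x \<partial>lborel)"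
    using D(4) by (intro integral_mono) auto
  ultimately show ?thesis unfolding boltzmann_has_ent[OF r] using D(4) by simp
qed auto

section \<open>Marginals and exchange of coordinates\<close>

lemma density_marginal_AE:
  fixes g :: "'a::euclidean_space \<times> 'b::euclidean_space \<Rightarrow> real"
  assumes [measurable]: "g \<in> borel_measurable borel" "m \<in> borel_measurable borel" and g0: "\<And>p. 0 \<le> g p"
    and eq: "distr (density lborel (\<lambda>p. ennreal (g p))) borel fst = density lborel (\<lambda>x. ennreal (m x))"
  shows "AE x in lborel. (\<integral>\<^sup>+y. ennreal (g (x, y)) \<partial>lborel) = ennreal (m x)"
proof -
  have gm[measurable]: "g \<in> borel_measurable (borel \<Otimes>\<^sub>M borel)" using assms(1) by (simp add: measurable_cong_sets[OF sets_borel_prod[symmetric] refl])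
  have "density lborel (\<lambda>x. \<integral>\<^sup>+y. ennreal (g (x, y)) \<partial>lborel) = density lborel (\<lambda>x. ennreal (m x))"
  proof (rule measure_eqI)
    fix A assume "A \<in> sets (density lborel (\<lambda>x. \<integral>\<^sup>+y. ennreal (g (x, y)) \<partial>lborel))"
    then have A[measurable]: "A \<in> sets borel" by simp
    have fA: "fst -` A \<inter> space (density lborel (\<lambda>p. ennreal (g p))) = A \<times> (UNIV :: 'b set)" by auto
    have AU[measurable]: "A \<times> (UNIV :: 'b set) \<in> sets borel" by (auto simp: sets_borel_prod)
    have "emeasure (density lborel (\<lambda>x. ennreal (m x))) A = emeasure (density lborel (\<lambda>p. ennreal (g p))) (A \<times> (UNIV :: 'b set))"
      unfolding eq[symmetric] by (subst emeasure_distr) (auto simp: fA[simplified] measurable_borel_prod)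
    also have "\<dots> = (\<integral>\<^sup>+p. ennreal (g p) * indicator (A \<times> UNIV) p \<partial>(lborel \<Otimes>\<^sub>M lborel))"
      by (subst emeasure_density) (auto simp: lborel_prod)
    also have "\<dots> = (\<integral>\<^sup>+x. \<integral>\<^sup>+y. ennreal (g (x, y)) * indicator (A \<times> UNIV) (x, y) \<partial>lborel \<partial>lborel)"
      by (rule lborel.nn_integral_fst[symmetric]) (auto simp: sets_borel_prod[symmetric])
    also have "\<dots> = (\<integral>\<^sup>+x. (\<integral>\<^sup>+y. ennreal (g (x, y)) \<partial>lborel) * indicator A x \<partial>lborel)"
      by (intro nn_integral_cong) (auto simp: indicator_def)
    also have "\<dots> = emeasure (density lborel (\<lambda>x. \<integral>\<^sup>+y. ennreal (g (x, y)) \<partial>lborel)) A"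
      by (subst emeasure_density) auto
    finally show "emeasure (density lborel (\<lambda>x. \<integral>\<^sup>+y. ennreal (g (x, y)) \<partial>lborel)) A = emeasure (density lborel (\<lambda>x. ennreal (m x))) A" ..
  qed simp
  then show ?thesis by (subst (asm) sigma_finite_measure.density_unique_iff[OF sigma_finite_lborel]) auto
qed

lemma ln_heat_density:
  assumes "v > 0"
  shows "ln (heat_density v (x::'a::euclidean_space)) = - (real DIM('a) / 2) * ln (2 * pi * v) - (norm x)\<^sup>2 / (2 * v)"
proof -
  have "0 < (2 * pi * v) powr (- real DIM('a) / 2)" using assms by simp
  then show ?thesis using assms by (simp add: heat_density_def ln_mult ln_powr)
qed

lemma borel_pair_measurable: 
  "f \<in> borel_measurable borel \<longleftrightarrow> f \<in> borel_measurable (borel \<Otimes>\<^sub>M borel)"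
  for f :: "'a::second_countable_topology \<times> 'b::second_countable_topology \<Rightarrow> 'c::topological_space"
  by (simp add: measurable_cong_sets[OF sets_borel_prod refl])

lemma nn_integral_has_ent_pair:
  fixes g :: "'a::euclidean_space \<times> 'b::euclidean_space \<Rightarrow> real"
  assumes g: "has_ent \<gamma> g" and f: "f \<in> borel_measurable borel"
  shows "(\<integral>\<^sup>+p. f p \<partial>\<gamma>) = (\<integral>\<^sup>+x. \<integral>\<^sup>+y. ennreal (g (x, y)) * f (x, y) \<partial>lborel \<partial>lborel)"
proof -
  note D = has_entD[OF g]
  have [measurable]: "g \<in> borel_measurable (borel \<Otimes>\<^sub>M borel)" "f \<in> borel_measurable (borel \<Otimes>\<^sub>M borel)"
    using D(1) f by (simp_all add: borel_pair_measurable)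
  have "(\<integral>\<^sup>+p. f p \<partial>\<gamma>) = (\<integral>\<^sup>+p. ennreal (g p) * f p \<partial>lborel)"
    unfolding D(3) by (rule nn_integral_density) (use D f in auto)
  also have "\<dots> = (\<integral>\<^sup>+p. ennreal (g p) * f p \<partial>(lborel \<Otimes>\<^sub>M lborel))" by (simp add: lborel_prod)
  also have "\<dots> = (\<integral>\<^sup>+x. \<integral>\<^sup>+y. ennreal (g (x, y)) * f (x, y) \<partial>lborel \<partial>lborel)"
    by (rule lborel.nn_integral_fst[symmetric]) measurable
  finally show ?thesis .
qed

text \<open>The joint density is compared with \<open>m x * q y\<close>, where \<open>q\<close> is a
  Gaussian density: Young's inequality at \<open>b = ln (m x * q y)\<close>, integrated in
  \<open>y\<close>, bounds \<open>m * ln m\<close> by the joint entropy and the second moment,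
  because \<open>ln q\<close> grows quadratically.\<close>

lemma marginal_has_ent:
  fixes \<gamma> :: "('a::euclidean_space \<times> 'b::euclidean_space) measure"
  assumes \<gamma>: "\<gamma> \<in> P2" and g: "has_ent \<gamma> g"
  obtains m where "has_ent (distr \<gamma> borel fst) m"
proof -
  note D = has_entD[OF g]
  note PD = P2D[OF \<gamma>]
  have gm[measurable]: "g \<in> borel_measurable (borel \<Otimes>\<^sub>M borel)" using D(1) by (simp add: borel_pair_measurable)
  have bl: "bounded_linear (fst :: 'a \<times> 'b \<Rightarrow> 'a)" by (rule bounded_linear_fst)
  note mP = P2_linear(3)[OF \<gamma> bl]
  define M where "M x = (\<integral>\<^sup>+y. ennreal (g (x, y)) \<partial>lborel)" for x
  define m where "m x = enn2real (M x)" for x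
  have [measurable]: "M \<in> borel_measurable borel" unfolding M_def by measurable
  have mm[measurable]: "m \<in> borel_measurable borel" unfolding m_def by measurable
  have m0: "0 \<le> m x" for x by (simp add: m_def)
  have nn: "(\<integral>\<^sup>+p. f p \<partial>\<gamma>) = (\<integral>\<^sup>+x. \<integral>\<^sup>+y. ennreal (g (x, y)) * f (x, y) \<partial>lborel \<partial>lborel)"
    if f: "f \<in> borel_measurable (borel \<Otimes>\<^sub>M borel)" for f
    by (rule nn_integral_has_ent_pair[OF g]) (use f in \<open>simp add: borel_pair_measurable\<close>)
  have M1: "(\<integral>\<^sup>+x. M x \<partial>lborel) = 1"
    using nn[of "\<lambda>_. 1"] prob_space.emeasure_space_1[OF PD(2)] by (simp add: M_def)
  have "AE x in lborel. M x \<noteq> \<infinity>" by (rule nn_integral_PInf_AE) (simp_all add: M1)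
  then have Mm: "AE x in lborel. M x = ennreal (m x)" by eventually_elim (simp add: m_def less_top)
  have m1: "(\<integral>\<^sup>+x. ennreal (m x) \<partial>lborel) = 1"
    using nn_integral_cong_AE[OF Mm] M1 by simp
  have eq: "distr \<gamma> borel fst = density lborel (\<lambda>x. ennreal (m x))"
  proof (rule measure_eqI)
    fix A assume "A \<in> sets (distr \<gamma> borel fst)"
    then have A[measurable]: "A \<in> sets borel" by simp
    have "emeasure (distr \<gamma> borel fst) A = (\<integral>\<^sup>+p. indicator A (fst p) \<partial>\<gamma>)"
      by (subst nn_integral_indicator[symmetric], simp, subst nn_integral_distr) (use measurable_borel_prod[OF PD(1)] in auto)
    also have "\<dots> = (\<integral>\<^sup>+x. \<integral>\<^sup>+y. ennreal (g (x, y)) * indicator A x \<partial>lborel \<partial>lborel)" by (subst nn) auto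
    also have "\<dots> = (\<integral>\<^sup>+x. M x * indicator A x \<partial>lborel)" by (simp add: nn_integral_multc M_def)
    also have "\<dots> = (\<integral>\<^sup>+x. ennreal (m x) * indicator A x \<partial>lborel)"
      by (rule nn_integral_cong_AE, use Mm in eventually_elim) simp
    also have "\<dots> = emeasure (density lborel (\<lambda>x. ennreal (m x))) A" by (subst emeasure_density) auto
    finally show "emeasure (distr \<gamma> borel fst) A = emeasure (density lborel (\<lambda>x. ennreal (m x))) A" .
  qed simp
  define q :: "'b \<Rightarrow> real" where "q = heat_density 1"
  have q: "q \<in> borel_measurable borel" "\<And>y. q y > 0" "(\<integral>\<^sup>+y. ennreal (q y) \<partial>lborel) = 1"
    using heat_density_pos[of 1] nn_integral_heat_density[of 1] by (auto simp: q_def)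
  note [measurable] = q(1)
  define c where "c = \<bar>real DIM('b) / 2 * ln (2 * pi)\<bar>"
  have lq: "\<bar>ln (q y)\<bar> \<le> c + (norm y)\<^sup>2 / 2" for y
  proof -
    have "ln (q y) = - (real DIM('b) / 2) * ln (2 * pi) - (norm y)\<^sup>2 / 2"
      unfolding q_def by (subst ln_heat_density) auto
    moreover have "0 \<le> (norm y)\<^sup>2 / 2" by simp
    ultimately show ?thesis unfolding c_def by linarith
  qed
  have pt: "g (x, y) * ln (m x) \<le> \<bar>g (x, y) * ln (g (x, y))\<bar> + g (x, y) * (c + (norm y)\<^sup>2 / 2) + m x * q y"
    if "m x > 0" for x y
  proof -
    have "g (x, y) * ln (m x * q y) \<le> ent (g (x, y)) + exp (ln (m x * q y)) - 1" by (rule ent_Young[OF D(2)])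
    also have "exp (ln (m x * q y)) = m x * q y" using that q(2)[of y] by simp
    also have "ln (m x * q y) = ln (m x) + ln (q y)" using that q(2)[of y] by (simp add: ln_mult)
    finally have "g (x, y) * ln (m x) \<le> g (x, y) * ln (g (x, y)) - g (x, y) - g (x, y) * ln (q y) + m x * q y"
      by (simp add: ent_def algebra_simps)
    moreover have "- (g (x, y) * ln (q y)) \<le> g (x, y) * (c + (norm y)\<^sup>2 / 2)"
    proof -
      have "g (x, y) * - ln (q y) \<le> g (x, y) * (c + (norm y)\<^sup>2 / 2)" by (rule mult_left_mono) (use lq[of y] D(2) in auto)
      then show ?thesis by simp
    qed
    ultimately show ?thesis using D(2)[of "(x, y)"] by linarith
  qed
  have "(\<integral>\<^sup>+x. ennreal (max 0 (m x * ln (m x))) \<partial>lborel) \<le>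
    (\<integral>\<^sup>+x. (\<integral>\<^sup>+y. ennreal \<bar>g (x, y) * ln (g (x, y))\<bar> \<partial>lborel) + (\<integral>\<^sup>+y. ennreal (g (x, y)) * ennreal (c + (norm y)\<^sup>2 / 2) \<partial>lborel) + ennreal (m x) \<partial>lborel)"
  proof (rule nn_integral_mono_AE, use Mm in eventually_elim)
    case (elim x)
    show ?case
    \<comment> \<open>The positive part of \<open>m * ln m\<close> lives where
      \<open>m x > 1\<close>; there \<open>ln (m x)\<close> is nonnegative and can be carried
      through nonnegative integrals.\<close>
    proof (cases "m x > 1")
      case False
      then have "m x * ln (m x) \<le> 0" using m0[of x] by (cases "m x = 0") (auto simp: mult_nonneg_nonpos)
      then show ?thesis by (simp add: max_def)
    next
      case True
      then have ln0: "0 \<le> ln (m x)" by simp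
      have "ennreal (max 0 (m x * ln (m x))) = ennreal (m x) * ennreal (ln (m x))"
        using ln0 m0[of x] by (simp add: ennreal_mult max_def)
      also have "\<dots> = (\<integral>\<^sup>+y. ennreal (g (x, y)) * ennreal (ln (m x)) \<partial>lborel)"
        using elim by (subst nn_integral_multc) (auto simp: M_def)
      also have "\<dots> \<le> (\<integral>\<^sup>+y. ennreal \<bar>g (x, y) * ln (g (x, y))\<bar> + ennreal (g (x, y)) * ennreal (c + (norm y)\<^sup>2 / 2) + ennreal (m x) * ennreal (q y) \<partial>lborel)"
      proof (rule nn_integral_mono)
        fix y :: 'b
        have c0: "0 \<le> c + (norm y)\<^sup>2 / 2" by (simp add: c_def)
        have "ennreal (g (x, y)) * ennreal (ln (m x)) = ennreal (g (x, y) * ln (m x))" using ln0 by (simp add: ennreal_mult'' )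
        also have "\<dots> \<le> ennreal (\<bar>g (x, y) * ln (g (x, y))\<bar> + g (x, y) * (c + (norm y)\<^sup>2 / 2) + m x * q y)"
          using pt[of x y] True by (intro ennreal_leI) auto
        also have "\<dots> = ennreal \<bar>g (x, y) * ln (g (x, y))\<bar> + ennreal (g (x, y)) * ennreal (c + (norm y)\<^sup>2 / 2) + ennreal (m x) * ennreal (q y)"
          using D(2) m0 q(2)[of y] c0 by (simp add: ennreal_mult[symmetric] ennreal_plus[symmetric] less_imp_le del: ennreal_plus)
        finally show "ennreal (g (x, y)) * ennreal (ln (m x)) \<le> \<dots>" .
      qed
      also have "\<dots> = (\<integral>\<^sup>+y. ennreal \<bar>g (x, y) * ln (g (x, y))\<bar> \<partial>lborel) + (\<integral>\<^sup>+y. ennreal (g (x, y)) * ennreal (c + (norm y)\<^sup>2 / 2) \<partial>lborel) + ennreal (m x)"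
        using q(3) by (simp add: nn_integral_add nn_integral_cmult)
      finally show ?thesis .
    qed
  qed
  also have "\<dots> = (\<integral>\<^sup>+x. \<integral>\<^sup>+y. ennreal \<bar>g (x, y) * ln (g (x, y))\<bar> \<partial>lborel \<partial>lborel)
      + (\<integral>\<^sup>+x. \<integral>\<^sup>+y. ennreal (g (x, y)) * ennreal (c + (norm y)\<^sup>2 / 2) \<partial>lborel \<partial>lborel) + 1"
    using m1 by (simp add: nn_integral_add)
  also have "\<dots> < \<infinity>"
  proof -
    have "(\<integral>\<^sup>+x. \<integral>\<^sup>+y. ennreal \<bar>g (x, y) * ln (g (x, y))\<bar> \<partial>lborel \<partial>lborel) = (\<integral>\<^sup>+p. ennreal (norm (g p * ln (g p))) \<partial>(lborel \<Otimes>\<^sub>M lborel))"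
      by (subst lborel.nn_integral_fst[symmetric]) auto
    also have "\<dots> = (\<integral>\<^sup>+p. ennreal (norm (g p * ln (g p))) \<partial>lborel)" by (simp add: lborel_prod)
    also have "\<dots> < \<infinity>" using D(4) by (simp add: integrable_iff_bounded)
    finally have 1: "(\<integral>\<^sup>+x. \<integral>\<^sup>+y. ennreal \<bar>g (x, y) * ln (g (x, y))\<bar> \<partial>lborel \<partial>lborel) < \<infinity>" .
    have bl2: "bounded_linear (snd :: 'a \<times> 'b \<Rightarrow> 'b)" by (rule bounded_linear_snd)
    interpret G: prob_space \<gamma> by (rule PD(2))
    have "integrable \<gamma> (\<lambda>p. c + (norm (snd p))\<^sup>2 / 2)" using P2_linear(2)[OF \<gamma> bl2] by simp
    moreover have "norm (c + (norm y)\<^sup>2 / 2) = c + (norm y)\<^sup>2 / 2" for y :: 'b by (simp add: c_def)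
    ultimately have "(\<integral>\<^sup>+p. ennreal (c + (norm (snd p))\<^sup>2 / 2) \<partial>\<gamma>) < \<infinity>" by (simp add: integrable_iff_bounded)
    then have 2: "(\<integral>\<^sup>+x. \<integral>\<^sup>+y. ennreal (g (x, y)) * ennreal (c + (norm y)\<^sup>2 / 2) \<partial>lborel \<partial>lborel) < \<infinity>"
      by (subst (asm) nn) auto
    show ?thesis using 1 2 by (simp add: less_top[symmetric] ennreal_add_eq_top)
  qed
  finally have "has_ent (distr \<gamma> borel fst) m"
    by (intro has_entI[OF mP eq mm m0]) simp
  then show thesis by (rule that)
qed

lemma lborel_distr_swap:
  "distr lborel borel prod.swap = (lborel :: ('b::euclidean_space \<times> 'a::euclidean_space) measure)"
proof -
  have "lborel \<Otimes>\<^sub>M lborel = distr (lborel \<Otimes>\<^sub>M lborel) (lborel \<Otimes>\<^sub>M lborel) (\<lambda>(x::'a, y::'b). (y, x))"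
    by (rule pair_sigma_finite.distr_pair_swap[OF pair_sigma_finite.intro[OF sigma_finite_lborel sigma_finite_lborel]])
  also have "\<dots> = distr (lborel \<Otimes>\<^sub>M lborel) borel prod.swap"
    by (rule distr_cong) (auto simp: sets_borel_prod prod.swap_def)
  finally show ?thesis by (simp add: lborel_prod)
qed

lemma swap_measurable: "prod.swap \<in> measurable borel (borel :: ('b::euclidean_space \<times> 'a::euclidean_space) measure)"
  by (intro borel_measurable_continuous_onI) (auto simp: prod.swap_def intro!: continuous_intros)

lemma has_ent_swap:
  fixes \<gamma> :: "('a::euclidean_space \<times> 'b::euclidean_space) measure"
  assumes g: "has_ent \<gamma> g"
  shows "has_ent (distr \<gamma> borel prod.swap) (\<lambda>p. g (prod.swap p))"
    "boltzmann_entropy (distr \<gamma> borel prod.swap) = boltzmann_entropy \<gamma>"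
proof -
  note D = has_entD[OF g]
  note [measurable] = D(1)
  have s1[measurable]: "prod.swap \<in> measurable borel (borel :: ('b \<times> 'a) measure)"
    and s2[measurable]: "prod.swap \<in> measurable borel (borel :: ('a \<times> 'b) measure)" by (rule swap_measurable)+
  have gs[measurable]: "(\<lambda>p. g (prod.swap p)) \<in> borel_measurable borel" using measurable_compose[OF s2 D(1)] .
  have eq: "distr \<gamma> borel prod.swap = density lborel (\<lambda>p. ennreal (g (prod.swap p)))"
  proof (rule measure_eqI)
    fix A assume "A \<in> sets (distr \<gamma> borel prod.swap)"
    then have A[measurable]: "A \<in> sets borel" by simp
    have "emeasure (density lborel (\<lambda>p. ennreal (g (prod.swap p)))) A = (\<integral>\<^sup>+p. ennreal (g (prod.swap p)) * indicator A p \<partial>lborel)"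
      by (subst emeasure_density) auto
    also have "\<dots> = (\<integral>\<^sup>+p. ennreal (g (prod.swap p)) * indicator A p \<partial>distr lborel borel prod.swap)"
      unfolding lborel_distr_swap ..
    also have "\<dots> = (\<integral>\<^sup>+p. ennreal (g p) * indicator A (prod.swap p) \<partial>lborel)"
      by (subst nn_integral_distr) auto
    also have "\<dots> = (\<integral>\<^sup>+p. indicator A (prod.swap p) \<partial>\<gamma>)"
      unfolding D(3) by (subst nn_integral_density) auto
    also have "\<dots> = emeasure (distr \<gamma> borel prod.swap) A"
      by (subst nn_integral_indicator[symmetric], simp, subst nn_integral_distr) (auto simp: D(3))
    finally show "emeasure (distr \<gamma> borel prod.swap) A = emeasure (density lborel (\<lambda>p. ennreal (g (prod.swap p)))) A" ..
  qed simp
  have "integrable (distr lborel borel prod.swap) (\<lambda>p. g p * ln (g p))" unfolding lborel_distr_swap by (rule D(4))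
  then have i: "integrable lborel (\<lambda>p. g (prod.swap p) * ln (g (prod.swap p)))"
    by (subst (asm) integrable_distr_eq) auto
  show h: "has_ent (distr \<gamma> borel prod.swap) (\<lambda>p. g (prod.swap p))"
    unfolding has_ent_def using eq D(2) i by simp
  have "(\<integral>p. g p * ln (g p) \<partial>distr lborel borel prod.swap) = (\<integral>p. g (prod.swap p) * ln (g (prod.swap p)) \<partial>lborel)"
    by (subst integral_distr) auto
  then show "boltzmann_entropy (distr \<gamma> borel prod.swap) = boltzmann_entropy \<gamma>"
    unfolding boltzmann_has_ent[OF h] boltzmann_has_ent[OF g] lborel_distr_swap by simp
qed

section \<open>Product measures and Gaussian smearing\<close>

lemma P2_pair:
  fixes \<mu> :: "'a::euclidean_space measure" and \<nu> :: "'b::euclidean_space measure"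
  assumes "\<mu> \<in> P2" "\<nu> \<in> P2"
  shows "\<mu> \<Otimes>\<^sub>M \<nu> \<in> P2"
    "(\<integral>p. (norm (snd p))\<^sup>2 \<partial>(\<mu> \<Otimes>\<^sub>M \<nu>)) = second_moment \<nu>"
proof -
  note M = P2D[OF assms(1)] and N = P2D[OF assms(2)]
  interpret M: prob_space \<mu> by fact
  interpret N: prob_space \<nu> by fact
  interpret P: pair_prob_space \<mu> \<nu> ..
  have s: "sets (\<mu> \<Otimes>\<^sub>M \<nu>) = sets borel" using sets_pair_measure_cong[OF M(1) N(1)] by (simp add: sets_borel_prod)
  have [measurable_cong]: "sets \<mu> = sets borel" "sets \<nu> = sets borel" by fact+
  have 1: "integrable (\<mu> \<Otimes>\<^sub>M \<nu>) (\<lambda>p. (norm (fst p))\<^sup>2)"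
  proof (rule integrableI_bounded)
    have "(\<integral>\<^sup>+p. ennreal (norm ((norm (fst p))\<^sup>2)) \<partial>(\<mu> \<Otimes>\<^sub>M \<nu>)) = (\<integral>\<^sup>+x. ennreal (norm ((norm x)\<^sup>2)) \<partial>\<mu>)"
      by (subst N.nn_integral_fst[symmetric]) (auto simp: N.emeasure_space_1)
    then show "(\<integral>\<^sup>+p. ennreal (norm ((norm (fst p))\<^sup>2)) \<partial>(\<mu> \<Otimes>\<^sub>M \<nu>)) < \<infinity>" using M(3) by (simp add: integrable_iff_bounded)
  qed measurable
  have n2: "(\<integral>\<^sup>+p. ennreal ((norm (snd p))\<^sup>2) \<partial>(\<mu> \<Otimes>\<^sub>M \<nu>)) = (\<integral>\<^sup>+x. ennreal ((norm x)\<^sup>2) \<partial>\<nu>)"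
    by (subst N.nn_integral_fst[symmetric]) (auto simp: M.emeasure_space_1)
  have 2: "integrable (\<mu> \<Otimes>\<^sub>M \<nu>) (\<lambda>p. (norm (snd p))\<^sup>2)"
    by (rule integrableI_bounded) (use n2 N(3) in \<open>auto simp: integrable_iff_bounded\<close>)
  have "integrable (\<mu> \<Otimes>\<^sub>M \<nu>) (\<lambda>p. (norm (fst p))\<^sup>2 + (norm (snd p))\<^sup>2)" using 1 2 by simp
  then have "integrable (\<mu> \<Otimes>\<^sub>M \<nu>) (\<lambda>p. (norm p)\<^sup>2)" by (simp add: norm_prod_def)
  then show "\<mu> \<Otimes>\<^sub>M \<nu> \<in> P2" using s P.prob_space_axioms by (simp add: P2_def)
  show "(\<integral>p. (norm (snd p))\<^sup>2 \<partial>(\<mu> \<Otimes>\<^sub>M \<nu>)) = second_moment \<nu>"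
    unfolding second_moment_def by (simp add: integral_eq_nn_integral n2)
qed

lemma heat_kernel_moment:
  assumes v: "v > 0"
  shows "(heat_kernel v :: 'a::euclidean_space measure) \<in> P2"
    "second_moment (heat_kernel v :: 'a::euclidean_space measure) = v * real DIM('a)"
proof -
  interpret H: prob_space "heat_kernel v :: 'a measure" by (rule prob_space_heat_kernel[OF v])
  interpret G: real_distribution "gauss1 v" by (rule real_distribution_gauss1[OF v])
  interpret Pr: product_prob_space "\<lambda>_::'a. gauss1 v" Basis by (rule product_prob_spaceI) unfold_locales
  have mc: "of_coords \<in> measurable (gaussI v (Basis :: 'a set)) borel"
    using of_coords_measurable measurable_cong_sets[OF sets_gaussI refl] by blast
  have coord: "(\<integral>\<^sup>+y. ennreal ((y b)\<^sup>2) \<partial>gaussI v (Basis :: 'a set)) = ennreal v" if b: "b \<in> Basis" for b :: 'a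
  proof -
    have "(\<integral>\<^sup>+y. ennreal ((y b)\<^sup>2) \<partial>gaussI v (Basis :: 'a set)) = (\<integral>\<^sup>+z. ennreal (z\<^sup>2) \<partial>distr (gaussI v (Basis :: 'a set)) (gauss1 v) (\<lambda>y. y b))"
      using b by (subst nn_integral_distr) auto
    also have "distr (gaussI v (Basis :: 'a set)) (gauss1 v) (\<lambda>y. y b) = gauss1 v" by (rule Pr.PiM_component[OF b])
    also have "(\<integral>\<^sup>+z. ennreal (z\<^sup>2) \<partial>gauss1 v) = ennreal v"
      using gauss1_tail(3,4)[OF v] by (subst nn_integral_eq_integral) auto
    finally show ?thesis .
  qed
  have n: "(\<integral>\<^sup>+x. ennreal ((norm (x::'a))\<^sup>2) \<partial>heat_kernel v) = ennreal (v * real DIM('a))"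
  proof -
    have "(\<integral>\<^sup>+x. ennreal ((norm (x::'a))\<^sup>2) \<partial>heat_kernel v) = (\<integral>\<^sup>+y. ennreal ((norm (of_coords y :: 'a))\<^sup>2) \<partial>gaussI v Basis)"
      unfolding heat_kernel_eq_distr[OF v] by (rule nn_integral_distr) (use mc in auto)
    also have "\<dots> = (\<integral>\<^sup>+y. (\<Sum>b\<in>(Basis::'a set). ennreal ((y b)\<^sup>2)) \<partial>gaussI v Basis)"
    proof (rule nn_integral_cong)
      fix y :: "'a \<Rightarrow> real"
      have "(norm (of_coords y :: 'a))\<^sup>2 = (\<Sum>b\<in>Basis. (y b)\<^sup>2)"
        by (subst power2_norm_eq_inner, subst euclidean_inner) (simp add: of_coords_inner power2_eq_square)
      then show "ennreal ((norm (of_coords y :: 'a))\<^sup>2) = (\<Sum>b\<in>(Basis::'a set). ennreal ((y b)\<^sup>2))" by simp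
    qed
    also have "\<dots> = (\<Sum>b\<in>(Basis::'a set). ennreal v)" 
      using coord by (subst nn_integral_sum) auto
    also have "\<dots> = ennreal (v * real DIM('a))" using v by (simp add: ennreal_mult'' mult.commute ennreal_of_nat_eq_real_of_nat)
    finally show ?thesis .
  qed
  have "integrable (heat_kernel v) (\<lambda>x::'a. (norm x)\<^sup>2)"
    by (rule integrableI_bounded) (use n v in \<open>auto simp: measurable_cong_sets[OF sets_heat_kernel refl]\<close>)
  then show "(heat_kernel v :: 'a measure) \<in> P2" using v H.prob_space_axioms by (simp add: P2_def)
  show "second_moment (heat_kernel v :: 'a measure) = v * real DIM('a)"
    unfolding second_moment_def using n v by (subst integral_eq_nn_integral) (auto simp: measurable_cong_sets[OF sets_heat_kernel refl])
qed

text \<open>This is the convolution \<open>\<mu> \<star> heat_kernel v\<close>, spelled out as a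
  linear image of a product so that the results on linear maps apply.\<close>

definition noise :: "real \<Rightarrow> 'a::euclidean_space measure \<Rightarrow> 'a measure" where
  "noise v \<mu> = distr (\<mu> \<Otimes>\<^sub>M heat_kernel v) borel (\<lambda>(x, z). x + z)"

lemma noise_P2:
  fixes \<mu> :: "'a::euclidean_space measure"
  assumes "\<mu> \<in> P2" "v > 0"
  shows "noise v \<mu> \<in> P2" "(W2 \<mu> (noise v \<mu>))\<^sup>2 \<le> v * real DIM('a)"
proof -
  note P = P2_pair[OF assms(1) heat_kernel_moment(1)[OF assms(2), where 'a='a]]
  have bl: "bounded_linear (\<lambda>p :: 'a \<times> 'a. fst p + snd p)" "bounded_linear (fst :: 'a \<times> 'a \<Rightarrow> 'a)" by (intro bounded_linear_intros)+
  show "noise v \<mu> \<in> P2" using P2_linear(3)[OF P(1) bl(1)] by (simp add: noise_def case_prod_unfold)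
  have "\<mu> \<Otimes>\<^sub>M heat_kernel v \<in> couplings \<mu> (heat_kernel v)"
    using pair_measure_couplings[OF P2D(2)[OF assms(1)] prob_space_heat_kernel[OF assms(2)] P2D(1)[OF assms(1)]] assms(2) by simp
  from couplingsD(2)[OF this] W2_sq_le_linear[OF P(1) bl(2) bl(1)]
  show "(W2 \<mu> (noise v \<mu>))\<^sup>2 \<le> v * real DIM('a)"
    using P(2) heat_kernel_moment(2)[OF assms(2), where 'a='a] by (simp add: noise_def case_prod_unfold)
qed

section \<open>The Schroedinger cost\<close>

text \<open>Meaningful for finite entropy; an infinite value is read as 0.\<close>

definition Ent :: "'a::euclidean_space measure \<Rightarrow> real" where
  "Ent \<mu> = real_of_ereal (boltzmann_entropy \<mu>)"

lemma Ent_eq: "has_ent \<mu> r \<Longrightarrow> Ent \<mu> = (\<integral>x. ln (r x) \<partial>\<mu>)"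
  by (simp add: Ent_def boltzmann_has_ent has_ent_ln(2))

text \<open>The functional minimized in \<open>sch e\<close>, as a real number; faithful for
  couplings of finite entropy between measures in \<open>P2\<close>.\<close>

definition schcost :: "real \<Rightarrow> ('a::euclidean_space \<times> 'a) measure \<Rightarrow> real" where
  "schcost e \<gamma> = (\<integral>p. (norm (fst p - snd p))\<^sup>2 \<partial>\<gamma>) / 2 + e * Ent \<gamma> + e * real DIM('a) / 2 * ln (2 * pi * e)"

lemma nn_integral_lborel_shift:
  fixes c :: "'a::euclidean_space"
  assumes "f \<in> borel_measurable borel"
  shows "(\<integral>\<^sup>+z. f (c + z) \<partial>lborel) = (\<integral>\<^sup>+y. f y \<partial>lborel)"
proof -
  have "(\<integral>\<^sup>+y. f y \<partial>lborel) = (\<integral>\<^sup>+y. f y \<partial>distr lborel borel ((+) c))" by (simp add: lborel_distr_plus)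
  also have "\<dots> = (\<integral>\<^sup>+z. f (c + z) \<partial>lborel)" by (rule nn_integral_distr) (use assms in auto)
  finally show ?thesis ..
qed

text \<open>Under \<open>\<gamma>\<close> the increment from first to second coordinate has the
  conditional density \<open>k (x, z)\<close> relative to the heat kernel at time \<open>e\<close>.
  Expanding \<open>ln k\<close> shows that \<open>e\<close> times its mean relative entropy is
  \<open>schcost e \<gamma> - e * Ent \<mu>\<close>, and Talagrand's inequality bounds this from
  below. The drawback is that \<open>\<rho>\<close> is compared with a smeared \<open>\<mu>\<close>,
  not with \<open>\<mu>\<close>.\<close>

lemma schcost_ge_talagrand:
  fixes \<mu> \<rho> :: "'a::euclidean_space measure"
  assumes \<gamma>: "\<gamma> \<in> couplings \<mu> \<rho>" and P: "\<mu> \<in> P2" "\<rho> \<in> P2"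
    and fin: "boltzmann_entropy \<gamma> < \<infinity>" and e: "e > 0"
  shows "(W2 \<rho> (noise e \<mu>))\<^sup>2 / 2 + e * Ent \<mu> \<le> schcost e \<gamma>"
proof -
  note C = couplingsD[OF \<gamma>]
  note \<gamma>P = couplings_P2[OF \<gamma> P]
  obtain g where g: "has_ent \<gamma> g" using has_ent_exists[OF \<gamma>P fin] by blast
  obtain m where m': "has_ent (distr \<gamma> borel fst) m" using marginal_has_ent[OF \<gamma>P g] by blast
  then have m: "has_ent \<mu> m" by (simp add: C)
  note gD = has_entD[OF g] and mD = has_entD[OF m] and gl = has_ent_ln[OF g] and ml = has_ent_ln[OF m]
  have [measurable]: "g \<in> borel_measurable (borel \<Otimes>\<^sub>M borel)" "m \<in> borel_measurable borel"
    using gD(1) mD(1) by (simp_all add: borel_pair_measurable)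
  note mP = P2D[OF P(1)]
  interpret M: prob_space \<mu> by (rule mP(2))
  interpret G: prob_space \<gamma> by (rule P2D(2)[OF \<gamma>P])
  interpret H: prob_space "heat_kernel e :: 'a measure" by (rule prob_space_heat_kernel[OF e])
  interpret MH: pair_prob_space \<mu> "heat_kernel e :: 'a measure" ..
  have [measurable_cong]: "sets \<mu> = sets borel" "sets (heat_kernel e :: 'a measure) = sets borel"
    using mP e by auto
  define \<sigma> :: "'a \<Rightarrow> real" where "\<sigma> = heat_density e"
  have \<sigma>m[measurable]: "\<sigma> \<in> borel_measurable borel" and \<sigma>0: "\<sigma> x > 0" for x
    using heat_density_pos[OF e] by (simp_all add: \<sigma>_def)
  note hint = nn_integral_heat_kernel[where 'a='a, OF e, folded \<sigma>_def]
  \<comment> \<open>The fibres on which the conditional density can be normalized. On the others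
    \<open>k\<close> is set to 1, so that it is a probability density for every
    \<open>x\<close>.\<close>
  define good where "good x \<longleftrightarrow> 0 < m x \<and> (\<integral>\<^sup>+y. ennreal (g (x, y)) \<partial>lborel) = ennreal (m x)" for x
  have good_m[measurable]: "Measurable.pred borel good" unfolding good_def by measurable
  define k where "k p = (if good (fst p) then g (fst p, fst p + snd p) / (m (fst p) * \<sigma> (snd p)) else 1)" for p
  have km'[measurable]: "k \<in> borel_measurable (borel \<Otimes>\<^sub>M borel)" unfolding k_def by measurable
  then have km: "k \<in> borel_measurable borel" by (simp add: borel_pair_measurable)
  have k0: "0 \<le> k (x, z)" for x z using gD(2) mD(2) \<sigma>0[of z] by (simp add: k_def less_imp_le)
  have \<sigma>k: "ennreal (\<sigma> z) * ennreal (k (x, z)) = ennreal (g (x, x + z)) * ennreal (1 / m x)" if "good x" for x z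
  proof -
    have "\<sigma> z * k (x, z) = g (x, x + z) * (1 / m x)" using that \<sigma>0[of z] by (simp add: k_def good_def)
    then show ?thesis using \<sigma>0[of z] gD(2) mD(2) k0 that by (simp add: ennreal_mult[symmetric] less_imp_le good_def)
  qed
  have gx[measurable]: "(\<lambda>y. g (x, y)) \<in> borel_measurable borel" for x by measurable
  have k1: "(\<integral>\<^sup>+z. ennreal (k (x, z)) \<partial>heat_kernel e) = 1" for x
  proof (cases "good x")
    case True
    have "(\<integral>\<^sup>+z. ennreal (k (x, z)) \<partial>heat_kernel e) = (\<integral>\<^sup>+z. ennreal (g (x, x + z)) * ennreal (1 / m x) \<partial>lborel)"
      by (subst hint) (auto simp: \<sigma>k[OF True])
    also have "\<dots> = (\<integral>\<^sup>+z. ennreal (g (x, x + z)) \<partial>lborel) * ennreal (1 / m x)" by (rule nn_integral_multc) measurable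
    also have "(\<integral>\<^sup>+z. ennreal (g (x, x + z)) \<partial>lborel) = (\<integral>\<^sup>+y. ennreal (g (x, y)) \<partial>lborel)"
      by (rule nn_integral_lborel_shift) measurable
    also have "\<dots> * ennreal (1 / m x) = 1" using True by (simp add: good_def ennreal_mult[symmetric])
    finally show ?thesis .
  next
    case False then show ?thesis using H.emeasure_space_1 by (simp add: k_def)
  qed
  have marg: "AE x in lborel. (\<integral>\<^sup>+y. ennreal (g (x, y)) \<partial>lborel) = ennreal (m x)"
    by (rule density_marginal_AE[OF gD(1) mD(1) gD(2)]) (use C(2) in \<open>simp add: gD(3)[symmetric] mD(3)[symmetric]\<close>)
  let ?D = "density (\<mu> \<Otimes>\<^sub>M heat_kernel e) (\<lambda>p. ennreal (k p))"
  define \<phi> where "\<phi> p = (fst p, fst p + snd p)" for p :: "'a \<times> 'a"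
  have \<phi>m: "\<phi> \<in> measurable ?D borel"
  proof -
    have "\<phi> \<in> measurable (borel \<Otimes>\<^sub>M borel) (borel \<Otimes>\<^sub>M borel)" unfolding \<phi>_def by measurable
    moreover have "sets ?D = sets (borel \<Otimes>\<^sub>M borel)" unfolding sets_density by (intro sets_pair_measure_cong) (use mP e in auto)
    ultimately show ?thesis by (simp add: measurable_cong_sets[OF _ sets_borel_prod])
  qed
  \<comment> \<open>\<open>\<gamma>\<close> is recovered from its start and the tilted increment, so
    the mean of \<open>ln k\<close> can be computed under \<open>\<gamma>\<close>.\<close>
  have law: "distr ?D borel \<phi> = \<gamma>"
  proof (rule measure_eqI)
    fix A assume "A \<in> sets (distr ?D borel \<phi>)"
    then have A: "A \<in> sets borel" by simp
    then have [measurable]: "A \<in> sets (borel \<Otimes>\<^sub>M borel)" by (simp add: sets_borel_prod)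
    have "emeasure (distr ?D borel \<phi>) A = (\<integral>\<^sup>+p. indicator A (\<phi> p) \<partial>?D)"
      using A by (subst nn_integral_indicator[symmetric], simp, subst nn_integral_distr[OF \<phi>m]) auto
    also have "\<dots> = (\<integral>\<^sup>+p. ennreal (k p) * indicator A (fst p, fst p + snd p) \<partial>(\<mu> \<Otimes>\<^sub>M heat_kernel e))"
      unfolding \<phi>_def by (rule nn_integral_density) measurable
    also have "\<dots> = (\<integral>\<^sup>+x. \<integral>\<^sup>+z. ennreal (k (x, z)) * indicator A (x, x + z) \<partial>heat_kernel e \<partial>\<mu>)"
      by (subst H.nn_integral_fst[symmetric]) auto
    also have "\<dots> = (\<integral>\<^sup>+x. ennreal (m x) * (\<integral>\<^sup>+z. ennreal (k (x, z)) * indicator A (x, x + z) \<partial>heat_kernel e) \<partial>lborel)"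
      unfolding mD(3) by (rule nn_integral_density) measurable
    also have "\<dots> = (\<integral>\<^sup>+x. \<integral>\<^sup>+y. ennreal (g (x, y)) * indicator A (x, y) \<partial>lborel \<partial>lborel)"
    proof (rule nn_integral_cong_AE, use marg in eventually_elim)
      case (elim x)
      show ?case
      proof (cases "m x > 0")
        case True
        then have good: "good x" using elim by (simp add: good_def)
        have "ennreal (m x) * (\<integral>\<^sup>+z. ennreal (k (x, z)) * indicator A (x, x + z) \<partial>heat_kernel e)
          = ennreal (m x) * (\<integral>\<^sup>+z. ennreal (1 / m x) * (ennreal (g (x, x + z)) * indicator A (x, x + z)) \<partial>lborel)"
        proof (subst hint)
          have "ennreal (\<sigma> z) * (ennreal (k (x, z)) * indicator A (x, x + z)) = ennreal (1 / m x) * (ennreal (g (x, x + z)) * indicator A (x, x + z))" for z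
          proof -
            have "ennreal (\<sigma> z) * (ennreal (k (x, z)) * indicator A (x, x + z)) = (ennreal (\<sigma> z) * ennreal (k (x, z))) * indicator A (x, x + z)"
              by (simp only: mult.assoc)
            also have "\<dots> = (ennreal (g (x, x + z)) * ennreal (1 / m x)) * indicator A (x, x + z)" by (simp only: \<sigma>k[OF good])
            finally show ?thesis by (simp only: ac_simps)
          qed
          then show "ennreal (m x) * (\<integral>\<^sup>+z. ennreal (\<sigma> z) * (ennreal (k (x, z)) * indicator A (x, x + z)) \<partial>lborel)
            = ennreal (m x) * (\<integral>\<^sup>+z. ennreal (1 / m x) * (ennreal (g (x, x + z)) * indicator A (x, x + z)) \<partial>lborel)" by simp
        qed measurable
        also have "\<dots> = (ennreal (m x) * ennreal (1 / m x)) * (\<integral>\<^sup>+z. ennreal (g (x, x + z)) * indicator A (x, x + z) \<partial>lborel)"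
          by (subst nn_integral_cmult) (auto simp: mult.assoc)
        also have "ennreal (m x) * ennreal (1 / m x) = 1" using True by (simp add: ennreal_mult[symmetric])
        also have "(\<integral>\<^sup>+z. ennreal (g (x, x + z)) * indicator A (x, x + z) \<partial>lborel) = (\<integral>\<^sup>+y. ennreal (g (x, y)) * indicator A (x, y) \<partial>lborel)"
          by (rule nn_integral_lborel_shift) measurable
        finally show ?thesis by simp
      next
        case False
        then have "m x = 0" using mD(2)[of x] by simp
        then have "(\<integral>\<^sup>+y. ennreal (g (x, y)) \<partial>lborel) = 0" using elim by simp
        then have "AE y in lborel. ennreal (g (x, y)) = 0"
          using nn_integral_0_iff_AE[of "\<lambda>y. ennreal (g (x, y))" lborel] by simp
        then have "AE y in lborel. ennreal (g (x, y)) * indicator A (x, y) = 0" by eventually_elim simp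
        then have "(\<integral>\<^sup>+y. ennreal (g (x, y)) * indicator A (x, y) \<partial>lborel) = (\<integral>\<^sup>+y. 0 \<partial>(lborel :: 'a measure))" by (rule nn_integral_cong_AE)
        then show ?thesis using \<open>m x = 0\<close> by simp
      qed
    qed
    also have "\<dots> = (\<integral>\<^sup>+p. indicator A p \<partial>\<gamma>)"
      by (rule nn_integral_has_ent_pair[OF g, symmetric]) (use A in auto)
    also have "\<dots> = emeasure \<gamma> A" using A C(1) by simp
    finally show "emeasure (distr ?D borel \<phi>) A = emeasure \<gamma> A" .
  qed (simp add: C)
  have rho: "distr ?D borel (\<lambda>(x, z). x + z) = \<rho>"
  proof -
    have "distr ?D borel (\<lambda>(x, z). x + z) = distr (distr ?D borel \<phi>) borel snd"
      by (subst distr_distr[OF _ \<phi>m]) (auto simp: o_def \<phi>_def case_prod_unfold measurable_borel_prod)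
    then show ?thesis by (simp add: law C)
  qed
  define K where "K p = ln (g p) - ln (m (fst p)) - ln (\<sigma> (snd p - fst p))" for p
  have bl: "bounded_linear (\<lambda>p :: 'a \<times> 'a. fst p - snd p)" by (intro bounded_linear_intros)
  have l\<sigma>: "ln (\<sigma> (snd p - fst p)) = - (real DIM('a) / 2) * ln (2 * pi * e) - (norm (fst p - snd p))\<^sup>2 / (2 * e)" for p
    unfolding \<sigma>_def by (subst ln_heat_density[OF e]) (simp add: norm_minus_commute)
  have i1: "integrable \<gamma> (\<lambda>p. (norm (fst p - snd p))\<^sup>2)" by (rule P2_linear(2)[OF \<gamma>P bl])
  have i2: "integrable \<gamma> (\<lambda>p. ln (\<sigma> (snd p - fst p)))" unfolding l\<sigma> using i1 by simp
  have lmm: "(\<lambda>x. ln (m x)) \<in> borel_measurable borel" by measurable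
  have i3: "integrable \<gamma> (\<lambda>p. ln (m (fst p)))"
    using ml(1) unfolding C(2)[symmetric] by (rule integrable_distr[OF C(5)])
  have e3: "(\<integral>p. ln (m (fst p)) \<partial>\<gamma>) = Ent \<mu>"
    using integral_distr[OF C(5) lmm] by (simp add: C(2) Ent_eq[OF m])
  have Ki: "integrable \<gamma> K" unfolding K_def using gl(1) i2 i3 by simp
  have KE: "(\<integral>p. K p \<partial>\<gamma>) = Ent \<gamma> - Ent \<mu> + real DIM('a) / 2 * ln (2 * pi * e) + (\<integral>p. (norm (fst p - snd p))\<^sup>2 \<partial>\<gamma>) / (2 * e)"
  proof -
    have "(\<integral>p. K p \<partial>\<gamma>) = (\<integral>p. ln (g p) \<partial>\<gamma>) - (\<integral>p. ln (m (fst p)) \<partial>\<gamma>) - (\<integral>p. ln (\<sigma> (snd p - fst p)) \<partial>\<gamma>)"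
      unfolding K_def using gl(1) i2 i3 by simp
    also have "(\<integral>p. ln (\<sigma> (snd p - fst p)) \<partial>\<gamma>) = - (real DIM('a) / 2) * ln (2 * pi * e) - (\<integral>p. (norm (fst p - snd p))\<^sup>2 \<partial>\<gamma>) / (2 * e)"
      unfolding l\<sigma> using i1 G.prob_space by simp
    finally show ?thesis by (simp add: e3 Ent_eq[OF g])
  qed
  have Km: "K \<in> borel_measurable borel"
  proof -
    have "K \<in> borel_measurable (borel \<Otimes>\<^sub>M borel)" unfolding K_def by measurable
    then show ?thesis by (simp add: borel_pair_measurable)
  qed
  have "AE p in \<gamma>. g p > 0 \<and> good (fst p)"
  proof -
    have "AE x in \<mu>. good x"
      unfolding mD(3) using marg by (subst AE_density) (auto simp: good_def elim!: eventually_mono)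
    then have "AE x in distr \<gamma> borel fst. good x" unfolding C(2) .
    then have "AE p in \<gamma>. good (fst p)" by (rule AE_distrD[OF C(5)])
    then show ?thesis using gl(3) by eventually_elim simp
  qed
  then have "AE p in distr ?D borel \<phi>. g p > 0 \<and> good (fst p)" unfolding law .
  then have "AE p in ?D. g (\<phi> p) > 0 \<and> good (fst (\<phi> p))" by (rule AE_distrD[OF \<phi>m])
  then have lnk: "AE p in ?D. ln (k p) = K (\<phi> p)"
  proof eventually_elim
    case (elim p)
    then show ?case using \<sigma>0[of "snd p"] by (simp add: k_def K_def \<phi>_def good_def ln_div ln_mult)
  qed
  have KD: "integrable ?D (\<lambda>p. K (\<phi> p))" "(\<integral>p. K (\<phi> p) \<partial>?D) = (\<integral>p. K p \<partial>\<gamma>)"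
    using Ki integral_distr[OF \<phi>m Km] unfolding law[symmetric] by (auto intro: integrable_distr[OF \<phi>m])
  have lnkm[measurable]: "(\<lambda>p. ln (k p)) \<in> borel_measurable (borel \<Otimes>\<^sub>M borel)" by measurable
  have m1: "(\<lambda>p. ln (k p)) \<in> borel_measurable ?D" "(\<lambda>p. K (\<phi> p)) \<in> borel_measurable ?D"
    using measurable_compose[OF \<phi>m Km] by measurable
  have iD: "integrable ?D (\<lambda>p. ln (k p))" "(\<integral>p. ln (k p) \<partial>?D) = (\<integral>p. K p \<partial>\<gamma>)"
    using integrable_cong_AE[OF m1 lnk] integral_cong_AE[OF m1 lnk] KD by auto
  have iMH: "integrable (\<mu> \<Otimes>\<^sub>M heat_kernel e) (\<lambda>p. k p * ln (k p))"
    "(\<integral>p. k p * ln (k p) \<partial>(\<mu> \<Otimes>\<^sub>M heat_kernel e)) = (\<integral>p. K p \<partial>\<gamma>)"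
  proof -
    have kk: "AE p in \<mu> \<Otimes>\<^sub>M heat_kernel e. 0 \<le> k p" using k0 by auto
    show "integrable (\<mu> \<Otimes>\<^sub>M heat_kernel e) (\<lambda>p. k p * ln (k p))"
      using iD(1) by (subst (asm) integrable_density[OF _ _ kk]) auto
    show "(\<integral>p. k p * ln (k p) \<partial>(\<mu> \<Otimes>\<^sub>M heat_kernel e)) = (\<integral>p. K p \<partial>\<gamma>)"
      unfolding iD(2)[symmetric] by (subst integral_density[OF _ _ kk]) auto
  qed
  have k_int: "integrable (\<mu> \<Otimes>\<^sub>M heat_kernel e) k" "(\<integral>p. k p \<partial>(\<mu> \<Otimes>\<^sub>M heat_kernel e)) = 1"
  proof -
    have "(\<integral>\<^sup>+p. ennreal (k p) \<partial>(\<mu> \<Otimes>\<^sub>M heat_kernel e)) = (\<integral>\<^sup>+x. \<integral>\<^sup>+z. ennreal (k (x, z)) \<partial>heat_kernel e \<partial>\<mu>)"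
      by (rule H.nn_integral_fst[symmetric]) measurable
    also have "\<dots> = 1" by (simp add: k1 M.emeasure_space_1)
    finally have "(\<integral>\<^sup>+p. ennreal (k p) \<partial>(\<mu> \<Otimes>\<^sub>M heat_kernel e)) = ennreal 1" by simp
    moreover have "AE p in \<mu> \<Otimes>\<^sub>M heat_kernel e. 0 \<le> k p" using k0 by auto
    ultimately have "has_bochner_integral (\<mu> \<Otimes>\<^sub>M heat_kernel e) k 1"
      by (intro has_bochner_integral_nn_integral) auto
    then show "integrable (\<mu> \<Otimes>\<^sub>M heat_kernel e) k" "(\<integral>p. k p \<partial>(\<mu> \<Otimes>\<^sub>M heat_kernel e)) = 1"
      by (auto simp: has_bochner_integral_iff)
  qed
  have ei: "integrable (\<mu> \<Otimes>\<^sub>M heat_kernel e) (\<lambda>p. ent (k p))" unfolding ent_def using iMH k_int by simp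
  have eI: "(\<integral>p. ent (k p) \<partial>(\<mu> \<Otimes>\<^sub>M heat_kernel e)) = (\<integral>p. K p \<partial>\<gamma>)"
    unfolding ent_def using iMH k_int MH.prob_space by simp
  have entk: "0 \<le> ent (k p)" for p using ent_nonneg k0[of "fst p" "snd p"] by simp
  have "(\<integral>\<^sup>+x. \<integral>\<^sup>+z. ennreal (ent (k (x, z))) \<partial>heat_kernel e \<partial>\<mu>) = (\<integral>\<^sup>+p. ennreal (ent (k p)) \<partial>(\<mu> \<Otimes>\<^sub>M heat_kernel e))"
    by (rule H.nn_integral_fst) measurable
  also have "\<dots> = ennreal (\<integral>p. K p \<partial>\<gamma>)"
    using ei entk by (subst nn_integral_eq_integral) (auto simp: eI)
  finally have "W2_squared \<rho> (noise e \<mu>) \<le> ennreal (2 * e) * ennreal (\<integral>p. K p \<partial>\<gamma>)"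
    using talagrand[OF mP(2,1) e km k0 k1] unfolding rho noise_def by simp
  also have "\<dots> = ennreal (2 * e * (\<integral>p. K p \<partial>\<gamma>))" using e by (simp add: ennreal_mult')
  finally have W: "W2_squared \<rho> (noise e \<mu>) \<le> ennreal (2 * e * (\<integral>p. K p \<partial>\<gamma>))" .
  have "0 \<le> (\<integral>p. ent (k p) \<partial>(\<mu> \<Otimes>\<^sub>M heat_kernel e))" using entk by (intro Bochner_Integration.integral_nonneg) auto
  then have "0 \<le> 2 * e * (\<integral>p. K p \<partial>\<gamma>)" using e eI by simp
  then have "(W2 \<rho> (noise e \<mu>))\<^sup>2 \<le> 2 * e * (\<integral>p. K p \<partial>\<gamma>)" using enn2real_leI[OF _ W] by (simp add: W2_def)
  moreover have "e * (\<integral>p. K p \<partial>\<gamma>) = schcost e \<gamma> - e * Ent \<mu>"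
    unfolding KE schcost_def using e by (simp add: field_simps)
  ultimately show ?thesis by simp
qed

lemma distr_distr_linear:
  fixes f :: "'a::euclidean_space \<Rightarrow> 'b::euclidean_space" and g :: "'b \<Rightarrow> 'c::euclidean_space"
  assumes "\<theta> \<in> P2" "bounded_linear f" "bounded_linear g"
  shows "distr (distr \<theta> borel f) borel g = distr \<theta> borel (\<lambda>x. g (f x))"
  using P2_linear(1)[OF assms(1,2)] borel_measurable_continuous_onI[OF linear_continuous_on[OF assms(3)]]
  by (subst distr_distr) (auto simp: o_def)

lemma swap_coupling:
  assumes \<gamma>: "\<gamma> \<in> couplings \<mu> \<rho>" and P: "\<mu> \<in> P2" "\<rho> \<in> P2" and fin: "boltzmann_entropy \<gamma> < \<infinity>"
  shows "distr \<gamma> borel prod.swap \<in> couplings \<rho> \<mu>" "boltzmann_entropy (distr \<gamma> borel prod.swap) < \<infinity>"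
    "schcost e (distr \<gamma> borel prod.swap) = schcost e \<gamma>"
proof -
  note \<gamma>P = couplings_P2[OF \<gamma> P] and C = couplingsD[OF \<gamma>]
  have bl: "bounded_linear (\<lambda>p :: 'a \<times> 'a. snd p)" "bounded_linear (\<lambda>p :: 'a \<times> 'a. fst p)" by (intro bounded_linear_intros)+
  have sw: "(prod.swap :: 'a \<times> 'a \<Rightarrow> _) = (\<lambda>p. (snd p, fst p))" by auto
  note l = linear_coupling[OF \<gamma>P bl]
  show "distr \<gamma> borel prod.swap \<in> couplings \<rho> \<mu>" using l(1) C unfolding sw by simp
  obtain g where g: "has_ent \<gamma> g" using has_ent_exists[OF \<gamma>P fin] by blast
  show "boltzmann_entropy (distr \<gamma> borel prod.swap) < \<infinity>" using has_ent_swap(2)[OF g] fin by simp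
  show "schcost e (distr \<gamma> borel prod.swap) = schcost e \<gamma>"
    using l(2) unfolding schcost_def Ent_def has_ent_swap(2)[OF g] by (simp add: sw norm_minus_commute)
qed

text \<open>Start, midpoint and end together have an explicit density, \<open>g\<close> times the
  Gaussian density of the deviation of the midpoint. Its logarithm is integrable, and the wanted law
  is a marginal.\<close>

lemma bridge_has_ent:
  fixes \<gamma> :: "('a::euclidean_space \<times> 'a) measure"
  assumes \<gamma>: "\<gamma> \<in> P2" and g: "has_ent \<gamma> g" and v: "v > 0"
  obtains j where "has_ent (distr (\<gamma> \<Otimes>\<^sub>M heat_kernel v) borel (\<lambda>q. (fst (fst q), (1/2) *\<^sub>R (fst (fst q) + snd (fst q)) + snd q))) j"
proof -
  let ?T = "\<gamma> \<Otimes>\<^sub>M (heat_kernel v :: 'a measure)"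
  note H = heat_kernel_moment(1)[OF v, where 'a='a]
  note TP = P2_pair(1)[OF \<gamma> H] and gD = has_entD[OF g] and gl = has_ent_ln[OF g]
  interpret G: prob_space \<gamma> by (rule P2D(2)[OF \<gamma>])
  interpret H: prob_space "heat_kernel v :: 'a measure" by (rule P2D(2)[OF H])
  interpret T: pair_prob_space \<gamma> "heat_kernel v :: 'a measure" ..
  define b :: "'a \<Rightarrow> real" where "b = heat_density v"
  have bm[measurable]: "b \<in> borel_measurable borel" and b0: "b z > 0" for z using heat_density_pos[OF v] by (simp_all add: b_def)
  note hint = nn_integral_heat_kernel[where 'a='a, OF v, folded b_def]
  have [measurable_cong]: "sets \<gamma> = sets (borel \<Otimes>\<^sub>M borel)" using P2D(1)[OF \<gamma>] by (simp add: sets_borel_prod)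
  have [measurable_cong]: "sets (heat_kernel v :: 'a measure) = sets borel" using v by simp
  have gm[measurable]: "g \<in> borel_measurable (borel \<Otimes>\<^sub>M borel)" using gD(1) by (simp add: borel_pair_measurable)
  define f where "f q = ((fst (fst q), (1/2) *\<^sub>R (fst (fst q) + snd (fst q)) + snd q), snd (fst q))" for q :: "('a \<times> 'a) \<times> 'a"
  have fl: "bounded_linear f" unfolding f_def by (intro bounded_linear_Pair bounded_linear_intros)
  note fm = P2_linear(1)[OF TP fl]
  define \<beta> where "\<beta> q = g (fst (fst q), snd q) * b (snd (fst q) - (1/2) *\<^sub>R (fst (fst q) + snd q))" for q :: "('a \<times> 'a) \<times> 'a"
  have \<beta>m'[measurable]: "\<beta> \<in> borel_measurable ((borel \<Otimes>\<^sub>M borel) \<Otimes>\<^sub>M borel)" unfolding \<beta>_def by measurable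
  have s3: "sets (borel :: (('a \<times> 'a) \<times> 'a) measure) = sets ((borel \<Otimes>\<^sub>M borel) \<Otimes>\<^sub>M borel)"
    unfolding sets_borel_prod[where 'a="'a \<times> 'a"] by (intro sets_pair_measure_cong sets_borel_prod refl)
  have \<beta>m: "\<beta> \<in> borel_measurable borel" using \<beta>m' by (simp add: measurable_cong_sets[OF s3 refl])
  have \<beta>0: "0 \<le> \<beta> q" for q using gD(2) b0 by (simp add: \<beta>_def less_imp_le)
  have eq: "distr ?T borel f = density lborel (\<lambda>q. ennreal (\<beta> q))"
  proof (rule measure_eqI)
    fix A assume "A \<in> sets (distr ?T borel f)"
    then have A: "A \<in> sets borel" by simp
    then have A3[measurable]: "A \<in> sets ((borel \<Otimes>\<^sub>M borel) \<Otimes>\<^sub>M borel)" by (simp add: s3)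
    have mI[measurable]: "(\<lambda>q. indicator A (f q) :: ennreal) \<in> borel_measurable ((borel \<Otimes>\<^sub>M borel) \<Otimes>\<^sub>M borel)"
      using measurable_compose[OF borel_measurable_continuous_onI[OF linear_continuous_on[OF fl]] borel_measurable_indicator[OF A]]
      by (simp add: measurable_cong_sets[OF s3 refl])
    have [measurable]: "f \<in> measurable ((borel \<Otimes>\<^sub>M borel) \<Otimes>\<^sub>M borel) ((borel \<Otimes>\<^sub>M borel) \<Otimes>\<^sub>M borel)"
      unfolding f_def by measurable
    have "emeasure (distr ?T borel f) A = (\<integral>\<^sup>+q. indicator A (f q) \<partial>?T)"
      using A by (subst nn_integral_indicator[symmetric], simp, subst nn_integral_distr[OF fm]) auto
    also have "\<dots> = (\<integral>\<^sup>+p. \<integral>\<^sup>+z. indicator A (f (p, z)) \<partial>heat_kernel v \<partial>\<gamma>)"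
      by (rule H.nn_integral_fst[symmetric]) measurable
    also have "\<dots> = (\<integral>\<^sup>+p. \<integral>\<^sup>+z. ennreal (b z) * indicator A (f (p, z)) \<partial>lborel \<partial>\<gamma>)"
      by (intro nn_integral_cong hint) (measurable, simp_all add: space_pair_measure)
    also have "\<dots> = (\<integral>\<^sup>+x. \<integral>\<^sup>+y. ennreal (g (x, y)) * (\<integral>\<^sup>+z. ennreal (b z) * indicator A (f ((x, y), z)) \<partial>lborel) \<partial>lborel \<partial>lborel)"
      by (rule nn_integral_has_ent_pair[OF g]) (unfold borel_pair_measurable, measurable)
    also have "\<dots> = (\<integral>\<^sup>+x. \<integral>\<^sup>+y. \<integral>\<^sup>+w. ennreal (\<beta> ((x, w), y)) * indicator A ((x, w), y) \<partial>lborel \<partial>lborel \<partial>lborel)"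
    proof (intro nn_integral_cong)
      fix x y :: 'a
      have "(\<integral>\<^sup>+z. ennreal (b z) * indicator A (f ((x, y), z)) \<partial>lborel)
        = (\<integral>\<^sup>+z. (\<lambda>w. ennreal (b (w - (1/2) *\<^sub>R (x + y))) * indicator A ((x, w), y)) ((1/2) *\<^sub>R (x + y) + z) \<partial>lborel)"
        by (simp add: f_def)
      also have "\<dots> = (\<integral>\<^sup>+w. ennreal (b (w - (1/2) *\<^sub>R (x + y))) * indicator A ((x, w), y) \<partial>lborel)"
        by (rule nn_integral_lborel_shift) measurable
      finally have "ennreal (g (x, y)) * (\<integral>\<^sup>+z. ennreal (b z) * indicator A (f ((x, y), z)) \<partial>lborel)
        = (\<integral>\<^sup>+w. ennreal (g (x, y)) * (ennreal (b (w - (1/2) *\<^sub>R (x + y))) * indicator A ((x, w), y)) \<partial>lborel)"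
        by (subst nn_integral_cmult) auto
      also have "\<dots> = (\<integral>\<^sup>+w. ennreal (\<beta> ((x, w), y)) * indicator A ((x, w), y) \<partial>lborel)"
        using gD(2) b0 by (simp add: \<beta>_def ennreal_mult less_imp_le mult.assoc)
      finally show "ennreal (g (x, y)) * (\<integral>\<^sup>+z. ennreal (b z) * indicator A (f ((x, y), z)) \<partial>lborel)
        = (\<integral>\<^sup>+w. ennreal (\<beta> ((x, w), y)) * indicator A ((x, w), y) \<partial>lborel)" .
    qed
    also have "\<dots> = (\<integral>\<^sup>+x. \<integral>\<^sup>+w. \<integral>\<^sup>+y. ennreal (\<beta> ((x, w), y)) * indicator A ((x, w), y) \<partial>lborel \<partial>lborel \<partial>lborel)"
      by (intro nn_integral_cong lborel_pair.Fubini') measurable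
    also have "\<dots> = (\<integral>\<^sup>+p. \<integral>\<^sup>+y. ennreal (\<beta> (p, y)) * indicator A (p, y) \<partial>lborel \<partial>(lborel \<Otimes>\<^sub>M lborel))"
      by (subst lborel.nn_integral_fst[symmetric]) auto
    also have "\<dots> = (\<integral>\<^sup>+p. \<integral>\<^sup>+y. ennreal (\<beta> (p, y)) * indicator A (p, y) \<partial>lborel \<partial>(lborel :: ('a \<times> 'a) measure))"
      by (simp add: lborel_prod)
    also have "\<dots> = (\<integral>\<^sup>+q. ennreal (\<beta> q) * indicator A q \<partial>(lborel \<Otimes>\<^sub>M lborel))"
    proof (rule lborel.nn_integral_fst)
      have "(\<lambda>q. ennreal (\<beta> q) * indicator A q) \<in> borel_measurable borel" using \<beta>m A by measurable
      then show "(\<lambda>q. ennreal (\<beta> q) * indicator A q) \<in> borel_measurable (lborel \<Otimes>\<^sub>M lborel)"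
        by (simp add: borel_pair_measurable)
    qed
    also have "\<dots> = emeasure (density lborel (\<lambda>q. ennreal (\<beta> q))) A"
      using A \<beta>m by (subst emeasure_density) (auto simp: lborel_prod)
    finally show "emeasure (distr ?T borel f) A = emeasure (density lborel (\<lambda>q. ennreal (\<beta> q))) A" .
  qed simp
  have bl2: "bounded_linear (snd :: ('a \<times> 'a) \<times> 'a \<Rightarrow> 'a)" by (rule bounded_linear_snd)
  have fst_T: "distr ?T \<gamma> fst = \<gamma>" by (rule H.distr_pair_fst)
  have i1: "integrable ?T (\<lambda>q. ln (g (fst q)))"
    using gl(1) integrable_distr[of fst ?T \<gamma> "\<lambda>p. ln (g p)"] by (simp add: fst_T)
  have i2: "integrable ?T (\<lambda>q. ln (b (snd q)))"
    unfolding b_def ln_heat_density[OF v] using P2_linear(2)[OF TP bl2] by simp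
  have "AE p in distr ?T \<gamma> fst. g p > 0" unfolding fst_T by (rule gl(3))
  then have "AE q in ?T. g (fst q) > 0" by (rule AE_distrD[rotated]) simp
  then have ae: "AE q in ?T. ln (\<beta> (f q)) = ln (g (fst q)) + ln (b (snd q))"
  proof eventually_elim
    case (elim q)
    then show ?case using b0[of "snd q"] by (simp add: \<beta>_def f_def ln_mult)
  qed
  have lnb: "(\<lambda>q. ln (\<beta> q)) \<in> borel_measurable borel" using \<beta>m by measurable
  have "integrable ?T (\<lambda>q. ln (\<beta> (f q)))"
  proof (rule integrable_cong_AE_imp[OF Bochner_Integration.integrable_add[OF i1 i2]])
    show "(\<lambda>q. ln (\<beta> (f q))) \<in> borel_measurable ?T" using measurable_compose[OF fm lnb] .
    show "AE q in ?T. ln (g (fst q)) + ln (b (snd q)) = ln (\<beta> (f q))" using ae by eventually_elim simp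
  qed
  then have "integrable (distr ?T borel f) (\<lambda>q. ln (\<beta> q))" using lnb by (subst integrable_distr_eq[OF fm]) auto
  then have "integrable lborel (\<lambda>q. \<beta> q * ln (\<beta> q))"
    unfolding eq using \<beta>m lnb \<beta>0 by (subst (asm) integrable_density) auto
  then have "has_ent (distr ?T borel f) \<beta>" using eq \<beta>m \<beta>0 by (simp add: has_ent_def)
  from marginal_has_ent[OF P2_linear(3)[OF TP fl] this]
  obtain j where "has_ent (distr (distr ?T borel f) borel fst) j" by blast
  then show thesis using that distr_distr_linear[OF TP fl bounded_linear_fst] by (simp add: f_def)
qed

lemma distr_pair_linear:
  fixes \<gamma> :: "'a::euclidean_space measure" and \<eta> :: "'c::euclidean_space measure" and h :: "'a \<Rightarrow> 'b::euclidean_space"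
  assumes \<gamma>: "\<gamma> \<in> P2" and \<eta>: "\<eta> \<in> P2" and h: "bounded_linear h" and f: "continuous_on UNIV f"
  shows "distr (distr \<gamma> borel h \<Otimes>\<^sub>M \<eta>) borel f = distr (\<gamma> \<Otimes>\<^sub>M \<eta>) (borel :: 'd::euclidean_space measure) (\<lambda>q. f (h (fst q), snd q))"
proof -
  interpret H: prob_space \<eta> by (rule P2D(2)[OF \<eta>])
  note hm = P2_linear(1)[OF \<gamma> h] and \<gamma>'P = P2_linear(3)[OF \<gamma> h]
  have fm: "f \<in> measurable (distr \<gamma> borel h \<Otimes>\<^sub>M \<eta>) borel"
    by (rule measurable_continuous_borel[OF P2D(1)[OF P2_pair(1)[OF \<gamma>'P \<eta>]] f])
  have "continuous_on UNIV (\<lambda>q :: 'a \<times> 'c. f (h (fst q), snd q))"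
    by (rule continuous_on_compose2[OF f])
      (auto intro!: continuous_intros continuous_on_compose2[OF linear_continuous_on[OF h]])
  then have fm2: "(\<lambda>q. f (h (fst q), snd q)) \<in> measurable (\<gamma> \<Otimes>\<^sub>M \<eta>) borel"
    by (rule measurable_continuous_borel[OF P2D(1)[OF P2_pair(1)[OF \<gamma> \<eta>]]])
  show ?thesis
  proof (rule measure_eqI)
    fix A assume "A \<in> sets (distr (distr \<gamma> borel h \<Otimes>\<^sub>M \<eta>) borel f)"
    then have A: "A \<in> sets borel" by simp
    have m1: "(\<lambda>q. indicator A (f q) :: ennreal) \<in> borel_measurable (distr \<gamma> borel h \<Otimes>\<^sub>M \<eta>)"
      using measurable_compose[OF fm borel_measurable_indicator[OF A]] .
    have "emeasure (distr (distr \<gamma> borel h \<Otimes>\<^sub>M \<eta>) borel f) A = (\<integral>\<^sup>+q. indicator A (f q) \<partial>(distr \<gamma> borel h \<Otimes>\<^sub>M \<eta>))"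
      using A by (subst nn_integral_indicator[symmetric], simp, subst nn_integral_distr[OF fm]) auto
    also have "\<dots> = (\<integral>\<^sup>+p. \<integral>\<^sup>+z. indicator A (f (p, z)) \<partial>\<eta> \<partial>distr \<gamma> borel h)"
      by (rule H.nn_integral_fst[OF m1, symmetric])
    also have "\<dots> = (\<integral>\<^sup>+p. \<integral>\<^sup>+z. indicator A (f (h p, z)) \<partial>\<eta> \<partial>\<gamma>)"
      by (rule nn_integral_distr[OF hm]) (use H.borel_measurable_nn_integral_fst[OF m1] in simp)
    also have "\<dots> = (\<integral>\<^sup>+q. indicator A (f (h (fst q), snd q)) \<partial>(\<gamma> \<Otimes>\<^sub>M \<eta>))"
      using measurable_compose[OF fm2 borel_measurable_indicator[OF A]] by (subst H.nn_integral_fst[symmetric]) auto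
    also have "\<dots> = emeasure (distr (\<gamma> \<Otimes>\<^sub>M \<eta>) borel (\<lambda>q. f (h (fst q), snd q))) A"
      using A by (subst nn_integral_indicator[symmetric], simp, subst nn_integral_distr[OF fm2]) auto
    finally show "emeasure (distr (distr \<gamma> borel h \<Otimes>\<^sub>M \<eta>) borel f) A = emeasure (distr (\<gamma> \<Otimes>\<^sub>M \<eta>) borel (\<lambda>q. f (h (fst q), snd q))) A" .
  qed simp
qed

text \<open>Inserting the midpoint of a Brownian bridge. The entropy inequality is the nonnegativity of the
  relative entropy of the joint law with respect to its Markovian version.\<close>

lemma schcost_split:
  fixes \<mu> \<rho> :: "'a::euclidean_space measure"
  assumes \<gamma>: "\<gamma> \<in> couplings \<mu> \<rho>" and P: "\<mu> \<in> P2" "\<rho> \<in> P2"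
    and fin: "boltzmann_entropy \<gamma> < \<infinity>" and e: "e > 0"
  obtains w \<gamma>1 \<gamma>2 where "w \<in> P2" "\<gamma>1 \<in> couplings \<mu> w" "\<gamma>2 \<in> couplings w \<rho>"
    "boltzmann_entropy \<gamma>1 < \<infinity>" "boltzmann_entropy \<gamma>2 < \<infinity>"
    "2 * schcost (e/2) \<gamma>1 + 2 * schcost (e/2) \<gamma>2 - e * Ent w \<le> schcost e \<gamma>"
proof -
  note C = couplingsD[OF \<gamma>] and \<gamma>P = couplings_P2[OF \<gamma> P]
  \<comment> \<open>The variance of the midpoint of a Brownian bridge of length
    \<open>e\<close>.\<close>
  define v where "v = e / 4"
  have v: "v > 0" using e by (simp add: v_def)
  obtain g where g: "has_ent \<gamma> g" using has_ent_exists[OF \<gamma>P fin] by blast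
  note gD = has_entD[OF g]
  let ?T = "\<gamma> \<Otimes>\<^sub>M (heat_kernel v :: 'a measure)"
  note HP = heat_kernel_moment(1)[OF v, where 'a='a]
  note TP = P2_pair(1)[OF \<gamma>P HP]
  interpret G: prob_space \<gamma> by (rule P2D(2)[OF \<gamma>P])
  interpret H: prob_space "heat_kernel v :: 'a measure" by (rule P2D(2)[OF HP])
  interpret T: pair_prob_space \<gamma> "heat_kernel v :: 'a measure" ..
  define X where "X q = fst (fst q)" for q :: "('a \<times> 'a) \<times> 'a"
  define Y where "Y q = snd (fst q)" for q :: "('a \<times> 'a) \<times> 'a"
  define W where "W q = (1/2) *\<^sub>R (fst (fst q) + snd (fst q)) + snd q" for q :: "('a \<times> 'a) \<times> 'a"
  have bl: "bounded_linear X" "bounded_linear Y" "bounded_linear W" "bounded_linear (snd :: ('a \<times> 'a) \<times> 'a \<Rightarrow> 'a)"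
    "bounded_linear (fst :: ('a \<times> 'a) \<times> 'a \<Rightarrow> 'a \<times> 'a)"
    unfolding X_def Y_def W_def by (intro bounded_linear_intros)+
  have pl: "bounded_linear (\<lambda>q. (X q, W q))" "bounded_linear (\<lambda>q. (W q, Y q))" "bounded_linear (\<lambda>q. (Y q, W q))"
    using bl by (auto intro: bounded_linear_Pair)
  have fst_T: "distr ?T \<gamma> fst = \<gamma>" by (rule H.distr_pair_fst)
  have fst_T': "distr ?T borel fst = \<gamma>"
    by (subst (2) fst_T[symmetric]) (rule distr_cong, use C(1) in auto)
  have XT: "distr ?T borel X = \<mu>"
    using distr_distr_linear[OF TP bl(5) bounded_linear_fst] by (simp add: fst_T' C X_def[abs_def])
  have YT: "distr ?T borel Y = \<rho>"
    using distr_distr_linear[OF TP bl(5) bounded_linear_snd] by (simp add: fst_T' C Y_def[abs_def])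
  define w where "w = distr ?T borel W"
  define \<gamma>1 where "\<gamma>1 = distr ?T borel (\<lambda>q. (X q, W q))"
  define \<gamma>2 where "\<gamma>2 = distr ?T borel (\<lambda>q. (W q, Y q))"
  have wP: "w \<in> P2" unfolding w_def by (rule P2_linear(3)[OF TP bl(3)])
  have c1: "\<gamma>1 \<in> couplings \<mu> w" using linear_coupling(1)[OF TP bl(1,3)] by (simp add: XT \<gamma>1_def w_def)
  have c2: "\<gamma>2 \<in> couplings w \<rho>" using linear_coupling(1)[OF TP bl(3,2)] by (simp add: YT \<gamma>2_def w_def)
  obtain j1 where j1: "has_ent \<gamma>1 j1"
    using bridge_has_ent[OF \<gamma>P g v] unfolding \<gamma>1_def X_def W_def by blast
  \<comment> \<open>The bridge is symmetric: exchanging the endpoints reduces the second half to the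
    first.\<close>
  obtain j2' where j2': "has_ent (distr ?T borel (\<lambda>q. (Y q, W q))) j2'"
  proof -
    have sw0: "(prod.swap :: 'a \<times> 'a \<Rightarrow> _) = (\<lambda>p. (snd p, fst p))" by auto
    have bsw: "bounded_linear (prod.swap :: 'a \<times> 'a \<Rightarrow> _)" unfolding sw0 by (intro bounded_linear_Pair bounded_linear_intros)
    obtain j where j: "has_ent (distr (distr \<gamma> borel prod.swap \<Otimes>\<^sub>M heat_kernel v) borel (\<lambda>q. (fst (fst q), (1/2) *\<^sub>R (fst (fst q) + snd (fst q)) + snd q))) j"
      using bridge_has_ent[OF P2_linear(3)[OF \<gamma>P bsw] has_ent_swap(1)[OF g] v] by blast
    have "distr (distr \<gamma> borel prod.swap \<Otimes>\<^sub>M heat_kernel v) borel (\<lambda>q. (fst (fst q), (1/2) *\<^sub>R (fst (fst q) + snd (fst q)) + snd q))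
      = distr ?T borel (\<lambda>q. (Y q, W q))"
      by (subst distr_pair_linear[OF \<gamma>P HP bsw]) (auto intro!: continuous_intros simp: Y_def W_def add.commute)
    then show thesis using that j by simp
  qed
  have sw2: "distr (distr ?T borel (\<lambda>q. (Y q, W q))) borel prod.swap = \<gamma>2"
  proof -
    have sw0: "(prod.swap :: 'a \<times> 'a \<Rightarrow> _) = (\<lambda>p. (snd p, fst p))" by auto
    have bsw: "bounded_linear (\<lambda>p :: 'a \<times> 'a. (snd p, fst p))" by (intro bounded_linear_Pair bounded_linear_intros)
    show ?thesis unfolding sw0 distr_distr_linear[OF TP pl(3) bsw] by (simp add: \<gamma>2_def)
  qed
  obtain j2 where j2: "has_ent \<gamma>2 j2" using has_ent_swap(1)[OF j2'] unfolding sw2 by blast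
  have b1: "boltzmann_entropy \<gamma>1 < \<infinity>" "boltzmann_entropy \<gamma>2 < \<infinity>"
    by (simp_all add: boltzmann_has_ent[OF j1] boltzmann_has_ent[OF j2])
  note j1s = has_ent_swap(1)[OF j1]
  have c1s: "distr \<gamma>1 borel prod.swap \<in> couplings w \<mu>" using swap_coupling(1)[OF c1 P(1) wP b1(1)] .
  obtain p where p: "has_ent w p"
    using marginal_has_ent[OF couplings_P2[OF c1s wP P(1)] j1s] couplingsD(2)[OF c1s] by auto
  note j1D = has_entD[OF j1] and j2D = has_entD[OF j2] and pD = has_entD[OF p]
  have [measurable]: "g \<in> borel_measurable (borel \<Otimes>\<^sub>M borel)" "j1 \<in> borel_measurable (borel \<Otimes>\<^sub>M borel)"
    "j2 \<in> borel_measurable (borel \<Otimes>\<^sub>M borel)" "p \<in> borel_measurable borel"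
    using gD(1) j1D(1) j2D(1) pD(1) by (simp_all add: borel_pair_measurable)
  have mj2: "AE x in lborel. (\<integral>\<^sup>+y. ennreal (j2 (x, y)) \<partial>lborel) = ennreal (p x)"
    by (rule density_marginal_AE[OF j2D(1) pD(1) j2D(2)])
      (use couplingsD(2)[OF c2] in \<open>simp add: j2D(3)[symmetric] pD(3)[symmetric]\<close>)
  have mj1: "AE x in lborel. (\<integral>\<^sup>+y. ennreal (j1 (y, x)) \<partial>lborel) = ennreal (p x)"
  proof -
    note sD = has_entD[OF j1s]
    have "AE x in lborel. (\<integral>\<^sup>+y. ennreal (j1 (prod.swap (x, y))) \<partial>lborel) = ennreal (p x)"
      by (rule density_marginal_AE[OF sD(1) pD(1) sD(2)])
        (use couplingsD(2)[OF c1s] in \<open>simp add: sD(3)[symmetric] pD(3)[symmetric]\<close>)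
    then show ?thesis by simp
  qed
  define b :: "'a \<Rightarrow> real" where "b = heat_density v"
  have bm[measurable]: "b \<in> borel_measurable borel" and b0: "b z > 0" for z using heat_density_pos[OF v] by (simp_all add: b_def)
  note hint = nn_integral_heat_kernel[where 'a='a, OF v, folded b_def]
  have sG[measurable_cong]: "sets \<gamma> = sets (borel \<Otimes>\<^sub>M borel)" using C(1) by (simp add: sets_borel_prod)
  have [measurable_cong]: "sets (heat_kernel v :: 'a measure) = sets borel" using v by simp
  have XYW[measurable]: "X \<in> measurable ((borel \<Otimes>\<^sub>M borel) \<Otimes>\<^sub>M borel) borel" "Y \<in> measurable ((borel \<Otimes>\<^sub>M borel) \<Otimes>\<^sub>M borel) borel"
    "W \<in> measurable ((borel \<Otimes>\<^sub>M borel) \<Otimes>\<^sub>M borel) borel"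
    unfolding X_def Y_def W_def by measurable
  \<comment> \<open>\<open>A\<close> is the density of the true law in the coordinates start, end
    and deviation of the midpoint; \<open>B\<close> is that of the Markov chain with the same two
    halves, in the same coordinates. Passing from deviation to midpoint is a translation, so no
    Jacobian enters.\<close>
  define A where "A q = g (fst q) * b (snd q)" for q
  define B where "B q = j1 (X q, W q) * j2 (W q, Y q) / p (W q)" for q
  have AB[measurable]: "A \<in> borel_measurable ((borel \<Otimes>\<^sub>M borel) \<Otimes>\<^sub>M borel)" "B \<in> borel_measurable ((borel \<Otimes>\<^sub>M borel) \<Otimes>\<^sub>M borel)"
    unfolding A_def B_def by measurable
  have AB0: "0 \<le> A q" "0 \<le> B q" for q using gD(2) b0[of "snd q"] j1D(2) j2D(2) pD(2) by (simp_all add: A_def B_def less_imp_le)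
  have pull: "integrable ?T (\<lambda>q. ln (r (f q)))" "(\<integral>q. ln (r (f q)) \<partial>?T) = Ent (distr ?T borel f)" "AE q in ?T. r (f q) > 0"
    if f: "bounded_linear f" and r: "has_ent (distr ?T borel f) r" for f :: "('a \<times> 'a) \<times> 'a \<Rightarrow> 'b::euclidean_space" and r
  proof -
    note fm = P2_linear(1)[OF TP f] and l = has_ent_ln[OF r]
    have lm: "(\<lambda>x. ln (r x)) \<in> borel_measurable borel" using has_entD(1)[OF r] by measurable
    show "integrable ?T (\<lambda>q. ln (r (f q)))" using integrable_distr[OF fm l(1)] .
    show "(\<integral>q. ln (r (f q)) \<partial>?T) = Ent (distr ?T borel f)" unfolding Ent_eq[OF r] by (rule integral_distr[OF fm lm, symmetric])
    show "AE q in ?T. r (f q) > 0" by (rule AE_distrD[OF fm l(3)])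
  qed
  have lg: "integrable ?T (\<lambda>q. ln (g (fst q)))" "(\<integral>q. ln (g (fst q)) \<partial>?T) = Ent \<gamma>" "AE q in ?T. g (fst q) > 0"
    using pull[OF bl(5), of g] g unfolding fst_T' by auto
  note l1 = pull[OF pl(1), folded \<gamma>1_def, OF j1] and l2 = pull[OF pl(2), folded \<gamma>2_def, OF j2]
    and lp = pull[OF bl(3), folded w_def, OF p]
  define Z where "Z = (\<integral>q. (norm (snd q))\<^sup>2 \<partial>?T)"
  have iZ: "integrable ?T (\<lambda>q. (norm (snd q))\<^sup>2)" by (rule P2_linear(2)[OF TP bl(4)])
  have lb: "integrable ?T (\<lambda>q. ln (b (snd q)))" "(\<integral>q. ln (b (snd q)) \<partial>?T) = - (real DIM('a) / 2) * ln (2 * pi * v) - Z / (2 * v)"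
    unfolding b_def ln_heat_density[OF v] using iZ T.prob_space by (simp_all add: Z_def)
  have pos: "AE q in ?T. g (fst q) > 0 \<and> j1 (X q, W q) > 0 \<and> j2 (W q, Y q) > 0 \<and> p (W q) > 0"
    using lg(3) l1(3) l2(3) lp(3) by eventually_elim simp
  \<comment> \<open>Only an inequality, since \<open>B\<close> may charge the zeros of
    \<open>A\<close>.\<close>
  have nnB: "(\<integral>\<^sup>+q. ennreal (B q / A q) \<partial>?T) \<le> 1"
  proof -
    have "(\<integral>\<^sup>+q. ennreal (B q / A q) \<partial>?T) = (\<integral>\<^sup>+r. \<integral>\<^sup>+z. ennreal (B (r, z) / A (r, z)) \<partial>heat_kernel v \<partial>\<gamma>)"
      by (rule H.nn_integral_fst[symmetric]) measurable
    also have "\<dots> = (\<integral>\<^sup>+r. \<integral>\<^sup>+z. ennreal (b z) * ennreal (B (r, z) / A (r, z)) \<partial>lborel \<partial>\<gamma>)"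
      by (intro nn_integral_cong hint) (measurable, simp_all add: space_pair_measure)
    also have "\<dots> = (\<integral>\<^sup>+x. \<integral>\<^sup>+y. ennreal (g (x, y)) * (\<integral>\<^sup>+z. ennreal (b z) * ennreal (B ((x, y), z) / A ((x, y), z)) \<partial>lborel) \<partial>lborel \<partial>lborel)"
      by (rule nn_integral_has_ent_pair[OF g]) (unfold borel_pair_measurable, measurable)
    also have "\<dots> \<le> (\<integral>\<^sup>+x. \<integral>\<^sup>+y. \<integral>\<^sup>+w. ennreal (j1 (x, w) * j2 (w, y) / p w) \<partial>lborel \<partial>lborel \<partial>lborel)"
    proof (intro nn_integral_mono)
      fix x y :: 'a
      have "ennreal (g (x, y)) * (\<integral>\<^sup>+z. ennreal (b z) * ennreal (B ((x, y), z) / A ((x, y), z)) \<partial>lborel)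
        = (\<integral>\<^sup>+z. ennreal (g (x, y)) * (ennreal (b z) * ennreal (B ((x, y), z) / A ((x, y), z))) \<partial>lborel)"
        by (rule nn_integral_cmult[symmetric]) measurable
      also have "\<dots> \<le> (\<integral>\<^sup>+z. ennreal (B ((x, y), z)) \<partial>lborel)"
      proof (intro nn_integral_mono)
        fix z :: 'a
        have "ennreal (g (x, y)) * (ennreal (b z) * ennreal (B ((x, y), z) / A ((x, y), z))) = ennreal (A ((x, y), z) * (B ((x, y), z) / A ((x, y), z)))"
          using gD(2) b0[of z] AB0 by (simp add: A_def ennreal_mult[symmetric] less_imp_le mult.assoc)
        also have "\<dots> \<le> ennreal (B ((x, y), z))" using AB0[of "((x, y), z)"] by (intro ennreal_leI) (cases "A ((x, y), z) = 0"; simp)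
        finally show "ennreal (g (x, y)) * (ennreal (b z) * ennreal (B ((x, y), z) / A ((x, y), z))) \<le> ennreal (B ((x, y), z))" .
      qed
      also have "\<dots> = (\<integral>\<^sup>+z. (\<lambda>w. ennreal (j1 (x, w) * j2 (w, y) / p w)) ((1/2) *\<^sub>R (x + y) + z) \<partial>lborel)"
        by (simp add: B_def X_def Y_def W_def)
      also have "\<dots> = (\<integral>\<^sup>+w. ennreal (j1 (x, w) * j2 (w, y) / p w) \<partial>lborel)"
        by (rule nn_integral_lborel_shift) measurable
      finally show "ennreal (g (x, y)) * (\<integral>\<^sup>+z. ennreal (b z) * ennreal (B ((x, y), z) / A ((x, y), z)) \<partial>lborel) \<le> (\<integral>\<^sup>+w. ennreal (j1 (x, w) * j2 (w, y) / p w) \<partial>lborel)" .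
    qed
    also have "\<dots> = (\<integral>\<^sup>+x. \<integral>\<^sup>+w. \<integral>\<^sup>+y. ennreal (j1 (x, w) * j2 (w, y) / p w) \<partial>lborel \<partial>lborel \<partial>lborel)"
      by (intro nn_integral_cong lborel_pair.Fubini') measurable
    also have "\<dots> = (\<integral>\<^sup>+w. \<integral>\<^sup>+x. \<integral>\<^sup>+y. ennreal (j1 (x, w) * j2 (w, y) / p w) \<partial>lborel \<partial>lborel \<partial>lborel)"
      by (intro lborel_pair.Fubini') measurable
    also have "\<dots> \<le> (\<integral>\<^sup>+w. ennreal (p w) \<partial>lborel)"
    proof (rule nn_integral_mono_AE, use mj1 mj2 in eventually_elim)
      case (elim w)
      have "(\<integral>\<^sup>+x. \<integral>\<^sup>+y. ennreal (j1 (x, w) * j2 (w, y) / p w) \<partial>lborel \<partial>lborel)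
        = (\<integral>\<^sup>+x. \<integral>\<^sup>+y. ennreal (1 / p w) * ennreal (j1 (x, w)) * ennreal (j2 (w, y)) \<partial>lborel \<partial>lborel)"
        using j1D(2) j2D(2) pD(2)[of w] by (simp add: ennreal_mult[symmetric])
      also have "\<dots> = (\<integral>\<^sup>+x. ennreal (1 / p w) * ennreal (j1 (x, w)) * ennreal (p w) \<partial>lborel)"
        by (intro nn_integral_cong) (simp add: nn_integral_cmult elim(2))
      also have "\<dots> = ennreal (1 / p w) * ennreal (p w) * ennreal (p w)"
        by (simp add: nn_integral_cmult nn_integral_multc elim(1))
      also have "\<dots> \<le> ennreal (p w)"
        using pD(2)[of w] by (cases "p w = 0") (auto simp: ennreal_mult[symmetric])
      finally show ?case .
    qed
    also have "\<dots> = 1"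
      using prob_space.emeasure_space_1[OF P2D(2)[OF wP]] unfolding pD(3) by (simp add: emeasure_density)
    finally show ?thesis .
  qed
  have iBA: "integrable ?T (\<lambda>q. B q / A q)" "(\<integral>q. B q / A q \<partial>?T) \<le> 1"
  proof -
    have nn0: "0 \<le> B q / A q" for q using AB0 by simp
    show i: "integrable ?T (\<lambda>q. B q / A q)"
    proof (rule integrableI_bounded)
      have "(\<integral>\<^sup>+q. ennreal (norm (B q / A q)) \<partial>?T) = (\<integral>\<^sup>+q. ennreal (B q / A q) \<partial>?T)"
        using nn0 by (intro nn_integral_cong) (simp only: real_norm_def abs_of_nonneg)
      also have "\<dots> < \<infinity>" using nnB by (simp add: le_less_trans[OF nnB])
      finally show "(\<integral>\<^sup>+q. ennreal (norm (B q / A q)) \<partial>?T) < \<infinity>" .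
    qed measurable
    have "ennreal (\<integral>q. B q / A q \<partial>?T) \<le> ennreal 1"
      using nnB nn_integral_eq_integral[OF i] nn0 by simp
    then show "(\<integral>q. B q / A q \<partial>?T) \<le> 1" by (subst (asm) ennreal_le_iff) auto
  qed
  \<comment> \<open>The nonnegativity of relative entropy: \<open>ln x \<le> x - 1\<close> at
    \<open>x = B q / A q\<close>.\<close>
  have "(\<integral>q. (ln (j1 (X q, W q)) + ln (j2 (W q, Y q)) - ln (p (W q))) - (ln (g (fst q)) + ln (b (snd q))) \<partial>?T) \<le> (\<integral>q. B q / A q - 1 \<partial>?T)"
  proof (rule integral_mono_AE)
    show "AE q in ?T. (ln (j1 (X q, W q)) + ln (j2 (W q, Y q)) - ln (p (W q))) - (ln (g (fst q)) + ln (b (snd q))) \<le> B q / A q - 1"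
      using pos
    proof eventually_elim
      case (elim q)
      have "B q / A q > 0" using elim b0[of "snd q"] by (simp add: A_def B_def)
      then have "ln (B q / A q) \<le> B q / A q - 1" by (rule ln_le_minus_one)
      moreover have "ln (B q / A q) = (ln (j1 (X q, W q)) + ln (j2 (W q, Y q)) - ln (p (W q))) - (ln (g (fst q)) + ln (b (snd q)))"
        using elim b0[of "snd q"] by (simp add: A_def B_def ln_div ln_mult)
      ultimately show ?case by simp
    qed
  qed (use iBA l1 l2 lp lg lb in auto)
  also have "\<dots> \<le> 0" using iBA T.prob_space by simp
  finally have ent: "Ent \<gamma>1 + Ent \<gamma>2 - Ent w - Ent \<gamma> - (- (real DIM('a) / 2) * ln (2 * pi * v) - Z / (2 * v)) \<le> 0"
    using l1 l2 lp lg lb by (simp add: Bochner_Integration.integral_diff Bochner_Integration.integral_add)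
  define Q where "Q = (\<integral>q. (norm (X q - Y q))\<^sup>2 \<partial>?T)"
  have Q: "(\<integral>p. (norm (fst p - snd p))\<^sup>2 \<partial>\<gamma>) = Q"
  proof -
    have "bounded_linear (\<lambda>p :: 'a \<times> 'a. fst p - snd p)" by (intro bounded_linear_intros)
    from integral_distr_norm_sq[OF TP bl(5) this] show ?thesis unfolding fst_T' by (simp add: Q_def X_def Y_def)
  qed
  have Q1: "(\<integral>p. (norm (fst p - snd p))\<^sup>2 \<partial>\<gamma>1) = (\<integral>q. (norm (X q - W q))\<^sup>2 \<partial>?T)"
    unfolding \<gamma>1_def by (rule linear_coupling(2)[OF TP bl(1,3)])
  have Q2: "(\<integral>p. (norm (fst p - snd p))\<^sup>2 \<partial>\<gamma>2) = (\<integral>q. (norm (W q - Y q))\<^sup>2 \<partial>?T)"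
    unfolding \<gamma>2_def by (rule linear_coupling(2)[OF TP bl(3,2)])
  have i3: "integrable ?T (\<lambda>q. (norm (X q - Y q))\<^sup>2)" "integrable ?T (\<lambda>q. (norm (X q - W q))\<^sup>2)" "integrable ?T (\<lambda>q. (norm (W q - Y q))\<^sup>2)"
    using bl by (auto intro!: P2_linear(2)[OF TP] bounded_linear_sub)
  have "(\<integral>q. (norm (X q - W q))\<^sup>2 \<partial>?T) + (\<integral>q. (norm (W q - Y q))\<^sup>2 \<partial>?T) = (\<integral>q. (norm (X q - W q))\<^sup>2 + (norm (W q - Y q))\<^sup>2 \<partial>?T)"
    using i3 by simp
  \<comment> \<open>Parallelogram law: through the midpoint the squared distances add up to half of
    the original one plus twice the squared deviation.\<close>
  also have "\<dots> = (\<integral>q. (norm (X q - Y q))\<^sup>2 / 2 + 2 * (norm (snd q))\<^sup>2 \<partial>?T)"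
  proof (rule Bochner_Integration.integral_cong[OF refl])
    fix q :: "('a \<times> 'a) \<times> 'a"
    define u z where "u = X q - Y q" "z = snd q"
    have 1: "X q - W q = (1/2) *\<^sub>R u - z" "W q - Y q = (1/2) *\<^sub>R u + z"
    proof -
      have "X q = (1/2) *\<^sub>R X q + (1/2) *\<^sub>R X q" "Y q = (1/2) *\<^sub>R Y q + (1/2) *\<^sub>R Y q"
        by (simp_all add: scaleR_add_left[symmetric])
      then show "X q - W q = (1/2) *\<^sub>R u - z" "W q - Y q = (1/2) *\<^sub>R u + z"
        unfolding W_def u_z_def X_def Y_def by (simp_all add: algebra_simps)
    qed
    show "(norm (X q - W q))\<^sup>2 + (norm (W q - Y q))\<^sup>2 = (norm (X q - Y q))\<^sup>2 / 2 + 2 * (norm (snd q))\<^sup>2"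
      unfolding 1 u_z_def[symmetric]
      by (simp add: power2_norm_eq_inner inner_diff_left inner_diff_right inner_add_left inner_add_right inner_commute)
  qed
  also have "\<dots> = Q / 2 + 2 * Z" using i3 iZ by (simp add: Q_def Z_def)
  finally have cost: "(\<integral>q. (norm (X q - W q))\<^sup>2 \<partial>?T) + (\<integral>q. (norm (W q - Y q))\<^sup>2 \<partial>?T) = Q / 2 + 2 * Z" .
  have l: "ln (2 * pi * v) = ln (pi * e) - ln 2" "ln (2 * pi * (e/2)) = ln (pi * e)" "ln (2 * pi * e) = ln (pi * e) + ln 2"
    using e by (simp_all add: v_def ln_mult ln_div)
  have "e * (Ent \<gamma>1 + Ent \<gamma>2 - Ent w - Ent \<gamma> + (real DIM('a) / 2) * (ln (pi * e) - ln 2) + Z / (2 * v)) \<le> 0"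
    using ent e unfolding l(1) by (intro mult_nonneg_nonpos) auto
  \<comment> \<open>With \<open>v = e / 4\<close> the deviation in the transport part cancels the
    one in the Gaussian entropy; the logarithmic constants balance in the same way.\<close>
  moreover have "e * (Z / (2 * v)) = 2 * Z" using e by (simp add: v_def)
  ultimately have "2 * schcost (e/2) \<gamma>1 + 2 * schcost (e/2) \<gamma>2 - e * Ent w \<le> schcost e \<gamma>"
    using cost unfolding schcost_def Q Q1 Q2 l by (simp add: algebra_simps add_divide_distrib)
  then show thesis using that wP c1 c2 b1 by blast
qed

text \<open>One midpoint and Talagrand's inequality from both ends of both halves give two bounds in
  which \<open>Ent w\<close> has opposite signs; their average leaves smearing at scale
  \<open>e / 2\<close>. Each further splitting halves the scale. The entropies of the midpoints
  cancel again, and the factor 2 lost in \<open>W2_sq_triangle\<close> at \<open>c = 1\<close> is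
  returned by the doubled costs of the halves.\<close>

lemma schcost_lower_dyadic:
  fixes \<mu> \<rho> :: "'a::euclidean_space measure"
  assumes "\<gamma> \<in> couplings \<mu> \<rho>" "\<mu> \<in> P2" "\<rho> \<in> P2" "boltzmann_entropy \<gamma> < \<infinity>" "e > 0"
  shows "e / 2 * (Ent \<mu> + Ent \<rho>) + ((W2 \<mu> \<rho>)\<^sup>2 + (W2 (noise (e / 2 ^ Suc k) \<mu>) (noise (e / 2 ^ Suc k) \<rho>))\<^sup>2) / 4 \<le> schcost e \<gamma>"
  using assms
proof (induction k arbitrary: e \<gamma> \<mu> \<rho>)
  case 0
  obtain w \<gamma>1 \<gamma>2 where w: "w \<in> P2" "\<gamma>1 \<in> couplings \<mu> w" "\<gamma>2 \<in> couplings w \<rho>"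
    "boltzmann_entropy \<gamma>1 < \<infinity>" "boltzmann_entropy \<gamma>2 < \<infinity>"
    and S: "2 * schcost (e/2) \<gamma>1 + 2 * schcost (e/2) \<gamma>2 - e * Ent w \<le> schcost e \<gamma>"
    by (rule schcost_split[OF 0])
  have e2: "e/2 > 0" using 0 by simp
  note s1 = swap_coupling[OF w(2) 0(2) w(1) w(4)] and s2 = swap_coupling[OF w(3) w(1) 0(3) w(5)]
  note T1 = schcost_ge_talagrand[OF w(2) 0(2) w(1) w(4) e2]
  note T1' = schcost_ge_talagrand[OF s1(1) w(1) 0(2) s1(2) e2, unfolded s1(3)]
  note T2 = schcost_ge_talagrand[OF w(3) w(1) 0(3) w(5) e2]
  note T2' = schcost_ge_talagrand[OF s2(1) 0(3) w(1) s2(2) e2, unfolded s2(3)]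
  have N: "noise (e/2) \<mu> \<in> P2" "noise (e/2) w \<in> P2" "noise (e/2) \<rho> \<in> P2" by (rule noise_P2(1)[OF _ e2], fact)+
  have t1: "(W2 \<mu> \<rho>)\<^sup>2 \<le> 2 * (W2 \<mu> (noise (e/2) w))\<^sup>2 + 2 * (W2 \<rho> (noise (e/2) w))\<^sup>2"
    using W2_sq_triangle[OF 0(2) N(2) 0(3), of 1] W2_commute[OF N(2) 0(3)] by simp
  have t2: "(W2 (noise (e/2) \<mu>) (noise (e/2) \<rho>))\<^sup>2 \<le> 2 * (W2 w (noise (e/2) \<mu>))\<^sup>2 + 2 * (W2 w (noise (e/2) \<rho>))\<^sup>2"
    using W2_sq_triangle[OF N(1) w(1) N(3), of 1] W2_commute[OF N(1) w(1)] by simp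
  \<comment> \<open>Here both halves start at \<open>w\<close>, in the next bound at the outer ends;
    \<open>e * Ent w\<close> enters with opposite signs.\<close>
  have a: "(W2 \<mu> (noise (e/2) w))\<^sup>2 + (W2 \<rho> (noise (e/2) w))\<^sup>2 + e * Ent w \<le> schcost e \<gamma>"
    using S T1' T2 by linarith
  have b: "(W2 w (noise (e/2) \<mu>))\<^sup>2 + (W2 w (noise (e/2) \<rho>))\<^sup>2 + e * Ent \<mu> + e * Ent \<rho> - e * Ent w \<le> schcost e \<gamma>"
    using S T1 T2' by linarith
  have "e / 2 * (Ent \<mu> + Ent \<rho>) = (e * Ent \<mu> + e * Ent \<rho>) / 2" by (simp add: algebra_simps)
  moreover have gen: "h / 2 + (x + y) / 4 \<le> S" if "x' + w' \<le> S" "y' + h - w' \<le> S" "x \<le> 2 * x'" "y \<le> 2 * y'" for h x y x' y' w' S :: real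
    using that by (simp add: field_simps)
  have "(e * Ent \<mu> + e * Ent \<rho>) / 2 + ((W2 \<mu> \<rho>)\<^sup>2 + (W2 (noise (e / 2) \<mu>) (noise (e / 2) \<rho>))\<^sup>2) / 4 \<le> schcost e \<gamma>"
    by (rule gen[where x'="(W2 \<mu> (noise (e/2) w))\<^sup>2 + (W2 \<rho> (noise (e/2) w))\<^sup>2" and w'="e * Ent w"
        and y'="(W2 w (noise (e/2) \<mu>))\<^sup>2 + (W2 w (noise (e/2) \<rho>))\<^sup>2"]) ((use a b in linarith)+, use t1 t2 in \<open>simp_all only: distrib_left\<close>)
  ultimately show ?case by simp
next
  case (Suc k)
  obtain w \<gamma>1 \<gamma>2 where w: "w \<in> P2" "\<gamma>1 \<in> couplings \<mu> w" "\<gamma>2 \<in> couplings w \<rho>"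
    "boltzmann_entropy \<gamma>1 < \<infinity>" "boltzmann_entropy \<gamma>2 < \<infinity>"
    and S: "2 * schcost (e/2) \<gamma>1 + 2 * schcost (e/2) \<gamma>2 - e * Ent w \<le> schcost e \<gamma>"
    by (rule schcost_split[OF Suc.prems])
  have e2: "e/2 > 0" using Suc.prems by simp
  define d where "d = e / 2 ^ Suc (Suc k)"
  have d: "e/2 / 2 ^ Suc k = d" "d > 0" using Suc.prems by (simp_all add: d_def)
  note I1 = Suc.IH[OF w(2) Suc.prems(2) w(1) w(4) e2, unfolded d(1)]
  note I2 = Suc.IH[OF w(3) w(1) Suc.prems(3) w(5) e2, unfolded d(1)]
  have N: "noise d \<mu> \<in> P2" "noise d w \<in> P2" "noise d \<rho> \<in> P2" by (rule noise_P2(1)[OF _ d(2)], fact)+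
  have t1: "(W2 \<mu> \<rho>)\<^sup>2 \<le> 2 * (W2 \<mu> w)\<^sup>2 + 2 * (W2 w \<rho>)\<^sup>2"
    using W2_sq_triangle[OF Suc.prems(2) w(1) Suc.prems(3), of 1] by simp
  have t2: "(W2 (noise d \<mu>) (noise d \<rho>))\<^sup>2 \<le> 2 * (W2 (noise d \<mu>) (noise d w))\<^sup>2 + 2 * (W2 (noise d w) (noise d \<rho>))\<^sup>2"
    using W2_sq_triangle[OF N, of 1] by simp
  have eq: "e / 2 * (Ent \<mu> + Ent \<rho>) = (e * Ent \<mu> + e * Ent \<rho>) / 2" "e/2/2 * (Ent \<mu> + Ent w) = (e * Ent \<mu> + e * Ent w) / 4"
    "e/2/2 * (Ent w + Ent \<rho>) = (e * Ent w + e * Ent \<rho>) / 4" by (simp_all add: algebra_simps)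
  have gen: "(a + c) / 2 + (x + y) / 4 \<le> S" if "2 * s1 + 2 * s2 - b \<le> S" "(a + b) / 4 + (x1 + y1) / 4 \<le> s1"
    "(b + c) / 4 + (x2 + y2) / 4 \<le> s2" "x \<le> 2 * x1 + 2 * x2" "y \<le> 2 * y1 + 2 * y2"
    for a b c x y x1 x2 y1 y2 s1 s2 S :: real
    using that by (simp add: field_simps)
  show ?case
    using gen[OF S I1[unfolded eq] I2[unfolded eq] t1 t2] unfolding eq d_def[symmetric] .
qed

text \<open>Along the dyadic estimate the scale of the smearing tends to 0, so the smeared distance
  may be replaced by \<open>W2 \<mu> \<rho>\<close>.\<close>

proposition schcost_lower:
  fixes \<mu> \<rho> :: "'a::euclidean_space measure"
  assumes \<gamma>: "\<gamma> \<in> couplings \<mu> \<rho>" and P: "\<mu> \<in> P2" "\<rho> \<in> P2" and fin: "boltzmann_entropy \<gamma> < \<infinity>" and e: "e > 0"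
  shows "e / 2 * (Ent \<mu> + Ent \<rho>) + (W2 \<mu> \<rho>)\<^sup>2 / 2 \<le> schcost e \<gamma>"
proof -
  define B where "B = 4 * (schcost e \<gamma> - e / 2 * (Ent \<mu> + Ent \<rho>)) - (W2 \<mu> \<rho>)\<^sup>2"
  define D where "D = real DIM('a)"
  have Bk: "(W2 (noise (e / 2 ^ Suc k) \<mu>) (noise (e / 2 ^ Suc k) \<rho>))\<^sup>2 \<le> B" for k
  proof -
    have "y \<le> 4 * (S - h) - x" if "h + (x + y) / 4 \<le> S" for h x y S :: real using that by (simp add: field_simps)
    from this[OF schcost_lower_dyadic[OF \<gamma> P fin e, of k]] show ?thesis by (simp only: B_def)
  qed
  \<comment> \<open>The smearing is removed at either end by the weighted triangle inequality. For
    fixed \<open>c\<close> the errors vanish as \<open>k\<close> grows, and only afterwards does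
    \<open>c\<close> tend to 0.\<close>
  have step: "(W2 \<mu> \<rho>)\<^sup>2 \<le> (1 + c) * ((1 + c) * B)" if c: "c > 0" for c :: real
  proof -
    have bd: "(W2 \<mu> \<rho>)\<^sup>2 \<le> (1 + c) * ((1 + c) * B + (1 + 1/c) * (e / 2 ^ Suc k * D)) + (1 + 1/c) * (e / 2 ^ Suc k * D)" for k
    proof -
      define d where "d = e / 2 ^ Suc k"
      have d: "d > 0" using e by (simp add: d_def)
      note N1 = noise_P2[OF P(1) d] and N2 = noise_P2[OF P(2) d]
      have "(W2 (noise d \<mu>) \<rho>)\<^sup>2 \<le> (1 + c) * (W2 (noise d \<mu>) (noise d \<rho>))\<^sup>2 + (1 + 1/c) * (W2 (noise d \<rho>) \<rho>)\<^sup>2"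
        by (rule W2_sq_triangle[OF N1(1) N2(1) P(2) c])
      also have "\<dots> \<le> (1 + c) * B + (1 + 1/c) * (d * D)"
        using Bk[of k] N2(2) c W2_commute[OF P(2) N2(1)] unfolding d_def[symmetric] D_def by (intro add_mono mult_left_mono) auto
      finally have 1: "(W2 (noise d \<mu>) \<rho>)\<^sup>2 \<le> (1 + c) * B + (1 + 1/c) * (d * D)" .
      have "(W2 \<mu> \<rho>)\<^sup>2 = (W2 \<rho> \<mu>)\<^sup>2" using W2_commute[OF P] by simp
      also have "\<dots> \<le> (1 + c) * (W2 \<rho> (noise d \<mu>))\<^sup>2 + (1 + 1/c) * (W2 (noise d \<mu>) \<mu>)\<^sup>2"
        by (rule W2_sq_triangle[OF P(2) N1(1) P(1) c])
      also have "\<dots> \<le> (1 + c) * ((1 + c) * B + (1 + 1/c) * (d * D)) + (1 + 1/c) * (d * D)"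
        using 1 N1(2) c W2_commute[OF P(1) N1(1)] W2_commute[OF P(2) N1(1)] unfolding D_def by (intro add_mono mult_left_mono) auto
      finally show ?thesis unfolding d_def .
    qed
    have "(\<lambda>k. e / 2 ^ Suc k) \<longlonglongrightarrow> 0"
    proof -
      have "(\<lambda>k. (e/2) * (1/2) ^ k) \<longlonglongrightarrow> (e/2) * 0" by (intro tendsto_mult tendsto_const LIMSEQ_realpow_zero) auto
      then show ?thesis by (simp add: power_divide)
    qed
    then have "(\<lambda>k. (1 + c) * ((1 + c) * B + (1 + 1/c) * (e / 2 ^ Suc k * D)) + (1 + 1/c) * (e / 2 ^ Suc k * D))
      \<longlonglongrightarrow> (1 + c) * ((1 + c) * B + (1 + 1/c) * (0 * D)) + (1 + 1/c) * (0 * D)"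
      by (intro tendsto_intros)
    from LIMSEQ_le_const[OF this] bd show ?thesis by auto
  qed
  have "(\<lambda>n. (1 + 1 / real (Suc n)) * ((1 + 1 / real (Suc n)) * B)) \<longlonglongrightarrow> (1 + 0) * ((1 + 0) * B)"
    by (intro tendsto_intros LIMSEQ_Suc[OF lim_1_over_n])
  from LIMSEQ_le_const[OF this] step have "(W2 \<mu> \<rho>)\<^sup>2 \<le> B" by auto
  moreover have "h + x / 2 \<le> S" if "x \<le> 4 * (S - h) - x" for h x S :: real using that by simp
  ultimately show ?thesis unfolding B_def by blast
qed

section \<open>Upper bound for the cost of a smeared target\<close>

lemma lborel_distr_uminus_euclidean: "distr lborel borel uminus = (lborel :: 'a::euclidean_space measure)"
  using lborel_affine[of "-1" "0 :: 'a"] by (simp add: density_1 one_ennreal_def[symmetric])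

lemma heat_kernel_uminus:
  assumes v: "v > 0"
  shows "distr (heat_kernel v) borel uminus = (heat_kernel v :: 'a::euclidean_space measure)"
proof (rule measure_eqI)
  fix A :: "'a set" assume "A \<in> sets (distr (heat_kernel v) borel uminus)"
  then have A[measurable]: "A \<in> sets borel" by simp
  have [measurable_cong]: "sets (heat_kernel v :: 'a measure) = sets borel" using v by simp
  have "emeasure (distr (heat_kernel v) borel uminus) A = (\<integral>\<^sup>+z. indicator A (- z) \<partial>heat_kernel v)"
    by (subst nn_integral_indicator[symmetric], simp, subst nn_integral_distr) auto
  also have "\<dots> = (\<integral>\<^sup>+z. ennreal (heat_density v z) * indicator A (- z) \<partial>lborel)"
    unfolding heat_kernel_density[OF v] by (rule nn_integral_density) auto
  also have "\<dots> = (\<integral>\<^sup>+z. ennreal (heat_density v (- z)) * indicator A (- z) \<partial>lborel)"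
    by (simp add: heat_density_minus)
  also have "\<dots> = (\<integral>\<^sup>+z. ennreal (heat_density v z) * indicator A z \<partial>distr lborel borel uminus)"
    by (subst nn_integral_distr) auto
  also have "\<dots> = emeasure (heat_kernel v) A"
    unfolding lborel_distr_uminus_euclidean heat_kernel_density[OF v] by (subst emeasure_density) auto
  finally show "emeasure (distr (heat_kernel v) borel uminus) A = emeasure (heat_kernel v) A" .
qed (use v in simp)

text \<open>The noise is symmetric, so changing its sign does not affect the left side; averaging
  over both signs is the parallelogram law and removes the cross term.\<close>

lemma heat_cost_add:
  fixes \<gamma> :: "'b::euclidean_space measure" and f :: "'b \<Rightarrow> 'a::euclidean_space"
  assumes \<gamma>: "\<gamma> \<in> P2" and f: "bounded_linear f" and v: "v > 0"
  shows "(\<integral>q. (norm (f (fst q) - snd q))\<^sup>2 \<partial>(\<gamma> \<Otimes>\<^sub>M heat_kernel v)) = (\<integral>p. (norm (f p))\<^sup>2 \<partial>\<gamma>) + v * real DIM('a)"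
proof -
  let ?T = "\<gamma> \<Otimes>\<^sub>M (heat_kernel v :: 'a measure)"
  note HP = heat_kernel_moment[OF v, where 'a='a]
  note TP = P2_pair[OF \<gamma> HP(1)]
  interpret G: prob_space \<gamma> by (rule P2D(2)[OF \<gamma>])
  interpret H: prob_space "heat_kernel v :: 'a measure" by (rule P2D(2)[OF HP(1)])
  have [measurable_cong]: "sets (heat_kernel v :: 'a measure) = sets borel" "sets \<gamma> = sets borel" using v P2D(1)[OF \<gamma>] by auto
  have blf: "bounded_linear (\<lambda>q :: 'b \<times> 'a. f (fst q))" by (rule bounded_linear_compose[OF f bounded_linear_fst])
  have bl: "bounded_linear (\<lambda>q :: 'b \<times> 'a. f (fst q) - snd q)" "bounded_linear (\<lambda>q :: 'b \<times> 'a. f (fst q) + snd q)" "bounded_linear (\<lambda>q :: 'b \<times> 'a. snd q)"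
    by (intro bounded_linear_sub bounded_linear_add blf bounded_linear_snd)+
  note i = P2_linear(2)[OF TP(1) bl(1)] P2_linear(2)[OF TP(1) bl(2)] P2_linear(2)[OF TP(1) blf] P2_linear(2)[OF TP(1) bl(3)]
  have fm[measurable]: "f \<in> borel_measurable borel" by (rule borel_measurable_continuous_onI[OF linear_continuous_on[OF f]])
  have "(\<integral>\<^sup>+q. ennreal ((norm (f (fst q) - snd q))\<^sup>2) \<partial>?T) = (\<integral>\<^sup>+p. \<integral>\<^sup>+z. ennreal ((norm (f p - z))\<^sup>2) \<partial>heat_kernel v \<partial>\<gamma>)"
    by (subst H.nn_integral_fst[symmetric]) auto
  also have "\<dots> = (\<integral>\<^sup>+p. \<integral>\<^sup>+z. ennreal ((norm (f p - z))\<^sup>2) \<partial>distr (heat_kernel v) borel uminus \<partial>\<gamma>)"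
    by (simp add: heat_kernel_uminus[OF v])
  also have "\<dots> = (\<integral>\<^sup>+p. \<integral>\<^sup>+z. ennreal ((norm (f p + z))\<^sup>2) \<partial>heat_kernel v \<partial>\<gamma>)"
    by (intro nn_integral_cong, subst nn_integral_distr) auto
  also have "\<dots> = (\<integral>\<^sup>+q. ennreal ((norm (f (fst q) + snd q))\<^sup>2) \<partial>?T)"
    by (subst H.nn_integral_fst[symmetric]) auto
  finally have "(\<integral>q. (norm (f (fst q) - snd q))\<^sup>2 \<partial>?T) = (\<integral>q. (norm (f (fst q) + snd q))\<^sup>2 \<partial>?T)"
    using i by (simp add: integral_eq_nn_integral)
  then have "2 * (\<integral>q. (norm (f (fst q) - snd q))\<^sup>2 \<partial>?T) = (\<integral>q. (norm (f (fst q) - snd q))\<^sup>2 + (norm (f (fst q) + snd q))\<^sup>2 \<partial>?T)"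
    using i by simp
  also have "\<dots> = (\<integral>q. 2 * (norm (f (fst q)))\<^sup>2 + 2 * (norm (snd q))\<^sup>2 \<partial>?T)"
    by (intro Bochner_Integration.integral_cong refl)
      (simp add: power2_norm_eq_inner inner_diff_left inner_diff_right inner_add_left inner_add_right inner_commute)
  also have "\<dots> = 2 * (\<integral>q. (norm (f (fst q)))\<^sup>2 \<partial>?T) + 2 * (v * real DIM('a))"
    using i TP(2) HP(2) by simp
  also have "(\<integral>q. (norm (f (fst q)))\<^sup>2 \<partial>?T) = (\<integral>p. (norm (f p))\<^sup>2 \<partial>\<gamma>)"
  proof -
    have "(\<integral>\<^sup>+q. ennreal ((norm (f (fst q)))\<^sup>2) \<partial>?T) = (\<integral>\<^sup>+p. ennreal ((norm (f p))\<^sup>2) \<partial>\<gamma>)"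
      by (subst H.nn_integral_fst[symmetric]) (auto simp: H.emeasure_space_1)
    then show ?thesis using i(3) P2_linear(2)[OF \<gamma> f] by (simp add: integral_eq_nn_integral)
  qed
  finally show ?thesis by simp
qed

text \<open>Smearing the second marginal of an optimal plan. Gibbs' inequality against the heat kernel
  around the unsmeared point bounds the conditional entropy by that of the heat kernel.\<close>

lemma schcost_upper:
  fixes \<mu> \<nu> :: "'a::euclidean_space measure"
  assumes P: "\<mu> \<in> P2" "\<nu> \<in> P2" and fin: "boltzmann_entropy \<mu> < \<infinity>" and e: "e > 0"
  obtains \<gamma> where "\<gamma> \<in> couplings \<mu> (noise e \<nu>)" "boltzmann_entropy \<gamma> < \<infinity>"
    "schcost e \<gamma> \<le> (W2 \<mu> \<nu>)\<^sup>2 / 2 + e * Ent \<mu>"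
proof -
  obtain \<gamma>0 where opt: "optimal_plan \<mu> \<nu> \<gamma>0" using optimal_plan_exists[of \<mu> \<nu>] P2D P by metis
  note o = optimal_plan_cost[OF opt P]
  note C0 = couplingsD[OF o(1)] and \<gamma>0P = couplings_P2[OF o(1) P]
  obtain m where m: "has_ent \<mu> m" using has_ent_exists[OF P(1) fin] by blast
  note mD = has_entD[OF m] and ml = has_ent_ln[OF m]
  let ?T = "\<gamma>0 \<Otimes>\<^sub>M (heat_kernel e :: 'a measure)"
  note HP = heat_kernel_moment[OF e, where 'a='a]
  note TP = P2_pair[OF \<gamma>0P HP(1)]
  interpret G0: prob_space \<gamma>0 by (rule P2D(2)[OF \<gamma>0P])
  interpret H: prob_space "heat_kernel e :: 'a measure" by (rule P2D(2)[OF HP(1)])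
  interpret T: pair_prob_space \<gamma>0 "heat_kernel e :: 'a measure" ..
  interpret M: prob_space \<mu> by (rule P2D(2)[OF P(1)])
  interpret MB: pair_sigma_finite \<mu> "lborel :: 'a measure" by unfold_locales
  have s0[measurable_cong]: "sets \<gamma>0 = sets (borel \<Otimes>\<^sub>M borel)" using C0(1) by (simp add: sets_borel_prod)
  have sH[measurable_cong]: "sets (heat_kernel e :: 'a measure) = sets borel" "sets \<mu> = sets borel" using e P2D(1)[OF P(1)] by auto
  define X where "X q = fst (fst q)" for q :: "('a \<times> 'a) \<times> 'a"
  define Y where "Y q = snd (fst q) + snd q" for q :: "('a \<times> 'a) \<times> 'a"
  have bl: "bounded_linear X" "bounded_linear Y" "bounded_linear (fst :: ('a \<times> 'a) \<times> 'a \<Rightarrow> 'a \<times> 'a)" "bounded_linear (snd :: ('a \<times> 'a) \<times> 'a \<Rightarrow> 'a)"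
    unfolding X_def Y_def by (intro bounded_linear_intros)+
  have pl: "bounded_linear (\<lambda>q. (X q, Y q))" using bl by (auto intro: bounded_linear_Pair)
  note pm = P2_linear(1)[OF TP(1) pl]
  define \<gamma> where "\<gamma> = distr ?T borel (\<lambda>q. (X q, Y q))"
  have fst_T: "distr ?T borel fst = \<gamma>0"
    by (subst (2) H.distr_pair_fst[symmetric, of \<gamma>0]) (rule distr_cong, use C0(1) in auto)
  have XT: "distr ?T borel X = \<mu>"
    using distr_distr_linear[OF TP(1) bl(3) bounded_linear_fst] by (simp add: fst_T C0 X_def[abs_def])
  have YT: "distr ?T borel Y = noise e \<nu>"
  proof -
    have "noise e \<nu> = distr (distr \<gamma>0 borel snd \<Otimes>\<^sub>M heat_kernel e) borel (\<lambda>q. fst q + snd q)"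
      by (simp add: noise_def C0 case_prod_unfold)
    also have "\<dots> = distr ?T borel (\<lambda>q. snd (fst q) + snd q)"
      by (subst distr_pair_linear[OF \<gamma>0P HP(1) bounded_linear_snd]) (auto intro!: continuous_intros)
    finally show ?thesis by (simp add: Y_def[abs_def])
  qed
  have \<gamma>c: "\<gamma> \<in> couplings \<mu> (noise e \<nu>)" using linear_coupling(1)[OF TP(1) bl(1,2)] by (simp add: XT YT \<gamma>_def)
  have \<gamma>P: "\<gamma> \<in> P2" using couplings_P2[OF \<gamma>c P(1) noise_P2(1)[OF P(2) e]] .
  interpret G: prob_space \<gamma> by (rule P2D(2)[OF \<gamma>P])
  note C = couplingsD[OF \<gamma>c]
  define \<sigma> :: "'a \<Rightarrow> real" where "\<sigma> = heat_density e"
  have \<sigma>m[measurable]: "\<sigma> \<in> borel_measurable borel" and \<sigma>0: "\<sigma> x > 0" for x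
    using heat_density_pos[OF e] by (simp_all add: \<sigma>_def)
  note hint = nn_integral_heat_kernel[where 'a='a, OF e, folded \<sigma>_def]
  have Tint: "(\<integral>\<^sup>+q. f q \<partial>?T) = (\<integral>\<^sup>+p. \<integral>\<^sup>+z. ennreal (\<sigma> z) * f (p, z) \<partial>lborel \<partial>\<gamma>0)"
    if f[measurable]: "f \<in> borel_measurable ((borel \<Otimes>\<^sub>M borel) \<Otimes>\<^sub>M borel)" for f
  proof -
    have "(\<integral>\<^sup>+q. f q \<partial>?T) = (\<integral>\<^sup>+p. \<integral>\<^sup>+z. f (p, z) \<partial>heat_kernel e \<partial>\<gamma>0)"
      by (rule H.nn_integral_fst[symmetric]) measurable
    also have "\<dots> = (\<integral>\<^sup>+p. \<integral>\<^sup>+z. ennreal (\<sigma> z) * f (p, z) \<partial>lborel \<partial>\<gamma>0)"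
      by (intro nn_integral_cong hint) (measurable, simp_all add: space_pair_measure)
    finally show ?thesis .
  qed
  have XYm[measurable]: "X \<in> measurable ((borel \<Otimes>\<^sub>M borel) \<Otimes>\<^sub>M borel) borel" "Y \<in> measurable ((borel \<Otimes>\<^sub>M borel) \<Otimes>\<^sub>M borel) borel"
    unfolding X_def Y_def by measurable
  have \<gamma>int: "(\<integral>\<^sup>+p. f p \<partial>\<gamma>) = (\<integral>\<^sup>+q. f (X q, Y q) \<partial>?T)" if "f \<in> borel_measurable borel" for f
    unfolding \<gamma>_def by (rule nn_integral_distr[OF pm]) (use that in simp)
  let ?R = "\<mu> \<Otimes>\<^sub>M (lborel :: 'a measure)"
  have sR: "sets ?R = sets borel" using sets_pair_measure_cong[OF P2D(1)[OF P(1)] sets_lborel] by (simp add: sets_borel_prod)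
  have AEfst: "AE p in \<gamma>0. Q (fst p)" if "AE x in \<mu>. Q x" for Q
  proof -
    have "AE x in distr \<gamma>0 borel fst. Q x" unfolding C0(2) by (rule that)
    then show ?thesis by (rule AE_distrD[OF C0(5)])
  qed
  \<comment> \<open>The Gaussian noise makes every fibre absolutely continuous, so sets with
    Lebesgue null fibres carry no mass.\<close>
  have ac: "absolutely_continuous ?R \<gamma>"
    unfolding absolutely_continuous_def
  proof
    fix A assume "A \<in> null_sets ?R"
    then have "A \<in> sets ?R" and A0: "emeasure ?R A = 0" by (auto simp: null_sets_def)
    then have A: "A \<in> sets borel" by (simp only: sR)
    have A2[measurable]: "A \<in> sets (borel \<Otimes>\<^sub>M borel)" using A by (simp add: sets_borel_prod)
    have "(\<integral>\<^sup>+x. \<integral>\<^sup>+y. indicator A (x, y) \<partial>lborel \<partial>\<mu>) = 0"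
    proof -
      have "(\<integral>\<^sup>+x. \<integral>\<^sup>+y. indicator A (x, y) \<partial>lborel \<partial>\<mu>) = (\<integral>\<^sup>+p. indicator A p \<partial>?R)"
        by (rule lborel.nn_integral_fst) measurable
      then show ?thesis using A A0 by (simp add: sR)
    qed
    then have "AE x in \<mu>. (\<integral>\<^sup>+y. indicator A (x, y) \<partial>(lborel :: 'a measure)) = 0"
      by (subst (asm) nn_integral_0_iff_AE) auto
    then have ae: "AE p in \<gamma>0. (\<integral>\<^sup>+y. indicator A (fst p, y) \<partial>(lborel :: 'a measure)) = 0" by (rule AEfst)
    have "emeasure \<gamma> A = (\<integral>\<^sup>+q. indicator A (X q, Y q) \<partial>?T)"
      using \<gamma>int[of "indicator A"] A C(1) by simp
    also have "\<dots> = (\<integral>\<^sup>+p. \<integral>\<^sup>+z. ennreal (\<sigma> z) * indicator A (X (p, z), Y (p, z)) \<partial>lborel \<partial>\<gamma>0)"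
      by (rule Tint) measurable
    also have "\<dots> = (\<integral>\<^sup>+p. 0 \<partial>\<gamma>0)"
    proof (rule nn_integral_cong_AE, use ae in eventually_elim)
      case (elim p)
      have "(\<integral>\<^sup>+z. indicator A (fst p, snd p + z) \<partial>lborel) = (\<integral>\<^sup>+y. indicator A (fst p, y) \<partial>(lborel :: 'a measure))"
        by (rule nn_integral_lborel_shift[of "\<lambda>y. indicator A (fst p, y)"]) measurable
      then have "AE z in lborel. indicator A (fst p, snd p + z) = (0 :: ennreal)"
        using elim nn_integral_0_iff_AE[of "\<lambda>z. indicator A (fst p, snd p + z)" lborel] by simp
      then have "AE z in lborel. ennreal (\<sigma> z) * indicator A (X (p, z), Y (p, z)) = 0"
        by eventually_elim (simp add: X_def Y_def)
      then have "(\<integral>\<^sup>+z. ennreal (\<sigma> z) * indicator A (X (p, z), Y (p, z)) \<partial>lborel) = (\<integral>\<^sup>+z. 0 \<partial>(lborel :: 'a measure))" by (rule nn_integral_cong_AE)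
      then show ?case by simp
    qed
    finally show "A \<in> null_sets \<gamma>" using A C(1) by (simp add: null_sets_def)
  qed
  \<comment> \<open>The conditional density of the smeared point given the first coordinate.
    Multiplying by the density of \<open>\<mu>\<close>, as in \<open>k\<close> below, gives the
    density of \<open>\<gamma>\<close>.\<close>
  define g where "g p = enn2real (RN_deriv ?R \<gamma> p)" for p
  have gm[measurable]: "g \<in> borel_measurable (borel \<Otimes>\<^sub>M borel)"
  proof -
    have "RN_deriv ?R \<gamma> \<in> borel_measurable ?R" by simp
    then have "g \<in> borel_measurable ?R" unfolding g_def[abs_def] by measurable
    then show ?thesis by (simp add: measurable_cong_sets[OF sR refl] borel_pair_measurable)
  qed
  have g0: "0 \<le> g p" for p by (simp add: g_def)
  have \<gamma>g: "\<gamma> = density ?R (\<lambda>p. ennreal (g p))"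
  proof -
    have "AE p in ?R. RN_deriv ?R \<gamma> p \<noteq> \<infinity>"
      using MB.RN_deriv_finite[OF G.sigma_finite_measure_axioms ac] C(1) sR by simp
    then have "AE p in ?R. ennreal (g p) = RN_deriv ?R \<gamma> p" by eventually_elim (simp add: g_def less_top)
    then have "density ?R (\<lambda>p. ennreal (g p)) = density ?R (RN_deriv ?R \<gamma>)"
      by (intro density_cong) (auto simp: measurable_cong_sets[OF sR refl] borel_pair_measurable)
    also have "\<dots> = \<gamma>" using MB.density_RN_deriv[OF ac] C(1) sR by simp
    finally show ?thesis ..
  qed
  have \<gamma>int2: "(\<integral>\<^sup>+p. f p \<partial>\<gamma>) = (\<integral>\<^sup>+x. \<integral>\<^sup>+y. ennreal (g (x, y)) * f (x, y) \<partial>lborel \<partial>\<mu>)"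
    if f[measurable]: "f \<in> borel_measurable (borel \<Otimes>\<^sub>M borel)" for f
  proof -
    have "(\<integral>\<^sup>+p. f p \<partial>\<gamma>) = (\<integral>\<^sup>+p. ennreal (g p) * f p \<partial>?R)"
      unfolding \<gamma>g by (rule nn_integral_density) measurable
    also have "\<dots> = (\<integral>\<^sup>+x. \<integral>\<^sup>+y. ennreal (g (x, y)) * f (x, y) \<partial>lborel \<partial>\<mu>)"
      by (rule lborel.nn_integral_fst[symmetric]) measurable
    finally show ?thesis .
  qed
  have g1: "AE x in \<mu>. (\<integral>\<^sup>+y. ennreal (g (x, y)) \<partial>lborel) = 1"
  proof -
    have "density \<mu> (\<lambda>x. \<integral>\<^sup>+y. ennreal (g (x, y)) \<partial>lborel) = density \<mu> (\<lambda>_. 1)"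
    proof (rule measure_eqI)
      fix A assume "A \<in> sets (density \<mu> (\<lambda>x. \<integral>\<^sup>+y. ennreal (g (x, y)) \<partial>lborel))"
      then have A[measurable]: "A \<in> sets borel" using P2D(1)[OF P(1)] by simp
      have "emeasure (density \<mu> (\<lambda>_. 1)) A = emeasure (distr \<gamma> borel fst) A" by (simp add: C density_1)
      also have "\<dots> = (\<integral>\<^sup>+p. indicator A (fst p) \<partial>\<gamma>)"
        by (subst nn_integral_indicator[symmetric], simp, subst nn_integral_distr[OF C(5)]) auto
      also have "\<dots> = (\<integral>\<^sup>+x. \<integral>\<^sup>+y. ennreal (g (x, y)) * indicator A x \<partial>lborel \<partial>\<mu>)" by (subst \<gamma>int2) auto
      also have "\<dots> = emeasure (density \<mu> (\<lambda>x. \<integral>\<^sup>+y. ennreal (g (x, y)) \<partial>lborel)) A"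
        by (subst emeasure_density) (auto simp: nn_integral_multc)
      finally show "emeasure (density \<mu> (\<lambda>x. \<integral>\<^sup>+y. ennreal (g (x, y)) \<partial>lborel)) A = emeasure (density \<mu> (\<lambda>_. 1)) A" ..
    qed simp
    then show ?thesis by (subst (asm) M.density_unique_iff) auto
  qed
  have gtot: "(\<integral>\<^sup>+p. \<integral>\<^sup>+z. ennreal (g (fst p, snd p + z)) \<partial>lborel \<partial>\<gamma>0) = 1"
  proof -
    have "(\<integral>\<^sup>+p. \<integral>\<^sup>+z. ennreal (g (fst p, snd p + z)) \<partial>lborel \<partial>\<gamma>0) = (\<integral>\<^sup>+p. 1 \<partial>\<gamma>0)"
    proof (rule nn_integral_cong_AE, use AEfst[OF g1] in eventually_elim)
      case (elim p)
      have "(\<integral>\<^sup>+z. ennreal (g (fst p, snd p + z)) \<partial>lborel) = (\<integral>\<^sup>+y. ennreal (g (fst p, y)) \<partial>lborel)"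
        by (rule nn_integral_lborel_shift[of "\<lambda>y. ennreal (g (fst p, y))"]) measurable
      then show ?case using elim by simp
    qed
    then show ?thesis by (simp add: G0.emeasure_space_1)
  qed
  define k where "k p = m (fst p) * g p" for p
  have km[measurable]: "k \<in> borel_measurable (borel \<Otimes>\<^sub>M borel)" using mD(1) unfolding k_def by measurable
  have km': "k \<in> borel_measurable borel" using km by (simp add: borel_pair_measurable)
  have k0: "0 \<le> k p" for p using mD(2) g0 by (simp add: k_def)
  have \<gamma>k: "\<gamma> = density lborel (\<lambda>p. ennreal (k p))"
  proof (rule measure_eqI)
    fix A assume "A \<in> sets \<gamma>"
    then have A: "A \<in> sets borel" using C(1) by simp
    then have A2[measurable]: "A \<in> sets (borel \<Otimes>\<^sub>M borel)" by (simp add: sets_borel_prod)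
    have [measurable]: "m \<in> borel_measurable borel" by (rule mD(1))
    have "emeasure \<gamma> A = (\<integral>\<^sup>+p. indicator A p \<partial>\<gamma>)" using A C(1) by simp
    also have "\<dots> = (\<integral>\<^sup>+x. \<integral>\<^sup>+y. ennreal (g (x, y)) * indicator A (x, y) \<partial>lborel \<partial>\<mu>)" by (rule \<gamma>int2) measurable
    also have "\<dots> = (\<integral>\<^sup>+x. ennreal (m x) * (\<integral>\<^sup>+y. ennreal (g (x, y)) * indicator A (x, y) \<partial>lborel) \<partial>lborel)"
      unfolding mD(3) by (rule nn_integral_density) measurable
    also have "\<dots> = (\<integral>\<^sup>+x. \<integral>\<^sup>+y. ennreal (k (x, y)) * indicator A (x, y) \<partial>lborel \<partial>lborel)"
    proof (rule nn_integral_cong)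
      fix x :: 'a
      have "ennreal (m x) * (\<integral>\<^sup>+y. ennreal (g (x, y)) * indicator A (x, y) \<partial>lborel) = (\<integral>\<^sup>+y. ennreal (m x) * (ennreal (g (x, y)) * indicator A (x, y)) \<partial>lborel)"
        by (rule nn_integral_cmult[symmetric]) measurable
      then show "ennreal (m x) * (\<integral>\<^sup>+y. ennreal (g (x, y)) * indicator A (x, y) \<partial>lborel) = (\<integral>\<^sup>+y. ennreal (k (x, y)) * indicator A (x, y) \<partial>lborel)"
        using mD(2) g0 by (simp add: k_def ennreal_mult mult.assoc)
    qed
    also have "\<dots> = (\<integral>\<^sup>+p. ennreal (k p) * indicator A p \<partial>(lborel \<Otimes>\<^sub>M lborel))"
      by (rule lborel.nn_integral_fst) measurable
    also have "\<dots> = emeasure (density lborel (\<lambda>p. ennreal (k p))) A"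
      using A km' by (subst emeasure_density) (auto simp: lborel_prod)
    finally show "emeasure \<gamma> A = emeasure (density lborel (\<lambda>p. ennreal (k p))) A" .
  qed (use C(1) in simp)
  have kpos: "AE p in \<gamma>. k p > 0" unfolding \<gamma>k using km' by (subst AE_density) (auto simp: ennreal_neg)
  then have "AE p in distr ?T borel (\<lambda>q. (X q, Y q)). k p > 0" unfolding \<gamma>_def .
  then have "AE q in ?T. k (X q, Y q) > 0" by (rule AE_distrD[OF pm])
  then have Tpos: "AE q in ?T. m (X q) > 0 \<and> g (X q, Y q) > 0"
    by eventually_elim (metis k_def fst_conv zero_less_mult_iff mD(2) g0 not_less)
  \<comment> \<open>The log ratio of the density of \<open>Y\<close> given \<open>X\<close> alone to
    that given also the unsmeared second coordinate. Forgetting that coordinate can only raise the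
    entropy, so the mean of \<open>\<Delta>\<close> has to be at most 0.\<close>
  define \<Delta> where "\<Delta> q = ln (g (X q, Y q)) - ln (\<sigma> (snd q))" for q
  have \<Delta>m[measurable]: "\<Delta> \<in> borel_measurable ((borel \<Otimes>\<^sub>M borel) \<Otimes>\<^sub>M borel)" unfolding \<Delta>_def by measurable
  have young: "\<sigma> (snd q) * \<Delta> q \<le> g (X q, Y q) - \<sigma> (snd q)" if "g (X q, Y q) > 0" for q
  proof -
    have "\<sigma> (snd q) * ln (g (X q, Y q)) \<le> ent (\<sigma> (snd q)) + exp (ln (g (X q, Y q))) - 1"
      using \<sigma>0[of "snd q"] by (intro ent_Young) simp
    then show ?thesis using that by (simp add: \<Delta>_def ent_def algebra_simps)
  qed
  have sT: "sets ?T = sets ((borel \<Otimes>\<^sub>M borel) \<Otimes>\<^sub>M borel)" by (intro sets_pair_measure_cong s0) (use e in simp)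
  have GT: "(\<integral>\<^sup>+q. ennreal (g (X q, Y q) / \<sigma> (snd q)) \<partial>?T) = 1"
  proof -
    have "(\<integral>\<^sup>+q. ennreal (g (X q, Y q) / \<sigma> (snd q)) \<partial>?T) = (\<integral>\<^sup>+p. \<integral>\<^sup>+z. ennreal (\<sigma> z) * ennreal (g (X (p, z), Y (p, z)) / \<sigma> (snd (p, z))) \<partial>lborel \<partial>\<gamma>0)"
      by (rule Tint) measurable
    also have "\<dots> = (\<integral>\<^sup>+p. \<integral>\<^sup>+z. ennreal (g (fst p, snd p + z)) \<partial>lborel \<partial>\<gamma>0)"
    proof (intro nn_integral_cong)
      fix p z
      show "ennreal (\<sigma> z) * ennreal (g (X (p, z), Y (p, z)) / \<sigma> (snd (p, z))) = ennreal (g (fst p, snd p + z))"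
        using \<sigma>0[of z] g0 by (simp add: ennreal_mult[symmetric] X_def Y_def)
    qed
    finally show ?thesis using gtot by simp
  qed
  \<comment> \<open>The positive part comes first: the finiteness of the entropy of
    \<open>\<gamma>\<close>, and with it the integrability of \<open>\<Delta>\<close>, is deduced
    from this bound.\<close>
  have \<Delta>pos: "(\<integral>\<^sup>+q. ennreal (max 0 (\<Delta> q)) \<partial>?T) \<le> 1"
  proof -
    have "(\<integral>\<^sup>+q. ennreal (max 0 (\<Delta> q)) \<partial>?T) \<le> (\<integral>\<^sup>+q. ennreal (g (X q, Y q) / \<sigma> (snd q)) \<partial>?T)"
    proof (rule nn_integral_mono_AE, use Tpos in eventually_elim)
      case (elim q)
      have "max 0 (\<Delta> q) \<le> g (X q, Y q) / \<sigma> (snd q)"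
      proof -
        have "\<Delta> q * \<sigma> (snd q) \<le> g (X q, Y q)" using young[of q] elim \<sigma>0[of "snd q"] by (simp add: mult.commute)
        then show ?thesis using \<sigma>0[of "snd q"] elim by (simp add: pos_le_divide_eq)
      qed
      then show ?case by (rule ennreal_leI)
    qed
    then show ?thesis by (simp add: GT)
  qed
  have lm: "integrable ?T (\<lambda>q. ln (m (X q)))" "(\<integral>q. ln (m (X q)) \<partial>?T) = Ent \<mu>"
  proof -
    have lmm: "(\<lambda>x. ln (m x)) \<in> borel_measurable borel" using mD(1) by measurable
    show "integrable ?T (\<lambda>q. ln (m (X q)))" using ml(1) unfolding XT[symmetric] by (rule integrable_distr[OF P2_linear(1)[OF TP(1) bl(1)]])
    show "(\<integral>q. ln (m (X q)) \<partial>?T) = Ent \<mu>" using integral_distr[OF P2_linear(1)[OF TP(1) bl(1)] lmm] by (simp add: XT Ent_eq[OF m])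
  qed
  have l\<sigma>: "integrable ?T (\<lambda>q. ln (\<sigma> (snd q)))" "(\<integral>q. ln (\<sigma> (snd q)) \<partial>?T) = - (real DIM('a) / 2) * ln (2 * pi * e) - real DIM('a) / 2"
    unfolding \<sigma>_def ln_heat_density[OF e] using P2_linear(2)[OF TP(1) bl(4)] T.prob_space TP(2) HP(2) e by simp_all
  have [measurable]: "(\<lambda>p. ln (k p)) \<in> borel_measurable (borel \<Otimes>\<^sub>M borel)" by measurable
  have lnk: "AE q in ?T. ln (k (X q, Y q)) = ln (m (X q)) + \<Delta> q + ln (\<sigma> (snd q))"
    using Tpos by eventually_elim (simp add: k_def \<Delta>_def ln_mult)
  have he: "has_ent \<gamma> k"
  proof (rule has_entI[OF \<gamma>P \<gamma>k km' k0])
    have [measurable]: "k \<in> borel_measurable borel" by (rule km')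
    have "(\<integral>\<^sup>+p. ennreal (max 0 (k p * ln (k p))) \<partial>lborel) = (\<integral>\<^sup>+p. ennreal (k p) * ennreal (max 0 (ln (k p))) \<partial>lborel)"
    proof (intro nn_integral_cong)
      fix p
      have "max 0 (k p * ln (k p)) = k p * max 0 (ln (k p))" using k0[of p] by (auto simp: max_def mult_le_0_iff zero_le_mult_iff)
      then show "ennreal (max 0 (k p * ln (k p))) = ennreal (k p) * ennreal (max 0 (ln (k p)))" using k0[of p] by (simp add: ennreal_mult)
    qed
    also have "\<dots> = (\<integral>\<^sup>+p. ennreal (max 0 (ln (k p))) \<partial>\<gamma>)" unfolding \<gamma>k by (rule nn_integral_density[symmetric]) auto
    also have "\<dots> = (\<integral>\<^sup>+q. ennreal (max 0 (ln (k (X q, Y q)))) \<partial>?T)" by (rule \<gamma>int) measurable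
    also have "\<dots> \<le> (\<integral>\<^sup>+q. ennreal (norm (ln (m (X q)))) + ennreal (max 0 (\<Delta> q)) + ennreal (norm (ln (\<sigma> (snd q)))) \<partial>?T)"
    proof (rule nn_integral_mono_AE, use lnk in eventually_elim)
      case (elim q)
      have "max 0 (ln (k (X q, Y q))) \<le> norm (ln (m (X q))) + max 0 (\<Delta> q) + norm (ln (\<sigma> (snd q)))"
        unfolding elim by (simp add: max_def) linarith
      then have "ennreal (max 0 (ln (k (X q, Y q)))) \<le> ennreal (norm (ln (m (X q))) + max 0 (\<Delta> q) + norm (ln (\<sigma> (snd q))))" by (rule ennreal_leI)
      also have "\<dots> = ennreal (norm (ln (m (X q)))) + ennreal (max 0 (\<Delta> q)) + ennreal (norm (ln (\<sigma> (snd q))))"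
        by (subst ennreal_plus, simp, simp, subst ennreal_plus) auto
      finally show ?case .
    qed
    also have "\<dots> = (\<integral>\<^sup>+q. ennreal (norm (ln (m (X q)))) \<partial>?T) + (\<integral>\<^sup>+q. ennreal (max 0 (\<Delta> q)) \<partial>?T) + (\<integral>\<^sup>+q. ennreal (norm (ln (\<sigma> (snd q)))) \<partial>?T)"
      using mD(1) by (subst nn_integral_add, measurable, subst nn_integral_add) auto
    also have "\<dots> < \<infinity>"
      using lm(1) l\<sigma>(1) \<Delta>pos by (auto simp: integrable_iff_bounded less_top[symmetric] top_unique)
    finally show "(\<integral>\<^sup>+p. ennreal (max 0 (k p * ln (k p))) \<partial>lborel) < \<infinity>" .
  qed
  have bz: "boltzmann_entropy \<gamma> < \<infinity>" by (simp add: boltzmann_has_ent[OF he])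
  have lkm: "(\<lambda>p. ln (k p)) \<in> borel_measurable borel" using km' by measurable
  have lk: "integrable ?T (\<lambda>q. ln (k (X q, Y q)))" "(\<integral>q. ln (k (X q, Y q)) \<partial>?T) = Ent \<gamma>"
    using integrable_distr[OF pm has_ent_ln(1)[OF he, unfolded \<gamma>_def]] integral_distr[OF pm lkm, folded \<gamma>_def]
    by (simp_all add: Ent_eq[OF he])
  have \<Delta>i: "integrable ?T \<Delta>"
  proof (rule integrable_cong_AE_imp)
    show "integrable ?T (\<lambda>q. ln (k (X q, Y q)) - ln (m (X q)) - ln (\<sigma> (snd q)))" using lk lm l\<sigma> by simp
    show "\<Delta> \<in> borel_measurable ?T" using \<Delta>m by (simp add: measurable_cong_sets[OF sT refl])
    show "AE q in ?T. ln (k (X q, Y q)) - ln (m (X q)) - ln (\<sigma> (snd q)) = \<Delta> q" using lnk by eventually_elim simp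
  qed
  have gi: "integrable ?T (\<lambda>q. g (X q, Y q) / \<sigma> (snd q))" "(\<integral>q. g (X q, Y q) / \<sigma> (snd q) \<partial>?T) = 1"
  proof -
    have nn0: "0 \<le> g (X q, Y q) / \<sigma> (snd q)" for q using g0 \<sigma>0[of "snd q"] by simp
    have "has_bochner_integral ?T (\<lambda>q. g (X q, Y q) / \<sigma> (snd q)) 1"
      by (rule has_bochner_integral_nn_integral) (use GT nn0 in auto)
    then show "integrable ?T (\<lambda>q. g (X q, Y q) / \<sigma> (snd q))" "(\<integral>q. g (X q, Y q) / \<sigma> (snd q) \<partial>?T) = 1"
      by (auto simp: has_bochner_integral_iff)
  qed
  have "(\<integral>q. \<Delta> q \<partial>?T) \<le> (\<integral>q. g (X q, Y q) / \<sigma> (snd q) - 1 \<partial>?T)"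
  proof (rule integral_mono_AE[OF \<Delta>i])
    show "integrable ?T (\<lambda>q. g (X q, Y q) / \<sigma> (snd q) - 1)" using gi by simp
    show "AE q in ?T. \<Delta> q \<le> g (X q, Y q) / \<sigma> (snd q) - 1" using Tpos
    proof eventually_elim
      case (elim q)
      then have "(\<Delta> q + 1) * \<sigma> (snd q) \<le> g (X q, Y q)"
        using young[of q] by (simp add: algebra_simps)
      then have "\<Delta> q + 1 \<le> g (X q, Y q) / \<sigma> (snd q)" using \<sigma>0[of "snd q"] by (simp only: pos_le_divide_eq)
      then show ?case by simp
    qed
  qed
  also have "\<dots> = 0" using gi T.prob_space by simp
  finally have \<Delta>0: "(\<integral>q. \<Delta> q \<partial>?T) \<le> 0" .
  have "Ent \<gamma> = (\<integral>q. ln (m (X q)) + \<Delta> q + ln (\<sigma> (snd q)) \<partial>?T)"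
    unfolding lk(2)[symmetric]
  proof (rule integral_cong_AE)
    show "(\<lambda>q. ln (k (X q, Y q))) \<in> borel_measurable ?T" using lk(1) by auto
    show "(\<lambda>q. ln (m (X q)) + \<Delta> q + ln (\<sigma> (snd q))) \<in> borel_measurable ?T" using lm(1) \<Delta>i l\<sigma>(1) by auto
  qed (rule lnk)
  also have "\<dots> = Ent \<mu> + (\<integral>q. \<Delta> q \<partial>?T) + (- (real DIM('a) / 2) * ln (2 * pi * e) - real DIM('a) / 2)"
    using lm \<Delta>i l\<sigma> by simp
  finally have Eg: "Ent \<gamma> \<le> Ent \<mu> - (real DIM('a) / 2) * ln (2 * pi * e) - real DIM('a) / 2" using \<Delta>0 by simp
  have cost: "(\<integral>p. (norm (fst p - snd p))\<^sup>2 \<partial>\<gamma>) = (W2 \<mu> \<nu>)\<^sup>2 + e * real DIM('a)"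
  proof -
    have blf: "bounded_linear (\<lambda>p :: 'a \<times> 'a. fst p - snd p)" by (intro bounded_linear_intros)
    have "(\<integral>p. (norm (fst p - snd p))\<^sup>2 \<partial>\<gamma>) = (\<integral>q. (norm (X q - Y q))\<^sup>2 \<partial>?T)"
      unfolding \<gamma>_def by (rule linear_coupling(2)[OF TP(1) bl(1,2)])
    also have "\<dots> = (\<integral>q. (norm ((fst (fst q) - snd (fst q)) - snd q))\<^sup>2 \<partial>?T)" by (simp add: X_def Y_def diff_diff_eq)
    also have "\<dots> = (\<integral>p. (norm (fst p - snd p))\<^sup>2 \<partial>\<gamma>0) + e * real DIM('a)" by (rule heat_cost_add[OF \<gamma>0P blf e])
    finally show ?thesis using o(2) by simp
  qed
  \<comment> \<open>In dimension \<open>d\<close> the smearing adds \<open>e * d / 2\<close> to the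
    transport part, and the Gaussian entropy takes off the same amount; the logarithm is offset by
    the normalization in \<open>schcost\<close>.\<close>
  have "e * Ent \<gamma> \<le> e * (Ent \<mu> - (real DIM('a) / 2) * ln (2 * pi * e) - real DIM('a) / 2)"
    using Eg e by (intro mult_left_mono) auto
  then have "schcost e \<gamma> \<le> (W2 \<mu> \<nu>)\<^sup>2 / 2 + e * Ent \<mu>"
    unfolding schcost_def cost by (simp add: algebra_simps add_divide_distrib)
  then show thesis using that \<gamma>c bz by blast
qed

section \<open>Consequences for the Schroedinger cost itself\<close>

lemma sch_coupling_value:
  fixes \<mu> \<rho> :: "'a::euclidean_space measure"
  assumes "\<gamma> \<in> couplings \<mu> \<rho>" "\<mu> \<in> P2" "\<rho> \<in> P2" "boltzmann_entropy \<gamma> < \<infinity>"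
  shows "ereal (\<integral>(x, y). (norm (x - y))\<^sup>2 / 2 \<partial>\<gamma>) + ereal e * boltzmann_entropy \<gamma>
      + ereal (e * real DIM('a) / 2 * ln (2 * pi * e)) = ereal (schcost e \<gamma>)"
proof -
  obtain g where g: "has_ent \<gamma> g" using has_ent_exists[OF couplings_P2[OF assms(1-3)] assms(4)] by blast
  have "boltzmann_entropy \<gamma> = ereal (Ent \<gamma>)" by (simp add: Ent_def boltzmann_has_ent[OF g])
  moreover have "(\<integral>(x, y). (norm (x - y))\<^sup>2 / 2 \<partial>\<gamma>) = (\<integral>p. (norm (fst p - snd p))\<^sup>2 \<partial>\<gamma>) / 2"
    by (simp add: case_prod_unfold)
  ultimately show ?thesis by (simp add: schcost_def)
qed

lemma sch_upper:
  fixes \<mu> \<nu> :: "'a::euclidean_space measure"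
  assumes P: "\<mu> \<in> P2" "\<nu> \<in> P2" and fin: "boltzmann_entropy \<mu> < \<infinity>" and e: "e > 0"
  shows "sch e \<mu> (noise e \<nu>) \<le> ereal ((W2 \<mu> \<nu>)\<^sup>2 / 2 + e * Ent \<mu>)"
proof -
  obtain \<gamma> where \<gamma>: "\<gamma> \<in> couplings \<mu> (noise e \<nu>)" "boltzmann_entropy \<gamma> < \<infinity>"
    "schcost e \<gamma> \<le> (W2 \<mu> \<nu>)\<^sup>2 / 2 + e * Ent \<mu>" by (rule schcost_upper[OF P fin e])
  have "sch e \<mu> (noise e \<nu>) \<le> ereal (schcost e \<gamma>)"
    unfolding sch_def using sch_coupling_value[OF \<gamma>(1) P(1) noise_P2(1)[OF P(2) e] \<gamma>(2), of e] \<gamma>(1)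
    by (metis (no_types, lifting) INF_lower)
  also have "\<dots> \<le> ereal ((W2 \<mu> \<nu>)\<^sup>2 / 2 + e * Ent \<mu>)" using \<gamma>(3) by simp
  finally show ?thesis .
qed

lemma sch_lower:
  fixes \<mu> \<rho> :: "'a::euclidean_space measure"
  assumes P: "\<mu> \<in> P2" "\<rho> \<in> P2" and e: "e > 0"
  shows "ereal (e / 2 * (Ent \<mu> + Ent \<rho>) + (W2 \<mu> \<rho>)\<^sup>2 / 2) \<le> sch e \<mu> \<rho>"
  unfolding sch_def
proof (rule INF_greatest)
  fix \<gamma> assume \<gamma>: "\<gamma> \<in> couplings \<mu> \<rho>"
  show "ereal (e / 2 * (Ent \<mu> + Ent \<rho>) + (W2 \<mu> \<rho>)\<^sup>2 / 2) \<le>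
    ereal (\<integral>(x, y). (norm (x - y))\<^sup>2 / 2 \<partial>\<gamma>) + ereal e * boltzmann_entropy \<gamma>
      + ereal (e * real DIM('a) / 2 * ln (2 * pi * e))"
  proof (cases "boltzmann_entropy \<gamma> < \<infinity>")
    case True
    show ?thesis unfolding sch_coupling_value[OF \<gamma> P True] using schcost_lower[OF \<gamma> P True e] by simp
  next
    case False
    then show ?thesis using e by simp
  qed
qed

text \<open>Some coupling has finite cost, hence finite entropy, and then so do its marginals; the
  second one is reached by exchanging coordinates.\<close>

lemma sch_finite_entropy:
  fixes \<mu> \<rho> :: "'a::euclidean_space measure"
  assumes P: "\<mu> \<in> P2" "\<rho> \<in> P2" and e: "e > 0" and fin: "sch e \<mu> \<rho> < \<infinity>"
  shows "boltzmann_entropy \<rho> < \<infinity>"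
proof -
  obtain \<gamma> where \<gamma>: "\<gamma> \<in> couplings \<mu> \<rho>" and lt: "ereal (\<integral>(x, y). (norm (x - y))\<^sup>2 / 2 \<partial>\<gamma>) + ereal e * boltzmann_entropy \<gamma>
      + ereal (e * real DIM('a) / 2 * ln (2 * pi * e)) < \<infinity>"
    using fin unfolding sch_def INF_less_iff by blast
  have b: "boltzmann_entropy \<gamma> < \<infinity>" using lt e by (cases "boltzmann_entropy \<gamma>") auto
  note s = swap_coupling[OF \<gamma> P b]
  obtain g where g: "has_ent (distr \<gamma> borel prod.swap) g"
    using has_ent_exists[OF couplings_P2[OF s(1) P(2,1)] s(2)] by blast
  obtain m where "has_ent (distr (distr \<gamma> borel prod.swap) borel fst) m"
    using marginal_has_ent[OF couplings_P2[OF s(1) P(2,1)] g] by blast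
  then have "has_ent \<rho> m" using couplingsD(2)[OF s(1)] by simp
  then show ?thesis by (simp add: boltzmann_has_ent)
qed

lemma W2_self: "\<mu> \<in> P2 \<Longrightarrow> W2 \<mu> \<mu> = 0" for \<mu> :: "'a::euclidean_space measure"
proof -
  assume \<mu>: "\<mu> \<in> P2"
  have "distr \<mu> borel (\<lambda>x. x) = \<mu>" by (rule distr_id2) (use P2D(1)[OF \<mu>] in simp)
  then have "(W2 \<mu> \<mu>)\<^sup>2 \<le> 0" using W2_sq_le_linear[OF \<mu> bounded_linear_ident bounded_linear_ident] by simp
  then show ?thesis by simp
qed

section \<open>Discrete Gronwall arguments\<close>

lemma discrete_gronwall:
  fixes u :: "nat \<Rightarrow> real"
  assumes k: "0 \<le> k" and u: "\<And>i. i \<le> n \<Longrightarrow> u i \<le> M + k * (\<Sum>j<i. u j)"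
  shows "i \<le> n \<Longrightarrow> u i \<le> M * (1 + k) ^ i"
proof -
  have S: "M + k * (\<Sum>j<i. u j) \<le> M * (1 + k) ^ i" if "i \<le> n" for i
    using that
  proof (induction i)
    case (Suc i)
    have "M + k * (\<Sum>j<Suc i. u j) = (M + k * (\<Sum>j<i. u j)) + k * u i" by (simp add: algebra_simps)
    also have "\<dots> \<le> (M + k * (\<Sum>j<i. u j)) + k * (M + k * (\<Sum>j<i. u j))"
      using u[of i] Suc.prems k by (intro add_left_mono mult_left_mono) auto
    also have "\<dots> = (1 + k) * (M + k * (\<Sum>j<i. u j))" by (simp add: algebra_simps)
    also have "\<dots> \<le> (1 + k) * (M * (1 + k) ^ i)" using Suc k by (intro mult_left_mono) auto
    finally show ?case by (simp add: mult_ac)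
  qed simp
  show "i \<le> n \<Longrightarrow> u i \<le> M * (1 + k) ^ i" using u[of i] S[of i] by simp
qed

text \<open>\<open>u\<close> stands for the squared distance to a reference measure,
  \<open>w\<close> for the squared lengths of the steps. The energy bound \<open>Q\<close> involves
  \<open>u i\<close> itself; after the triangle inequality with weight \<open>a * \<tau>\<close> its
  coefficient is at most \<open>5/8 + 1/8 = 3/4\<close>, and the remaining \<open>1/4\<close>
  explains the factors 4.\<close>

lemma moment_gronwall:
  fixes u w :: "nat \<Rightarrow> real"
  assumes \<tau>: "\<tau> > 0" "\<tau> \<le> t" "real n * \<tau> \<le> t" and a: "a > 0" and E: "0 \<le> E" and b: "0 \<le> b" "2 * \<tau> * b \<le> 5/8" "2 * b / a \<le> 1/8"
    and u0: "\<And>i. 0 \<le> u i"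
    and rec: "\<And>i. i < n \<Longrightarrow> u (Suc i) \<le> (1 + a * \<tau>) * u i + (1 + 1 / (a * \<tau>)) * w i"
    and Q: "\<And>i. i \<le> n \<Longrightarrow> (\<Sum>j<i. w j) / (2 * \<tau>) \<le> E + b * u i"
  shows "i \<le> n \<Longrightarrow> u i \<le> 4 * (u 0 + 2 * (t + 1/a) * E) * exp (4 * a * t)"
proof -
  assume i: "i \<le> n"
  have sum: "u i \<le> u 0 + a * \<tau> * (\<Sum>j<i. u j) + (1 + 1 / (a * \<tau>)) * (\<Sum>j<i. w j)" if "i \<le> n" for i
    using that
  proof (induction i)
    case (Suc i)
    then show ?case using rec[of i] by (simp add: algebra_simps)
  qed simp
  have step: "u i \<le> 4 * (u 0 + 2 * (t + 1/a) * E) + 4 * a * \<tau> * (\<Sum>j<i. u j)" if i: "i \<le> n" for i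
  proof -
    have "(1 + 1 / (a * \<tau>)) * (\<Sum>j<i. w j) = 2 * (\<tau> + 1/a) * ((\<Sum>j<i. w j) / (2 * \<tau>))"
      using \<tau> a by (simp add: field_simps)
    also have "\<dots> \<le> 2 * (\<tau> + 1/a) * (E + b * u i)" using Q[OF i] \<tau> a by (intro mult_left_mono) auto
    also have "\<dots> = 2 * (\<tau> + 1/a) * E + (2 * \<tau> * b + 2 * b / a) * u i" by (simp add: algebra_simps)
    also have "\<dots> \<le> 2 * (t + 1/a) * E + (5/8 + 1/8) * u i"
      using \<tau> E b u0[of i] by (intro add_mono mult_right_mono) auto
    finally have "(1 + 1 / (a * \<tau>)) * (\<Sum>j<i. w j) \<le> 2 * (t + 1/a) * E + (5/8 + 1/8) * u i" .
    moreover have "x \<le> 4 * (z + e) + 4 * a * \<tau> * S" if "X \<le> e + (5/8 + 1/8) * x" "x \<le> z + a * \<tau> * S + X" for x X S z e :: real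
      using that by (simp add: algebra_simps)
    ultimately show ?thesis using sum[OF i] by blast
  qed
  define M where "M = 4 * (u 0 + 2 * (t + 1/a) * E)"
  have M: "0 \<le> M" unfolding M_def using u0[of 0] \<tau> a E by auto
  have "u i \<le> M * (1 + 4 * a * \<tau>) ^ i"
    by (rule discrete_gronwall[where n = n]) (use \<tau> a step i in \<open>auto simp: M_def\<close>)
  also have "\<dots> \<le> M * exp (4 * a * \<tau>) ^ i"
    using M \<tau> a by (intro mult_left_mono power_mono exp_ge_add_one_self) auto
  also have "exp (4 * a * \<tau>) ^ i = exp (4 * a * (real i * \<tau>))" by (simp add: exp_of_nat_mult[symmetric] mult_ac)
  also have "M * \<dots> \<le> M * exp (4 * a * t)"
  proof -
    have "real i * \<tau> \<le> real n * \<tau>" using i \<tau> by (intro mult_right_mono) auto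
    then have "real i * \<tau> \<le> t" using \<tau>(3) by linarith
    then show ?thesis using a M by (intro mult_left_mono) auto
  qed
  finally show ?thesis by (simp add: M_def)
qed

lemma second_moment_le_W2:
  assumes P: "b \<in> P2" "x \<in> P2"
  shows "second_moment x \<le> 2 * second_moment b + 2 * (W2 b x)\<^sup>2"
proof -
  obtain \<gamma> where \<gamma>: "optimal_plan b x \<gamma>" using optimal_plan_exists[of b x] P P2D by metis
  note o = optimal_plan_cost[OF \<gamma> P]
  note G = couplings_P2[OF o(1) P]
  have i: "integrable \<gamma> (\<lambda>p. (norm (fst p))\<^sup>2)" "integrable \<gamma> (\<lambda>p. (norm (snd p))\<^sup>2)"
    by (rule P2_linear(2)[OF G], intro bounded_linear_intros)+
  note c = couplings_cost(1)[OF o(1) P]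
  have "(\<integral>p. (norm (snd p))\<^sup>2 \<partial>\<gamma>) \<le> (\<integral>p. 2 * (norm (fst p))\<^sup>2 + 2 * (norm (fst p - snd p))\<^sup>2 \<partial>\<gamma>)"
  proof (rule integral_mono)
    fix p :: "'a \<times> 'a"
    show "(norm (snd p))\<^sup>2 \<le> 2 * (norm (fst p))\<^sup>2 + 2 * (norm (fst p - snd p))\<^sup>2"
      using norm_sq_add_le[of 1 "fst p" "snd p - fst p"] by (simp add: norm_minus_commute)
  qed (use i c in auto)
  then show ?thesis using i c by (simp add: couplings_marginal_sq[OF o(1)] o(2))
qed

lemma W2_sq_le_second_moments:
  fixes \<mu> \<nu> :: "'a::euclidean_space measure"
  assumes P: "\<mu> \<in> P2" "\<nu> \<in> P2"
  shows "(W2 \<mu> \<nu>)\<^sup>2 \<le> 2 * second_moment \<mu> + 2 * second_moment \<nu>"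
proof -
  obtain \<gamma> where \<gamma>: "optimal_plan \<mu> \<nu> \<gamma>" using optimal_plan_exists[of \<mu> \<nu>] P P2D by metis
  note o = optimal_plan_cost[OF \<gamma> P]
  note G = couplings_P2[OF o(1) P]
  have i: "integrable \<gamma> (\<lambda>p. (norm (fst p))\<^sup>2)" "integrable \<gamma> (\<lambda>p. (norm (snd p))\<^sup>2)"
    by (rule P2_linear(2)[OF G], intro bounded_linear_intros)+
  have "(\<integral>p. (norm (fst p - snd p))\<^sup>2 \<partial>\<gamma>) \<le> (\<integral>p. 2 * (norm (fst p))\<^sup>2 + 2 * (norm (snd p))\<^sup>2 \<partial>\<gamma>)"
  proof (rule integral_mono)
    fix p :: "'a \<times> 'a"
    show "(norm (fst p - snd p))\<^sup>2 \<le> 2 * (norm (fst p))\<^sup>2 + 2 * (norm (snd p))\<^sup>2"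
      using norm_sq_add_le[of 1 "fst p" "- snd p"] by simp
  qed (use i couplings_cost(1)[OF o(1) P] in auto)
  then show ?thesis using i by (simp add: couplings_marginal_sq[OF o(1)] o(2))
qed

lemma Ent_lower_bound:
  fixes b x :: "'a::euclidean_space measure"
  assumes P: "b \<in> P2" "x \<in> P2" and fin: "boltzmann_entropy x < \<infinity>" and a: "a > 0"
  shows "- (2 * a * (second_moment b + (W2 b x)\<^sup>2)) - (pi / a) powr (real DIM('a) / 2) \<le> Ent x"
proof -
  obtain r where "has_ent x r" using has_ent_exists[OF P(2) fin] by blast
  then have "boltzmann_entropy x = ereal (Ent x)" by (simp add: Ent_def boltzmann_has_ent)
  then have "- (a * second_moment x) - (pi / a) powr (real DIM('a) / 2) \<le> Ent x"
    using boltzmann_lower_bound[OF P(2) a] by simp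
  moreover have "a * second_moment x \<le> a * (2 * second_moment b + 2 * (W2 b x)\<^sup>2)"
    using second_moment_le_W2[OF P] a by (intro mult_left_mono) auto
  ultimately show ?thesis by (simp add: algebra_simps)
qed

lemma energy_sum:
  fixes f H w :: "nat \<Rightarrow> real"
  assumes "\<And>i. i < n \<Longrightarrow> a / 2 * (H (Suc i) - H i) - K * a * \<tau> / 2 + w i / (2 * \<tau>) + f (Suc i) \<le> f i"
  shows "i \<le> n \<Longrightarrow> f i + (\<Sum>j<i. w j) / (2 * \<tau>) + a / 2 * H i \<le> f 0 + a / 2 * H 0 + real i * (K * a * \<tau> / 2)"
proof (induction i)
  case (Suc i)
  have gen: "f' + (S + w') / T + a / 2 * H' \<le> f0 + a / 2 * H0 + (1 + m) * c"
    if "f1 + S / T + a / 2 * H1 \<le> f0 + a / 2 * H0 + m * c" "a / 2 * (H' - H1) - c + w' / T + f' \<le> f1"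
    for f' S w' T H' f0 H0 m c f1 H1 :: real
    using that by (simp add: algebra_simps add_divide_distrib diff_divide_distrib)
  show ?case using gen[OF Suc.IH assms[of i]] Suc.prems by (simp add: algebra_simps)
qed simp

section \<open>Potentials for the doubling of variables\<close>

lemma le_exp_of_one_minus:
  fixes V X \<kappa> :: real
  assumes "(1 - \<kappa>) * V \<le> X" "0 \<le> X" "0 \<le> \<kappa>" "\<kappa> \<le> 1/2"
  shows "V \<le> exp (2 * \<kappa>) * X"
proof -
  have "(1 - \<kappa>) * (1 + 2 * \<kappa>) \<le> (1 - \<kappa>) * exp (2 * \<kappa>)"
    using assms by (intro mult_left_mono exp_ge_add_one_self) auto
  moreover have "1 \<le> (1 - \<kappa>) * (1 + 2 * \<kappa>)"
    using mult_left_mono[of "2 * \<kappa>" 1 \<kappa>] assms by (simp add: algebra_simps)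
  ultimately have "1 \<le> (1 - \<kappa>) * exp (2 * \<kappa>)" by linarith
  then have "1 * X \<le> ((1 - \<kappa>) * exp (2 * \<kappa>)) * X" using assms by (intro mult_right_mono) auto
  then have "(1 - \<kappa>) * V \<le> (1 - \<kappa>) * (exp (2 * \<kappa>) * X)" using assms(1) by (simp add: mult.assoc)
  then show ?thesis using assms by simp
qed

text \<open>The differences \<open>f0 - f1\<close> and \<open>h0 - h1\<close> have no sign, so they
  are stored in a potential rather than estimated. Its nonnegativity lets the factor
  \<open>1 - \<kappa>\<close> act on distance and potential together.\<close>

lemma potential_block:
  fixes E :: "nat \<Rightarrow> real" and k :: nat and \<kappa> \<eta> p w q f0 f1 h0 h1 :: real
  assumes k: "0 < k" and \<kappa>: "0 \<le> \<kappa>" "\<kappa> \<le> 1/2" and pos: "0 \<le> \<eta>" "0 \<le> p" "0 \<le> f0" "0 \<le> f1" "0 \<le> h0" "0 \<le> h1" "0 \<le> w" "0 \<le> q"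
    and E: "\<And>r. 0 \<le> E r"
    and step: "\<And>r. r < k \<Longrightarrow> (1 - \<kappa>) * E (Suc r) \<le> E r + \<kappa> * w + 2 * \<eta> * (1 - r / k) * (f0 - f1) + (p * (h0 - h1) + q) / k"
  shows "E k + \<eta> * (real k + 1) * f1 + p * h1 \<le> exp (2 * \<kappa> * k) * (E 0 + \<eta> * (real k + 1) * f0 + p * h0 + (k * \<kappa> * w + q))"
proof -
  \<comment> \<open>Chosen so that \<open>P r - P (Suc r)\<close> is the coefficient
    \<open>2 * \<eta> * (1 - r / k)\<close> of the energy difference; the total over the block is
    \<open>\<eta> * (k + 1)\<close>.\<close>
  define P where "P r = \<eta> * ((real k - real r)\<^sup>2 + (real k - real r)) / k" for r
  define \<Phi> where "\<Phi> r = P r * f0 + (\<eta> * (real k + 1) - P r) * f1 + p * ((1 - r / k) * h0 + (r / k) * h1)" for r :: nat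
  define c where "c = \<kappa> * w + q / k"
  have c: "0 \<le> c" using \<kappa> pos k by (simp add: c_def)
  have P: "0 \<le> P r" "P r \<le> \<eta> * (real k + 1)" if "r \<le> k" for r
  proof -
    show "0 \<le> P r" using that pos k by (simp add: P_def)
    have "(real k - real r)\<^sup>2 + (real k - real r) \<le> (real k)\<^sup>2 + real k"
      using that by (intro add_mono power_mono) auto
    then have "P r \<le> \<eta> * ((real k)\<^sup>2 + real k) / k" unfolding P_def using pos k by (intro divide_right_mono mult_left_mono) auto
    also have "\<dots> = \<eta> * (real k + 1)" using k by (simp add: field_simps power2_eq_square)
    finally show "P r \<le> \<eta> * (real k + 1)" .
  qed
  have \<Phi>: "0 \<le> \<Phi> r" if "r \<le> k" for r
    unfolding \<Phi>_def using P[OF that] pos that k by (intro add_nonneg_nonneg mult_nonneg_nonneg) auto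
  have Pd: "P (Suc r) = P r - 2 * \<eta> * (1 - r / k)" for r
    using k by (simp add: P_def field_simps power2_eq_square)
  have \<Phi>d: "\<Phi> (Suc r) = \<Phi> r - 2 * \<eta> * (1 - r / k) * (f0 - f1) - p * (h0 - h1) / k" for r
    unfolding \<Phi>_def Pd using k by (simp add: field_simps)
  have V: "r \<le> k \<Longrightarrow> E r + \<Phi> r \<le> exp (2 * \<kappa> * r) * (E 0 + \<Phi> 0 + r * c)" for r
  proof (induction r)
    case (Suc r)
    have "(1 - \<kappa>) * (E (Suc r) + \<Phi> (Suc r)) \<le> (1 - \<kappa>) * E (Suc r) + \<Phi> (Suc r)"
      using \<Phi>[OF Suc.prems] \<kappa> by (simp add: algebra_simps)
    also have "\<dots> \<le> E r + \<Phi> r + c"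
      using step[of r] Suc.prems unfolding \<Phi>d c_def by (simp add: add_divide_distrib)
    finally have "E (Suc r) + \<Phi> (Suc r) \<le> exp (2 * \<kappa>) * (E r + \<Phi> r + c)"
      using E[of r] \<Phi>[of r] Suc.prems c \<kappa> by (intro le_exp_of_one_minus) auto
    also have "\<dots> \<le> exp (2 * \<kappa>) * (exp (2 * \<kappa> * r) * (E 0 + \<Phi> 0 + r * c) + exp (2 * \<kappa> * r) * c)"
      using Suc c \<kappa> mult_right_mono[of 1 "exp (2 * \<kappa> * r)" c] by (intro mult_left_mono add_mono) auto
    also have "\<dots> = (exp (2 * \<kappa>) * exp (2 * \<kappa> * r)) * (E 0 + \<Phi> 0 + (r + 1) * c)" by (simp add: algebra_simps)
    also have "exp (2 * \<kappa>) * exp (2 * \<kappa> * r) = exp (2 * \<kappa> * Suc r)" by (simp add: exp_add[symmetric] algebra_simps)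
    finally show ?case by (simp add: add.commute)
  qed simp
  have "\<Phi> k = \<eta> * (real k + 1) * f1 + p * h1" using k by (simp add: \<Phi>_def P_def)
  moreover have "\<Phi> 0 = \<eta> * (real k + 1) * f0 + p * h0" using k by (simp add: \<Phi>_def P_def field_simps power2_eq_square)
  moreover have "k * c = k * \<kappa> * w + q" using k by (simp add: c_def field_simps)
  ultimately show ?thesis using V[of k] by (simp add: add.assoc add.commute[of "real k" 1])
qed

text \<open>Each block returns the potential in the form in which the next one starts, so the blocks
  compose and the exponents add.\<close>

lemma potential_blocks:
  fixes f h w D :: "nat \<Rightarrow> real" and \<kappa> b p k q :: real
  assumes b: "0 \<le> \<kappa>" "\<And>i. i < n \<Longrightarrow> D (Suc i) + b * f (Suc i) + p * h (Suc i)
      \<le> exp (2 * \<kappa> * k) * (D i + b * f i + p * h i + (k * \<kappa> * w i + q))"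
    and pos: "0 \<le> k" "0 \<le> q" "\<And>i. 0 \<le> w i"
  shows "i \<le> n \<Longrightarrow> D i + b * f i + p * h i \<le> exp (2 * \<kappa> * k * i) * (D 0 + b * f 0 + p * h 0 + (k * \<kappa> * (\<Sum>j<i. w j) + i * q))"
proof (induction i)
  case (Suc i)
  define c where "c = k * \<kappa> * w i + q"
  define V where "V = D 0 + b * f 0 + p * h 0 + (k * \<kappa> * (\<Sum>j<i. w j) + i * q)"
  have c: "0 \<le> c" using b(1) pos by (simp add: c_def)
  have "D (Suc i) + b * f (Suc i) + p * h (Suc i) \<le> exp (2 * \<kappa> * k) * (D i + b * f i + p * h i + c)"
    using b(2)[of i] Suc.prems by (simp add: c_def)
  also have "\<dots> \<le> exp (2 * \<kappa> * k) * (exp (2 * \<kappa> * k * i) * V + exp (2 * \<kappa> * k * i) * c)"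
    using Suc c b pos mult_right_mono[of 1 "exp (2 * \<kappa> * k * i)" c] by (intro mult_left_mono add_mono) (auto simp: V_def)
  also have "\<dots> = (exp (2 * \<kappa> * k) * exp (2 * \<kappa> * k * i)) * (V + c)" by (simp add: algebra_simps)
  also have "exp (2 * \<kappa> * k) * exp (2 * \<kappa> * k * i) = exp (2 * \<kappa> * k * Suc i)" by (simp add: exp_add[symmetric] algebra_simps)
  also have "V + c = D 0 + b * f 0 + p * h 0 + (k * \<kappa> * (\<Sum>j<Suc i. w j) + Suc i * q)" by (simp add: V_def c_def algebra_simps)
  finally show ?case .
qed simp

text \<open>One fine step: \<open>g\<close>, the energy of the new fine point, cancels because \<open>\<tau> = k \<eta>\<close>.\<close>

lemma doubling_step:
  fixes l \<eta> \<tau> s \<theta> :: real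
  assumes k: "0 < (k::real)" and \<tau>: "\<tau> = k * \<eta>" "0 \<le> \<eta>" and s: "0 \<le> s" "s \<le> 1" and \<theta>: "0 \<le> \<theta>" "\<theta> + 1 / k \<le> 1"
    and a: "(1 + l * \<eta>) * Y0 \<le> X0 + 2 * \<eta> * (f0 - g)" and b: "(1 + l * \<eta>) * Y1 \<le> X1 + 2 * \<eta> * (f1 - g)"
    and c: "(1 - s) * (1 + l * \<tau>) * Y1 \<le> Y0 + 2 * \<tau> * (g - f1) + e"
    and d: "Y0 \<le> 2 * Y1 + 2 * W" "Y1 \<le> 2 * Y0 + 2 * W" and pos: "0 \<le> Y0" "0 \<le> Y1" "0 \<le> W"
    and \<kappa>: "2 * (s / k + 2 * \<bar>l\<bar> * \<eta>) \<le> \<kappa>"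
  shows "(1 - \<kappa>) * ((1 - (\<theta> + 1/k)) * Y0 + (\<theta> + 1/k) * Y1)
    \<le> (1 - \<theta>) * X0 + \<theta> * X1 + \<kappa> * W + 2 * \<eta> * (1 - \<theta>) * (f0 - f1) + e / k"
proof -
  \<comment> \<open>The move has two stages: the fine point advances at weight
    \<open>\<theta>\<close>, then the weight shifts by \<open>1 / k\<close>, which changes the value
    by \<open>(Y1 - Y0) / k\<close>. The fine inequalities handle the first stage, the coarse one
    divided by \<open>k\<close> the second.\<close>
  define X where "X = (1 - \<theta>) * Y0 + \<theta> * Y1"
  define E' where "E' = (1 - (\<theta> + 1/k)) * Y0 + (\<theta> + 1/k) * Y1"
  have "0 < 1 / k" using k by simp
  then have \<theta>1: "\<theta> \<le> 1" "0 < 1 / k" using \<theta> by (linarith, simp)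
  have E': "0 \<le> E'" unfolding E'_def using \<theta> \<theta>1 pos by (intro add_nonneg_nonneg mult_nonneg_nonneg) auto
  have E'X: "E' = X + (Y1 - Y0) / k" by (simp add: E'_def X_def algebra_simps add_divide_distrib diff_divide_distrib)
  have "(1 - \<theta>) * ((1 + l * \<eta>) * Y0) + \<theta> * ((1 + l * \<eta>) * Y1)
    \<le> (1 - \<theta>) * (X0 + 2 * \<eta> * (f0 - g)) + \<theta> * (X1 + 2 * \<eta> * (f1 - g))"
    by (intro add_mono mult_left_mono) (use a b \<theta>(1) \<theta>1(1) in linarith)+
  then have 1: "X \<le> - (l * \<eta>) * X + (1 - \<theta>) * X0 + \<theta> * X1 + 2 * \<eta> * ((1 - \<theta>) * f0 + \<theta> * f1 - g)"
    by (simp add: X_def algebra_simps)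
  have "1 - s - \<bar>l\<bar> * \<tau> \<le> (1 - s) * (1 + l * \<tau>)"
  proof -
    have "- \<bar>l\<bar> * \<tau> \<le> l * \<tau>" using \<tau> k by (intro mult_right_mono) auto
    then have "(1 - s) * (- \<bar>l\<bar> * \<tau>) \<le> (1 - s) * (l * \<tau>)" using s by (intro mult_left_mono) auto
    moreover have "0 \<le> s * (\<bar>l\<bar> * \<tau>)" using s \<tau> k by simp
    ultimately show ?thesis by (simp add: algebra_simps)
  qed
  then have "(1 - s - \<bar>l\<bar> * \<tau>) * Y1 \<le> (1 - s) * (1 + l * \<tau>) * Y1" using pos by (intro mult_right_mono) auto
  then have "Y1 - Y0 \<le> (s + \<bar>l\<bar> * \<tau>) * Y1 + 2 * \<tau> * (g - f1) + e" using c by (simp add: algebra_simps)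
  then have "(Y1 - Y0) / k \<le> ((s + \<bar>l\<bar> * \<tau>) * Y1 + 2 * \<tau> * (g - f1) + e) / k" using k by (intro divide_right_mono) auto
  also have "\<dots> = (s / k + \<bar>l\<bar> * \<eta>) * Y1 + 2 * \<eta> * (g - f1) + e / k" using k by (simp add: \<tau> field_simps)
  finally have 2: "(Y1 - Y0) / k \<le> (s / k + \<bar>l\<bar> * \<eta>) * Y1 + 2 * \<eta> * (g - f1) + e / k" .
  \<comment> \<open>The two distances are comparable up to \<open>W\<close>. Lower-order terms in
    any mixture of them can therefore be charged to \<open>E'\<close> and \<open>W\<close>, whatever
    the weights.\<close>
  have le: "(1 - v) * Y0 + v * Y1 \<le> 2 * (u * Y0 + (1 - u) * Y1) + 2 * W" if "0 \<le> u" "u \<le> 1" "0 \<le> v" "v \<le> 1" for u v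
  proof -
    have *: "Y \<le> 2 * (u * Y0 + (1 - u) * Y1) + 2 * W" if "Y \<le> 2 * Y0 + 2 * W" "Y \<le> 2 * Y1 + 2 * W" for Y
    proof -
      have "u * Y + (1 - u) * Y \<le> u * (2 * Y0 + 2 * W) + (1 - u) * (2 * Y1 + 2 * W)"
        using that \<open>0 \<le> u\<close> \<open>u \<le> 1\<close> by (intro add_mono mult_left_mono) auto
      then show ?thesis by (simp add: algebra_simps)
    qed
    have "(1 - v) * Y0 + v * Y1 \<le> (1 - v) * (2 * (u * Y0 + (1 - u) * Y1) + 2 * W) + v * (2 * (u * Y0 + (1 - u) * Y1) + 2 * W)"
      using that d pos by (intro add_mono mult_left_mono *) auto
    then show ?thesis by (simp add: algebra_simps)
  qed
  have X: "X \<le> 2 * E' + 2 * W" and Y1: "Y1 \<le> 2 * E' + 2 * W"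
    using le[of "1 - (\<theta> + 1/k)" \<theta>] le[of "1 - (\<theta> + 1/k)" 1] \<theta> \<theta>1 by (auto simp: X_def E'_def)
  have X0: "0 \<le> X" unfolding X_def by (intro add_nonneg_nonneg mult_nonneg_nonneg) (use pos \<theta>(1) \<theta>1(1) in linarith)+
  have "- (l * \<eta>) * X \<le> (\<bar>l\<bar> * \<eta>) * X" using X0 \<tau> by (intro mult_right_mono) (auto simp: abs_if mult_nonneg_nonneg mult_nonpos_nonneg)
  also have "\<dots> \<le> (\<bar>l\<bar> * \<eta>) * (2 * E' + 2 * W)" using X \<tau> by (intro mult_left_mono) auto
  finally have 3: "- (l * \<eta>) * X \<le> (\<bar>l\<bar> * \<eta>) * (2 * E' + 2 * W)" .
  have 4: "(s / k + \<bar>l\<bar> * \<eta>) * Y1 \<le> (s / k + \<bar>l\<bar> * \<eta>) * (2 * E' + 2 * W)" using Y1 \<tau> s k by (intro mult_left_mono) auto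
  have 5: "2 * (s / k + 2 * \<bar>l\<bar> * \<eta>) * (E' + W) \<le> \<kappa> * (E' + W)" using \<kappa> E' pos by (intro mult_right_mono) auto
  have 6: "(\<bar>l\<bar> * \<eta>) * (2 * E' + 2 * W) + (s / k + \<bar>l\<bar> * \<eta>) * (2 * E' + 2 * W) = 2 * (s / k + 2 * \<bar>l\<bar> * \<eta>) * (E' + W)"
    by (simp add: algebra_simps add_divide_distrib)
  have 7: "2 * \<eta> * ((1 - \<theta>) * f0 + \<theta> * f1 - g) + 2 * \<eta> * (g - f1) = 2 * \<eta> * (1 - \<theta>) * (f0 - f1)" by (simp add: algebra_simps)
  have 8: "\<kappa> * (E' + W) = \<kappa> * E' + \<kappa> * W" "(1 - \<kappa>) * E' = E' - \<kappa> * E'" by (simp_all add: algebra_simps)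
  show ?thesis unfolding E'_def[symmetric] using 1 2 3 4 5 6 7 8 E'X by linarith
qed

section \<open>Variational inequalities and comparison of the two schemes\<close>

context
  fixes F :: "'a::ordered_euclidean_space measure \<Rightarrow> ereal"
  assumes F_not_minf: "\<And>\<mu>. \<mu> \<in> P2 \<Longrightarrow> F \<mu> \<noteq> - \<infinity>"
begin

lemma F_ereal: "\<mu> \<in> P2 \<Longrightarrow> F \<mu> < \<infinity> \<Longrightarrow> F \<mu> = ereal (real_of_ereal (F \<mu>))"
  using F_not_minf[of \<mu>] by (cases "F \<mu>") auto

text \<open>The competitor is \<open>\<eta>\<close> smeared up to time
  \<open>e = \<alpha> * \<tau>\<close>: \<open>sch_upper\<close> bounds its cost, and the heat flow
  raises \<open>F\<close> by at most \<open>K * e / 2\<close>. At the minimizer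
  \<open>sch_lower\<close> applies, and the entropies combine to
  \<open>\<alpha> / 2 * (Ent \<rho> - Ent \<mu>)\<close>. Finiteness comes from the competitor with
  \<open>\<eta> = \<mu>\<close>.\<close>

lemma entropic_jko_step_ineq:
  assumes A: "hypothesis_A F l K" and step: "entropic_jko_step F \<alpha> \<tau> \<mu> \<rho>"
    and \<alpha>: "\<alpha> > 0" and \<tau>: "\<tau> > 0" and \<mu>: "\<mu> \<in> P2" "F \<mu> < \<infinity>" "boltzmann_entropy \<mu> < \<infinity>"
  shows "\<rho> \<in> P2" "F \<rho> < \<infinity>" "boltzmann_entropy \<rho> < \<infinity>"
    "\<eta> \<in> P2 \<Longrightarrow> F \<eta> < \<infinity> \<Longrightarrow> \<alpha> / 2 * (Ent \<rho> - Ent \<mu>) - K * \<alpha> * \<tau> / 2 + (W2 \<mu> \<rho>)\<^sup>2 / (2 * \<tau>) + real_of_ereal (F \<rho>)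
      \<le> (W2 \<mu> \<eta>)\<^sup>2 / (2 * \<tau>) + real_of_ereal (F \<eta>)"
proof -
  define e where "e = \<alpha> * \<tau>"
  have e: "e > 0" using \<alpha> \<tau> by (simp add: e_def)
  show \<rho>: "\<rho> \<in> P2" using step \<tau> by (simp add: entropic_jko_step_def is_arg_min_def)
  have min: "sch e \<mu> \<rho> / ereal \<tau> + F \<rho> \<le> sch e \<mu> \<nu> / ereal \<tau> + F \<nu>" if "\<nu> \<in> P2" for \<nu>
    using step \<tau> that by (auto simp: entropic_jko_step_def is_arg_min_def e_def not_less)
  have comp: "sch e \<mu> \<rho> / ereal \<tau> + F \<rho> \<le> ereal (((W2 \<mu> \<eta>)\<^sup>2 / 2 + e * Ent \<mu>) / \<tau> + (real_of_ereal (F \<eta>) + K * (e / 2)))"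
    if \<eta>: "\<eta> \<in> P2" "F \<eta> < \<infinity>" for \<eta>
  proof -
    have "F (\<eta> \<star> heat_kernel e) \<le> F \<eta> + ereal (K * (e / 2))"
      using A \<eta>(1) e unfolding hypothesis_A_def by auto
    moreover have "\<eta> \<star> heat_kernel e = noise e \<eta>" by (simp add: noise_def convolution_def)
    ultimately have 1: "F (noise e \<eta>) \<le> ereal (real_of_ereal (F \<eta>) + K * (e / 2))"
      using F_ereal[OF \<eta>] by (metis plus_ereal.simps(1))
    have "sch e \<mu> (noise e \<eta>) / ereal \<tau> \<le> ereal ((W2 \<mu> \<eta>)\<^sup>2 / 2 + e * Ent \<mu>) / ereal \<tau>"
      using sch_upper[OF \<mu>(1) \<eta>(1) \<mu>(3) e] \<tau> by (intro ereal_divide_right_mono) auto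
    then have "sch e \<mu> (noise e \<eta>) / ereal \<tau> \<le> ereal (((W2 \<mu> \<eta>)\<^sup>2 / 2 + e * Ent \<mu>) / \<tau>)" using \<tau> by simp
    from order_trans[OF min[OF noise_P2(1)[OF \<eta>(1) e]] add_mono[OF this 1]] show ?thesis by simp
  qed
  define L where "L = e / 2 * (Ent \<mu> + Ent \<rho>) + (W2 \<mu> \<rho>)\<^sup>2 / 2"
  have low: "ereal (L / \<tau>) \<le> sch e \<mu> \<rho> / ereal \<tau>"
  proof -
    have "ereal L / ereal \<tau> \<le> sch e \<mu> \<rho> / ereal \<tau>"
      using sch_lower[OF \<mu>(1) \<rho> e] \<tau> unfolding L_def by (intro ereal_divide_right_mono) auto
    then show ?thesis using \<tau> by simp
  qed
  show F\<rho>: "F \<rho> < \<infinity>" using comp[OF \<mu>(1,2)] low by (cases "F \<rho>"; cases "sch e \<mu> \<rho> / ereal \<tau>") auto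
  have "sch e \<mu> \<rho> / ereal \<tau> < \<infinity>" using comp[OF \<mu>(1,2)] F_ereal[OF \<rho> F\<rho>] by (cases "sch e \<mu> \<rho> / ereal \<tau>"; cases "F \<rho>") auto
  then have "sch e \<mu> \<rho> < \<infinity>" using \<tau> by (cases "sch e \<mu> \<rho>") auto
  then show "boltzmann_entropy \<rho> < \<infinity>" by (rule sch_finite_entropy[OF \<mu>(1) \<rho> e])
  assume \<eta>: "\<eta> \<in> P2" "F \<eta> < \<infinity>"
  have "ereal (L / \<tau>) + F \<rho> \<le> ereal (((W2 \<mu> \<eta>)\<^sup>2 / 2 + e * Ent \<mu>) / \<tau> + (real_of_ereal (F \<eta>) + K * (e / 2)))"
    using order_trans[OF add_right_mono[OF low] comp[OF \<eta>]] .
  then have "L / \<tau> + real_of_ereal (F \<rho>) \<le> ((W2 \<mu> \<eta>)\<^sup>2 / 2 + e * Ent \<mu>) / \<tau> + (real_of_ereal (F \<eta>) + K * (e / 2))"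
    using F_ereal[OF \<rho> F\<rho>] by (metis ereal_less_eq(3) plus_ereal.simps(1))
  moreover have "L / \<tau> = \<alpha> / 2 * (Ent \<mu> + Ent \<rho>) + (W2 \<mu> \<rho>)\<^sup>2 / (2 * \<tau>)"
    using \<tau> by (simp add: L_def e_def field_simps)
  moreover have "((W2 \<mu> \<eta>)\<^sup>2 / 2 + e * Ent \<mu>) / \<tau> = (W2 \<mu> \<eta>)\<^sup>2 / (2 * \<tau>) + \<alpha> * Ent \<mu>"
    using \<tau> by (simp add: e_def field_simps)
  ultimately have "\<alpha> / 2 * (Ent \<mu> + Ent \<rho>) + (W2 \<mu> \<rho>)\<^sup>2 / (2 * \<tau>) + real_of_ereal (F \<rho>)
      \<le> (W2 \<mu> \<eta>)\<^sup>2 / (2 * \<tau>) + \<alpha> * Ent \<mu> + (real_of_ereal (F \<eta>) + K * (e / 2))" by simp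
  then show "\<alpha> / 2 * (Ent \<rho> - Ent \<mu>) - K * \<alpha> * \<tau> / 2 + (W2 \<mu> \<rho>)\<^sup>2 / (2 * \<tau>) + real_of_ereal (F \<rho>)
      \<le> (W2 \<mu> \<eta>)\<^sup>2 / (2 * \<tau>) + real_of_ereal (F \<eta>)"
    by (simp add: e_def algebra_simps add_divide_distrib diff_divide_distrib)
qed

lemma jko_step_ineq:
  assumes step: "jko_step F \<tau> \<mu> \<rho>" and \<tau>: "\<tau> > 0" and \<mu>: "\<mu> \<in> P2" "F \<mu> < \<infinity>"
  shows "\<rho> \<in> P2" "F \<rho> < \<infinity>"
    "\<eta> \<in> P2 \<Longrightarrow> F \<eta> < \<infinity> \<Longrightarrow> (W2 \<mu> \<rho>)\<^sup>2 / (2 * \<tau>) + real_of_ereal (F \<rho>) \<le> (W2 \<mu> \<eta>)\<^sup>2 / (2 * \<tau>) + real_of_ereal (F \<eta>)"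
proof -
  show \<rho>: "\<rho> \<in> P2" using step \<tau> by (simp add: jko_step_def is_arg_min_def)
  have min: "ereal ((W2 \<mu> \<rho>)\<^sup>2 / (2 * \<tau>)) + F \<rho> \<le> ereal ((W2 \<mu> \<nu>)\<^sup>2 / (2 * \<tau>)) + F \<nu>" if "\<nu> \<in> P2" for \<nu>
    using step \<tau> that by (auto simp: jko_step_def is_arg_min_def not_less)
  show F\<rho>: "F \<rho> < \<infinity>" using min[OF \<mu>(1)] F_ereal[OF \<mu>] by (cases "F \<rho>"; cases "F \<mu>") auto
  assume \<eta>: "\<eta> \<in> P2" "F \<eta> < \<infinity>"
  show "(W2 \<mu> \<rho>)\<^sup>2 / (2 * \<tau>) + real_of_ereal (F \<rho>) \<le> (W2 \<mu> \<eta>)\<^sup>2 / (2 * \<tau>) + real_of_ereal (F \<eta>)"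
    using min[OF \<eta>(1)] F_ereal[OF \<eta>] F_ereal[OF \<rho> F\<rho>] by (metis ereal_less_eq(3) plus_ereal.simps(1))
qed

text \<open>The defect \<open>c\<close> in the minimality of \<open>\<rho>\<close> makes it impossible to let \<open>s\<close> tend to 0.\<close>

lemma discrete_EVI:
  assumes cvx: "convex_gen_geodesics l F" and P: "\<mu> \<in> P2" "\<rho> \<in> P2" "\<nu> \<in> P2"
    and fin: "F \<rho> < \<infinity>" "F \<nu> < \<infinity>" and \<tau>: "\<tau> > 0" "0 \<le> 1 + l * \<tau>" and s: "0 < s" "s \<le> 1"
    and min: "\<And>\<eta>. \<eta> \<in> P2 \<Longrightarrow> F \<eta> < \<infinity> \<Longrightarrow>
      c + (W2 \<mu> \<rho>)\<^sup>2 / (2 * \<tau>) + real_of_ereal (F \<rho>) \<le> (W2 \<mu> \<eta>)\<^sup>2 / (2 * \<tau>) + real_of_ereal (F \<eta>)"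
  shows "(1 - s) * (1 + l * \<tau>) * (W2 \<rho> \<nu>)\<^sup>2 \<le> (W2 \<mu> \<nu>)\<^sup>2 - (W2 \<mu> \<rho>)\<^sup>2
    + 2 * \<tau> * (real_of_ereal (F \<nu>) - real_of_ereal (F \<rho>)) - 2 * \<tau> * c / s"
proof -
  obtain Q where Q: "(W2 \<rho> \<nu>)\<^sup>2 \<le> Q"
    and int: "\<And>s. s \<in> {0..1} \<Longrightarrow> \<exists>\<eta>\<in>P2. F \<eta> \<le> ereal s * F \<nu> + ereal (1 - s) * F \<rho> - ereal (l / 2 * s * (1 - s) * Q) \<and>
      (W2 \<mu> \<eta>)\<^sup>2 \<le> s * (W2 \<mu> \<nu>)\<^sup>2 + (1 - s) * (W2 \<mu> \<rho>)\<^sup>2 - s * (1 - s) * Q"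
    using gen_geodesic_interpolation[OF cvx P] by blast
  define f\<nu> f\<rho> where "f\<nu> = real_of_ereal (F \<nu>)" "f\<rho> = real_of_ereal (F \<rho>)"
  obtain \<eta> where \<eta>: "\<eta> \<in> P2" "F \<eta> \<le> ereal s * F \<nu> + ereal (1 - s) * F \<rho> - ereal (l / 2 * s * (1 - s) * Q)"
    "(W2 \<mu> \<eta>)\<^sup>2 \<le> s * (W2 \<mu> \<nu>)\<^sup>2 + (1 - s) * (W2 \<mu> \<rho>)\<^sup>2 - s * (1 - s) * Q"
    using int[of s] s by auto
  have eq: "F \<nu> = ereal f\<nu>" "F \<rho> = ereal f\<rho>" using F_ereal[OF P(3) fin(2)] F_ereal[OF P(2) fin(1)] by (simp_all add: f\<nu>_f\<rho>_def)
  have F\<eta>: "F \<eta> \<le> ereal (s * f\<nu> + (1 - s) * f\<rho> - l / 2 * s * (1 - s) * Q)" using \<eta>(2) unfolding eq by simp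
  then have fin\<eta>: "F \<eta> < \<infinity>" by (cases "F \<eta>") auto
  have f\<eta>: "real_of_ereal (F \<eta>) \<le> s * f\<nu> + (1 - s) * f\<rho> - l / 2 * s * (1 - s) * Q"
    using F\<eta> F_ereal[OF \<eta>(1) fin\<eta>] by (metis ereal_less_eq(3))
  define a b where "a = (W2 \<mu> \<nu>)\<^sup>2" "b = (W2 \<mu> \<rho>)\<^sup>2"
  have "c + b / (2 * \<tau>) + f\<rho> \<le> (s * a + (1 - s) * b - s * (1 - s) * Q) / (2 * \<tau>) + (s * f\<nu> + (1 - s) * f\<rho> - l / 2 * s * (1 - s) * Q)"
  proof -
    have "(W2 \<mu> \<eta>)\<^sup>2 / (2 * \<tau>) \<le> (s * a + (1 - s) * b - s * (1 - s) * Q) / (2 * \<tau>)"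
      using \<eta>(3) \<tau> by (intro divide_right_mono) (auto simp: a_b_def)
    then show ?thesis using min[OF \<eta>(1) fin\<eta>] f\<eta> by (simp add: a_b_def f\<nu>_f\<rho>_def)
  qed
  \<comment> \<open>The terms of order 0 in \<open>s\<close> cancel, except for the defect; hence it
    alone is divided by \<open>s\<close> afterwards.\<close>
  then have "s * ((1 - s) * (1 + l * \<tau>) * Q) \<le> s * (a - b + 2 * \<tau> * (f\<nu> - f\<rho>)) - 2 * \<tau> * c"
  proof -
    have gen: "T * c + b + T * f\<rho> \<le> X + T * z" if "c + b / T + f\<rho> \<le> X / T + z" "T > 0" for X T z :: real
      using mult_left_mono[OF that(1), of T] that(2) by (simp add: distrib_left)
    from gen[OF \<open>c + b / (2 * \<tau>) + f\<rho> \<le> _\<close>] \<tau>(1) show ?thesis by (simp add: algebra_simps diff_divide_distrib)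
  qed
  then have "s * ((1 - s) * (1 + l * \<tau>) * Q) \<le> s * (a - b + 2 * \<tau> * (f\<nu> - f\<rho>) - 2 * \<tau> * c / s)"
    using s by (simp add: right_diff_distrib)
  then have "(1 - s) * (1 + l * \<tau>) * Q \<le> a - b + 2 * \<tau> * (f\<nu> - f\<rho>) - 2 * \<tau> * c / s"
    using s by (simp only: mult_le_cancel_left_pos)
  moreover have "(1 - s) * (1 + l * \<tau>) * (W2 \<rho> \<nu>)\<^sup>2 \<le> (1 - s) * (1 + l * \<tau>) * Q"
    using Q s \<tau> by (intro mult_left_mono) auto
  ultimately show ?thesis by (simp add: a_b_def f\<nu>_f\<rho>_def)
qed

text \<open>An exact minimizer has no defect, so \<open>s\<close> may tend to 0 and the full factor
  \<open>1 + l * \<tau>\<close> is kept.\<close>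

lemma jko_EVI:
  assumes cvx: "convex_gen_geodesics l F" and step: "jko_step F \<tau> \<mu> \<rho>" and \<mu>: "\<mu> \<in> P2" "F \<mu> < \<infinity>"
    and \<nu>: "\<nu> \<in> P2" "F \<nu> < \<infinity>" and \<tau>: "\<tau> > 0" "0 \<le> 1 + l * \<tau>"
  shows "(1 + l * \<tau>) * (W2 \<rho> \<nu>)\<^sup>2 \<le> (W2 \<mu> \<nu>)\<^sup>2 + 2 * \<tau> * (real_of_ereal (F \<nu>) - real_of_ereal (F \<rho>))"
proof -
  note J = jko_step_ineq[OF step \<tau>(1) \<mu>]
  define A where "A = (1 + l * \<tau>) * (W2 \<rho> \<nu>)\<^sup>2"
  define B where "B = (W2 \<mu> \<nu>)\<^sup>2 + 2 * \<tau> * (real_of_ereal (F \<nu>) - real_of_ereal (F \<rho>))"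
  have *: "(1 - s) * A \<le> B" if "0 < s" "s \<le> 1" for s
  proof -
    have "(1 - s) * (1 + l * \<tau>) * (W2 \<rho> \<nu>)\<^sup>2 \<le> (W2 \<mu> \<nu>)\<^sup>2 - (W2 \<mu> \<rho>)\<^sup>2
      + 2 * \<tau> * (real_of_ereal (F \<nu>) - real_of_ereal (F \<rho>)) - 2 * \<tau> * 0 / s"
      by (rule discrete_EVI[OF cvx \<mu>(1) J(1) \<nu>(1) J(2) \<nu>(2) \<tau> that]) (use J(3) in simp)
    then have "(1 - s) * A \<le> B - (W2 \<mu> \<rho>)\<^sup>2" by (simp add: A_def B_def mult.assoc)
    then show ?thesis using zero_le_power2[of "W2 \<mu> \<rho>"] by linarith
  qed
  have "(\<lambda>n. (1 - 1 / real (Suc n)) * A) \<longlonglongrightarrow> (1 - 0) * A"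
    by (intro tendsto_intros LIMSEQ_Suc[OF lim_1_over_n])
  then have "A \<le> B" using LIMSEQ_le_const2[of "\<lambda>n. (1 - 1 / real (Suc n)) * A" "(1 - 0) * A" B] * by auto
  then show ?thesis by (simp add: A_def B_def)
qed

text \<open>A bootstrap: the crude bound, with any coefficient \<open>B\<close>, is used only within
  distance 1 of \<open>b\<close>, and convexity from \<open>b\<close> propagates it outwards with
  the coefficient \<open>l / 2\<close> and an error of linear growth.\<close>

lemma convex_lower_bound:
  assumes cvx: "convex_gen_geodesics l F" and b: "b \<in> P2" "F b < \<infinity>"
    and low: "\<And>x. x \<in> P2 \<Longrightarrow> ereal (- A - B * (W2 b x)\<^sup>2) \<le> F x" and AB: "0 \<le> A" "0 \<le> B"
    and x: "x \<in> P2"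
  shows "ereal (l / 2 * (W2 b x)\<^sup>2 - (A + B + \<bar>real_of_ereal (F b)\<bar> + \<bar>l\<bar>) * (1 + W2 b x)) \<le> F x"
proof (cases "F x < \<infinity>")
  case False then show ?thesis by simp
next
  case True
  define D fx fb c where "D = W2 b x" and "fx = real_of_ereal (F x)" and "fb = real_of_ereal (F b)" and "c = A + B + \<bar>fb\<bar> + \<bar>l\<bar>"
  have eq: "F x = ereal fx" "F b = ereal fb" using F_ereal[OF x True] F_ereal[OF b] by (simp_all add: fx_def fb_def)
  have D0: "0 \<le> D" by (simp add: D_def W2_def)
  have c0: "0 \<le> c" using AB by (simp add: c_def)
  have "l / 2 * D\<^sup>2 - c * (1 + D) \<le> fx"
  proof (cases "D \<le> 1")
    case True
    have lo: "- A - B * D\<^sup>2 \<le> fx" using low[OF x] by (simp add: eq D_def)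
    have D2: "0 \<le> D\<^sup>2" "D\<^sup>2 \<le> 1" using True D0 by (simp_all add: power_le_one)
    have "l / 2 * D\<^sup>2 \<le> \<bar>l\<bar> * 1" using D2 by (intro mult_mono) auto
    moreover have "B * D\<^sup>2 \<le> B * 1" using D2 AB by (intro mult_left_mono) auto
    moreover have "0 \<le> c * D" using c0 D0 by simp
    ultimately show ?thesis using lo by (simp add: distrib_left) (simp add: c_def)
  next
    case False
    obtain Q where Q: "(W2 b x)\<^sup>2 \<le> Q"
      and int: "\<And>s. s \<in> {0..1} \<Longrightarrow> \<exists>\<eta>\<in>P2. F \<eta> \<le> ereal s * F x + ereal (1 - s) * F b - ereal (l / 2 * s * (1 - s) * Q) \<and>
        (W2 b \<eta>)\<^sup>2 \<le> s * (W2 b x)\<^sup>2 + (1 - s) * (W2 b b)\<^sup>2 - s * (1 - s) * Q"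
      using gen_geodesic_interpolation[OF cvx b(1) b(1) x] by blast
    \<comment> \<open>Base point and start coincide, and the squared distance to the base cannot
      become negative along the geodesic; as \<open>s\<close> tends to 0 this pins \<open>Q\<close>
      to \<open>D\<^sup>2\<close>.\<close>
    have Qs: "(1 - s) * Q \<le> D\<^sup>2" if s: "0 < s" "s \<le> 1" for s
    proof -
      obtain \<eta> where "(W2 b \<eta>)\<^sup>2 \<le> s * (W2 b x)\<^sup>2 + (1 - s) * (W2 b b)\<^sup>2 - s * (1 - s) * Q" using int[of s] s by auto
      then have "(W2 b \<eta>)\<^sup>2 \<le> s * D\<^sup>2 - s * ((1 - s) * Q)" using W2_self[OF b(1)] by (simp add: D_def mult.assoc)
      then have "s * ((1 - s) * Q) \<le> s * D\<^sup>2" using zero_le_power2[of "W2 b \<eta>"] by linarith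
      then show ?thesis using s by simp
    qed
    have "(\<lambda>n. (1 - 1 / real (Suc n)) * Q) \<longlonglongrightarrow> (1 - 0) * Q"
      by (intro tendsto_intros LIMSEQ_Suc[OF lim_1_over_n])
    then have "Q \<le> D\<^sup>2" using LIMSEQ_le_const2[of "\<lambda>n. (1 - 1 / real (Suc n)) * Q" "(1 - 0) * Q" "D\<^sup>2"] Qs by auto
    then have QD: "Q = D\<^sup>2" using Q by (simp add: D_def)
    \<comment> \<open>Selects a point within distance 1 of \<open>b\<close>, where the crude bound
      costs at most \<open>A + B\<close>.\<close>
    define s where "s = 1 / D"
    have s: "0 < s" "s \<le> 1" "s * D = 1" using False by (auto simp: s_def)
    obtain \<eta> where \<eta>: "\<eta> \<in> P2" "F \<eta> \<le> ereal s * F x + ereal (1 - s) * F b - ereal (l / 2 * s * (1 - s) * Q)"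
      "(W2 b \<eta>)\<^sup>2 \<le> s * (W2 b x)\<^sup>2 + (1 - s) * (W2 b b)\<^sup>2 - s * (1 - s) * Q" using int[of s] s by auto
    have "(W2 b \<eta>)\<^sup>2 \<le> s * D\<^sup>2 - s * (1 - s) * D\<^sup>2" using \<eta>(3) W2_self[OF b(1)] unfolding QD by (simp add: D_def)
    also have "\<dots> = (s * D)\<^sup>2" by (simp add: algebra_simps power2_eq_square)
    finally have W1: "(W2 b \<eta>)\<^sup>2 \<le> 1" using s by simp
    have "B * (W2 b \<eta>)\<^sup>2 \<le> B * 1" using W1 AB by (intro mult_left_mono) auto
    then have "ereal (- A - B) \<le> ereal (- A - B * (W2 b \<eta>)\<^sup>2)" by simp
    also have "\<dots> \<le> F \<eta>" by (rule low[OF \<eta>(1)])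
    also have "\<dots> \<le> ereal (s * fx + (1 - s) * fb - l / 2 * s * (1 - s) * D\<^sup>2)" using \<eta>(2) unfolding eq QD by simp
    finally have "- A - B \<le> s * fx + (1 - s) * fb - l / 2 * s * (1 - s) * D\<^sup>2" by simp
    then have "D * (- A - B) \<le> D * (s * fx + (1 - s) * fb - l / 2 * s * (1 - s) * D\<^sup>2)" using D0 by (intro mult_left_mono) auto
    also have "\<dots> = (s * D) * fx + (D - s * D) * fb - l / 2 * (s * D) * (D - s * D) * D" by (simp add: algebra_simps power2_eq_square)
    also have "\<dots> = fx + (D - 1) * fb - l / 2 * (D - 1) * D" using s by simp
    finally have fx: "D * (- A - B) - (D - 1) * fb + l / 2 * (D - 1) * D \<le> fx" by simp
    have "(D - 1) * fb \<le> (D - 1) * \<bar>fb\<bar>" using False by (intro mult_left_mono) auto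
    also have "\<dots> \<le> D * \<bar>fb\<bar>" by (intro mult_right_mono) auto
    finally have "(D - 1) * fb \<le> D * \<bar>fb\<bar>" .
    moreover have "l / 2 * D \<le> \<bar>l\<bar> * D" using D0 by (intro mult_right_mono) auto
    moreover have "D * (- A - B) - (D - 1) * fb + l / 2 * (D - 1) * D
      = - (A * D) - B * D - (D - 1) * fb + (l / 2 * D\<^sup>2 - l / 2 * D)"
      by (simp add: field_simps power2_eq_square)
    moreover have "c * (1 + D) = c + A * D + B * D + D * \<bar>fb\<bar> + \<bar>l\<bar> * D" by (simp add: c_def algebra_simps)
    ultimately show ?thesis using fx c0 by linarith
  qed
  then show ?thesis unfolding eq(1) by (simp add: D_def c_def fb_def)
qed

text \<open>Completing the square absorbs the linear error into an arbitrarily small excess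
  \<open>d\<close> of the coefficient.\<close>

lemma quadratic_lower_bound:
  assumes cvx: "convex_gen_geodesics l F" and b: "b \<in> P2" "F b < \<infinity>"
    and low: "\<And>x. x \<in> P2 \<Longrightarrow> ereal (- A - B * (W2 b x)\<^sup>2) \<le> F x" and AB: "0 \<le> A" "0 \<le> B"
    and d: "d > 0"
  obtains c where "0 \<le> c" "\<And>x. x \<in> P2 \<Longrightarrow> F x < \<infinity> \<Longrightarrow> - c - (max (- l) 0 / 2 + d) * (W2 b x)\<^sup>2 \<le> real_of_ereal (F x)"
proof -
  define c where "c = A + B + \<bar>real_of_ereal (F b)\<bar> + \<bar>l\<bar>"
  have c0: "0 \<le> c" using AB unfolding c_def by (intro add_nonneg_nonneg abs_ge_zero)
  show ?thesis
  proof (rule that[of "c + c\<^sup>2 / (4 * d)"])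
    show "0 \<le> c + c\<^sup>2 / (4 * d)" using c0 d by simp
    fix x :: "'a measure" assume x: "x \<in> P2" "F x < \<infinity>"
    define D where "D = W2 b x"
    have "ereal (l / 2 * D\<^sup>2 - c * (1 + D)) \<le> F x"
      unfolding D_def c_def by (rule convex_lower_bound[OF cvx b low AB x(1)])
    then have 1: "l / 2 * D\<^sup>2 - c * (1 + D) \<le> real_of_ereal (F x)" using F_ereal[OF x] by (metis ereal_less_eq(3))
    have "0 \<le> (2 * d * D - c)\<^sup>2 / (4 * d)" using d by simp
    also have "\<dots> = d * D\<^sup>2 - c * D + c\<^sup>2 / (4 * d)" using d by (simp add: power2_eq_square field_simps)
    finally have 2: "c * D \<le> d * D\<^sup>2 + c\<^sup>2 / (4 * d)" by simp
    have 3: "(- max (- l) 0 / 2) * D\<^sup>2 \<le> l / 2 * D\<^sup>2" by (intro mult_right_mono) auto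
    have gen: "- (c + z) - (m + d) * q \<le> f" if "lq - c * (1 + D) \<le> f" "c * D \<le> d * q + z" "(- m) * q \<le> lq" for z m q lq f :: real
      using that by (simp add: algebra_simps)
    show "- (c + c\<^sup>2 / (4 * d)) - (max (- l) 0 / 2 + d) * (W2 b x)\<^sup>2 \<le> real_of_ereal (F x)"
      unfolding D_def[symmetric] by (rule gen[OF 1 2]) (use 3 in simp)
  qed
qed

text \<open>The summed energy inequalities bound the squared steps in terms of lower bounds for
  \<open>F\<close> and \<open>Ent\<close>, which are themselves quadratic in the distance to
  \<open>b\<close>. Their coefficient is small enough for the admissible time steps, so
  \<open>moment_gronwall\<close> closes the loop. Distances are measured from the reference
  \<open>b\<close>, and \<open>x 0\<close> enters through its energy, entropy and second moment
  only, so one \<open>R\<close> serves all such data.\<close>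

lemma entropic_iterates_bounds:
  assumes A: "hypothesis_A F l K" and b: "b \<in> P2" "F b < \<infinity>"
    and low: "\<And>x. x \<in> P2 \<Longrightarrow> ereal (- A0 - B0 * (W2 b x)\<^sup>2) \<le> F x" and AB: "0 \<le> A0" "0 \<le> B0"
    and t: "t > 0" and \<alpha>0: "\<alpha>0 > 0"
  obtains R where "0 \<le> R" "\<And>n \<alpha> \<tau> x. real n * \<tau> = t \<Longrightarrow> 0 < \<tau> \<Longrightarrow> max (- l) 0 * (2 * \<tau>) \<le> 1 \<Longrightarrow> 0 < \<alpha> \<Longrightarrow> \<alpha> \<le> \<alpha>0
    \<Longrightarrow> x 0 \<in> P2 \<Longrightarrow> F (x 0) = ereal f0 \<Longrightarrow> boltzmann_entropy (x 0) = ereal h0 \<Longrightarrow> second_moment (x 0) = second_moment b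
    \<Longrightarrow> (\<And>i. i < n \<Longrightarrow> entropic_jko_step F \<alpha> \<tau> (x i) (x (Suc i)))
    \<Longrightarrow> (\<forall>i\<le>n. x i \<in> P2 \<and> F (x i) < \<infinity> \<and> boltzmann_entropy (x i) < \<infinity> \<and> - R \<le> real_of_ereal (F (x i)) \<and> - R \<le> Ent (x i))
      \<and> (\<Sum>i<n. (W2 (x i) (x (Suc i)))\<^sup>2) \<le> R * \<tau>"
proof -
  have cvx: "convex_gen_geodesics l F" using A by (simp add: hypothesis_A_def)
  \<comment> \<open>Makes \<open>4 * d * t\<close> equal to \<open>1/8\<close>.\<close>
  define d where "d = 1 / (32 * t)"
  have d: "d > 0" using t by (simp add: d_def)
  obtain c where c0: "0 \<le> c" and c: "\<And>x. x \<in> P2 \<Longrightarrow> F x < \<infinity> \<Longrightarrow> - c - (max (- l) 0 / 2 + d) * (W2 b x)\<^sup>2 \<le> real_of_ereal (F x)"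
    using quadratic_lower_bound[OF cvx b low AB d] by blast
  \<comment> \<open>The coefficient from \<open>F\<close> contains one \<open>d\<close>; the second
    one pays for the entropy.\<close>
  define \<beta> where "\<beta> = max (- l) 0 / 2 + 2 * d"
  have \<beta>: "\<beta> > 0" using d by (simp add: \<beta>_def add_nonneg_pos)
  define a where "a = 16 * \<beta>"
  have a: "a > 0" "2 * \<beta> / a \<le> 1/8" using \<beta> by (simp_all add: a_def)
  define m2 where "m2 = second_moment b"
  have m2: "0 \<le> m2" by (simp add: m2_def second_moment_def)
  \<comment> \<open>Makes the entropy, weighted by at most \<open>\<alpha>0 / 2\<close>, cost no
    more than \<open>d\<close> times the squared distance.\<close>
  define \<epsilon> where "\<epsilon> = d / \<alpha>0"
  have \<epsilon>: "\<epsilon> > 0" "\<alpha>0 * \<epsilon> = d" using d \<alpha>0 by (simp_all add: \<epsilon>_def)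
  define C where "C = (pi / \<epsilon>) powr (real DIM('a) / 2)"
  have C: "0 \<le> C" by (simp add: C_def)
  define E where "E = \<bar>f0\<bar> + \<alpha>0 / 2 * \<bar>h0\<bar> + \<bar>K\<bar> * \<alpha>0 * t / 2 + c + \<alpha>0 / 2 * (2 * \<epsilon> * m2 + C)"
  have E: "0 \<le> E" "c \<le> E" unfolding E_def using \<alpha>0 t c0 \<epsilon> m2 C by auto
  \<comment> \<open>\<open>4 * m2\<close> bounds the squared distance of two measures with second
    moment \<open>m2\<close>, here of \<open>x 0\<close> and \<open>b\<close>.\<close>
  define U where "U = 4 * (4 * m2 + 2 * (t + 1/a) * E) * exp (4 * a * t)"
  have U: "0 \<le> U" unfolding U_def using m2 t a E by auto
  define R where "R = 2 * (E + \<beta> * U) + 2 * \<epsilon> * (m2 + U) + C"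
  have R: "E + \<beta> * U \<le> R" "2 * (E + \<beta> * U) \<le> R" "2 * \<epsilon> * (m2 + U) + C \<le> R" "0 \<le> R"
    unfolding R_def using E \<beta> U \<epsilon> m2 C by auto
  show ?thesis
  proof (rule that[OF R(4)])
    fix n :: nat and \<alpha> \<tau> :: real and x :: "nat \<Rightarrow> 'a measure"
    assume n\<tau>: "real n * \<tau> = t" and \<tau>: "0 < \<tau>" and l\<tau>: "max (- l) 0 * (2 * \<tau>) \<le> 1" and \<alpha>: "0 < \<alpha>" "\<alpha> \<le> \<alpha>0"
      and x0: "x 0 \<in> P2" "F (x 0) = ereal f0" "boltzmann_entropy (x 0) = ereal h0" "second_moment (x 0) = second_moment b"
      and step: "\<And>i. i < n \<Longrightarrow> entropic_jko_step F \<alpha> \<tau> (x i) (x (Suc i))"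
    have x: "i \<le> n \<Longrightarrow> x i \<in> P2 \<and> F (x i) < \<infinity> \<and> boltzmann_entropy (x i) < \<infinity>" for i
    proof (induction i)
      case (Suc i)
      then show ?case using entropic_jko_step_ineq(1-3)[OF A step[of i] \<alpha>(1) \<tau>] by simp
    qed (use x0 in simp)
    define f H w u where "f i = real_of_ereal (F (x i))" and "H i = Ent (x i)" and "w i = (W2 (x i) (x (Suc i)))\<^sup>2"
      and "u i = (W2 b (x i))\<^sup>2" for i
    have "1 \<le> n" using n\<tau> t by (cases n) auto
    then have \<tau>t: "\<tau> \<le> t" using n\<tau> \<tau> mult_right_mono[of 1 "real n" \<tau>] by simp
    have energy: "\<alpha> / 2 * (H (Suc i) - H i) - K * \<alpha> * \<tau> / 2 + w i / (2 * \<tau>) + f (Suc i) \<le> f i" if "i < n" for i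
      using entropic_jko_step_ineq(4)[OF A step[OF that] \<alpha>(1) \<tau>, of "x i"] x[of i] that W2_self[of "x i"]
      by (simp add: f_def H_def w_def)
    have f: "- c - (max (- l) 0 / 2 + d) * u i \<le> f i" if "i \<le> n" for i
      using c[of "x i"] x[OF that] by (simp add: u_def f_def)
    have H: "- (2 * \<epsilon> * (m2 + u i)) - C \<le> H i" if "i \<le> n" for i
      using Ent_lower_bound[OF b(1) _ _ \<epsilon>(1), of "x i"] x[OF that] by (simp add: m2_def u_def H_def C_def)
    have u0: "0 \<le> u i" for i by (simp add: u_def)
    have Q: "(\<Sum>j<i. w j) / (2 * \<tau>) \<le> E + \<beta> * u i" if i: "i \<le> n" for i
    proof -
      have "(\<alpha> / 2) * - H i \<le> \<alpha> / 2 * (2 * \<epsilon> * (m2 + u i) + C)"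
        using \<alpha> H[OF i] by (intro mult_left_mono) auto
      then have "- (\<alpha> / 2 * H i) \<le> \<alpha> / 2 * (2 * \<epsilon> * (m2 + u i) + C)" by simp
      also have "\<alpha> / 2 * (2 * \<epsilon> * (m2 + u i) + C) \<le> \<alpha>0 / 2 * (2 * \<epsilon> * (m2 + u i) + C)"
        using \<alpha> \<epsilon> m2 u0[of i] C by (intro mult_right_mono) auto
      also have "\<alpha>0 / 2 * (2 * \<epsilon> * (m2 + u i) + C) = \<alpha>0 / 2 * (2 * \<epsilon> * m2 + C) + (\<alpha>0 * \<epsilon>) * u i"
        by (simp add: algebra_simps)
      finally have 1: "- (\<alpha> / 2 * H i) \<le> \<alpha>0 / 2 * (2 * \<epsilon> * m2 + C) + d * u i" by (simp only: \<epsilon>(2))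
      have "\<alpha> / 2 * H 0 \<le> \<alpha> / 2 * \<bar>h0\<bar>" using \<alpha> by (intro mult_left_mono) (auto simp: H_def Ent_def x0(3))
      also have "\<dots> \<le> \<alpha>0 / 2 * \<bar>h0\<bar>" using \<alpha> by (intro mult_right_mono) auto
      finally have "\<alpha> / 2 * H 0 \<le> \<alpha>0 / 2 * \<bar>h0\<bar>" .
      moreover have "f 0 \<le> \<bar>f0\<bar>" by (simp add: f_def x0)
      moreover have "real i * (K * \<alpha> * \<tau> / 2) \<le> \<bar>K\<bar> * \<alpha>0 * t / 2"
      proof -
        have "real i * (K * \<alpha> * \<tau> / 2) = (K * \<alpha>) * (real i * \<tau>) / 2" by simp
        also have "\<dots> \<le> (\<bar>K\<bar> * \<alpha>) * (real i * \<tau>) / 2"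
          using \<alpha> \<tau> by (intro divide_right_mono mult_right_mono) auto
        also have "\<dots> \<le> (\<bar>K\<bar> * \<alpha>0) * (real n * \<tau>) / 2"
          using \<alpha> \<alpha>0 \<tau> i by (intro divide_right_mono mult_mono) auto
        finally show ?thesis by (simp add: n\<tau>)
      qed
      moreover have "f i + (\<Sum>j<i. w j) / (2 * \<tau>) + \<alpha> / 2 * H i \<le> f 0 + \<alpha> / 2 * H 0 + real i * (K * \<alpha> * \<tau> / 2)"
        using i by (rule energy_sum[where n = n, rotated]) (rule energy)
      ultimately have "(\<Sum>j<i. w j) / (2 * \<tau>) \<le> E - c + d * u i - f i" using 1 unfolding E_def by linarith
      also have "\<dots> \<le> E + \<beta> * u i" using f[OF i] by (simp add: \<beta>_def algebra_simps)
      finally show ?thesis .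
    qed
    have ub: "u i \<le> U" if i: "i \<le> n" for i
    proof -
      have "u i \<le> 4 * (u 0 + 2 * (t + 1/a) * E) * exp (4 * a * t)"
      proof (rule moment_gronwall[OF \<tau> \<tau>t _ a(1) E(1) _ _ a(2) u0 _ Q i])
        \<comment> \<open>\<open>5/8\<close> is \<open>1/2 + 1/8\<close>: the restriction on the
          time step pays for the negative part of \<open>l\<close>, the choice of \<open>d\<close>
          for the rest.\<close>
        show "2 * \<tau> * \<beta> \<le> 5 / 8"
        proof -
          have "2 * \<tau> * \<beta> = max (- l) 0 * (2 * \<tau>) / 2 + 4 * d * \<tau>" by (simp add: \<beta>_def algebra_simps)
          also have "4 * d * \<tau> \<le> 4 * d * t" using d \<tau>t by (intro mult_left_mono) auto
          also have "4 * d * t = 1/8" using t by (simp add: d_def)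
          finally show ?thesis using l\<tau> by simp
        qed
        show "u (Suc i) \<le> (1 + a * \<tau>) * u i + (1 + 1 / (a * \<tau>)) * w i" if "i < n" for i
          unfolding u_def w_def using that x[of i] x[of "Suc i"] a \<tau> by (intro W2_sq_triangle b(1)) auto
      qed (use n\<tau> \<beta> in auto)
      also have "\<dots> \<le> U" unfolding U_def
        using W2_sq_le_second_moments[OF b(1) x0(1)] x0(4) by (intro mult_right_mono mult_left_mono add_right_mono) (auto simp: u_def m2_def)
      finally show ?thesis .
    qed
    have \<beta>u: "\<beta> * u i \<le> \<beta> * U" if "i \<le> n" for i using ub[OF that] \<beta> by (intro mult_left_mono) auto
    have "- R \<le> f i \<and> - R \<le> H i" if i: "i \<le> n" for i
    proof
      have "(max (- l) 0 / 2 + d) * u i \<le> \<beta> * u i" using d u0 by (intro mult_right_mono) (auto simp: \<beta>_def)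
      then show "- R \<le> f i" using f[OF i] \<beta>u[OF i] R(1) E by linarith
      have "2 * \<epsilon> * (m2 + u i) \<le> 2 * \<epsilon> * (m2 + U)" using ub[OF i] \<epsilon> by (intro mult_left_mono) auto
      then show "- R \<le> H i" using H[OF i] R(3) by linarith
    qed
    moreover have "(\<Sum>i<n. w i) \<le> R * \<tau>"
    proof -
      have "(\<Sum>i<n. w i) / (2 * \<tau>) \<le> E + \<beta> * U" using Q[of n] \<beta>u[of n] by simp
      then have "(\<Sum>i<n. w i) \<le> (E + \<beta> * U) * (2 * \<tau>)" using \<tau> by (simp add: pos_divide_le_eq)
      also have "\<dots> = 2 * (E + \<beta> * U) * \<tau>" by simp
      also have "\<dots> \<le> R * \<tau>" using R \<tau> by (intro mult_right_mono) auto
      finally show ?thesis .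
    qed
    ultimately show "(\<forall>i\<le>n. x i \<in> P2 \<and> F (x i) < \<infinity> \<and> boltzmann_entropy (x i) < \<infinity> \<and> - R \<le> real_of_ereal (F (x i)) \<and> - R \<le> Ent (x i))
      \<and> (\<Sum>i<n. (W2 (x i) (x (Suc i)))\<^sup>2) \<le> R * \<tau>"
      using x by (auto simp: f_def H_def w_def)
  qed
qed

text \<open>One entropic step of length \<open>k * \<eta>\<close> against \<open>k\<close> exact
  steps of length \<open>\<eta>\<close>. While the block proceeds, the weight moves linearly from
  \<open>x0\<close> to \<open>x1\<close>, at the rate for which the energies of the fine points
  cancel. The parameter in \<open>discrete_EVI\<close> is \<open>s = 1 / n\<close>.\<close>

lemma doubling_block:
  fixes x0 x1 :: "'a measure" and y :: "nat \<Rightarrow> 'a measure" and n k :: nat and \<eta> l K \<alpha> \<kappa> R :: real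
  assumes A: "hypothesis_A F l K" and n: "0 < n" and k: "0 < k" and \<eta>: "0 < \<eta>" and l: "0 \<le> 1 + l * (k * \<eta>)"
    and \<alpha>: "0 < \<alpha>" and \<kappa>: "2 * (1 / (n * k) + 2 * \<bar>l\<bar> * \<eta>) \<le> \<kappa>" "\<kappa> \<le> 1/2"
    and x0: "x0 \<in> P2" "F x0 < \<infinity>" "boltzmann_entropy x0 < \<infinity>"
    and xs: "entropic_jko_step F \<alpha> (k * \<eta>) x0 x1"
    and lower: "- R \<le> real_of_ereal (F x0)" "- R \<le> real_of_ereal (F x1)" "- R \<le> Ent x0" "- R \<le> Ent x1"
    and y0: "y 0 \<in> P2" "F (y 0) < \<infinity>" and ys: "\<And>r. r < k \<Longrightarrow> jko_step F \<eta> (y r) (y (Suc r))"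
  defines "t \<equiv> n * k * \<eta>"
  shows "(W2 x1 (y k))\<^sup>2 + \<eta> * (real k + 1) * (real_of_ereal (F x1) + R) + t * \<alpha> * (Ent x1 + R)
    \<le> exp (2 * \<kappa> * k) * ((W2 x0 (y 0))\<^sup>2 + \<eta> * (real k + 1) * (real_of_ereal (F x0) + R) + t * \<alpha> * (Ent x0 + R)
      + (k * \<kappa> * (W2 x0 x1)\<^sup>2 + t * (\<bar>K\<bar> * \<alpha> * (k * \<eta>))))"
proof -
  have cvx: "convex_gen_geodesics l F" using A by (simp add: hypothesis_A_def)
  have \<tau>: "0 < k * \<eta>" using k \<eta> by simp
  note S = entropic_jko_step_ineq[OF A xs \<alpha> \<tau> x0]
  have l\<eta>: "0 \<le> 1 + l * \<eta>"
  proof (cases "0 \<le> l")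
    case False
    have "l * (k * \<eta>) \<le> l * \<eta>" using False \<eta> k by (intro mult_left_mono_neg) auto
    then show ?thesis using l by linarith
  qed (use \<eta> in simp)
  have y: "r \<le> k \<Longrightarrow> y r \<in> P2 \<and> F (y r) < \<infinity>" for r
  proof (induction r)
    case (Suc r)
    then show ?case using jko_step_ineq(1,2)[OF ys[of r] \<eta>] by simp
  qed (use y0 in simp)
  define E where "E r = (1 - real r / k) * (W2 x0 (y r))\<^sup>2 + (real r / k) * (W2 x1 (y r))\<^sup>2" for r
  \<comment> \<open>Beyond \<open>k\<close> the interpolation weights leave the unit interval; the
    value 0 supplies nonnegativity for all \<open>r\<close>.\<close>
  define E' where "E' r = (if r \<le> k then E r else 0)" for r
  have t: "0 \<le> t" using \<eta> by (simp add: t_def)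
  have \<kappa>0: "0 \<le> \<kappa>" using \<kappa>(1) \<eta> by (intro order_trans[OF _ \<kappa>(1)]) auto
  have "E' k + \<eta> * (real k + 1) * (real_of_ereal (F x1) + R) + t * \<alpha> * (Ent x1 + R)
    \<le> exp (2 * \<kappa> * k) * (E' 0 + \<eta> * (real k + 1) * (real_of_ereal (F x0) + R) + t * \<alpha> * (Ent x0 + R)
      + (k * \<kappa> * (W2 x0 x1)\<^sup>2 + t * (\<bar>K\<bar> * \<alpha> * (k * \<eta>))))"
  proof (rule potential_block[OF k \<kappa>0 \<kappa>(2)])
    show "0 \<le> E' r" for r
      unfolding E'_def E_def using k by (auto intro!: add_nonneg_nonneg mult_nonneg_nonneg simp: divide_le_eq_1)
    fix r assume r: "r < k"
    define z where "z = y (Suc r)"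
    have z: "z \<in> P2" "F z < \<infinity>" and yr: "y r \<in> P2" "F (y r) < \<infinity>" using y[of "Suc r"] y[of r] r by (auto simp: z_def)
    have j: "(1 + l * \<eta>) * (W2 \<nu> z)\<^sup>2 \<le> (W2 \<nu> (y r))\<^sup>2 + 2 * \<eta> * (real_of_ereal (F \<nu>) - real_of_ereal (F z))"
      if "\<nu> \<in> P2" "F \<nu> < \<infinity>" for \<nu>
      using jko_EVI[OF cvx ys[OF r] yr that \<eta> l\<eta>] W2_commute[OF that(1) z(1)] W2_commute[OF that(1) yr(1)]
      by (simp add: z_def)
    have sk: "Suc r / real k = real r / k + 1 / k" by (simp add: add_divide_distrib)
    have rk: "real r / k + 1 / k \<le> 1" using r k unfolding sk[symmetric] by simp
    define c where "c = \<alpha> / 2 * (Ent x1 - Ent x0) - K * \<alpha> * (k * \<eta>) / 2"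
    \<comment> \<open>The defect divided by \<open>s = 1 / n\<close>: the factor
      \<open>2 * k * \<eta> * n\<close> is \<open>2 * t\<close>, so the entropy difference enters
      with weight \<open>t * \<alpha>\<close> for every \<open>n\<close>.\<close>
    define e where "e = - (2 * (k * \<eta>) * c / (1 / n))"
    have e: "e \<le> t * \<alpha> * (Ent x0 - Ent x1) + t * (\<bar>K\<bar> * \<alpha> * (k * \<eta>))"
    proof -
      have "e = t * \<alpha> * (Ent x0 - Ent x1) + t * (K * \<alpha> * (k * \<eta>))"
        by (simp add: e_def c_def t_def algebra_simps diff_divide_distrib)
      moreover have "t * (K * \<alpha> * (k * \<eta>)) \<le> t * (\<bar>K\<bar> * \<alpha> * (k * \<eta>))"
        using t \<alpha> \<eta> by (intro mult_left_mono mult_right_mono) auto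
      ultimately show ?thesis by simp
    qed
    have "(1 - 1/n) * (1 + l * (k * \<eta>)) * (W2 x1 z)\<^sup>2 \<le> (W2 x0 z)\<^sup>2 - (W2 x0 x1)\<^sup>2
        + 2 * (k * \<eta>) * (real_of_ereal (F z) - real_of_ereal (F x1)) - 2 * (k * \<eta>) * c / (1/n)"
      by (rule discrete_EVI[OF cvx x0(1) S(1) z(1) S(2) z(2) \<tau> l]) (use n S(4) in \<open>auto simp: c_def\<close>)
    then have c: "(1 - 1/n) * (1 + l * (k * \<eta>)) * (W2 x1 z)\<^sup>2 \<le> (W2 x0 z)\<^sup>2
        + 2 * (k * \<eta>) * (real_of_ereal (F z) - real_of_ereal (F x1)) + e"
      using zero_le_power2[of "W2 x0 x1"] unfolding e_def by linarith
    have d: "(W2 x0 z)\<^sup>2 \<le> 2 * (W2 x1 z)\<^sup>2 + 2 * (W2 x0 x1)\<^sup>2" "(W2 x1 z)\<^sup>2 \<le> 2 * (W2 x0 z)\<^sup>2 + 2 * (W2 x0 x1)\<^sup>2"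
      using W2_sq_triangle[OF x0(1) S(1) z(1), of 1] W2_sq_triangle[OF S(1) x0(1) z(1), of 1] W2_commute[OF x0(1) S(1)] by auto
    have "(1 - \<kappa>) * ((1 - (real r / k + 1/k)) * (W2 x0 z)\<^sup>2 + (real r / k + 1/k) * (W2 x1 z)\<^sup>2)
      \<le> (1 - real r / k) * (W2 x0 (y r))\<^sup>2 + (real r / k) * (W2 x1 (y r))\<^sup>2 + \<kappa> * (W2 x0 x1)\<^sup>2
        + 2 * \<eta> * (1 - real r / k) * (real_of_ereal (F x0) - real_of_ereal (F x1)) + e / k"
      by (rule doubling_step[OF _ refl _ _ _ _ rk j[OF x0(1,2)] j[OF S(1,2)] c d])
        (use k \<eta> n \<kappa>(1) in \<open>auto simp: mult.commute\<close>)
    also have "e / k \<le> (t * \<alpha> * (Ent x0 - Ent x1) + t * (\<bar>K\<bar> * \<alpha> * (k * \<eta>))) / k"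
      using e k by (intro divide_right_mono) auto
    finally show "(1 - \<kappa>) * E' (Suc r) \<le> E' r + \<kappa> * (W2 x0 x1)\<^sup>2
      + 2 * \<eta> * (1 - real r / k) * ((real_of_ereal (F x0) + R) - (real_of_ereal (F x1) + R))
      + (t * \<alpha> * ((Ent x0 + R) - (Ent x1 + R)) + t * (\<bar>K\<bar> * \<alpha> * (k * \<eta>))) / k"
      using r unfolding E'_def E_def sk z_def by simp
  qed (use \<eta> \<alpha> t lower in auto)
  then show ?thesis using k by (simp add: E'_def E_def)
qed

lemma jko_iterates_P2:
  assumes "\<And>j. j < m \<Longrightarrow> jko_step F \<eta> (y j) (y (Suc j))" "0 < \<eta>" "y 0 \<in> P2" "F (y 0) < \<infinity>"
  shows "j \<le> m \<Longrightarrow> y j \<in> P2 \<and> F (y j) < \<infinity>"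
proof (induction j)
  case (Suc j)
  then show ?case using jko_step_ineq(1,2)[OF assms(1)[of j] assms(2)] by simp
qed (use assms in simp)

text \<open>With \<open>c = 1 + \<bar>l\<bar> * t\<close> the loss per fine step is
  \<open>\<kappa> = 4 * c / (n * k)\<close>, so \<open>n * k\<close> steps cost a factor
  \<open>exp (8 * c)\<close> whatever \<open>k\<close> is; the bound on \<open>k\<close> ensures
  \<open>\<kappa> \<le> 1/2\<close>. The energy potential has weight at most
  \<open>2 * t / n\<close>, the entropy and \<open>K\<close> terms are proportional to
  \<open>\<alpha>\<close>, and the squared steps sum to order \<open>1 / n\<close>. The square root
  is taken later.\<close>

lemma doubling_estimate:
  fixes x y :: "nat \<Rightarrow> 'a measure" and n k :: nat and t l K \<alpha> R :: real
  assumes A: "hypothesis_A F l K" and n: "0 < n" and t: "0 < t" and l: "0 \<le> 1 + l * (t / n)"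
    and \<alpha>: "0 < \<alpha>" and k: "8 * (1 + \<bar>l\<bar> * t) \<le> k"
    and x: "\<And>i. i \<le> n \<Longrightarrow> x i \<in> P2 \<and> F (x i) < \<infinity> \<and> boltzmann_entropy (x i) < \<infinity> \<and> - R \<le> real_of_ereal (F (x i)) \<and> - R \<le> Ent (x i)"
    and W: "(\<Sum>i<n. (W2 (x i) (x (Suc i)))\<^sup>2) \<le> R * (t / n)" and R: "0 \<le> R"
    and xs: "\<And>i. i < n \<Longrightarrow> entropic_jko_step F \<alpha> (t / n) (x i) (x (Suc i))"
    and y0: "y 0 = x 0" and ys: "\<And>j. j < n * k \<Longrightarrow> jko_step F (t / (n * k)) (y j) (y (Suc j))"
  shows "(W2 (x n) (y (n * k)))\<^sup>2 \<le> exp (8 * (1 + \<bar>l\<bar> * t)) * (2 * t * (real_of_ereal (F (x 0)) + R) + 4 * (1 + \<bar>l\<bar> * t) * R * t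
    + t * (Ent (x 0) + R) + \<bar>K\<bar> * t\<^sup>2) * (\<alpha> + 1 / n)"
proof -
  define c where "c = 1 + \<bar>l\<bar> * t"
  have c: "1 \<le> c" using t by (simp add: c_def)
  have k0: "0 < k" "1 \<le> real k" using k c by (auto simp: c_def[symmetric])
  define \<eta> where "\<eta> = t / (n * k)"
  define \<kappa> where "\<kappa> = 4 * c / (n * k)"
  have \<eta>: "0 < \<eta>" "n * k * \<eta> = t" "k * \<eta> = t / n" using t n k0 by (simp_all add: \<eta>_def)
  have \<kappa>0: "0 \<le> \<kappa>" using c by (simp add: \<kappa>_def)
  have nk: "real k \<le> real n * real k" using n k0 mult_right_mono[of 1 "real n" "real k"] by simp
  have \<kappa>: "2 * (1 / (n * k) + 2 * \<bar>l\<bar> * \<eta>) \<le> \<kappa>" "\<kappa> \<le> 1/2"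
  proof -
    have "2 * (1 / (n * k) + 2 * \<bar>l\<bar> * \<eta>) = (2 + 4 * \<bar>l\<bar> * t) / (n * k)" by (simp add: \<eta>_def add_divide_distrib)
    also have "\<dots> \<le> \<kappa>" unfolding \<kappa>_def c_def by (intro divide_right_mono) auto
    finally show "2 * (1 / (n * k) + 2 * \<bar>l\<bar> * \<eta>) \<le> \<kappa>" .
    have "8 * c \<le> real n * real k" using k nk by (simp add: c_def)
    then show "\<kappa> \<le> 1/2" using n k0 by (simp add: \<kappa>_def divide_le_eq)
  qed
  have y: "j \<le> n * k \<Longrightarrow> y j \<in> P2 \<and> F (y j) < \<infinity>" for j
    by (rule jko_iterates_P2[of "n * k" "t / (n * k)"]) (use ys y0 x[of 0] \<eta> in \<open>auto simp: \<eta>_def\<close>)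
  define f h w D where "f i = real_of_ereal (F (x i)) + R" and "h i = Ent (x i) + R" and "w i = (W2 (x i) (x (Suc i)))\<^sup>2"
    and "D i = (W2 (x i) (y (i * k)))\<^sup>2" for i
  define q where "q = t * (\<bar>K\<bar> * \<alpha> * (t / n))"
  have q: "0 \<le> q" using t \<alpha> by (simp add: q_def)
  have f: "0 \<le> f i" "0 \<le> h i" if "i \<le> n" for i using x[OF that] by (auto simp: f_def h_def)
  have block: "D (Suc i) + \<eta> * (real k + 1) * f (Suc i) + t * \<alpha> * h (Suc i)
      \<le> exp (2 * \<kappa> * k) * (D i + \<eta> * (real k + 1) * f i + t * \<alpha> * h i + (k * \<kappa> * w i + q))" if i: "i < n" for i
  proof -
    have ik: "Suc i * k \<le> n * k" using i by (intro mult_right_mono) auto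
    have "(W2 (x (Suc i)) (y (i * k + k)))\<^sup>2 + \<eta> * (real k + 1) * (real_of_ereal (F (x (Suc i))) + R) + (real (n * k) * \<eta>) * \<alpha> * (Ent (x (Suc i)) + R)
      \<le> exp (2 * \<kappa> * k) * ((W2 (x i) (y (i * k + 0)))\<^sup>2 + \<eta> * (real k + 1) * (real_of_ereal (F (x i)) + R) + (real (n * k) * \<eta>) * \<alpha> * (Ent (x i) + R)
      + (k * \<kappa> * (W2 (x i) (x (Suc i)))\<^sup>2 + (real (n * k) * \<eta>) * (\<bar>K\<bar> * \<alpha> * (k * \<eta>))))"
    proof (rule doubling_block[OF A n k0(1) \<eta>(1) _ \<alpha> \<kappa>, where y = "\<lambda>r. y (i * k + r)"])
      show "jko_step F \<eta> (y (i * k + r)) (y (i * k + Suc r))" if "r < k" for r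
        using ys[of "i * k + r"] that ik by (simp add: \<eta>_def)
    qed (use x[of i] x[of "Suc i"] xs[OF i] i l y[of "i * k"] ik \<eta>(3) in auto)
    moreover have "real (n * k) * \<eta> = t" using \<eta>(2) by simp
    ultimately show ?thesis unfolding D_def f_def h_def w_def q_def by (simp only: \<eta>(3) mult_Suc add.commute[of k] add_0_right)
  qed
  have "D n + \<eta> * (real k + 1) * f n + t * \<alpha> * h n
    \<le> exp (2 * \<kappa> * k * n) * (D 0 + \<eta> * (real k + 1) * f 0 + t * \<alpha> * h 0 + (k * \<kappa> * (\<Sum>j<n. w j) + n * q))"
    by (rule potential_blocks[where D = D and f = f and h = h and w = w, OF \<kappa>0 block]) (use q in \<open>auto simp: w_def\<close>)
  moreover have "0 \<le> \<eta> * (real k + 1) * f n" "0 \<le> t * \<alpha> * h n" using f[of n] \<eta> t \<alpha> by auto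
  moreover have "2 * \<kappa> * k * n = 8 * c" using n k0 by (simp add: \<kappa>_def)
  moreover have "D 0 = 0" using x[of 0] by (simp add: D_def y0 W2_self)
  ultimately have "D n \<le> exp (8 * c) * (\<eta> * (real k + 1) * f 0 + t * \<alpha> * h 0 + (k * \<kappa> * (\<Sum>j<n. w j) + n * q))" by simp
  also have "\<dots> \<le> exp (8 * c) * ((2 * t * f 0 + 4 * c * R * t + t * h 0 + \<bar>K\<bar> * t\<^sup>2) * (\<alpha> + 1 / n))"
  proof (intro mult_left_mono)
    have "\<eta> * (real k + 1) \<le> 2 * (t / n)"
      using mult_left_mono[of "real k + 1" "2 * real k" \<eta>] \<eta>(1) k0 unfolding \<eta>(3)[symmetric] by (simp add: mult_ac)
    then have 1: "\<eta> * (real k + 1) * f 0 \<le> 2 * (t / n) * f 0" using f[of 0] by (intro mult_right_mono) auto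
    have "k * \<kappa> = 4 * c / n" using k0 by (simp add: \<kappa>_def)
    also have "\<dots> \<le> 4 * c" using n c by (simp add: divide_le_eq)
    finally have "k * \<kappa> * (\<Sum>j<n. w j) \<le> 4 * c * (R * (t / n))"
      by (rule mult_mono) (use W c in \<open>auto simp: w_def intro: sum_nonneg\<close>)
    moreover have "n * q = \<bar>K\<bar> * t\<^sup>2 * \<alpha>" using n by (simp add: q_def power2_eq_square)
    ultimately have "\<eta> * (real k + 1) * f 0 + t * \<alpha> * h 0 + (k * \<kappa> * (\<Sum>j<n. w j) + n * q)
      \<le> (2 * t * f 0 + 4 * c * R * t) * (1 / n) + (t * h 0 + \<bar>K\<bar> * t\<^sup>2) * \<alpha>" using 1 by (simp add: algebra_simps add_divide_distrib)
    also have "\<dots> \<le> (2 * t * f 0 + 4 * c * R * t + t * h 0 + \<bar>K\<bar> * t\<^sup>2) * (1 / n) + (2 * t * f 0 + 4 * c * R * t + t * h 0 + \<bar>K\<bar> * t\<^sup>2) * \<alpha>"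
    proof -
      have N: "0 \<le> 2 * t * f 0" "0 \<le> 4 * c * R * t" "0 \<le> t * h 0" "0 \<le> \<bar>K\<bar> * t\<^sup>2" using f[of 0] t c R by auto
      have gen: "(p + q) * u + (r + z) * a \<le> (p + q + r + z) * u + (p + q + r + z) * a"
        if "0 \<le> p" "0 \<le> q" "0 \<le> r" "0 \<le> z" "0 \<le> u" "0 \<le> a" for p q r z u a :: real
        by (rule add_mono; rule mult_right_mono) (use that in auto)
      show ?thesis by (rule gen[OF N]) (use \<alpha> in simp_all)
    qed
    finally show "\<eta> * (real k + 1) * f 0 + t * \<alpha> * h 0 + (k * \<kappa> * (\<Sum>j<n. w j) + n * q)
      \<le> (2 * t * f 0 + 4 * c * R * t + t * h 0 + \<bar>K\<bar> * t\<^sup>2) * (\<alpha> + 1 / n)" by (simp add: algebra_simps)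
  qed simp
  finally show ?thesis by (simp add: D_def f_def h_def c_def mult.assoc)
qed

text \<open>\<open>b\<close> is the representative that fixes the constant; \<open>\<mu>0\<close>
  ranges over the data with the same second moment, energy and entropy.\<close>

lemma entropic_jko_rate:
  fixes b \<rho>b :: "'a measure" and t l K \<alpha>0 :: real
  assumes A: "hypothesis_A F l K" and b: "b \<in> P2" "F b < \<infinity>" "boltzmann_entropy b < \<infinity>" and lim: "jko_limit F b t \<rho>b"
    and t: "0 < t" and \<alpha>0: "0 < \<alpha>0"
  obtains C where "\<And>\<mu>0 \<rho>0 (n::nat) \<alpha> \<mu>. \<mu>0 \<in> P2 \<Longrightarrow> F \<mu>0 = F b \<Longrightarrow> boltzmann_entropy \<mu>0 = boltzmann_entropy b \<Longrightarrow> second_moment \<mu>0 = second_moment b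
    \<Longrightarrow> jko_limit F \<mu>0 t \<rho>0 \<Longrightarrow> n \<ge> 1 \<Longrightarrow> max (- l) 0 * (2 * (t / n)) \<le> 1 \<Longrightarrow> 0 < \<alpha> \<Longrightarrow> \<alpha> \<le> \<alpha>0
    \<Longrightarrow> (entropic_jko_step F \<alpha> (t / n) ^^ n) \<mu>0 \<mu> \<Longrightarrow> W2 \<mu> \<rho>0 \<le> C * (sqrt \<alpha> + sqrt (1 / n))"
proof -
  define fb hb where "fb = real_of_ereal (F b)" and "hb = Ent b"
  have Fb: "F b = ereal fb" using F_ereal[OF b(1,2)] by (simp add: fb_def)
  obtain r where "has_ent b r" using has_ent_exists[OF b(1,3)] by blast
  then have Hb: "boltzmann_entropy b = ereal hb" by (simp add: hb_def Ent_def boltzmann_has_ent)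
  \<comment> \<open>A single fine step from \<open>b\<close> bounds \<open>F\<close> below: the
    minimality of \<open>y\<close> against an arbitrary \<open>x\<close> is a quadratic lower bound
    for \<open>F x\<close>. Its coefficient depends on the step and may be large, which
    \<open>convex_lower_bound\<close> repairs.\<close>
  obtain A0 B0 where AB: "0 \<le> A0" "0 \<le> B0" and low: "\<And>x. x \<in> P2 \<Longrightarrow> ereal (- A0 - B0 * (W2 b x)\<^sup>2) \<le> F x"
  proof -
    obtain \<mu>s where "\<forall>\<^sub>F m in sequentially. (jko_step F (t / real m) ^^ m) b (\<mu>s m)" using lim by (auto simp: jko_limit_def)
    then obtain m where m: "0 < m" "(jko_step F (t / real m) ^^ m) b (\<mu>s m)"
      using eventually_conj[OF _ eventually_gt_at_top[of 0]] eventually_happens trivial_limit_sequentially by (metis (mono_tags, lifting))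
    then obtain y where y: "jko_step F (t / m) b y"
      using m(2) unfolding relpowp_fun_conv by metis
    have \<eta>: "0 < t / m" using t m by simp
    show ?thesis
    proof (rule that[of "\<bar>real_of_ereal (F y)\<bar>" "1 / (2 * (t / m))"])
      fix x :: "'a measure" assume x: "x \<in> P2"
      show "ereal (- \<bar>real_of_ereal (F y)\<bar> - 1 / (2 * (t / m)) * (W2 b x)\<^sup>2) \<le> F x"
      proof (cases "F x < \<infinity>")
        case True
        have "(W2 b y)\<^sup>2 / (2 * (t / m)) + real_of_ereal (F y) \<le> (W2 b x)\<^sup>2 / (2 * (t / m)) + real_of_ereal (F x)"
          by (rule jko_step_ineq(3)[OF y \<eta> b(1,2) x True])
        moreover have "0 \<le> (W2 b y)\<^sup>2 / (2 * (t / m))" using \<eta> by (intro divide_nonneg_nonneg) auto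
        moreover have "- \<bar>real_of_ereal (F y)\<bar> \<le> real_of_ereal (F y)" by linarith
        ultimately have "- \<bar>real_of_ereal (F y)\<bar> - (W2 b x)\<^sup>2 / (2 * (t / m)) \<le> real_of_ereal (F x)" by linarith
        then show ?thesis using F_ereal[OF x True] by (metis ereal_less_eq(3) mult_1 times_divide_eq_left)
      qed simp
    next
      show "0 \<le> \<bar>real_of_ereal (F y)\<bar>" by (rule abs_ge_zero)
      show "0 \<le> 1 / (2 * (t / m))" using \<eta> by (intro divide_nonneg_nonneg) auto
    qed
  qed
  obtain R where R: "0 \<le> R" and bounds: "\<And>n \<alpha> \<tau> x. real n * \<tau> = t \<Longrightarrow> 0 < \<tau> \<Longrightarrow> max (- l) 0 * (2 * \<tau>) \<le> 1 \<Longrightarrow> 0 < \<alpha> \<Longrightarrow> \<alpha> \<le> \<alpha>0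
    \<Longrightarrow> x 0 \<in> P2 \<Longrightarrow> F (x 0) = ereal fb \<Longrightarrow> boltzmann_entropy (x 0) = ereal hb \<Longrightarrow> second_moment (x 0) = second_moment b
    \<Longrightarrow> (\<And>i. i < n \<Longrightarrow> entropic_jko_step F \<alpha> \<tau> (x i) (x (Suc i)))
    \<Longrightarrow> (\<forall>i\<le>n. x i \<in> P2 \<and> F (x i) < \<infinity> \<and> boltzmann_entropy (x i) < \<infinity> \<and> - R \<le> real_of_ereal (F (x i)) \<and> - R \<le> Ent (x i))
      \<and> (\<Sum>i<n. (W2 (x i) (x (Suc i)))\<^sup>2) \<le> R * \<tau>"
    using entropic_iterates_bounds[OF A b(1,2) low AB t \<alpha>0, of fb hb] by blast
  define C where "C = exp (8 * (1 + \<bar>l\<bar> * t)) * (2 * t * (fb + R) + 4 * (1 + \<bar>l\<bar> * t) * R * t + t * (hb + R) + \<bar>K\<bar> * t\<^sup>2)"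
  show ?thesis
  proof (rule that[of "sqrt (2 * C)"])
    fix \<mu>0 \<rho>0 \<mu> :: "'a measure" and n :: nat and \<alpha> :: real
    assume \<mu>0: "\<mu>0 \<in> P2" "F \<mu>0 = F b" "boltzmann_entropy \<mu>0 = boltzmann_entropy b" "second_moment \<mu>0 = second_moment b"
      and lim: "jko_limit F \<mu>0 t \<rho>0" and n: "n \<ge> 1" and l: "max (- l) 0 * (2 * (t / n)) \<le> 1" and \<alpha>: "0 < \<alpha>" "\<alpha> \<le> \<alpha>0"
      and \<mu>: "(entropic_jko_step F \<alpha> (t / n) ^^ n) \<mu>0 \<mu>"
    obtain x where x: "x 0 = \<mu>0" "x n = \<mu>" "\<And>i. i < n \<Longrightarrow> entropic_jko_step F \<alpha> (t / n) (x i) (x (Suc i))"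
      using \<mu> unfolding relpowp_fun_conv by blast
    have \<tau>: "0 < t / n" using t n by simp
    have l': "0 \<le> 1 + l * (t / n)"
    proof -
      have "- l * (t / n) \<le> max (- l) 0 * (t / n)" using \<tau> by (intro mult_right_mono) auto
      moreover have "0 \<le> max (- l) 0 * (t / n)" using \<tau> by (intro mult_nonneg_nonneg) auto
      ultimately show ?thesis using l by simp
    qed
    have xb: "\<forall>i\<le>n. x i \<in> P2 \<and> F (x i) < \<infinity> \<and> boltzmann_entropy (x i) < \<infinity> \<and> - R \<le> real_of_ereal (F (x i)) \<and> - R \<le> Ent (x i)"
      and W: "(\<Sum>i<n. (W2 (x i) (x (Suc i)))\<^sup>2) \<le> R * (t / n)"
      using bounds[of n "t / n" \<alpha> x] \<tau> l \<alpha> \<mu>0 n x Fb Hb by auto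
    have \<rho>0: "\<rho>0 \<in> P2" using lim by (simp add: jko_limit_def)
    obtain \<mu>s where ev: "\<forall>\<^sub>F m in sequentially. (jko_step F (t / real m) ^^ m) \<mu>0 (\<mu>s m)" and \<mu>s: "(\<lambda>m. W2 (\<mu>s m) \<rho>0) \<longlonglongrightarrow> 0"
      using lim by (auto simp: jko_limit_def)
    \<comment> \<open>The limit is followed along multiples of \<open>n\<close>, so that each
      entropic step corresponds to \<open>k\<close> fine ones.\<close>
    have nk: "filterlim (\<lambda>k. n * k) sequentially sequentially"
      by (rule filterlim_subseq) (use n in \<open>auto simp: strict_mono_def\<close>)
    \<comment> \<open>The constant is the same for all large \<open>k\<close>; only the distance of
      the fine iterate to the limit still depends on \<open>k\<close>, and it tends to 0.\<close>
    have ev': "\<forall>\<^sub>F k in sequentially. (W2 \<mu> \<rho>0)\<^sup>2 \<le> 2 * (C * (\<alpha> + 1 / n)) + 2 * (W2 (\<mu>s (n * k)) \<rho>0)\<^sup>2"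
      using filterlim_iff[THEN iffD1, OF nk, rule_format, OF ev] eventually_ge_at_top[of "nat \<lceil>8 * (1 + \<bar>l\<bar> * t)\<rceil>"]
    proof eventually_elim
      case (elim k)
      have k: "8 * (1 + \<bar>l\<bar> * t) \<le> real k" using elim(2) by linarith
      moreover have "0 \<le> \<bar>l\<bar> * t" using t by simp
      ultimately have k0: "0 < k" by (cases k) auto
      obtain y where y: "y 0 = \<mu>0" "y (n * k) = \<mu>s (n * k)" "\<And>j. j < n * k \<Longrightarrow> jko_step F (t / real (n * k)) (y j) (y (Suc j))"
        using elim(1) unfolding relpowp_fun_conv by blast
      have "y (n * k) \<in> P2"
        using jko_iterates_P2[where y = y, OF y(3), of "n * k"] t n k0 y(1) \<mu>0 b(2) by simp
      moreover have "(W2 (x n) (y (n * k)))\<^sup>2 \<le> C * (\<alpha> + 1 / n)"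
        using doubling_estimate[OF A _ t l' \<alpha>(1) k _ W R x(3), of y] xb y n x(1) \<mu>0(2,3) by (simp add: C_def fb_def hb_def Ent_def)
      moreover have "\<mu> \<in> P2" using xb x(2) by auto
      ultimately show ?case using W2_sq_triangle[of \<mu> "y (n * k)" \<rho>0 1] \<rho>0 x(2) y(2) by auto
    qed
    have "(\<lambda>k. 2 * (C * (\<alpha> + 1 / n)) + 2 * (W2 (\<mu>s (n * k)) \<rho>0)\<^sup>2) \<longlonglongrightarrow> 2 * (C * (\<alpha> + 1 / n)) + 2 * 0\<^sup>2"
      by (intro tendsto_intros filterlim_compose[OF \<mu>s nk])
    then have sq: "(W2 \<mu> \<rho>0)\<^sup>2 \<le> 2 * C * (\<alpha> + 1 / n)"
      using tendsto_lowerbound[OF _ ev'] by (simp add: mult.assoc)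
    have "0 \<le> fb + R" "0 \<le> hb + R" using xb x(1) \<mu>0(2,3) by (force simp: fb_def hb_def Ent_def)+
    then have "0 \<le> 2 * t * (fb + R)" "0 \<le> 4 * (1 + \<bar>l\<bar> * t) * R * t" "0 \<le> t * (hb + R)" "0 \<le> \<bar>K\<bar> * t\<^sup>2"
      using R t by (simp_all add: add_nonneg_nonneg)
    then have C: "0 \<le> C" unfolding C_def by (simp del: zero_le_mult_iff)
    have "\<alpha> + 1 / n \<le> (sqrt \<alpha> + sqrt (1 / n))\<^sup>2" using \<alpha> by (simp add: power2_sum)
    then have "(W2 \<mu> \<rho>0)\<^sup>2 \<le> 2 * C * (sqrt \<alpha> + sqrt (1 / n))\<^sup>2"
      using C by (intro order_trans[OF sq] mult_left_mono) auto
    also have "\<dots> = (sqrt (2 * C) * (sqrt \<alpha> + sqrt (1 / n)))\<^sup>2" using C by (simp add: power_mult_distrib)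
    finally show "W2 \<mu> \<rho>0 \<le> sqrt (2 * C) * (sqrt \<alpha> + sqrt (1 / n))"
      by (rule power2_le_imp_le) (use C \<alpha> in simp)
  qed
qed

end

theorem corollary1p3p1:
  fixes F :: "(real ^ 'n) measure \<Rightarrow> ereal"
  assumes "\<And>\<mu>. \<mu> \<in> P2 \<Longrightarrow> F \<mu> \<noteq> - \<infinity>"
  shows "\<exists>C :: real \<Rightarrow> real \<Rightarrow> ereal \<Rightarrow> ereal \<Rightarrow> real \<Rightarrow> real \<Rightarrow> real \<Rightarrow> real.
    \<forall>(l :: real) (K :: real) (\<mu>0 :: (real ^ 'n) measure) (t :: real) (\<rho>0 :: (real ^ 'n) measure).
      hypothesis_A F l K \<and> \<mu>0 \<in> P2 \<and> F \<mu>0 < \<infinity> \<and> boltzmann_entropy \<mu>0 < \<infinity> \<and>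
      0 \<le> t \<and> jko_limit F \<mu>0 t \<rho>0 \<longrightarrow>
      (\<forall>\<alpha>0>0. \<forall>n::nat. n \<ge> 1 \<and> (max (- l) 0 \<noteq> 0 \<longrightarrow> t / real n \<le> 1 / (2 * max (- l) 0)) \<longrightarrow>
        (\<forall>\<alpha>. 0 < \<alpha> \<and> \<alpha> \<le> \<alpha>0 \<longrightarrow>
          (\<forall>\<mu>. (entropic_jko_step F \<alpha> (t / real n) ^^ n) \<mu>0 \<mu> \<longrightarrow>
            W2 \<mu> \<rho>0 \<le> C (second_moment \<mu>0) t (F \<mu>0) (boltzmann_entropy \<mu>0) l K \<alpha>0
                        * (sqrt \<alpha> + sqrt (1 / real n)))))"
proof -
  \<comment> \<open>Collects all data with prescribed second moment, energy and entropy, so that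
    choosing a constant for each tuple of arguments makes it a function of these quantities.\<close>
  define good where "good m2 t f h l K \<alpha>0 C \<longleftrightarrow> (\<forall>\<mu>0 \<rho>0 (n::nat) \<alpha> \<mu>.
    hypothesis_A F l K \<and> \<mu>0 \<in> P2 \<and> F \<mu>0 < \<infinity> \<and> boltzmann_entropy \<mu>0 < \<infinity> \<and> 0 \<le> t \<and> jko_limit F \<mu>0 t \<rho>0 \<and>
    second_moment \<mu>0 = m2 \<and> F \<mu>0 = f \<and> boltzmann_entropy \<mu>0 = h \<and> 0 < \<alpha>0 \<and>
    n \<ge> 1 \<and> (max (- l) 0 \<noteq> 0 \<longrightarrow> t / real n \<le> 1 / (2 * max (- l) 0)) \<and> 0 < \<alpha> \<and> \<alpha> \<le> \<alpha>0 \<and>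
    (entropic_jko_step F \<alpha> (t / real n) ^^ n) \<mu>0 \<mu> \<longrightarrow> W2 \<mu> \<rho>0 \<le> C * (sqrt \<alpha> + sqrt (1 / real n)))"
    for m2 t :: real and f h :: ereal and l K \<alpha>0 C :: real
  \<comment> \<open>If no datum has the prescribed values, the claim is vacuous; otherwise one of
    them is picked as the representative \<open>b\<close>.\<close>
  have ex: "\<exists>C. good m2 t f h l K \<alpha>0 C" for m2 t f h l K \<alpha>0
  proof (cases "hypothesis_A F l K \<and> 0 < \<alpha>0 \<and> 0 \<le> t \<and> (\<exists>b \<rho>b. b \<in> P2 \<and> F b < \<infinity> \<and> boltzmann_entropy b < \<infinity> \<and>
      jko_limit F b t \<rho>b \<and> second_moment b = m2 \<and> F b = f \<and> boltzmann_entropy b = h)")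
    case False
    then have "good m2 t f h l K \<alpha>0 0" unfolding good_def by blast
    then show ?thesis ..
  next
    case True
    then obtain b \<rho>b where A: "hypothesis_A F l K" "0 < \<alpha>0" "0 \<le> t"
      and b: "b \<in> P2" "F b < \<infinity>" "boltzmann_entropy b < \<infinity>" "jko_limit F b t \<rho>b" "second_moment b = m2" "F b = f" "boltzmann_entropy b = h"
      by blast
    show ?thesis
    proof (cases "t = 0")
      case True
      \<comment> \<open>A step of size 0 is the identity, so both schemes stay at the datum, and the
        limit is at distance 0 from it.\<close>
      have fix0: "P = (\<lambda>a b. b = a) \<Longrightarrow> (P ^^ n) \<mu> \<nu> \<Longrightarrow> \<nu> = \<mu>" for P :: "(real ^ 'n) measure \<Rightarrow> _" and n :: nat and \<mu> \<nu>
        by (induction n arbitrary: \<nu>) auto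
      have "good m2 t f h l K \<alpha>0 0" unfolding good_def
      proof (intro allI impI, elim conjE)
        fix \<mu>0 \<rho>0 \<mu> :: "(real ^ 'n) measure" and n :: nat and \<alpha> :: real
        assume lim: "jko_limit F \<mu>0 t \<rho>0" and \<mu>: "(entropic_jko_step F \<alpha> (t / real n) ^^ n) \<mu>0 \<mu>"
        have \<mu>0: "\<mu> = \<mu>0" by (rule fix0[OF _ \<mu>]) (auto simp: True entropic_jko_step_def fun_eq_iff)
        obtain \<mu>s where ev: "\<forall>\<^sub>F m in sequentially. (jko_step F (t / real m) ^^ m) \<mu>0 (\<mu>s m)" and \<mu>s: "(\<lambda>m. W2 (\<mu>s m) \<rho>0) \<longlonglongrightarrow> 0"
          using lim by (auto simp: jko_limit_def)
        have "\<forall>\<^sub>F m in sequentially. W2 (\<mu>s m) \<rho>0 = W2 \<mu>0 \<rho>0"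
          using ev
        proof eventually_elim
          case (elim m)
          have "\<mu>s m = \<mu>0" by (rule fix0[OF _ elim]) (auto simp: True jko_step_def fun_eq_iff)
          then show ?case by simp
        qed
        from tendsto_cong[OF this] \<mu>s have "(\<lambda>m::nat. W2 \<mu>0 \<rho>0) \<longlonglongrightarrow> 0" by simp
        then have "W2 \<mu>0 \<rho>0 = 0" by (simp add: LIMSEQ_const_iff)
        then show "W2 \<mu> \<rho>0 \<le> 0 * (sqrt \<alpha> + sqrt (1 / real n))" by (simp add: \<mu>0)
      qed
      then show ?thesis ..
    next
      case False
      then have t: "0 < t" using A(3) by simp
      have cond: "max (- l) 0 * (2 * (t / n)) \<le> 1" if "max (- l) 0 \<noteq> 0 \<longrightarrow> t / real n \<le> 1 / (2 * max (- l) 0)" for n :: nat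
      proof (cases "max (- l) 0 = 0")
        case False
        then have "0 < max (- l) 0" by auto
        then show ?thesis using that by (simp only: pos_le_divide_eq mult_pos_pos zero_less_numeral) (simp add: mult_ac)
      qed simp
      show ?thesis
      proof (rule entropic_jko_rate[OF assms A(1) b(1-4) t A(2)])
        fix C :: real assume C: "\<And>\<mu>0 \<rho>0 (n::nat) \<alpha> \<mu>. \<mu>0 \<in> P2 \<Longrightarrow> F \<mu>0 = F b \<Longrightarrow> boltzmann_entropy \<mu>0 = boltzmann_entropy b \<Longrightarrow> second_moment \<mu>0 = second_moment b
          \<Longrightarrow> jko_limit F \<mu>0 t \<rho>0 \<Longrightarrow> n \<ge> 1 \<Longrightarrow> max (- l) 0 * (2 * (t / n)) \<le> 1 \<Longrightarrow> 0 < \<alpha> \<Longrightarrow> \<alpha> \<le> \<alpha>0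
          \<Longrightarrow> (entropic_jko_step F \<alpha> (t / n) ^^ n) \<mu>0 \<mu> \<Longrightarrow> W2 \<mu> \<rho>0 \<le> C * (sqrt \<alpha> + sqrt (1 / n))"
        have "good m2 t f h l K \<alpha>0 C" unfolding good_def
          by (intro allI impI, elim conjE, rule C) (rule cond | simp add: b(5-7))+
        then show "\<exists>C. good m2 t f h l K \<alpha>0 C" ..
      qed
    qed
  qed
  then obtain C where C: "\<And>m2 t f h l K \<alpha>0. good m2 t f h l K \<alpha>0 (C m2 t f h l K \<alpha>0)" by metis
  show ?thesis
  proof (intro exI[of _ C] allI impI, elim conjE)
    fix l K t \<alpha>0 \<alpha> :: real and n :: nat and \<mu>0 \<rho>0 \<mu> :: "(real ^ 'n) measure"
    assume "hypothesis_A F l K" "\<mu>0 \<in> P2" "F \<mu>0 < \<infinity>" "boltzmann_entropy \<mu>0 < \<infinity>" "0 \<le> t" "jko_limit F \<mu>0 t \<rho>0" "0 < \<alpha>0"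
      "1 \<le> n" "max (- l) 0 \<noteq> 0 \<longrightarrow> t / real n \<le> 1 / (2 * max (- l) 0)" "0 < \<alpha>" "\<alpha> \<le> \<alpha>0"
      "(entropic_jko_step F \<alpha> (t / real n) ^^ n) \<mu>0 \<mu>"
    then show "W2 \<mu> \<rho>0 \<le> C (second_moment \<mu>0) t (F \<mu>0) (boltzmann_entropy \<mu>0) l K \<alpha>0 * (sqrt \<alpha> + sqrt (1 / real n))"
      using C[of "second_moment \<mu>0" t "F \<mu>0" "boltzmann_entropy \<mu>0" l K \<alpha>0, unfolded good_def, rule_format, of \<mu>0 \<rho>0 n \<alpha> \<mu>] by blast
  qed
qed

end
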